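(* Let $\mathbb{I}$ be a $\mathfrak{D}$-saturated idealistic filtration over $R$ and $P\in\operatorname{Spec}R$ a closed point. Case $P\notin\operatorname{Supp}(\mathbb{I})$. Then $\mathbb{I}_P=R_P\times\mathbb{R}$, and accordingly $\sigma(P)$ takes the absolute minimum: $\sigma(P)(e)=0$ for all $e\in\mathbb{Z}_{\ge0}$. Case $P\in\operatorname{Supp}(\mathbb{I})$. Fix $e\in\mathbb{Z}_{\ge0}$. Let $0\le e_1<\cdots<e_K\le e-1$ be the integers indicating the places where $l^{\mathrm{pure}}_{p^\alpha}(P)$, $\alpha=0,\dots,e-1$, jumps, i.e. $$0=l^{\mathrm{pure}}_{p^0}(P)=\cdots=l^{\mathrm{pure}}_{p^{e_1-1}}(P)<l^{\mathrm{pure}}_{p^{e_1}}(P)=\cdots=l^{\mathrm{pure}}_{p^{e_2-1}}(P)<\cdots<l^{\mathrm{pure}}_{p^{e_K}}(P)=\cdots=l^{\mathrm{pure}}_{p^{e-1}}(P).$$ Introduce variables $v_{ij}$ for $i=1,\dots,K$ and $j=1,\dots,l^{\mathrm{pure}}_{p^{e_i}}(P)-l^{\mathrm{pure}}_{p^{e_{i-1}}}(P)$ (with $l^{\mathrm{pure}}_{p^{e_0}}(P):=0$). Then $$l^{\mathrm{pure}}_{p^e}(P)=l_{p^e}(P)-l^{\mathrm{mixed}}_{p^e}(P),$$ where $$l^{\mathrm{mixed}}_{p^e}(P)=\#\Bigl\{\text{monomials of the form }\prod_{i=1}^K\prod_j(v_{ij}^{p^{e_i}})^{b_{ij}}:\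 \sum_{i,j}p^{e_i}b_{ij}=p^e,\ p^{e_i}b_{ij}\ne p^e\ \forall i,j\Bigr\},\quad b_{ij}\in\mathbb{Z}_{\ge0}.$$ Moreover, let $s_1,\dots,s_r$ generate the ideal $\mathbb{I}_{p^e}\subset R$ of $\mathbb{I}$ at level $p^e$, and let $X=(x_1,\dots,x_d)$ be a regular system of parameters at $P$. Then $$l_{p^e}(P)=\operatorname{rank}\bigl[\partial_{X^I}(s_\beta)(P)\bigr]_{|I|=p^e}^{\beta=1,\dots,r}.$$
   Context: Standing setting: $k$ is an algebraically closed field of characteristic $p>0$ or of characteristic $0$; in characteristic $0$ one formally sets $p=\infty$ with $p^0=1$, and only the exponent $e=0$ is considered wherever $p^e$ occurs. $W$ is a nonsingular variety over $k$ of dimension $d$, and $R$ is the coordinate ring of an affine open subset $\operatorname{Spec}R\subset W$. For a closed point $P$, $R_P$ is the local ring and $\mathfrak{m}_P$ its maximal ideal. Idealistic filtrations. An idealistic filtration over a ring $A$ is a subset $\mathbb{I}\subset A\times\mathbb{R}$ such that, writing $\mathbb{I}_a=\{f\in A: (f,a)\in\mathbb{I}\}$ (the ideal at level $a$): each $\mathbb{I}_a$ is an ideal of $A$, with $\mathbb{I}_a=A$ for $a\le 0$; $(f,a),(g,b)\in\mathbb{I}$ implies $(fg,a+b)\in\mathbb{I}$; and $(f,a)\in\mathbb{I}$, $b\le a$ implies $(f,b)\in\mathbb{I}$. $\mathbb{I}$ over $R$ is $\mathfrak{D}$-saturated if $(f,a)\in\mathbb{I}$ and $D$ a $k$-linear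 (Grothendieck) differential operator on $R$ of degree $\le t$ imply $(D(f),a-t)\in\mathbb{I}$. The localization $\mathbb{I}_P$ over $R_P$ is given by $(\mathbb{I}_P)_a=\mathbb{I}_aR_P$. The support is $\operatorname{Supp}(\mathbb{I})=\{Q\in\operatorname{Spec}R: \operatorname{ord}_Q(f)\ge a\text{ for all }(f,a)\in\mathbb{I},\ a>0\}$, where $\operatorname{ord}_Q(f)=\sup\{n: f\in\mathfrak{m}_Q^nR_Q\}$. Leading algebra and $\sigma$. Put $G_P=\bigoplus_{n\ge0}\mathfrak{m}_P^n/\mathfrak{m}_P^{n+1}$, $L(\mathbb{I}_P)_n=\{f\bmod\mathfrak{m}_P^{n+1}: (f,n)\in\mathbb{I}_P, f\in\mathfrak{m}_P^n\}$, $L(\mathbb{I}_P)^{\mathrm{pure}}_{p^e}=L(\mathbb{I}_P)_{p^e}\cap\{v^{p^e}: v\in\mathfrak{m}_P/\mathfrak{m}_P^2\}$, $l_{p^e}(P)=\dim_kL(\mathbb{I}_P)_{p^e}$, $l^{\mathrm{pure}}_{p^e}(P)=\dim_kL(\mathbb{I}_P)^{\mathrm{pure}}_{p^e}$, and $\sigma(P)=(\sigma(P)(e))_{e\in\mathbb{Z}_{\ge0}}$ with $\sigma(P)(e)=d-l^{\mathrm{pure}}_{p^e}(P)$ (only the term $e=0$ in characteristic $0$). The sequence $l^{\mathrm{pure}}_{p^e}(P)$ is non-decreasing in $e$. $\partial_{X^I}$ ($I\in(\mathbb{Z}_{\ge0})^d$) are the divided-power (Hasse) partial differential operators with respect to $X$,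 so that the expansion of $s$ at $P$ is $\sum_I\partial_{X^I}(s)(P)X^I$. In the displayed chain of (in)equalities, the segment before $e_1$ is empty if $e_1=0$. *)

theory Defs
  imports
    "HOL-Algebra.QuotRing"
    "HOL-Algebra.Ideal_Product"
    "HOL-Algebra.Embedded_Algebras"
    "HOL-Algebra.Generated_Rings"
    "HOL-Algebra.Ring_Divisibility"
    "HOL-Computational_Algebra.Computational_Algebra"
    "HOL-Library.Extended_Real"
    "HOL-Library.Poly_Mapping"
    "Jordan_Normal_Form.DL_Rank"
begin

text \<open>The coordinate ring \<open>R\<close> is a type \<open>'r :: idom\<close>, the ground field \<open>k\<close> is a type
  \<open>'k :: alg_closed_field\<close>, and the structure map is \<open>\<phi> :: 'k \<Rightarrow> 'r\<close>. As \<open>R\<close> is a domain, its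
  localizations \<open>R\<^sub>P\<close> are realized as subrings of the fraction field \<open>'r fract\<close>.\<close>

section \<open>Local rings of a domain, Krull dimension, nonsingular varieties\<close>

definition ring_on :: "'a::comm_ring_1 set \<Rightarrow> 'a ring" where
  "ring_on A = \<lparr>carrier = A, monoid.mult = (*), one = 1, ring.zero = 0, add = (+)\<rparr>"

definition to_frac :: "'r::idom \<Rightarrow> 'r fract" where
  "to_frac f = Fraction_Field.Fract f 1"

definition local_ring :: "'r::idom set \<Rightarrow> 'r fract ring" where
  "local_ring P = ring_on {Fraction_Field.Fract a b | a b. b \<notin> P}"

definition local_max :: "'r::idom set \<Rightarrow> 'r fract set" where
  "local_max P = {Fraction_Field.Fract a b | a b. a \<in> P \<and> b \<notin> P}"

text \<open>\<open>\<mm>\<^sub>P\<^sup>n\<close>, the power being taken in the multiplicative monoid of ideals of \<open>R\<^sub>P\<close>.\<close>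

definition local_max_pow :: "'r::idom set \<Rightarrow> nat \<Rightarrow> 'r fract set" where
  "local_max_pow P n = local_max P [^]\<^bsub>ideals_set (local_ring P)\<^esub> n"

definition krull_dim :: "('a, 'b) ring_scheme \<Rightarrow> enat" where
  "krull_dim A = (SUP n \<in> {n. \<exists>C :: nat \<Rightarrow> 'a set.
       (\<forall>i\<le>n. primeideal (C i) A) \<and> (\<forall>i<n. C i \<subset> C (Suc i))}. enat n)"

definition regular_local_ring :: "('a, 'b) ring_scheme \<Rightarrow> bool" where
  "regular_local_ring A \<longleftrightarrow> cring A \<and> noetherian_ring A \<and>
     (\<exists>m. {M. maximalideal M A} = {m} \<and>
       (\<exists>S \<subseteq> carrier A. finite S \<and> krull_dim A = enat (card S) \<and> m = genideal A S))"

definition nonsingular_affine_variety :: "('k::field \<Rightarrow> 'r::idom) \<Rightarrow> nat \<Rightarrow> bool" where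
  "nonsingular_affine_variety \<phi> d \<longleftrightarrow>
     comm_ring_hom \<phi> \<and>
     (\<exists>S. finite S \<and> generate_ring (ring_on UNIV) (range \<phi> \<union> S) = UNIV) \<and>
     krull_dim (ring_on (UNIV :: 'r set)) = enat d \<and>
     (\<forall>Q :: 'r set. primeideal Q (ring_on UNIV) \<longrightarrow> regular_local_ring (local_ring Q))"

section \<open>Differential operators\<close>

definition k_linear_on ::
  "('k \<Rightarrow> 'a::comm_ring_1) \<Rightarrow> 'a set \<Rightarrow> ('a \<Rightarrow> 'a) \<Rightarrow> bool" where
  "k_linear_on \<psi> A D \<longleftrightarrow> D \<in> A \<rightarrow> A \<and>
     (\<forall>f\<in>A. \<forall>g\<in>A. D (f + g) = D f + D g) \<and> (\<forall>c. \<forall>f\<in>A. D (\<psi> c * f) = \<psi> c * D f)"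

text \<open>Grothendieck's recursive definition: \<open>D\<close> has degree \<open>\<le> t\<close> iff all commutators \<open>[D, a]\<close> have
  degree \<open>\<le> t - 1\<close>, the only operator of degree \<open>\<le> -1\<close> being zero.\<close>

primrec diff_op ::
  "('k \<Rightarrow> 'a::comm_ring_1) \<Rightarrow> 'a set \<Rightarrow> nat \<Rightarrow> ('a \<Rightarrow> 'a) \<Rightarrow> bool" where
  "diff_op \<psi> A 0 D \<longleftrightarrow> k_linear_on \<psi> A D \<and> (\<forall>a\<in>A. \<forall>f\<in>A. D (a * f) - a * D f = 0)"
| "diff_op \<psi> A (Suc t) D \<longleftrightarrow>
     k_linear_on \<psi> A D \<and> (\<forall>a\<in>A. diff_op \<psi> A t (\<lambda>f. D (a * f) - a * D f))"

definition multi_indices :: "nat \<Rightarrow> (nat \<Rightarrow> nat) set" where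
  "multi_indices d = {I. \<forall>i\<ge>d. I i = 0}"

definition multi_deg :: "nat \<Rightarrow> (nat \<Rightarrow> nat) \<Rightarrow> nat" where
  "multi_deg d I = (\<Sum>i<d. I i)"

definition multi_power :: "nat \<Rightarrow> (nat \<Rightarrow> 'a::comm_monoid_mult) \<Rightarrow> (nat \<Rightarrow> nat) \<Rightarrow> 'a" where
  "multi_power d x I = (\<Prod>i<d. x i ^ I i)"

definition regular_parameters :: "'r::idom set \<Rightarrow> nat \<Rightarrow> (nat \<Rightarrow> 'r fract) \<Rightarrow> bool" where
  "regular_parameters P d x \<longleftrightarrow> krull_dim (local_ring P) = enat d \<and>
     x ` {..<d} \<subseteq> carrier (local_ring P) \<and> genideal (local_ring P) (x ` {..<d}) = local_max P"

text \<open>The divided-power operators \<open>\<partial>\<^bsub>X\<^sup>I\<^esub>\<close> on \<open>R\<^sub>P\<close>: the differential operators of degree \<open>\<le> |I|\<close>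
  with \<open>\<partial>\<^bsub>X\<^sup>I\<^esub> (X\<^sup>J) = binom(J, I) X\<^sup>J\<^sup>-\<^sup>I\<close>. When \<open>I \<le> J\<close> fails, the binomial coefficient vanishes, so
  the truncated subtraction \<open>J - I\<close> is harmless.\<close>

definition hasse_operators ::
  "('k \<Rightarrow> 'r::idom) \<Rightarrow> 'r set \<Rightarrow> nat \<Rightarrow> (nat \<Rightarrow> 'r fract) \<Rightarrow>
   ((nat \<Rightarrow> nat) \<Rightarrow> 'r fract \<Rightarrow> 'r fract) \<Rightarrow> bool" where
  "hasse_operators \<phi> P d x \<Delta> \<longleftrightarrow> (\<forall>I \<in> multi_indices d.
     diff_op (to_frac \<circ> \<phi>) (carrier (local_ring P)) (multi_deg d I) (\<Delta> I) \<and>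
     (\<forall>J \<in> multi_indices d. \<Delta> I (multi_power d x J) =
        of_nat (\<Prod>i<d. J i choose I i) * multi_power d x (\<lambda>i. J i - I i)))"

text \<open>The value \<open>f(P) \<in> k\<close> of \<open>f \<in> R\<^sub>P\<close> at a closed point \<open>P\<close>, whose residue field is \<open>k\<close>.\<close>

definition value_at :: "('k \<Rightarrow> 'r::idom) \<Rightarrow> 'r set \<Rightarrow> 'r fract \<Rightarrow> 'k" where
  "value_at \<phi> P f = (THE c. f - to_frac (\<phi> c) \<in> local_max P)"

section \<open>Idealistic filtrations\<close>

definition level :: "('a \<times> real) set \<Rightarrow> real \<Rightarrow> 'a set" where
  "level \<II> a = {f. (f, a) \<in> \<II>}"

definition idealistic_filtration :: "('r::comm_ring_1 \<times> real) set \<Rightarrow> bool" where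
  "idealistic_filtration \<II> \<longleftrightarrow>
     (\<forall>a. ideal (level \<II> a) (ring_on UNIV)) \<and>
     (\<forall>a\<le>0. level \<II> a = UNIV) \<and>
     (\<forall>f a g b. (f, a) \<in> \<II> \<longrightarrow> (g, b) \<in> \<II> \<longrightarrow> (f * g, a + b) \<in> \<II>) \<and>
     (\<forall>f a b. (f, a) \<in> \<II> \<longrightarrow> b \<le> a \<longrightarrow> (f, b) \<in> \<II>)"

definition D_saturated ::
  "('k \<Rightarrow> 'r::comm_ring_1) \<Rightarrow> ('r \<times> real) set \<Rightarrow> bool" where
  "D_saturated \<phi> \<II> \<longleftrightarrow>
     (\<forall>f a t D. (f, a) \<in> \<II> \<longrightarrow> diff_op \<phi> UNIV t D \<longrightarrow> (D f, a - real t) \<in> \<II>)"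

definition localized_filtration ::
  "'r::idom set \<Rightarrow> ('r \<times> real) set \<Rightarrow> ('r fract \<times> real) set" where
  "localized_filtration P \<II> = {(f, a). f \<in> genideal (local_ring P) (to_frac ` level \<II> a)}"

definition ord_at :: "'r::idom set \<Rightarrow> 'r \<Rightarrow> ereal" where
  "ord_at Q f = (SUP n \<in> {n. to_frac f \<in> local_max_pow Q n}. ereal (real n))"

definition Supp :: "('r::idom \<times> real) set \<Rightarrow> 'r set set" where
  "Supp \<II> = {Q. primeideal Q (ring_on UNIV) \<and>
     (\<forall>f a. (f, a) \<in> \<II> \<longrightarrow> a > 0 \<longrightarrow> ord_at Q f \<ge> ereal a)}"

section \<open>The leading algebra and the invariant \<open>\<sigma>\<close>\<close>

text \<open>The graded piece \<open>\<mm>\<^sub>P\<^sup>n/\<mm>\<^sub>P\<^sup>n\<^sup>+\<^sup>1\<close> of \<open>G\<^sub>P\<close> is an ideal of the ring \<open>R\<^sub>P/\<mm>\<^sub>P\<^sup>n\<^sup>+\<^sup>1\<close>, in which \<open>k\<close> embeds as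
  a subfield; \<open>k\<close>-dimensions of subspaces of the piece are taken in that ring.\<close>

definition jet_ring :: "'r::idom set \<Rightarrow> nat \<Rightarrow> 'r fract set ring" where
  "jet_ring P n = local_ring P Quot local_max_pow P (Suc n)"

definition gr_class :: "'r::idom set \<Rightarrow> nat \<Rightarrow> 'r fract \<Rightarrow> 'r fract set" where
  "gr_class P n f = local_max_pow P (Suc n) +>\<^bsub>local_ring P\<^esub> f"

definition k_dim :: "('k \<Rightarrow> 'r::idom) \<Rightarrow> 'r set \<Rightarrow> nat \<Rightarrow> 'r fract set set \<Rightarrow> nat" where
  "k_dim \<phi> P n E = ring.dim (jet_ring P n) (range (\<lambda>c. gr_class P n (to_frac (\<phi> c)))) E"

definition leading :: "'r::idom set \<Rightarrow> ('r \<times> real) set \<Rightarrow> nat \<Rightarrow> 'r fract set set" where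
  "leading P \<II> n =
     {gr_class P n f | f. (f, real n) \<in> localized_filtration P \<II> \<and> f \<in> local_max_pow P n}"

text \<open>In \<open>G\<^sub>P\<close>, the \<open>q\<close>-th power of the class of \<open>f\<close> in \<open>\<mm>\<^sub>P/\<mm>\<^sub>P\<^sup>2\<close> is the class of \<open>f\<^sup>q\<close> in degree \<open>q\<close>.\<close>

definition leading_pure :: "'r::idom set \<Rightarrow> ('r \<times> real) set \<Rightarrow> nat \<Rightarrow> 'r fract set set" where
  "leading_pure P \<II> q = leading P \<II> q \<inter> {gr_class P q (f ^ q) | f. f \<in> local_max P}"

text \<open>In characteristic \<open>0\<close> the library has \<open>CHAR('k) = 0\<close>; there only \<open>e = 0\<close> is used, and
  \<open>CHAR('k) ^ 0 = 1\<close> agrees with the convention \<open>p\<^sup>0 = 1\<close>.\<close>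

definition l_dim :: "('k::field \<Rightarrow> 'r::idom) \<Rightarrow> 'r set \<Rightarrow> ('r \<times> real) set \<Rightarrow> nat \<Rightarrow> nat" where
  "l_dim \<phi> P \<II> e = k_dim \<phi> P (CHAR('k) ^ e) (leading P \<II> (CHAR('k) ^ e))"

definition l_pure :: "('k::field \<Rightarrow> 'r::idom) \<Rightarrow> 'r set \<Rightarrow> ('r \<times> real) set \<Rightarrow> nat \<Rightarrow> nat" where
  "l_pure \<phi> P \<II> e = k_dim \<phi> P (CHAR('k) ^ e) (leading_pure P \<II> (CHAR('k) ^ e))"

definition sigma ::
  "('k::field \<Rightarrow> 'r::idom) \<Rightarrow> nat \<Rightarrow> ('r \<times> real) set \<Rightarrow> 'r set \<Rightarrow> nat \<Rightarrow> int" where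
  "sigma \<phi> d \<II> P e = int d - int (l_pure \<phi> P \<II> e)"

section \<open>Jumps and mixed monomials\<close>

definition before_jump :: "(nat \<Rightarrow> nat) \<Rightarrow> (nat \<Rightarrow> nat) \<Rightarrow> nat \<Rightarrow> nat" where
  "before_jump l E i = (if i \<le> 1 then 0 else l (E (i - 1)))"

text \<open>\<open>E 1 < \<dots> < E K\<close> are the places in \<open>{0, \<dots>, e - 1}\<close> where \<open>l\<close> jumps, i.e.
  \<open>0 = l 0 = \<dots> = l (E 1 - 1) < l (E 1) = \<dots> = l (E 2 - 1) < \<dots> < l (E K) = \<dots> = l (e - 1)\<close>.\<close>

definition jump_places :: "(nat \<Rightarrow> nat) \<Rightarrow> nat \<Rightarrow> nat \<Rightarrow> (nat \<Rightarrow> nat) \<Rightarrow> bool" where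
  "jump_places l e K E \<longleftrightarrow>
     strict_mono_on {1..K} E \<and> (\<forall>i\<in>{1..K}. E i < e) \<and>
     (\<forall>\<alpha><e. (\<forall>i\<in>{1..K}. \<alpha> < E i) \<longrightarrow> l \<alpha> = 0) \<and>
     (\<forall>i\<in>{1..K}. before_jump l E i < l (E i)) \<and>
     (\<forall>i\<in>{1..K}. \<forall>\<alpha><e. E i \<le> \<alpha> \<and> (i < K \<longrightarrow> \<alpha> < E (Suc i)) \<longrightarrow> l \<alpha> = l (E i))"

definition var_indices :: "(nat \<Rightarrow> nat) \<Rightarrow> nat \<Rightarrow> (nat \<Rightarrow> nat) \<Rightarrow> (nat \<times> nat) set" where
  "var_indices l K E = (SIGMA i:{1..K}. {1..l (E i) - before_jump l E i})"

text \<open>A monomial in the variables \<open>v\<^sub>i\<^sub>j\<close> is its exponent vector, an element of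
  \<open>nat \<times> nat \<Rightarrow>\<^sub>0 nat\<close>; products of monomials are sums of exponent vectors.\<close>

definition mixed_monomials ::
  "nat \<Rightarrow> (nat \<Rightarrow> nat) \<Rightarrow> nat \<Rightarrow> nat \<Rightarrow> (nat \<Rightarrow> nat) \<Rightarrow> (nat \<times> nat \<Rightarrow>\<^sub>0 nat) set" where
  "mixed_monomials p l e K E =
     {\<Sum>(i, j) \<in> var_indices l K E. Poly_Mapping.single (i, j) (p ^ E i * b (i, j)) | b.
        (\<Sum>(i, j) \<in> var_indices l K E. p ^ E i * b (i, j)) = p ^ e \<and>
        (\<forall>(i, j) \<in> var_indices l K E. p ^ E i * b (i, j) \<noteq> p ^ e)}"

definition l_mixed :: "nat \<Rightarrow> (nat \<Rightarrow> nat) \<Rightarrow> nat \<Rightarrow> nat \<Rightarrow> (nat \<Rightarrow> nat) \<Rightarrow> nat" where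
  "l_mixed p l e K E = card (mixed_monomials p l e K E)"

text \<open>The matrix \<open>[\<partial>\<^bsub>X\<^sup>I\<^esub>(s\<^sub>\<beta>)(P)]\<close> with \<open>r\<close> columns and with rows indexed by the list \<open>Is\<close> of
  multi-indices.\<close>

definition hasse_matrix ::
  "('k \<Rightarrow> 'r::idom) \<Rightarrow> 'r set \<Rightarrow> ((nat \<Rightarrow> nat) \<Rightarrow> 'r fract \<Rightarrow> 'r fract) \<Rightarrow>
   (nat \<Rightarrow> nat) list \<Rightarrow> nat \<Rightarrow> (nat \<Rightarrow> 'r) \<Rightarrow> 'k mat" where
  "hasse_matrix \<phi> P \<Delta> Is r s =
     mat (length Is) r (\<lambda>(a, \<beta>). value_at \<phi> P (\<Delta> (Is ! a) (to_frac (s \<beta>))))"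

end

theory Submission
  imports Defs "Jordan_Normal_Form.Char_Poly"
begin

text \<open>At a closed point of the support the operators of degree \<open>s\<close> lower the level of the filtration and the
  order of vanishing by the same amount. If the regular parameters are adapted to the chain of pure parts,
  then a leading form of degree \<open>p\<^sup>e\<close> involves only monomials \<open>X\<^sup>J\<close> with \<open>p\<^sup>a dvd J\<^sub>i\<close> for some \<open>a\<close> such
  that \<open>x\<^sub>i\<close> occurs in the pure part at \<open>a\<close>: otherwise a suitable Hasse derivative would produce a forbidden
  leading form of smaller degree. Hence these monomials form a basis of the leading part; the pure
  powers among them number \<open>l\<^sup>p\<^sup>u\<^sup>r\<^sup>e\<close> and the rest are the mixed monomials. Outside the support a
  differential operator turns an element of too small order into a unit of positive level.

  Enough operators exist on \<open>R\<close> itself: linear duality modulo \<open>\<mm>\<^sup>M\<^sup>+\<^sup>1\<close> is solved at all points near \<open>P\<close>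
  simultaneously, after multiplication by a function that does not vanish at \<open>P\<close>, and a function on \<open>R\<close> is
  determined by its values at closed points. Regularity of the monomials in a system of parameters
  follows from comparing the growth of \<open>R/\<mm>\<^sup>n\<close> with that of a polynomial ring given by Noether normalization.\<close>

section \<open>Elementary ideal theory: products, powers, finite generation\<close>

section \<open>Ideals and their powers\<close>

text \<open>Saturation concerns operators on the whole ring, while Hasse derivatives for parameters
  at \<open>P\<close> exist only near \<open>P\<close>. Clearing denominators turns a derivative
  into a nonzero multiple of it at \<open>P\<close>, up to terms of higher order. Nothing is lost,
  because the argument only asks which coefficients of a leading form vanish. Characteristic
  \<open>p\<close> enters twice: \<open>binom(p^a v, p^a)\<close> equals \<open>v\<close> modulo
  \<open>p\<close>, so a derivative isolates \<open>x^(p^a)\<close> from \<open>x^(p^a v)\<close>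
  when \<open>p\<close> does not divide \<open>v\<close>; and \<open>k\<close> has
  \<open>p^a\<close>-th roots, so a combination of \<open>p^a\<close>-th powers of parameters is
  again such a power and must belong to the pure part at \<open>a\<close>. Regularity is available
  only through Krull dimensions and numbers of generators. Both are compared with the size of a
  transcendence basis: prime chains produce algebraically independent elements, and a relation
  between monomials at one point would, by semicontinuity, slow the growth of \<open>R/m^n\<close>
  on an open set, which a suitable fibre over affine space refutes. The normalization need only be
  free after inverting \<open>h\<close>, since the origin can be moved off the zeros of
  \<open>h\<close>.\<close>

definition is_ideal :: "'a::comm_ring_1 set \<Rightarrow> bool" where
  "is_ideal I \<longleftrightarrow> 0 \<in> I \<and> (\<forall>a\<in>I. \<forall>b\<in>I. a + b \<in> I) \<and> (\<forall>r. \<forall>a\<in>I. r * a \<in> I)"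

definition is_prime :: "'a::comm_ring_1 set \<Rightarrow> bool" where
  "is_prime I \<longleftrightarrow> is_ideal I \<and> 1 \<notin> I \<and> (\<forall>a b. a * b \<in> I \<longrightarrow> a \<in> I \<or> b \<in> I)"

lemma is_idealD:
  assumes "is_ideal I"
  shows "0 \<in> I" "a \<in> I \<Longrightarrow> b \<in> I \<Longrightarrow> a + b \<in> I" "a \<in> I \<Longrightarrow> r * a \<in> I" "a \<in> I \<Longrightarrow> a * r \<in> I"
    "a \<in> I \<Longrightarrow> - a \<in> I" "a \<in> I \<Longrightarrow> b \<in> I \<Longrightarrow> a - b \<in> I"
proof -
  show z: "0 \<in> I" using assms by (auto simp: is_ideal_def)
  show a: "a + b \<in> I" if "a \<in> I" "b \<in> I" for a b
    using assms that by (auto simp: is_ideal_def)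
  show m: "r * a \<in> I" if "a \<in> I" for a r using assms that by (auto simp: is_ideal_def)
  show "a * r \<in> I" if "a \<in> I" for a r using m[OF that, of r] by (simp add: mult.commute)
  show u: "- a \<in> I" if "a \<in> I" for a using m[OF that, of "- 1"] by simp
  show "a - b \<in> I" if "a \<in> I" "b \<in> I" for a b using a[OF that(1) u[OF that(2)]] by simp
qed

lemma is_ideal_sum:
  assumes "is_ideal I" "\<And>x. x \<in> S \<Longrightarrow> f x \<in> I"
  shows "sum f S \<in> I"
  using assms(2) by (induction S rule: infinite_finite_induct) (auto intro: is_idealD[OF assms(1)])

lemma is_primeD:
  assumes "is_prime Q"
  shows "is_ideal Q" "1 \<notin> Q" "a * b \<in> Q \<Longrightarrow> a \<in> Q \<or> b \<in> Q"
  using assms by (auto simp: is_prime_def)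

lemma is_prime_power:
  assumes "is_prime Q" "a ^ n \<in> Q"
  shows "a \<in> Q"
  using assms(2) by (induction n) (use is_primeD[OF assms(1)] in auto)

lemma is_prime_prod:
  assumes "is_prime Q" "finite S" "prod f S \<in> Q"
  shows "\<exists>x\<in>S. f x \<in> Q"
  using assms(2,3) by (induction S rule: finite_induct) (use is_primeD[OF assms(1)] in auto)

text \<open>Finite sums of products, generated inductively so that inclusions of product ideals
  follow by rule induction, one product at a time.\<close>

inductive_set iprod :: "'a::comm_ring_1 set \<Rightarrow> 'a set \<Rightarrow> 'a set" for I J where
  zero: "0 \<in> iprod I J"
| step: "a \<in> I \<Longrightarrow> b \<in> J \<Longrightarrow> s \<in> iprod I J \<Longrightarrow> a * b + s \<in> iprod I J"

lemma iprod_mult: "a \<in> I \<Longrightarrow> b \<in> J \<Longrightarrow> a * b \<in> iprod I J"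
  using iprod.step[OF _ _ iprod.zero] by force

lemma iprod_add: "a \<in> iprod I J \<Longrightarrow> b \<in> iprod I J \<Longrightarrow> a + b \<in> iprod I J"
  by (induction a rule: iprod.induct) (auto simp: add.assoc intro: iprod.step)

lemma is_ideal_iprod:
  assumes "is_ideal J"
  shows "is_ideal (iprod I J)"
  unfolding is_ideal_def
proof (intro conjI ballI allI)
  fix r a assume "a \<in> iprod I J"
  then show "r * a \<in> iprod I J"
  proof (induction a rule: iprod.induct)
    case (step a b s)
    have "a * (r * b) + r * s \<in> iprod I J"
      by (intro iprod.step step is_idealD[OF assms])
    then show ?case by (simp add: algebra_simps)
  qed (auto intro: iprod.zero)
qed (auto intro: iprod.zero iprod_add)

lemma iprod_least:
  assumes "is_ideal K" "\<And>a b. a \<in> I \<Longrightarrow> b \<in> J \<Longrightarrow> a * b \<in> K"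
  shows "iprod I J \<subseteq> K"
proof
  fix x assume "x \<in> iprod I J"
  then show "x \<in> K" by (induction rule: iprod.induct) (auto intro: is_idealD[OF assms(1)] assms(2))
qed

primrec ipow :: "'a::comm_ring_1 set \<Rightarrow> nat \<Rightarrow> 'a set" where
  "ipow I 0 = UNIV"
| "ipow I (Suc n) = iprod I (ipow I n)"

lemma is_ideal_ipow: "is_ideal (ipow I n)"
proof (induction n)
  case 0 show ?case by (simp add: is_ideal_def)
qed (simp add: is_ideal_iprod)

lemmas ipowD = is_idealD[OF is_ideal_ipow]

lemma ipow_antimono: "m \<le> n \<Longrightarrow> ipow I n \<subseteq> ipow I m"
proof (induction rule: dec_induct)
  case (step n)
  have "ipow I (Suc n) \<subseteq> ipow I n" by (simp, rule iprod_least) (auto intro: ipowD is_ideal_ipow)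
  with step show ?case by blast
qed auto

lemma ipow_Suc_0:
  assumes "is_ideal I"
  shows "ipow I (Suc 0) = I"
proof
  show "ipow I (Suc 0) \<subseteq> I" by (simp, rule iprod_least) (auto intro: is_idealD[OF assms] assms)
  show "I \<subseteq> ipow I (Suc 0)"
  proof
    fix x assume "x \<in> I" then show "x \<in> ipow I (Suc 0)" using iprod_mult[of x I 1 UNIV] by simp
  qed
qed

lemma ipow_mult: "a \<in> ipow I m \<Longrightarrow> b \<in> ipow I n \<Longrightarrow> a * b \<in> ipow I (m + n)"
proof (induction m arbitrary: a)
  case (Suc m)
  from Suc.prems(1) have "a \<in> iprod I (ipow I m)" by simp
  then show ?case
  proof (induction a rule: iprod.induct)
    case zero then show ?case using ipowD(1)[of I "Suc m + n"] by simp
  next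
    case (step x y s)
    have "x * (y * b) + s * b \<in> ipow I (Suc m + n)"
      using iprod.step[OF step(1) Suc.IH[OF step(2) Suc.prems(2)]] step by simp
    then show ?case by (simp add: algebra_simps)
  qed
qed (auto intro: ipowD)

lemma ipow_add: "ipow I (m + n) \<subseteq> iprod (ipow I m) (ipow I n)"
proof (induction m)
  case 0 then show ?case using iprod_mult[of 1 UNIV] by fastforce
next
  case (Suc m)
  have "ipow I (Suc m + n) = iprod I (ipow I (m + n))" by simp
  also have "\<dots> \<subseteq> iprod (ipow I (Suc m)) (ipow I n)"
  proof (rule iprod_least[OF is_ideal_iprod[OF is_ideal_ipow]])
    fix a b assume a: "a \<in> I" and "b \<in> ipow I (m + n)"
    with Suc have "b \<in> iprod (ipow I m) (ipow I n)" by blast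
    then show "a * b \<in> iprod (ipow I (Suc m)) (ipow I n)"
    proof (induction b rule: iprod.induct)
      case (step x y s)
      have "(a * x) * y + a * s \<in> iprod (ipow I (Suc m)) (ipow I n)"
        by (intro iprod.step step) (auto intro: iprod_mult a step)
      then show ?case by (simp add: algebra_simps)
    qed (auto intro: iprod.zero)
  qed
  finally show ?case .
qed

lemma iprod_mono: "I \<subseteq> I' \<Longrightarrow> J \<subseteq> J' \<Longrightarrow> is_ideal J' \<Longrightarrow> iprod I J \<subseteq> iprod I' J'"
  by (rule iprod_least[OF is_ideal_iprod]) (auto intro: iprod_mult)

lemma ipow_ipow: "ipow I (m * n) \<subseteq> ipow (ipow I m) n"
proof (induction n)
  case (Suc n)
  have "ipow I (m * Suc n) \<subseteq> iprod (ipow I m) (ipow I (m * n))" using ipow_add[of I m "m * n"] by simp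
  also have "\<dots> \<subseteq> iprod (ipow I m) (ipow (ipow I m) n)" by (intro iprod_mono Suc is_ideal_ipow order_refl)
  finally show ?case by simp
qed simp

lemma ipow_power:
  assumes "a \<in> ipow I m" shows "a ^ n \<in> ipow I (m * n)"
proof (induction n)
  case (Suc n)
  show ?case using ipow_mult[OF assms Suc] by simp
qed simp

lemma ipow_power1: "a \<in> I \<Longrightarrow> a ^ n \<in> ipow I n"
  by (induction n) (auto intro: iprod_mult)

lemma ipow_prod:
  assumes "finite S" "\<And>i. i \<in> S \<Longrightarrow> f i \<in> ipow I (e i)"
  shows "prod f S \<in> ipow I (sum e S)"
  using assms by (induction S rule: finite_induct) (auto intro: ipow_mult)

text \<open>If \<open>w\<close> pushes \<open>I\<close> into \<open>J\<close>, a product of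
  \<open>n\<close> elements of \<open>I\<close> needs \<open>n\<close> copies of \<open>w\<close>,
  one for each factor. This transports orders of vanishing along a local denominator
  \<open>w\<close>.\<close>

lemma ipow_twist:
  assumes "x \<in> ipow I n" "\<And>c. c \<in> I \<Longrightarrow> c * w \<in> J"
  shows "x * w ^ n \<in> ipow J n"
  using assms(1)
proof (induction n arbitrary: x)
  case (Suc n)
  from Suc.prems have "x \<in> iprod I (ipow I n)" by simp
  then show ?case
  proof (induction x rule: iprod.induct)
    case zero then show ?case using ipowD(1)[of J "Suc n"] by simp
  next
    case (step a b s)
    have "(a * w) * (b * w ^ n) + s * w ^ Suc n \<in> ipow J (Suc n)"
      unfolding ipow.simps
      by (intro iprod.step assms(2) step(1) Suc.IH step(2)) (use step in simp)
    then show ?case by (simp add: algebra_simps)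
  qed
qed simp

text \<open>The sum runs over the whole set and is 0 by convention when \<open>G\<close> is
  infinite, so the definition is meant for finite \<open>G\<close>.\<close>

definition gideal :: "'a::comm_ring_1 set \<Rightarrow> 'a set" where
  "gideal G = {\<Sum>v\<in>G. r v * v | r. True}"

lemma is_ideal_gideal: "is_ideal (gideal G)"
  unfolding is_ideal_def
proof (intro conjI ballI allI)
  show "0 \<in> gideal G" unfolding gideal_def by (auto intro!: exI[of _ "\<lambda>_. 0"])
next
  fix a b assume "a \<in> gideal G" "b \<in> gideal G"
  then obtain r s where "a = (\<Sum>v\<in>G. r v * v)" "b = (\<Sum>v\<in>G. s v * v)" by (auto simp: gideal_def)
  then show "a + b \<in> gideal G" unfolding gideal_def
    by (auto intro!: exI[of _ "\<lambda>v. r v + s v"] simp: sum.distrib algebra_simps)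
next
  fix a b assume "a \<in> gideal G"
  then obtain r where "a = (\<Sum>v\<in>G. r v * v)" by (auto simp: gideal_def)
  then show "b * a \<in> gideal G" unfolding gideal_def
    by (auto intro!: exI[of _ "\<lambda>v. b * r v"] simp: sum_distrib_left mult.assoc)
qed

lemma gideal_incl: "finite G \<Longrightarrow> v \<in> G \<Longrightarrow> v \<in> gideal G"
  unfolding gideal_def
proof (rule CollectI, rule exI[of _ "\<lambda>w. if w = v then 1 else 0"])
  assume "finite G" "v \<in> G"
  moreover have "(\<Sum>w\<in>G. (if w = v then 1 else 0) * w) = (\<Sum>w\<in>G. if w = v then w else 0)"
    by (rule sum.cong) auto
  ultimately show "v = (\<Sum>w\<in>G. (if w = v then 1 else 0) * w) \<and> True" by simp
qed

lemma gideal_least: "is_ideal I \<Longrightarrow> G \<subseteq> I \<Longrightarrow> gideal G \<subseteq> I"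
  unfolding gideal_def by (auto intro!: is_ideal_sum intro: is_idealD)

lemma iprod_gideal:
  assumes "finite G" "finite H"
  shows "iprod (gideal G) (gideal H) = gideal ((\<lambda>(a, b). a * b) ` (G \<times> H))" (is "_ = gideal ?M")
proof
  show "gideal ?M \<subseteq> iprod (gideal G) (gideal H)"
    by (rule gideal_least) (auto intro!: is_ideal_iprod is_ideal_gideal iprod_mult gideal_incl assms)
  show "iprod (gideal G) (gideal H) \<subseteq> gideal ?M"
  proof (rule iprod_least[OF is_ideal_gideal])
    fix a b assume "a \<in> gideal G" "b \<in> gideal H"
    then obtain r s where ab: "a = (\<Sum>v\<in>G. r v * v)" "b = (\<Sum>v\<in>H. s v * v)"
      by (auto simp: gideal_def)
    have "a * b = (\<Sum>v\<in>G. \<Sum>w\<in>H. (r v * s w) * (v * w))"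
      by (simp add: ab sum_product mult_ac)
    also have "\<dots> \<in> gideal ?M"
      using assms
      by (intro is_ideal_sum[OF is_ideal_gideal] is_idealD(3)[OF is_ideal_gideal] gideal_incl) auto
    finally show "a * b \<in> gideal ?M" .
  qed
qed

lemma ipow_gideal:
  assumes "finite G"
  shows "\<exists>H. finite H \<and> ipow (gideal G) n = gideal H"
proof (induction n)
  case 0
  have "x \<in> gideal {1}" for x :: 'a unfolding gideal_def by (auto intro: exI[of _ "\<lambda>_. x"])
  then show ?case by (intro exI[of _ "{1}"]) auto
next
  case (Suc n)
  then obtain H where "finite H" "ipow (gideal G) n = gideal H" by blast
  then show ?case using iprod_gideal[OF assms, of H] assms
    by (intro exI[of _ "(\<lambda>(a, b). a * b) ` (G \<times> H)"]) auto
qed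

section \<open>Homogeneous linear systems\<close>

definition is_subring :: "'a::comm_ring_1 set \<Rightarrow> bool" where
  "is_subring S \<longleftrightarrow> 0 \<in> S \<and> 1 \<in> S \<and> (\<forall>a\<in>S. \<forall>b\<in>S. a + b \<in> S \<and> a * b \<in> S) \<and> (\<forall>a\<in>S. - a \<in> S)"

lemma is_subringD:
  assumes "is_subring S"
  shows "0 \<in> S" "1 \<in> S" "a \<in> S \<Longrightarrow> b \<in> S \<Longrightarrow> a + b \<in> S" "a \<in> S \<Longrightarrow> b \<in> S \<Longrightarrow> a * b \<in> S"
    "a \<in> S \<Longrightarrow> - a \<in> S" "a \<in> S \<Longrightarrow> b \<in> S \<Longrightarrow> a - b \<in> S"
proof -
  show "0 \<in> S" "1 \<in> S" "a \<in> S \<Longrightarrow> b \<in> S \<Longrightarrow> a * b \<in> S"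
    and a: "a \<in> S \<Longrightarrow> b \<in> S \<Longrightarrow> a + b \<in> S" and u: "a \<in> S \<Longrightarrow> - a \<in> S" for a b
    using assms unfolding is_subring_def by auto
  show "a \<in> S \<Longrightarrow> b \<in> S \<Longrightarrow> a - b \<in> S" using a[of a "- b"] u[of b] by simp
qed

lemma is_subring_sum:
  assumes "is_subring I" "\<And>x. x \<in> S \<Longrightarrow> f x \<in> I"
  shows "sum f S \<in> I"
  using assms(2) by (induction S rule: infinite_finite_induct) (auto intro: is_subringD[OF assms(1)])

lemma is_subring_prod:
  assumes "is_subring I" "\<And>x. x \<in> S \<Longrightarrow> f x \<in> I"
  shows "prod f S \<in> I"
  using assms(2) by (induction S rule: infinite_finite_induct) (auto intro: is_subringD[OF assms(1)])

lemma is_subring_power: "is_subring I \<Longrightarrow> x \<in> I \<Longrightarrow> x ^ n \<in> I"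
  by (induction n) (auto intro: is_subringD)

text \<open>Gaussian elimination with cross multiplication in place of division, so that the
  solution stays inside the given subring \<open>S\<close>. It serves both the field
  \<open>k\<close> and images of polynomial rings inside \<open>R\<close>.\<close>

lemma homogeneous_system:
  fixes A :: "'j \<Rightarrow> 'i \<Rightarrow> 'a::idom"
  assumes S: "is_subring S"
    and "finite I" "finite J" "card I < card J" "\<And>j i. j \<in> J \<Longrightarrow> i \<in> I \<Longrightarrow> A j i \<in> S"
  shows "\<exists>c. (\<forall>j. c j \<in> S) \<and> (\<exists>j\<in>J. c j \<noteq> 0) \<and> (\<forall>i\<in>I. (\<Sum>j\<in>J. c j * A j i) = 0)"
  using assms(2-)
proof (induction I arbitrary: J A rule: finite_induct)
  case empty
  then have "J \<noteq> {}" by auto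
  then show ?case by (intro exI[of _ "\<lambda>_. 1"]) (auto intro: is_subringD[OF S])
next
  case (insert i0 I)
  show ?case
  proof (cases "\<forall>j\<in>J. A j i0 = 0")
    case True
    have "\<exists>c. (\<forall>j. c j \<in> S) \<and> (\<exists>j\<in>J. c j \<noteq> 0) \<and> (\<forall>i\<in>I. (\<Sum>j\<in>J. c j * A j i) = 0)"
      using insert by (intro insert.IH) auto
    then obtain c where "\<forall>j. c j \<in> S" "\<exists>j\<in>J. c j \<noteq> 0" "\<forall>i\<in>I. (\<Sum>j\<in>J. c j * A j i) = 0" by blast
    with True show ?thesis by (intro exI[of _ c]) simp
  next
    case False
    then obtain j0 where j0: "j0 \<in> J" "A j0 i0 \<noteq> 0" by blast
    let ?J = "J - {j0}" and ?a = "A j0 i0"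
    \<comment> \<open>Eliminates the unknown at the pivot \<open>j0\<close> from the remaining
      equations; multiplying by the pivot instead of dividing keeps the entries in
      \<open>S\<close>.\<close>
    define A' where "A' j i = ?a * A j i - A j i0 * A j0 i" for j i
    have card: "card I < card ?J"
    proof -
      have "card ?J = card J - 1" using j0 by simp
      moreover have "card (insert i0 I) = Suc (card I)" using insert by simp
      ultimately show ?thesis using insert.prems by simp
    qed
    have "A' j i \<in> S" if "j \<in> ?J" "i \<in> I" for j i
      unfolding A'_def using that insert.prems(3) j0 by (auto intro!: is_subringD[OF S])
    then have "\<exists>c. (\<forall>j. c j \<in> S) \<and> (\<exists>j\<in>?J. c j \<noteq> 0) \<and> (\<forall>i\<in>I. (\<Sum>j\<in>?J. c j * A' j i) = 0)"
      using insert.prems(1) card by (intro insert.IH) auto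
    then obtain c where
      c: "\<And>j. c j \<in> S" "\<exists>j\<in>?J. c j \<noteq> 0" "\<And>i. i \<in> I \<Longrightarrow> (\<Sum>j\<in>?J. c j * A' j i) = 0" by blast
    \<comment> \<open>Scaling by the pivot, nonzero in a domain, keeps the solution nontrivial; the
      value at \<open>j0\<close> is forced by the equation \<open>i0\<close>.\<close>
    define c' where "c' j = (if j \<in> ?J then ?a * c j else if j = j0 then - (\<Sum>j\<in>?J. c j * A j i0) else 0)" for j
    have sum: "(\<Sum>j\<in>J. c' j * A j i) = (\<Sum>j\<in>?J. c j * A' j i)" for i
    proof -
      have "(\<Sum>j\<in>J. c' j * A j i) = c' j0 * A j0 i + (\<Sum>j\<in>?J. c' j * A j i)"
        using j0 insert.prems by (simp add: sum.remove)
      also have "(\<Sum>j\<in>?J. c' j * A j i) = (\<Sum>j\<in>?J. ?a * c j * A j i)"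
        by (rule sum.cong) (auto simp: c'_def)
      also have "c' j0 * A j0 i = (\<Sum>j\<in>?J. - (c j * A j i0 * A j0 i))"
        by (simp add: c'_def sum_distrib_right sum_negf)
      also have "(\<Sum>j\<in>?J. - (c j * A j i0 * A j0 i)) + (\<Sum>j\<in>?J. ?a * c j * A j i) = (\<Sum>j\<in>?J. c j * A' j i)"
        unfolding sum.distrib[symmetric] by (rule sum.cong) (auto simp: A'_def algebra_simps)
      finally show ?thesis .
    qed
    have "(\<Sum>j\<in>?J. c j * A' j i0) = 0" by (rule sum.neutral) (simp add: A'_def)
    then have "\<forall>i\<in>insert i0 I. (\<Sum>j\<in>J. c' j * A j i) = 0" using c(3) sum by auto
    moreover have "\<exists>j\<in>J. c' j \<noteq> 0" using c(2) j0 by (auto simp: c'_def)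
    moreover have "c' j \<in> S" for j
      unfolding c'_def using c(1) insert.prems(3) j0
      by (auto intro!: is_subringD[OF S] is_subring_sum[OF S])
    ultimately show ?thesis by blast
  qed
qed

section \<open>Algebras over a field and their points\<close>

locale kalg = comm_ring_hom \<phi> for \<phi> :: "'k::field \<Rightarrow> 'r::comm_ring_1"
begin

definition ksub :: "'r set \<Rightarrow> bool" where
  "ksub W \<longleftrightarrow> 0 \<in> W \<and> (\<forall>a\<in>W. \<forall>b\<in>W. a + b \<in> W) \<and> (\<forall>c. \<forall>a\<in>W. \<phi> c * a \<in> W)"

definition kcomb :: "'r set \<Rightarrow> ('r \<Rightarrow> 'k) \<Rightarrow> 'r" where
  "kcomb X a = (\<Sum>x\<in>X. \<phi> (a x) * x)"

definition spans_mod :: "'r set \<Rightarrow> 'r set \<Rightarrow> bool" where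
  "spans_mod X W \<longleftrightarrow> finite X \<and> (\<forall>f. \<exists>a. f - kcomb X a \<in> W)"

definition points :: "('r \<Rightarrow> 'k) set" where
  "points = {\<chi>. comm_ring_hom \<chi> \<and> (\<forall>c. \<chi> (\<phi> c) = c)}"

definition ker :: "('r \<Rightarrow> 'k) \<Rightarrow> 'r set" where "ker \<chi> = {f. \<chi> f = 0}"

lemma ksubD:
  assumes "ksub W"
  shows "0 \<in> W" "a \<in> W \<Longrightarrow> b \<in> W \<Longrightarrow> a + b \<in> W" "a \<in> W \<Longrightarrow> \<phi> c * a \<in> W" "a \<in> W \<Longrightarrow> - a \<in> W"
    "a \<in> W \<Longrightarrow> b \<in> W \<Longrightarrow> a - b \<in> W"
proof -
  show z: "0 \<in> W" using assms by (auto simp: ksub_def)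
  show a: "a + b \<in> W" if "a \<in> W" "b \<in> W" for a b using assms that by (auto simp: ksub_def)
  show m: "\<phi> c * a \<in> W" if "a \<in> W" for a c using assms that by (auto simp: ksub_def)
  show u: "- a \<in> W" if "a \<in> W" for a using m[OF that, of "- 1"] by (simp add: hom_uminus)
  show "a - b \<in> W" if "a \<in> W" "b \<in> W" for a b using a[OF that(1) u[OF that(2)]] by simp
qed

lemma ksub_sum: "ksub W \<Longrightarrow> (\<And>x. x \<in> S \<Longrightarrow> f x \<in> W) \<Longrightarrow> sum f S \<in> W"
  by (induction S rule: infinite_finite_induct) (auto intro: ksubD)

lemma ksub_ideal: "is_ideal W \<Longrightarrow> ksub W"
  unfolding ksub_def by (auto intro: is_idealD)

lemma ksub_kcomb: "ksub W \<Longrightarrow> X \<subseteq> W \<Longrightarrow> kcomb X a \<in> W"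
  unfolding kcomb_def by (auto intro!: ksub_sum ksubD)

lemma phi_inverse: "c \<noteq> 0 \<Longrightarrow> \<phi> c * \<phi> (inverse c) = 1"
  by (simp add: hom_mult[symmetric])

lemma ksub_scale_iff: "ksub W \<Longrightarrow> c \<noteq> 0 \<Longrightarrow> \<phi> c * a \<in> W \<longleftrightarrow> a \<in> W"
proof
  assume W: "ksub W" and c: "c \<noteq> 0"
  have "\<phi> (inverse c) * (\<phi> c * a) = (\<phi> c * \<phi> (inverse c)) * a" by (simp only: mult_ac)
  then have "\<phi> (inverse c) * (\<phi> c * a) = a" using phi_inverse[OF c] by simp
  then show "\<phi> c * a \<in> W \<Longrightarrow> a \<in> W" using ksubD(3)[OF W, of "\<phi> c * a" "inverse c"] by simp
qed (rule ksubD)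

text \<open>The coordinate vectors over \<open>X\<close> of the elements \<open>y j\<close> are
  dependent because they outnumber the coordinates; the errors stay in \<open>W\<close>.\<close>

lemma linear_dependence_mod:
  assumes W: "ksub W" and "finite X" "finite J" "card X < card J"
    and "\<And>j. j \<in> J \<Longrightarrow> \<exists>a. y j - kcomb X a \<in> W"
  shows "\<exists>c. (\<exists>j\<in>J. c j \<noteq> 0) \<and> (\<Sum>j\<in>J. \<phi> (c j) * y j) \<in> W"
proof -
  from assms(5) obtain A where A: "\<And>j. j \<in> J \<Longrightarrow> y j - kcomb X (A j) \<in> W" by metis
  have "is_subring (UNIV :: 'k set)" by (simp add: is_subring_def)
  from homogeneous_system[OF this assms(2-4), of A] obtain c where
    c: "\<exists>j\<in>J. c j \<noteq> 0" "\<forall>x\<in>X. (\<Sum>j\<in>J. c j * A j x) = 0" by auto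
  have "(\<Sum>j\<in>J. \<phi> (c j) * kcomb X (A j)) = (\<Sum>x\<in>X. (\<Sum>j\<in>J. \<phi> (c j * A j x) * x))"
    unfolding kcomb_def sum_distrib_left by (subst sum.swap) (simp add: hom_mult mult.assoc)
  also have "\<dots> = (\<Sum>x\<in>X. \<phi> (\<Sum>j\<in>J. c j * A j x) * x)"
    by (simp add: hom_sum sum_distrib_right)
  also have "\<dots> = 0" using c(2) by simp
  finally have "(\<Sum>j\<in>J. \<phi> (c j) * y j) = (\<Sum>j\<in>J. \<phi> (c j) * (y j - kcomb X (A j)))"
    by (simp add: right_diff_distrib sum_subtractf)
  also have "\<dots> \<in> W" using A by (intro ksub_sum[OF W] ksubD(3)[OF W])
  finally show ?thesis using c(1) by blast
qed

lemma kcomb_singleton_in: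
  assumes "finite X" "x \<in> X"
  shows "kcomb X (\<lambda>w. if w = x then c else 0) = \<phi> c * x"
proof -
  have "kcomb X (\<lambda>w. if w = x then c else 0) = (\<Sum>w\<in>X. if w = x then \<phi> c * w else 0)"
    unfolding kcomb_def by (rule sum.cong) auto
  then show ?thesis using assms by simp
qed

lemma kcomb_add: "kcomb X (\<lambda>x. a x + b x) = kcomb X a + kcomb X b"
  by (simp add: kcomb_def hom_add algebra_simps sum.distrib)

lemma kcomb_scale: "kcomb X (\<lambda>x. c * a x) = \<phi> c * kcomb X a"
  by (simp add: kcomb_def hom_mult algebra_simps sum_distrib_left)

lemma ksub_mod_span:
  assumes "ksub W" "finite X"
  shows "ksub {f. \<exists>a. f - kcomb X a \<in> W}"
  unfolding ksub_def
proof (intro conjI ballI allI; clarify)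
  show "\<exists>a. 0 - kcomb X a \<in> W" 
    by (rule exI[of _ "\<lambda>_. 0"]) (simp add: kcomb_def ksubD[OF assms(1)])
next
  fix f g a b assume "f - kcomb X a \<in> W" "g - kcomb X b \<in> W"
  then have "(f - kcomb X a) + (g - kcomb X b) \<in> W" by (rule ksubD[OF assms(1)])
  then show "\<exists>a. f + g - kcomb X a \<in> W"
    by (intro exI[of _ "\<lambda>x. a x + b x"]) (simp add: kcomb_add algebra_simps)
next
  fix c f a assume "f - kcomb X a \<in> W"
  then have "\<phi> c * (f - kcomb X a) \<in> W" by (rule ksubD[OF assms(1)])
  then show "\<exists>a. \<phi> c * f - kcomb X a \<in> W"
    by (intro exI[of _ "\<lambda>x. c * a x"]) (simp add: kcomb_scale algebra_simps)
qed

subsection \<open>Codimension\<close>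

definition fin_codim :: "'r set \<Rightarrow> bool" where "fin_codim W \<longleftrightarrow> (\<exists>X. spans_mod X W)"

text \<open>A least number of spanning vectors in place of the dimension of a quotient; meaningful
  under \<open>fin_codim\<close>.\<close>

definition codim :: "'r set \<Rightarrow> nat" where "codim W = (LEAST n. \<exists>X. spans_mod X W \<and> card X = n)"

lemma codim_le: "spans_mod X W \<Longrightarrow> codim W \<le> card X"
  unfolding codim_def by (rule Least_le) blast

lemma codim_witness: "fin_codim W \<Longrightarrow> \<exists>X. spans_mod X W \<and> card X = codim W"
  unfolding codim_def fin_codim_def by (rule LeastI_ex) blast

lemma spans_mod_mono: "spans_mod X W \<Longrightarrow> W \<subseteq> W' \<Longrightarrow> spans_mod X W'"
  unfolding spans_mod_def by blast

lemma fin_codim_mono: "fin_codim W \<Longrightarrow> W \<subseteq> W' \<Longrightarrow> fin_codim W'"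
  unfolding fin_codim_def using spans_mod_mono by blast

text \<open>Exchange: an element of \<open>W'\<close> outside \<open>W\<close> has a nonzero
  coefficient at some \<open>x0\<close> of a smallest spanning set for \<open>W\<close>, and modulo
  \<open>W'\<close> that expansion makes \<open>x0\<close> redundant.\<close>

lemma codim_strict:
  assumes "fin_codim W" "ksub W" "ksub W'" "W \<subset> W'"
  shows "codim W' < codim W"
proof -
  obtain X where X: "spans_mod X W" "card X = codim W" using codim_witness[OF assms(1)] by blast
  obtain f where f: "f \<in> W'" "f \<notin> W" using assms(4) by blast
  obtain a where a: "f - kcomb X a \<in> W" using X by (auto simp: spans_mod_def)
  have fin: "finite X" using X by (simp add: spans_mod_def)
  have "\<exists>x0\<in>X. a x0 \<noteq> 0"
  proof (rule ccontr)
    assume "\<not> ?thesis"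
    then have "kcomb X a = 0" by (auto simp: kcomb_def intro!: sum.neutral)
    with a f show False by simp
  qed
  then obtain x0 where x0: "x0 \<in> X" "a x0 \<noteq> 0" by blast
  let ?Y = "X - {x0}" and ?V = "{f. \<exists>b. f - kcomb (X - {x0}) b \<in> W'}"
  have V: "ksub ?V" by (rule ksub_mod_span) (use assms fin in auto)
  have WV: "W' \<subseteq> ?V"
    by (auto intro!: exI[of _ "\<lambda>_. 0"] simp: kcomb_def)
  have YV: "x \<in> ?V" if "x \<in> ?Y" for x
    using kcomb_singleton_in[of ?Y x 1] that fin ksubD(1)[OF assms(3)]
    by (intro CollectI exI[of _ "\<lambda>w. if w = x then 1 else 0"]) simp
  have "f - kcomb X a \<in> ?V" using a assms(4) WV by blast
  then have "kcomb X a \<in> ?V" using ksubD(5)[OF V, of f "f - kcomb X a"] f WV by auto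
  moreover have "kcomb X a = \<phi> (a x0) * x0 + kcomb ?Y a"
    unfolding kcomb_def using x0 fin by (simp add: sum.remove)
  moreover have "kcomb ?Y a \<in> ?V" using YV by (intro ksub_kcomb V) blast
  ultimately have "\<phi> (a x0) * x0 \<in> ?V" using ksubD(5)[OF V, of "kcomb X a" "kcomb ?Y a"] by simp
  then have "x0 \<in> ?V" using ksub_scale_iff[OF V x0(2)] by blast
  with YV have XV: "X \<subseteq> ?V" by blast
  have "spans_mod ?Y W'"
    unfolding spans_mod_def
  proof (intro conjI allI)
    fix g
    obtain b where "g - kcomb X b \<in> W" using X by (auto simp: spans_mod_def)
    then have "g - kcomb X b \<in> ?V" using assms(4) WV by blast
    from ksubD(2)[OF V this ksub_kcomb[OF V XV, of b]] show "\<exists>a. g - kcomb ?Y a \<in> W'" by simp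
  qed (use fin in auto)
  from codim_le[OF this] have "codim W' \<le> card X - 1" using x0 fin by simp
  moreover have "card X > 0" using x0 fin card_gt_0_iff by blast
  ultimately show ?thesis using X by linarith
qed

text \<open>Modulo \<open>gideal H\<close> the finite set \<open>Y\<close> suffices. Inside
  \<open>gideal H\<close> the coefficient of each generator can be reduced modulo \<open>I\<close>
  to the span of \<open>X\<close>, the error landing in the product ideal. Hence \<open>Y\<close>
  and the products of \<open>X\<close> with \<open>H\<close> span.\<close>

lemma fin_codim_iprod:
  assumes "fin_codim I" "is_ideal I" "finite H" "fin_codim (gideal H)"
  shows "fin_codim (iprod I (gideal H))"
proof -
  obtain X where X: "spans_mod X I" using assms by (auto simp: fin_codim_def)
  obtain Y where Y: "spans_mod Y (gideal H)" using assms by (auto simp: fin_codim_def)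
  let ?Z = "Y \<union> (\<lambda>(x, y). x * y) ` (X \<times> H)"
  let ?W = "iprod I (gideal H)"
  have fin: "finite X" "finite Y" "finite ?Z" using X Y assms by (auto simp: spans_mod_def)
  have W: "ksub ?W" by (intro ksub_ideal is_ideal_iprod is_ideal_gideal)
  let ?V = "{f. \<exists>b. f - kcomb ?Z b \<in> ?W}"
  have V: "ksub ?V" by (rule ksub_mod_span[OF W fin(3)])
  have WV: "?W \<subseteq> ?V" by (auto intro!: exI[of _ "\<lambda>_. 0"] simp: kcomb_def)
  have ZV: "x \<in> ?V" if "x \<in> ?Z" for x
    using kcomb_singleton_in[OF fin(3) that, of 1] ksubD(1)[OF W]
    by (intro CollectI exI[of _ "\<lambda>w. if w = x then 1 else 0"]) simp
  have GV: "gideal H \<subseteq> ?V"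
  proof
    fix g assume "g \<in> gideal H"
    then obtain r where g: "g = (\<Sum>v\<in>H. r v * v)" by (auto simp: gideal_def)
    have "r v * v \<in> ?V" if v: "v \<in> H" for v
    proof -
      obtain a where a: "r v - kcomb X a \<in> I" using X by (auto simp: spans_mod_def)
      have 1: "(r v - kcomb X a) * v \<in> ?V" using a v WV iprod_mult gideal_incl[OF assms(3)] by blast
      have "kcomb X a * v = (\<Sum>x\<in>X. \<phi> (a x) * (x * v))" 
        by (simp add: kcomb_def sum_distrib_right mult.assoc)
      also have "\<dots> \<in> ?V"
        using v by (intro ksub_sum[OF V] ksubD(3)[OF V] ZV) auto
      finally have "(r v - kcomb X a) * v + kcomb X a * v \<in> ?V" by (rule ksubD(2)[OF V 1])
      moreover have "(r v - kcomb X a) * v + kcomb X a * v = r v * v" by (simp add: algebra_simps)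
      ultimately show ?thesis by simp
    qed
    then show "g \<in> ?V" unfolding g by (intro ksub_sum[OF V])
  qed
  have "\<exists>b. f - kcomb ?Z b \<in> ?W" for f
  proof -
    obtain a where "f - kcomb Y a \<in> gideal H" using Y by (auto simp: spans_mod_def)
    then have "f - kcomb Y a \<in> ?V" using GV by blast
    moreover have "kcomb Y a \<in> ?V" using ZV by (intro ksub_kcomb[OF V]) blast
    ultimately have "(f - kcomb Y a) + kcomb Y a \<in> ?V" by (rule ksubD(2)[OF V])
    then show ?thesis by simp
  qed
  then show ?thesis unfolding fin_codim_def spans_mod_def using fin(3) by blast
qed

lemma fin_codim_ipow:
  assumes "finite G" "fin_codim (gideal G)"
  shows "fin_codim (ipow (gideal G) n)"
proof (induction n)
  case 0 show ?case by (auto simp: fin_codim_def spans_mod_def)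
next
  case (Suc n)
  obtain H where H: "finite H" "ipow (gideal G) n = gideal H" using ipow_gideal[OF assms(1)] by blast
  with Suc fin_codim_iprod[OF assms(2) is_ideal_gideal H(1)] show ?case by simp
qed

subsection \<open>Points\<close>

lemma pointsD:
  assumes "\<chi> \<in> points"
  shows "comm_ring_hom \<chi>" "\<chi> (\<phi> c) = c" "\<chi> (f + g) = \<chi> f + \<chi> g" "\<chi> (f * g) = \<chi> f * \<chi> g"
    "\<chi> 0 = 0" "\<chi> 1 = 1" "\<chi> (- f) = - \<chi> f" "\<chi> (f - g) = \<chi> f - \<chi> g" "\<chi> (f ^ n) = \<chi> f ^ n"
    "\<chi> (sum F S) = (\<Sum>x\<in>S. \<chi> (F x))" "\<chi> (prod F S) = (\<Prod>x\<in>S. \<chi> (F x))"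
proof -
  show c: "comm_ring_hom \<chi>" and "\<chi> (\<phi> c) = c" using assms by (auto simp: points_def)
  interpret h: comm_ring_hom \<chi> by (rule c)
  show "\<chi> (f + g) = \<chi> f + \<chi> g" "\<chi> (f * g) = \<chi> f * \<chi> g"
    "\<chi> 0 = 0" "\<chi> 1 = 1" "\<chi> (- f) = - \<chi> f" "\<chi> (f - g) = \<chi> f - \<chi> g" "\<chi> (f ^ n) = \<chi> f ^ n"
    "\<chi> (sum F S) = (\<Sum>x\<in>S. \<chi> (F x))" "\<chi> (prod F S) = (\<Prod>x\<in>S. \<chi> (F x))"
    by (auto simp: h.hom_add h.hom_mult h.hom_uminus h.hom_minus h.hom_power h.hom_sum h.hom_prod)
qed

lemma is_ideal_ker: "\<chi> \<in> points \<Longrightarrow> is_ideal (ker \<chi>)"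
  by (auto simp: is_ideal_def ker_def pointsD)

lemma is_prime_ker: "\<chi> \<in> points \<Longrightarrow> is_prime (ker \<chi>)"
  unfolding is_prime_def by (auto simp: is_ideal_ker, auto simp: ker_def pointsD)

lemma sub_point_in_ker: "\<chi> \<in> points \<Longrightarrow> f - \<phi> (\<chi> f) \<in> ker \<chi>"
  by (simp add: ker_def pointsD)

lemma ker_subset_imp_eq:
  assumes "\<chi> \<in> points" "\<psi> \<in> points" "ker \<chi> \<subseteq> ker \<psi>"
  shows "\<chi> = \<psi>"
proof
  fix f
  have "f - \<phi> (\<chi> f) \<in> ker \<psi>" using assms sub_point_in_ker by blast
  then show "\<chi> f = \<psi> f" using assms(2) by (simp add: ker_def pointsD)
qed

text \<open>Nonzero constants are units, so the constant congruent to \<open>z\<close> is unique,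
  and uniqueness makes the assignment a ring homomorphism.\<close>

lemma point_of_ideal:
  assumes "is_ideal Q" "1 \<notin> Q" "\<And>z. \<exists>c. z - \<phi> c \<in> Q"
  shows "\<exists>\<chi>\<in>points. ker \<chi> = Q"
proof -
  from assms(3) obtain \<chi> where \<chi>: "\<And>z. z - \<phi> (\<chi> z) \<in> Q" by metis
  have uniq: "\<chi> z = c" if "z - \<phi> c \<in> Q" for z c
  proof (rule ccontr)
    assume ne: "\<chi> z \<noteq> c"
    have "(z - \<phi> c) - (z - \<phi> (\<chi> z)) \<in> Q" using that \<chi> by (rule is_idealD(6)[OF assms(1)])
    then have "\<phi> (\<chi> z - c) * 1 \<in> Q" by (simp add: hom_minus)
    then show False using ksub_scale_iff[OF ksub_ideal[OF assms(1)], of "\<chi> z - c" 1] ne assms(2) by auto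
  qed
  have "\<chi> \<in> points"
    unfolding points_def
  proof (intro CollectI conjI allI)
    show "\<chi> (\<phi> c) = c" for c by (rule uniq) (simp add: is_idealD[OF assms(1)])
    have a: "\<chi> (f + g) = \<chi> f + \<chi> g" for f g
    proof (rule uniq)
      have "(f - \<phi> (\<chi> f)) + (g - \<phi> (\<chi> g)) \<in> Q" using \<chi> \<chi> by (rule is_idealD[OF assms(1)])
      then show "f + g - \<phi> (\<chi> f + \<chi> g) \<in> Q" by (simp add: hom_add algebra_simps)
    qed
    have m: "\<chi> (f * g) = \<chi> f * \<chi> g" for f g
    proof (rule uniq)
      have "(f - \<phi> (\<chi> f)) * g + (g - \<phi> (\<chi> g)) * \<phi> (\<chi> f) \<in> Q"
        by (intro is_idealD(2,4)[OF assms(1)] \<chi>)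
      then show "f * g - \<phi> (\<chi> f * \<chi> g) \<in> Q" by (simp add: hom_mult algebra_simps)
    qed
    show "comm_ring_hom \<chi>"
    proof
      show "\<chi> 0 = 0" "\<chi> 1 = 1" by (rule uniq, simp add: is_idealD[OF assms(1)])+
    qed (auto simp: a m)
  qed
  moreover have "ker \<chi> = Q"
  proof
    show "ker \<chi> \<subseteq> Q" using \<chi> by (auto simp: ker_def) (metis diff_zero hom_zero)
    show "Q \<subseteq> ker \<chi>" using uniq[of _ 0] by (auto simp: ker_def)
  qed
  ultimately show ?thesis by blast
qed

end

locale kalg_ac = kalg \<phi> for \<phi> :: "'k::alg_closed_field \<Rightarrow> 'r::comm_ring_1"
begin

sublocale mp: map_poly_comm_ring_hom \<phi> ..

text \<open>The polynomial splits into linear factors over \<open>k\<close>, and a prime containing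
  the product contains one of the factors.\<close>

lemma root_mod_prime:
  assumes Q: "is_prime Q" and "p \<noteq> 0" "poly (map_poly \<phi> p) z \<in> Q"
  shows "\<exists>c. z - \<phi> c \<in> Q"
  using assms(2,3)
proof (induction "degree p" arbitrary: p rule: less_induct)
  case less
  show ?case
  proof (cases "degree p = 0")
    case True
    then obtain c where c: "p = [:c:]" using degree_eq_zeroE by blast
    with less.prems have "c \<noteq> 0" "\<phi> c * 1 \<in> Q" by (auto simp: map_poly_pCons)
    then have "1 \<in> Q" using ksub_scale_iff[OF ksub_ideal[OF is_primeD(1)[OF Q]]] by blast
    then show ?thesis using is_primeD(2)[OF Q] by blast
  next
    case False
    then obtain x where x: "poly p x = 0" using alg_closed_imp_poly_has_root[of p] by auto
    then obtain q where q: "p = [:-x, 1:] * q" by (metis poly_eq_0_iff_dvd dvdE)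
    have "q \<noteq> 0" using q less.prems by auto
    then have "degree q < degree p" unfolding q by (subst degree_mult_eq) auto
    have "map_poly \<phi> p = [: - \<phi> x, 1:] * map_poly \<phi> q"
      unfolding q mp.hom_mult by (simp add: map_poly_pCons hom_uminus)
    then have "poly (map_poly \<phi> p) z = (z - \<phi> x) * poly (map_poly \<phi> q) z"
      by (simp del: mult_pCons_left add: poly_mult)
    with less.prems is_primeD(3)[OF Q] have "z - \<phi> x \<in> Q \<or> poly (map_poly \<phi> q) z \<in> Q" by metis
    then show ?thesis
    proof
      assume "poly (map_poly \<phi> q) z \<in> Q"
      with less.hyps \<open>degree q < degree p\<close> \<open>q \<noteq> 0\<close> show ?thesis by blast
    qed blast
  qed
qed

text \<open>In a finite-dimensional quotient the powers of \<open>z\<close> are dependent, so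
  \<open>z\<close> satisfies a nonzero polynomial over \<open>k\<close> modulo \<open>Q\<close> and
  is congruent to a constant.\<close>

lemma finite_codim_prime_is_point:
  assumes Q: "is_prime Q" and fin: "fin_codim Q"
  shows "\<exists>\<chi>\<in>points. ker \<chi> = Q"
proof (rule point_of_ideal)
  fix z
  obtain X where X: "spans_mod X Q" using fin by (auto simp: fin_codim_def)
  have "\<exists>c. (\<exists>j\<in>{..card X}. c j \<noteq> 0) \<and> (\<Sum>j\<in>{..card X}. \<phi> (c j) * z ^ j) \<in> Q"
    using X is_primeD(1)[OF Q]
    by (intro linear_dependence_mod[of Q X]) (auto simp: spans_mod_def ksub_ideal)
  then obtain c j where c: "j \<le> card X" "c j \<noteq> 0" "(\<Sum>j\<in>{..card X}. \<phi> (c j) * z ^ j) \<in> Q" by blast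
  define p where "p = (\<Sum>j\<in>{..card X}. monom (c j) j)"
  have "coeff p j = c j" using c(1) by (simp add: p_def coeff_sum)
  then have "p \<noteq> 0" using c(2) by auto
  moreover have "poly (map_poly \<phi> p) z = (\<Sum>j\<in>{..card X}. \<phi> (c j) * z ^ j)"
    by (simp add: p_def mp.hom_sum poly_sum map_poly_monom poly_monom)
  ultimately show "\<exists>c. z - \<phi> c \<in> Q" using root_mod_prime[OF Q] c(3) by metis
qed (use is_primeD[OF Q] in auto)

section \<open>Associated points of ideals of finite codimension\<close>

definition colon :: "'r set \<Rightarrow> 'r \<Rightarrow> 'r set" where "colon I f = {r. r * f \<in> I}"

lemma is_ideal_colon: "is_ideal I \<Longrightarrow> is_ideal (colon I f)"
  unfolding colon_def by (subst is_ideal_def) (auto simp: algebra_simps dest: is_idealD)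

lemma subset_colon: "is_ideal I \<Longrightarrow> I \<subseteq> colon I f"
  by (auto simp: colon_def dest: is_idealD)

text \<open>Among the multiples of \<open>f\<close> outside \<open>I\<close>, one whose annihilator
  modulo \<open>I\<close> has least codimension has a maximal annihilator, and maximal annihilators
  are prime. Finite codimension takes the place of a chain condition.\<close>

lemma associated_point:
  assumes I: "is_ideal I" "fin_codim I" and f: "f \<notin> I"
  shows "\<exists>u. \<exists>\<chi>\<in>points. colon I (u * f) = ker \<chi>"
proof -
  have "\<exists>u. u * f \<notin> I" using f by (intro exI[of _ 1]) simp
  then obtain u where u: "u * f \<notin> I"
    and least: "\<And>v. v * f \<notin> I \<Longrightarrow> codim (colon I (u * f)) \<le> codim (colon I (v * f))"
    using ex_has_least_nat[of "\<lambda>u. u * f \<notin> I" _ "\<lambda>u. codim (colon I (u * f))"] by metis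
  let ?Q = "colon I (u * f)"
  have fin: "fin_codim (colon I g)" for g using fin_codim_mono[OF I(2) subset_colon[OF I(1)]] .
  have "is_prime ?Q"
    unfolding is_prime_def
  proof (intro conjI allI impI is_ideal_colon I)
    show "1 \<notin> ?Q" using u by (simp add: colon_def)
    fix a b assume ab: "a * b \<in> ?Q"
    show "a \<in> ?Q \<or> b \<in> ?Q"
    proof (rule disjCI)
      assume b: "b \<notin> ?Q"
      then have bu: "(b * u) * f \<notin> I" by (simp add: colon_def mult.assoc)
      have sub: "?Q \<subseteq> colon I ((b * u) * f)"
      proof
        fix r assume "r \<in> ?Q"
        then have "b * (r * (u * f)) \<in> I" unfolding colon_def using is_idealD(3)[OF I(1), of "r * (u * f)" b] by simp
        then show "r \<in> colon I ((b * u) * f)" by (simp add: colon_def algebra_simps)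
      qed
      have "\<not> ?Q \<subset> colon I ((b * u) * f)"
        using codim_strict[OF fin ksub_ideal[OF is_ideal_colon[OF I(1)]] ksub_ideal[OF is_ideal_colon[OF I(1)]]]
          least[OF bu] by (meson not_le)
      with sub have "?Q = colon I ((b * u) * f)" by blast
      moreover have "a \<in> colon I ((b * u) * f)" using ab by (simp add: colon_def algebra_simps)
      ultimately show "a \<in> ?Q" by simp
    qed
  qed
  from finite_codim_prime_is_point[OF this fin] show ?thesis by metis
qed

text \<open>A composition series of \<open>R/I\<close> built from associated points: each step
  passes from \<open>I\<close> to \<open>I + Ru\<close> with a quotient of dimension one. Its length
  is at most \<open>D\<close>, which bounds both the number of points in \<open>X\<close> and the
  power of \<open>ker \<chi>\<close> that a local denominator \<open>w\<close> moves into
  \<open>I\<close>. Away from \<open>X\<close> the ideal is locally the whole ring, so there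
  \<open>w\<close> itself lies in \<open>I\<close>.\<close>

lemma primary_structure:
  assumes "is_ideal I" "fin_codim I" "codim I \<le> D"
  shows "\<exists>X\<subseteq>points. finite X \<and> card X \<le> D \<and> (\<forall>\<chi>\<in>X. I \<subseteq> ker \<chi>) \<and> (1 \<in> I \<or> X \<noteq> {}) \<and>
    (\<forall>\<chi>\<in>points. \<exists>w. \<chi> w \<noteq> 0 \<and> (\<forall>c\<in>ipow (ker \<chi>) D. c * w \<in> I) \<and> (\<chi> \<notin> X \<longrightarrow> w \<in> I))"
  using assms
proof (induction D arbitrary: I)
  case 0
  obtain X where X: "spans_mod X I" "card X = 0" using codim_witness[OF 0(2)] 0(3) by auto
  then have "X = {}" by (auto simp: spans_mod_def)
  with X have "1 \<in> I" unfolding spans_mod_def kcomb_def by (metis diff_zero sum.empty)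
  then show ?case using is_idealD(3)[OF 0(1), of 1]
    by (intro exI[of _ "{}"]) (auto simp: pointsD intro!: exI[of _ 1])
next
  case (Suc D)
  show ?case
  proof (cases "1 \<in> I")
    case True
    then show ?thesis using is_idealD(3)[OF Suc.prems(1), of 1]
      by (intro exI[of _ "{}"]) (auto simp: pointsD intro!: exI[of _ 1])
  next
    case False
    from associated_point[OF Suc.prems(1,2) this] obtain u \<psi> where
      u: "\<psi> \<in> points" "colon I u = ker \<psi>" by auto
    have "1 \<notin> colon I u" using u by (simp add: ker_def pointsD)
    then have uI: "u \<notin> I" by (simp add: colon_def)
    \<comment> \<open>The quotient \<open>J/I\<close> is a copy of \<open>R/ker \<psi>\<close>,
      since \<open>ker \<psi>\<close> is exactly the annihilator of \<open>u\<close> modulo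
      \<open>I\<close>.\<close>
    define J where "J = {b + r * u | b r. b \<in> I}"
    have J: "is_ideal J"
      unfolding is_ideal_def
    proof (intro conjI ballI allI)
      show "0 \<in> J" unfolding J_def using is_idealD(1)[OF Suc.prems(1)] by (auto intro!: exI[of _ 0])
    next
      fix x y assume "x \<in> J" "y \<in> J"
      then obtain b r c s where "b \<in> I" "c \<in> I" "x = b + r * u" "y = c + s * u" by (auto simp: J_def)
      then show "x + y \<in> J" unfolding J_def
        by (intro CollectI exI[of _ "b + c"] exI[of _ "r + s"])
          (auto simp: algebra_simps intro: is_idealD[OF Suc.prems(1)])
    next
      fix x t assume "x \<in> J"
      then obtain b r where "b \<in> I" "x = b + r * u" by (auto simp: J_def)
      then show "t * x \<in> J" unfolding J_def
        by (intro CollectI exI[of _ "t * b"] exI[of _ "t * r"])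
          (auto simp: algebra_simps intro: is_idealD[OF Suc.prems(1)])
    qed
    have IJ: "I \<subseteq> J"
    proof
      fix x assume "x \<in> I"
      then show "x \<in> J" unfolding J_def by (intro CollectI exI[of _ x] exI[of _ 0]) simp
    qed
    have uJ: "u \<in> J" unfolding J_def using is_idealD(1)[OF Suc.prems(1)] 
      by (intro CollectI exI[of _ 0] exI[of _ 1]) auto
    have "codim J < codim I"
      using IJ uJ uI by (intro codim_strict Suc.prems ksub_ideal J) auto
    then have "codim J \<le> D" using Suc.prems by simp
    from Suc.IH[OF J fin_codim_mono[OF Suc.prems(2) IJ] this] obtain X where
      X': "X \<subseteq> points" "finite X" "card X \<le> D" "\<forall>\<chi>\<in>X. J \<subseteq> ker \<chi>" "1 \<in> J \<or> X \<noteq> {}"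
      "\<forall>\<chi>\<in>points. \<exists>w. \<chi> w \<noteq> 0 \<and> (\<forall>c\<in>ipow (ker \<chi>) D. c * w \<in> J) \<and> (\<chi> \<notin> X \<longrightarrow> w \<in> J)"
      by (elim exE conjE)
    note X = X'(1-3) bspec[OF X'(4)] bspec[OF X'(6)]
    have kill: "q * j \<in> I" if qj: "q \<in> ker \<psi>" "j \<in> J" for q j
    proof -
      obtain b r where j: "b \<in> I" "j = b + r * u" using qj(2) by (auto simp: J_def)
      have "q * u \<in> I" using qj(1) u(2) by (auto simp: colon_def)
      from is_idealD(2)[OF Suc.prems(1) is_idealD(3)[OF Suc.prems(1) j(1), of q] is_idealD(3)[OF Suc.prems(1) this, of r]]
      have "q * b + r * (q * u) \<in> I" .
      then show ?thesis by (simp add: j(2) algebra_simps)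
    qed
    show ?thesis
    proof (intro exI[of _ "insert \<psi> X"] conjI ballI)
      show "insert \<psi> X \<subseteq> points" "finite (insert \<psi> X)" using X u by auto
      show "card (insert \<psi> X) \<le> Suc D" using X(2,3) by (simp add: card_insert_if)
      show "1 \<in> I \<or> insert \<psi> X \<noteq> {}" by simp
      show "I \<subseteq> ker \<chi>" if "\<chi> \<in> insert \<psi> X" for \<chi>
        using that X(4)[of \<chi>] IJ subset_colon[OF Suc.prems(1), of u] u(2) by blast
    next
      fix \<chi> assume \<chi>: "\<chi> \<in> points"
      obtain w where w: "\<chi> w \<noteq> 0" "\<And>c. c \<in> ipow (ker \<chi>) D \<Longrightarrow> c * w \<in> J" "\<chi> \<notin> X \<Longrightarrow> w \<in> J"
        using X(5)[OF \<chi>] by blast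
      show "\<exists>w. \<chi> w \<noteq> 0 \<and> (\<forall>c\<in>ipow (ker \<chi>) (Suc D). c * w \<in> I) \<and> (\<chi> \<notin> insert \<psi> X \<longrightarrow> w \<in> I)"
      proof (cases "\<chi> = \<psi>")
        case True
        have "c * w \<in> I" if "c \<in> ipow (ker \<chi>) (Suc D)" for c
        proof -
          from that have "c \<in> iprod (ker \<chi>) (ipow (ker \<chi>) D)" by simp
          then show ?thesis
          proof (induction rule: iprod.induct)
            case (step a b s)
            have "a * (b * w) + s * w \<in> I"
              by (rule is_idealD(2)[OF Suc.prems(1) kill step.IH]) (use step w(2) True in auto)
            then show ?case by (simp add: algebra_simps)
          qed (simp add: is_idealD[OF Suc.prems(1)])
        qed
        then show ?thesis using w(1) True by blast
      next
        case False
        \<comment> \<open>At a point other than \<open>\<psi>\<close> some \<open>v\<close> in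
          \<open>ker \<psi>\<close> is nonzero; multiplying the denominator by it kills the new
          factor \<open>J/I\<close>.\<close>
        have "\<not> ker \<psi> \<subseteq> ker \<chi>" using ker_subset_imp_eq[OF u(1) \<chi>] False by blast
        then obtain v where v: "v \<in> ker \<psi>" "\<chi> v \<noteq> 0" by (auto simp: ker_def)
        show ?thesis
        proof (intro exI[of _ "v * w"] conjI ballI impI)
          show "\<chi> (v * w) \<noteq> 0" using v w \<chi> by (simp add: pointsD)
          show "v * w \<in> I" if "\<chi> \<notin> insert \<psi> X" using that w(3) v(1) kill by blast
          fix c assume "c \<in> ipow (ker \<chi>) (Suc D)"
          then have "c \<in> ipow (ker \<chi>) D" by (rule rev_subsetD) (rule ipow_antimono, simp)
          then have "c * w \<in> J" by (rule w(2))
          from kill[OF v(1) this] show "c * (v * w) \<in> I" by (simp add: algebra_simps)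
        qed
      qed
    qed
  qed
qed

text \<open>If membership failed, some point would be associated to a multiple of \<open>f\<close>
  modulo the \<open>M\<close>-th power. But a power of the local denominator \<open>w\<close> at
  that point moves \<open>f\<close> into the \<open>M\<close>-th power, \<open>D\<close> orders of
  vanishing being traded for one factor of the ideal. As \<open>w\<close> is nonzero at the point,
  this is a contradiction.\<close>

lemma mem_ipow_of_local:
  assumes "finite G" "fin_codim (gideal G)" "codim (gideal G) \<le> D"
  shows "\<exists>X\<subseteq>points. finite X \<and> card X \<le> D \<and> (\<forall>\<chi>\<in>X. G \<subseteq> ker \<chi>) \<and> (1 \<in> gideal G \<or> X \<noteq> {}) \<and>
    (\<forall>f M. (\<forall>\<chi>\<in>X. f \<in> ipow (ker \<chi>) (D * M)) \<longrightarrow> f \<in> ipow (gideal G) M)"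
proof -
  let ?I = "gideal G"
  from primary_structure[OF is_ideal_gideal assms(2,3)] obtain X where
    X': "X \<subseteq> points" "finite X" "card X \<le> D" "\<forall>\<chi>\<in>X. ?I \<subseteq> ker \<chi>" "1 \<in> ?I \<or> X \<noteq> {}"
    "\<forall>\<chi>\<in>points. \<exists>w. \<chi> w \<noteq> 0 \<and> (\<forall>c\<in>ipow (ker \<chi>) D. c * w \<in> ?I) \<and> (\<chi> \<notin> X \<longrightarrow> w \<in> ?I)"
    by (elim exE conjE)
  note X = X'(1-5) bspec[OF X'(6)]
  have "f \<in> ipow ?I M" if f: "\<And>\<chi>. \<chi> \<in> X \<Longrightarrow> f \<in> ipow (ker \<chi>) (D * M)" for f M
  proof (rule ccontr)
    assume nf: "f \<notin> ipow ?I M"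
    from associated_point[OF is_ideal_ipow fin_codim_ipow[OF assms(1,2)] nf]
    obtain u \<chi> where u: "\<chi> \<in> points" "colon (ipow ?I M) (u * f) = ker \<chi>" by blast
    obtain w where w: "\<chi> w \<noteq> 0" "\<And>c. c \<in> ipow (ker \<chi>) D \<Longrightarrow> c * w \<in> ?I" "\<chi> \<notin> X \<Longrightarrow> w \<in> ?I"
      using X(6)[OF u(1)] by blast
    have "f * w ^ M \<in> ipow ?I M"
    proof (cases "\<chi> \<in> X")
      case True
      then have "f \<in> ipow (ipow (ker \<chi>) D) M" using f ipow_ipow by blast
      then show ?thesis by (rule ipow_twist) (rule w(2))
    next
      case False
      then show ?thesis using w(3) ipow_power1 ipowD(3) by blast
    qed
    then have "w ^ M * (u * f) \<in> ipow ?I M" using ipowD(3)[of "f * w ^ M" ?I M u] by (simp add: algebra_simps)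
    then have "w ^ M \<in> ker \<chi>" using u(2) by (auto simp: colon_def)
    then show False using w(1) u(1) by (simp add: ker_def pointsD)
  qed
  moreover have "G \<subseteq> ?I" using gideal_incl[OF assms(1)] by blast
  ultimately show ?thesis using X(1-5) by (intro exI[of _ X]) (auto dest!: subsetD)
qed

end

section \<open>Evaluation, variables and degrees of multivariate polynomials\<close>

section \<open>Polynomials in several variables\<close>

type_synonym 'k mp = "(nat \<Rightarrow>\<^sub>0 nat) \<Rightarrow>\<^sub>0 'k"

definition mono_at :: "(nat \<Rightarrow> 'a::comm_ring_1) \<Rightarrow> (nat \<Rightarrow>\<^sub>0 nat) \<Rightarrow> 'a" where
  "mono_at y m = (\<Prod>i\<in>Poly_Mapping.keys m. y i ^ Poly_Mapping.lookup m i)"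

definition ins :: "('k::comm_ring_1 \<Rightarrow> 'a::comm_ring_1) \<Rightarrow> (nat \<Rightarrow> 'a) \<Rightarrow> 'k mp \<Rightarrow> 'a" where
  "ins \<psi> y p = (\<Sum>m\<in>Poly_Mapping.keys p. \<psi> (Poly_Mapping.lookup p m) * mono_at y m)"

definition Var :: "nat \<Rightarrow> 'k::comm_ring_1 mp" where
  "Var i = Poly_Mapping.single (Poly_Mapping.single i 1) 1"

definition Const :: "'k::comm_ring_1 \<Rightarrow> 'k mp" where
  "Const c = Poly_Mapping.single 0 c"

lemma mono_at_superset:
  assumes "finite S" "Poly_Mapping.keys m \<subseteq> S"
  shows "mono_at y m = (\<Prod>i\<in>S. y i ^ Poly_Mapping.lookup m i)"
  unfolding mono_at_def by (rule prod.mono_neutral_left) (use assms in \<open>auto simp: in_keys_iff\<close>)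

lemma mono_at_add: "mono_at y (a + b) = mono_at y a * mono_at y b"
proof -
  let ?S = "Poly_Mapping.keys a \<union> Poly_Mapping.keys b"
  have "Poly_Mapping.keys (a + b) \<subseteq> ?S" by (rule Poly_Mapping.keys_add)
  then show ?thesis
    by (simp add: mono_at_superset[of ?S] lookup_add power_add prod.distrib)
qed

lemma mono_at_0 [simp]: "mono_at y 0 = 1" by (simp add: mono_at_def)

lemma mono_at_single [simp]: "mono_at y (Poly_Mapping.single i n) = y i ^ n"
  by (simp add: mono_at_def)

lemma poly_mapping_sum_single:
  "(\<Sum>m\<in>Poly_Mapping.keys p. Poly_Mapping.single m (Poly_Mapping.lookup p m)) = p"
proof (rule poly_mapping_eqI)
  fix k
  have "(\<Sum>m\<in>Poly_Mapping.keys p. Poly_Mapping.lookup (Poly_Mapping.single m (Poly_Mapping.lookup p m)) k)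
    = (\<Sum>m\<in>Poly_Mapping.keys p. if m = k then Poly_Mapping.lookup p m else 0)"
    by (rule sum.cong) (auto simp: lookup_single)
  then show "Poly_Mapping.lookup (\<Sum>m\<in>Poly_Mapping.keys p. Poly_Mapping.single m (Poly_Mapping.lookup p m)) k =
    Poly_Mapping.lookup p k"
    by (simp add: lookup_sum in_keys_iff)
qed

lemma Var_power: "Var i ^ n = Poly_Mapping.single (Poly_Mapping.single i n) 1"
  by (induction n) (simp_all add: Var_def mult_single single_add[symmetric])

lemma mono_at_Var: "mono_at Var m = Poly_Mapping.single m 1"
proof -
  have "(\<Prod>i\<in>S. Poly_Mapping.single (f i) (1::'a)) = Poly_Mapping.single (sum f S) 1" if "finite S"
    for S and f :: "nat \<Rightarrow> (nat \<Rightarrow>\<^sub>0 nat)"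
    using that by (induction S rule: finite_induct) (auto simp: mult_single)
  from this[of "Poly_Mapping.keys m" "\<lambda>i. Poly_Mapping.single i (Poly_Mapping.lookup m i)"]
  show ?thesis by (simp add: mono_at_def Var_power poly_mapping_sum_single)
qed

context comm_ring_hom
begin

lemma ins_superset:
  assumes "finite S" "Poly_Mapping.keys p \<subseteq> S"
  shows "ins hom y p = (\<Sum>m\<in>S. hom (Poly_Mapping.lookup p m) * mono_at y m)"
  unfolding ins_def by (rule sum.mono_neutral_left) (use assms in \<open>auto simp: in_keys_iff\<close>)

lemma ins_add: "ins hom y (p + q) = ins hom y p + ins hom y q"
proof -
  let ?S = "Poly_Mapping.keys p \<union> Poly_Mapping.keys q"
  have "Poly_Mapping.keys (p + q) \<subseteq> ?S" by (rule Poly_Mapping.keys_add)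
  then show ?thesis
    by (simp add: ins_superset[of ?S] lookup_add hom_add algebra_simps sum.distrib)
qed

lemma ins_single: "ins hom y (Poly_Mapping.single m c) = hom c * mono_at y m"
  by (cases "c = 0") (simp_all add: ins_def)

lemma ins_0: "ins hom y 0 = 0" by (simp add: ins_def)

lemma ins_sum: "ins hom y (sum f S) = (\<Sum>x\<in>S. ins hom y (f x))"
  by (induction S rule: infinite_finite_induct) (simp_all add: ins_0 ins_add)

lemma ins_mult: "ins hom y (p * q) = ins hom y p * ins hom y q"
proof -
  let ?s = "\<lambda>p m. Poly_Mapping.single m (Poly_Mapping.lookup p m)"
  have "p * q = (\<Sum>m\<in>Poly_Mapping.keys p. ?s p m) * (\<Sum>n\<in>Poly_Mapping.keys q. ?s q n)"
    by (simp add: poly_mapping_sum_single)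
  also have "\<dots> = (\<Sum>m\<in>Poly_Mapping.keys p. \<Sum>n\<in>Poly_Mapping.keys q.
      Poly_Mapping.single (m + n) (Poly_Mapping.lookup p m * Poly_Mapping.lookup q n))"
    by (simp add: sum_product mult_single)
  finally have "ins hom y (p * q) = (\<Sum>m\<in>Poly_Mapping.keys p. \<Sum>n\<in>Poly_Mapping.keys q.
      (hom (Poly_Mapping.lookup p m) * mono_at y m) * (hom (Poly_Mapping.lookup q n) * mono_at y n))"
    by (simp add: ins_sum ins_single hom_mult mono_at_add mult_ac)
  also have "\<dots> = ins hom y p * ins hom y q" by (simp add: ins_def sum_product)
  finally show ?thesis .
qed

lemma comm_ring_hom_ins: "comm_ring_hom (ins hom y)"
  by standard (simp_all add: ins_add ins_mult ins_0 ins_single flip: single_one)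

lemma ins_Var: "ins hom y (Var i) = y i" and ins_Const: "ins hom y (Const c) = hom c"
  by (simp_all add: ins_single Var_def Const_def)

end

lemma hom_ins:
  assumes "comm_ring_hom F"
  shows "F (ins \<psi> y p) = ins (F \<circ> \<psi>) (F \<circ> y) p"
proof -
  interpret comm_ring_hom F by (rule assms)
  show ?thesis by (simp add: ins_def mono_at_def hom_sum hom_mult hom_prod hom_power)
qed

lemma comm_ring_hom_Const: "comm_ring_hom Const"
  by standard (simp_all add: Const_def single_add mult_single)

lemma ins_Const_Var: "ins Const Var p = p"
proof -
  have "ins Const Var p = (\<Sum>m\<in>Poly_Mapping.keys p. Poly_Mapping.single m (Poly_Mapping.lookup p m))"
    unfolding ins_def by (rule sum.cong) (auto simp: mono_at_Var mult_single Const_def)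
  then show ?thesis by (simp add: poly_mapping_sum_single)
qed

lemma ins_cong:
  assumes "\<And>m i. m \<in> Poly_Mapping.keys p \<Longrightarrow> i \<in> Poly_Mapping.keys m \<Longrightarrow> y i = y' i"
  shows "ins \<psi> y p = ins \<psi> y' p"
  unfolding ins_def mono_at_def using assms by (intro sum.cong prod.cong refl arg_cong2[where f = "(*)"]) auto

subsection \<open>Polynomials in a given set of variables\<close>

lemma in_keys_multE:
  assumes "m \<in> Poly_Mapping.keys (p * q)"
  obtains a b where "m = a + b" "a \<in> Poly_Mapping.keys p" "b \<in> Poly_Mapping.keys q"
  using assms Poly_Mapping.keys_mult[of p q] by blast

definition Pol :: "nat set \<Rightarrow> 'k::comm_ring_1 mp set" where
  "Pol T = {p. \<forall>m\<in>Poly_Mapping.keys p. Poly_Mapping.keys m \<subseteq> T}"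

lemma Pol_mult: "p \<in> Pol T \<Longrightarrow> q \<in> Pol T \<Longrightarrow> p * q \<in> Pol T"
  unfolding Pol_def
proof (intro CollectI ballI)
  fix m assume pq: "p \<in> {p. \<forall>m\<in>Poly_Mapping.keys p. Poly_Mapping.keys m \<subseteq> T}"
    "q \<in> {p. \<forall>m\<in>Poly_Mapping.keys p. Poly_Mapping.keys m \<subseteq> T}" and "m \<in> Poly_Mapping.keys (p * q)"
  then obtain a b where ab: "m = a + b" "a \<in> Poly_Mapping.keys p" "b \<in> Poly_Mapping.keys q"
    by (auto elim: in_keys_multE)
  then have "Poly_Mapping.keys a \<subseteq> T" "Poly_Mapping.keys b \<subseteq> T" using pq by auto
  then show "Poly_Mapping.keys m \<subseteq> T" unfolding ab(1) using Poly_Mapping.keys_add[of a b] by auto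
qed

lemma Pol_add: "p \<in> Pol T \<Longrightarrow> q \<in> Pol T \<Longrightarrow> p + q \<in> Pol T"
  unfolding Pol_def using Poly_Mapping.keys_add[of p q] by blast

lemma Pol_single: "Poly_Mapping.keys m \<subseteq> T \<Longrightarrow> Poly_Mapping.single m c \<in> Pol T"
  unfolding Pol_def by simp

lemma is_subring_Pol: "is_subring (Pol T)"
  unfolding is_subring_def by (auto simp: Pol_mult Pol_add) (auto simp: Pol_def)

lemma Pol_Var: "i \<in> T \<Longrightarrow> Var i \<in> Pol T" and Pol_Const: "Const c \<in> Pol T"
  by (simp_all add: Pol_single Var_def Const_def)

lemma Pol_least:
  fixes S :: "'k::comm_ring_1 mp set"
  assumes S: "is_subring S" and "\<And>c. Const c \<in> S" "\<And>i. i \<in> T \<Longrightarrow> Var i \<in> S"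
  shows "Pol T \<subseteq> S"
proof
  fix p :: "'k mp" assume p: "p \<in> Pol T"
  have "ins Const Var p \<in> S"
    unfolding ins_def mono_at_def
    using p assms(2,3) unfolding Pol_def
    by (intro is_subring_sum[OF S] is_subringD(4)[OF S] is_subring_prod[OF S] is_subring_power[OF S]) auto
  then show "p \<in> S" by (simp add: ins_Const_Var)
qed

lemma Pol_empty: "p \<in> Pol {} \<Longrightarrow> p = Const (Poly_Mapping.lookup p 0)"
proof (rule poly_mapping_eqI)
  fix k assume "p \<in> Pol {}"
  then have "m = 0" if "m \<in> Poly_Mapping.keys p" for m using that by (auto simp: Pol_def)
  then show "Poly_Mapping.lookup p k = Poly_Mapping.lookup (Const (Poly_Mapping.lookup p 0)) k"
    by (cases "k = 0") (auto simp: Const_def lookup_single in_keys_iff)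
qed

text \<open>Univariate polynomials with coefficients in \<open>Pol T\<close>, evaluated at the new
  variable, form a subring that contains the constants and all variables.\<close>

lemma Pol_insert_poly:
  fixes p :: "'k::comm_ring_1 mp"
  assumes "p \<in> Pol (insert j T)"
  shows "\<exists>q. (\<forall>i. coeff q i \<in> Pol T) \<and> poly q (Var j) = p"
proof -
  let ?S = "{poly q (Var j :: 'k mp) | q. \<forall>i. coeff q i \<in> Pol T}"
  note P = is_subringD[OF is_subring_Pol]
  have S: "is_subring ?S"
    unfolding is_subring_def
  proof (intro conjI ballI)
    show "0 \<in> ?S" by (intro CollectI exI[of _ 0]) (simp add: P)
    show "1 \<in> ?S" by (intro CollectI exI[of _ 1]) (simp add: coeff_1 P)
  next
    fix a b assume "a \<in> ?S" "b \<in> ?S"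
    then obtain q r where qr: "a = poly q (Var j)" "b = poly r (Var j)" "\<forall>i. coeff q i \<in> Pol T"
      "\<forall>i. coeff r i \<in> Pol T" by blast
    then show "a + b \<in> ?S" by (intro CollectI exI[of _ "q + r"]) (simp add: P)
    show "a * b \<in> ?S" using qr
      by (intro CollectI exI[of _ "q * r"]) (auto simp: coeff_mult intro!: is_subring_sum[OF is_subring_Pol] P)
  next
    fix a assume "a \<in> ?S"
    then obtain q where "a = poly q (Var j)" "\<forall>i. coeff q i \<in> Pol T" by blast
    then show "- a \<in> ?S" by (intro CollectI exI[of _ "- q"]) (simp add: P)
  qed
  have C: "c \<in> ?S" if "c \<in> Pol T" for c
    using that by (intro CollectI exI[of _ "[:c:]"]) (auto simp: coeff_pCons P split: nat.split)
  have V: "Var i \<in> ?S" if "i \<in> insert j T" for i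
  proof (cases "i = j")
    case True
    then show ?thesis by (intro CollectI exI[of _ "[:0, 1:]"]) (auto simp: coeff_pCons P split: nat.split)
  next
    case False
    with that show ?thesis by (intro C Pol_Var) auto
  qed
  have "Pol (insert j T) \<subseteq> ?S" by (rule Pol_least[OF S C[OF Pol_Const] V])
  with assms show ?thesis by blast
qed

text \<open>Over a finite field the product of all \<open>X - a\<close>, plus one, has positive
  degree and no root.\<close>

lemma infinite_alg_closed: "infinite (UNIV :: 'k::alg_closed_field set)"
proof
  assume fin: "finite (UNIV :: 'k set)"
  let ?q = "(\<Prod>a\<in>(UNIV :: 'k set). [:- a, 1:])"
  have "degree ?q = card (UNIV :: 'k set)" by (subst degree_prod_eq_sum_degree) auto
  moreover have "card (UNIV :: 'k set) > 0" using fin by (simp add: card_gt_0_iff)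
  ultimately have "degree (?q + 1) > 0" by (subst degree_add_eq_left) auto
  then obtain x where "poly (?q + 1) x = 0" using alg_closed_imp_poly_has_root by blast
  moreover have "poly ?q x = 0" using fin by (auto simp: poly_prod)
  ultimately show False by simp
qed

lemma comm_ring_hom_id: "comm_ring_hom (\<lambda>x::'a::comm_ring_1. x)"
  by standard simp_all

text \<open>One variable at a time: choose the other coordinates so that the leading coefficient
  survives, then avoid the finitely many roots of the resulting univariate polynomial.\<close>

lemma nonroot_exists:
  fixes p :: "'k::alg_closed_field mp"
  assumes "finite T" "p \<in> Pol T" "p \<noteq> 0"
  shows "\<exists>a. ins (\<lambda>c. c) a p \<noteq> 0"
  using assms
proof (induction T arbitrary: p rule: finite_induct)
  case empty
  obtain c where c: "p = Const c" using Pol_empty[OF empty(1)] by (rule that)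
  then have "c \<noteq> 0" using empty(2) by (auto simp: Const_def)
  then show ?case unfolding c by (simp add: comm_ring_hom.ins_Const[OF comm_ring_hom_id])
next
  case (insert j T)
  obtain q where q: "\<And>i. coeff q i \<in> Pol T" "poly q (Var j) = p"
    using Pol_insert_poly[OF insert.prems(1)] by blast
  have "q \<noteq> 0" using q(2) insert.prems by auto
  then obtain a where a: "ins (\<lambda>c. c) a (lead_coeff q) \<noteq> 0" using insert.IH[OF q(1), of "degree q"] by auto
  let ?h = "\<lambda>a. ins (\<lambda>c::'k. c) a"
  have hom: "comm_ring_hom (?h a)" for a by (rule comm_ring_hom.comm_ring_hom_ins[OF comm_ring_hom_id])
  have "coeff (map_poly (?h a) q) (degree q) \<noteq> 0" using a 
    by (simp add: coeff_map_poly comm_ring_hom.ins_0[OF comm_ring_hom_id])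
  then have nz: "map_poly (?h a) q \<noteq> 0" by auto
  have "\<not> {v. poly (map_poly (?h a) q) v = 0} = UNIV"
    using poly_roots_finite[OF nz] infinite_alg_closed[where 'k = 'k] by auto
  then obtain v where v: "poly (map_poly (?h a) q) v \<noteq> 0" by blast
  have eq: "map_poly (?h (a(j := v))) q = map_poly (?h a) q"
  proof (rule map_poly_cong)
    fix c assume "c \<in> set (coeffs q)"
    then have "c \<in> Pol T" using q(1) by (auto simp: coeffs_def split: if_splits)
    then show "?h (a(j := v)) c = ?h a c" using insert.hyps(2) by (intro ins_cong) (auto simp: Pol_def)
  qed
  interpret h: comm_ring_hom "?h (a(j := v))" by (rule hom)
  interpret mh: map_poly_comm_ring_hom "?h (a(j := v))" ..
  have "?h (a(j := v)) p = poly (map_poly (?h (a(j := v))) q) (?h (a(j := v)) (Var j))"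
    unfolding q(2)[symmetric] by (rule h.poly_map_poly[symmetric])
  moreover have "?h (a(j := v)) (Var j) = v"
    using comm_ring_hom.ins_Var[OF comm_ring_hom_id, of "a(j := v)" j] by simp
  ultimately have "?h (a(j := v)) p \<noteq> 0" using v eq by simp
  then show ?case by blast
qed

subsection \<open>Degrees\<close>

definition mdeg :: "(nat \<Rightarrow>\<^sub>0 nat) \<Rightarrow> nat" where
  "mdeg m = (\<Sum>i\<in>Poly_Mapping.keys m. Poly_Mapping.lookup m i)"

lemma mdeg_add: "mdeg (a + b) = mdeg a + mdeg b"
proof -
  have sup: "mdeg m = (\<Sum>i\<in>S. Poly_Mapping.lookup m i)"
    if "finite S" "Poly_Mapping.keys m \<subseteq> S" for S m
    unfolding mdeg_def by (rule sum.mono_neutral_left) (use that in \<open>auto simp: in_keys_iff\<close>)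
  let ?S = "Poly_Mapping.keys a \<union> Poly_Mapping.keys b"
  have "Poly_Mapping.keys (a + b) \<subseteq> ?S" by (rule Poly_Mapping.keys_add)
  then show ?thesis by (simp add: sup[of ?S] lookup_add sum.distrib)
qed

lemma mdeg_eq_0: "mdeg m = 0 \<Longrightarrow> m = 0"
  by (rule poly_mapping_eqI) (auto simp: mdeg_def in_keys_iff)

text \<open>The \<open>M\<close>-th power of the maximal ideal of the origin, described through
  monomials.\<close>

definition high :: "nat \<Rightarrow> 'k::comm_ring_1 mp set" where
  "high M = {p. \<forall>m\<in>Poly_Mapping.keys p. M \<le> mdeg m}"

lemma is_ideal_high: "is_ideal (high M)"
  unfolding is_ideal_def
proof (intro conjI ballI allI)
  show "0 \<in> high M" by (simp add: high_def)
  show "p + q \<in> high M" if "p \<in> high M" "q \<in> high M" for p q :: "'a mp"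
    using that Poly_Mapping.keys_add[of p q] unfolding high_def by blast
  show "r * p \<in> high M" if "p \<in> high M" for r p :: "'a mp"
    using that unfolding high_def by (auto elim!: in_keys_multE simp: mdeg_add intro!: trans_le_add2)
qed

lemma high_mult: "p \<in> high M \<Longrightarrow> q \<in> high N \<Longrightarrow> p * q \<in> high (M + N)"
  unfolding high_def by (auto elim!: in_keys_multE simp: mdeg_add intro!: add_mono)

lemma Var_in_high: "Var i \<in> high (Suc 0)"
  unfolding high_def by (simp add: Var_def mdeg_def)

lemma lookup_Const_mult: "Poly_Mapping.lookup (Const c * p) m = c * Poly_Mapping.lookup p m"
  unfolding Const_def mult_map_scale_conv_mult[symmetric] by (simp add: Poly_Mapping.map.rep_eq when_def)

text \<open>A monomial of least degree in \<open>G\<close> cannot be cancelled in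
  \<open>h * G\<close>: it occurs there multiplied by the constant term of \<open>h\<close>, while
  the other terms of \<open>h\<close> only raise degrees.\<close>

lemma high_cancel:
  fixes h :: "'k::idom mp"
  assumes h: "Poly_Mapping.lookup h 0 \<noteq> 0" and hG: "h * G \<in> high M"
  shows "G \<in> high M"
proof (rule ccontr)
  assume "G \<notin> high M"
  then obtain b where "b \<in> Poly_Mapping.keys G \<and> mdeg b < M" by (auto simp: high_def not_le)
  from ex_has_least_nat[of "\<lambda>b. b \<in> Poly_Mapping.keys G \<and> mdeg b < M", OF this, of mdeg]
  obtain a where a: "a \<in> Poly_Mapping.keys G" "mdeg a < M"
    "\<And>b. b \<in> Poly_Mapping.keys G \<Longrightarrow> mdeg b < M \<Longrightarrow> mdeg a \<le> mdeg b" by blast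
  define h' where "h' = h - Const (Poly_Mapping.lookup h 0)"
  have h'0: "Poly_Mapping.lookup h' 0 = 0" by (simp add: h'_def Const_def lookup_minus)
  have "a \<notin> Poly_Mapping.keys (h' * G)"
  proof
    assume "a \<in> Poly_Mapping.keys (h' * G)"
    then obtain b c where bc: "a = b + c" "b \<in> Poly_Mapping.keys h'" "c \<in> Poly_Mapping.keys G"
      by (auto elim: in_keys_multE)
    have "b \<noteq> 0" using bc(2) h'0 by (auto simp: in_keys_iff)
    then have "mdeg b \<noteq> 0" using mdeg_eq_0 by blast
    then have "mdeg c < mdeg a" using bc by (simp add: mdeg_add)
    with a(2) a(3)[OF bc(3)] show False by simp
  qed
  moreover have "h * G = Const (Poly_Mapping.lookup h 0) * G + h' * G" by (simp add: h'_def algebra_simps)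
  ultimately have "Poly_Mapping.lookup (h * G) a = Poly_Mapping.lookup h 0 * Poly_Mapping.lookup G a"
    by (simp add: lookup_add lookup_Const_mult in_keys_iff)
  then have "a \<in> Poly_Mapping.keys (h * G)" using h a(1) by (simp add: in_keys_iff)
  then show False using hG a(2) by (auto simp: high_def)
qed

text \<open>Exponents are bounded coordinatewise rather than by total degree, so that there are
  exactly \<open>Suc N ^ card T\<close> of them.\<close>

definition Box :: "nat set \<Rightarrow> nat \<Rightarrow> (nat \<Rightarrow>\<^sub>0 nat) set" where
  "Box T N = {m. Poly_Mapping.keys m \<subseteq> T \<and> (\<forall>i. Poly_Mapping.lookup m i \<le> N)}"

lemma card_Box:
  assumes "finite T"
  shows "finite (Box T N)" "card (Box T N) = Suc N ^ card T"
proof -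
  have "bij_betw (\<lambda>m. restrict (Poly_Mapping.lookup m) T) (Box T N) (PiE T (\<lambda>_. {..N}))"
  proof (rule bij_betw_byWitness[where f' = "\<lambda>g. Abs_poly_mapping (\<lambda>i. if i \<in> T then g i else 0)"])
    have look: "Poly_Mapping.lookup (Abs_poly_mapping (\<lambda>i. if i \<in> T then g i else 0)) i = (if i \<in> T then g i else 0)"
      for g :: "nat \<Rightarrow> nat" and i
      by (subst Poly_Mapping.lookup_Abs_poly_mapping) (auto intro: finite_subset[OF _ assms])
    show "\<forall>m\<in>Box T N. Abs_poly_mapping (\<lambda>i. if i \<in> T then restrict (Poly_Mapping.lookup m) T i else 0) = m"
      by (auto intro!: poly_mapping_eqI simp: look) (auto simp: Box_def in_keys_iff)
    show "\<forall>g\<in>T \<rightarrow>\<^sub>E {..N}. restrict (Poly_Mapping.lookup (Abs_poly_mapping (\<lambda>i. if i \<in> T then g i else 0))) T = g"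
      by (auto simp: look fun_eq_iff PiE_def extensional_def)
    show "(\<lambda>m. restrict (Poly_Mapping.lookup m) T) ` Box T N \<subseteq> T \<rightarrow>\<^sub>E {..N}"
      by (auto simp: Box_def)
    show "(\<lambda>g. Abs_poly_mapping (\<lambda>i. if i \<in> T then g i else 0)) ` (T \<rightarrow>\<^sub>E {..N}) \<subseteq> Box T N"
      by (auto simp: Box_def look in_keys_iff split: if_splits)
  qed
  from bij_betw_finite[OF this] bij_betw_same_card[OF this] assms
  show "finite (Box T N)" "card (Box T N) = Suc N ^ card T"
    by (auto simp: card_PiE finite_PiE)
qed

lemma Box_mono: "N \<le> N' \<Longrightarrow> Box T N \<subseteq> Box T N'" unfolding Box_def by (auto intro: order_trans)

lemma Box_add: "a \<in> Box T N \<Longrightarrow> b \<in> Box T N' \<Longrightarrow> a + b \<in> Box T (N + N')"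
  unfolding Box_def using Poly_Mapping.keys_add[of a b] by (auto simp: lookup_add intro: add_mono)

lemma Box_mdeg:
  assumes "finite T" "m \<in> Box T N"
  shows "mdeg m \<le> card T * N"
proof -
  have "mdeg m \<le> (\<Sum>i\<in>Poly_Mapping.keys m. N)" unfolding mdeg_def using assms by (intro sum_mono) (auto simp: Box_def)
  also have "\<dots> \<le> card T * N" using assms by (auto simp: Box_def intro: card_mono)
  finally show ?thesis .
qed

definition boxed :: "nat set \<Rightarrow> nat \<Rightarrow> 'k::comm_ring_1 mp set" where
  "boxed T N = {p. Poly_Mapping.keys p \<subseteq> Box T N}"

lemma boxed_mult: "p \<in> boxed T M \<Longrightarrow> q \<in> boxed T N \<Longrightarrow> p * q \<in> boxed T (M + N)"
  unfolding boxed_def by (auto elim!: in_keys_multE intro!: Box_add)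

lemma boxed_add: "p \<in> boxed T N \<Longrightarrow> q \<in> boxed T N \<Longrightarrow> p + q \<in> boxed T N"
  unfolding boxed_def using Poly_Mapping.keys_add[of p q] by blast

lemma boxed_mono: "M \<le> N \<Longrightarrow> boxed T M \<subseteq> boxed T N"
  unfolding boxed_def using Box_mono by blast

lemma boxed_Const: "Const c \<in> boxed T N" by (simp add: Const_def boxed_def Box_def)

lemma boxed_sub_Pol: "boxed T N \<subseteq> Pol T" by (auto simp: boxed_def Box_def Pol_def)

lemma Pol_boxed: "p \<in> Pol T \<Longrightarrow> \<exists>N. p \<in> boxed T N"
proof -
  assume p: "p \<in> Pol T"
  let ?N = "\<Sum>m\<in>Poly_Mapping.keys p. mdeg m"
  have "Poly_Mapping.lookup m i \<le> ?N" if "m \<in> Poly_Mapping.keys p" for m i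
  proof (cases "i \<in> Poly_Mapping.keys m")
    case True
    then have "Poly_Mapping.lookup m i \<le> mdeg m" unfolding mdeg_def by (intro member_le_sum) auto
    also have "\<dots> \<le> ?N" using that by (intro member_le_sum) auto
    finally show ?thesis .
  qed (simp add: in_keys_iff)
  then show ?thesis using p by (intro exI[of _ ?N]) (auto simp: boxed_def Box_def Pol_def)
qed

section \<open>Noether normalization up to a denominator\<close>

section \<open>Generic normalization\<close>

text \<open>The coefficient set \<open>A\<close> need not be a ring: besides polynomial subrings it
  will be a set of polynomials with bounded exponents or of high order.\<close>

definition amod :: "'a::comm_ring_1 set \<Rightarrow> 'a set \<Rightarrow> 'a set \<Rightarrow> 'a set" where
  "amod A I C = {f. \<exists>a. (\<forall>c\<in>C. a c \<in> A) \<and> f - (\<Sum>c\<in>C. a c * c) \<in> I}"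

definition indep_mod :: "'a::comm_ring_1 set \<Rightarrow> 'a set \<Rightarrow> 'a set \<Rightarrow> bool" where
  "indep_mod A I B \<longleftrightarrow> (\<forall>a. (\<forall>b\<in>B. a b \<in> A) \<longrightarrow> (\<Sum>b\<in>B. a b * b) \<in> I \<longrightarrow> (\<forall>b\<in>B. a b \<in> I))"

definition add_closed :: "'a::comm_ring_1 set \<Rightarrow> bool" where
  "add_closed A \<longleftrightarrow> 0 \<in> A \<and> (\<forall>a\<in>A. \<forall>b\<in>A. a + b \<in> A)"

lemma add_closed_subring: "is_subring A \<Longrightarrow> add_closed A"
  by (auto simp: add_closed_def is_subring_def)

lemma amodI: "(\<And>c. c \<in> C \<Longrightarrow> a c \<in> A) \<Longrightarrow> f - (\<Sum>c\<in>C. a c * c) \<in> I \<Longrightarrow> f \<in> amod A I C"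
  unfolding amod_def by blast

lemma amodE:
  assumes "f \<in> amod A I C"
  obtains a where "\<forall>c\<in>C. a c \<in> A" "f - (\<Sum>c\<in>C. a c * c) \<in> I"
  using assms unfolding amod_def by blast

lemma amod_mono: "A \<subseteq> A' \<Longrightarrow> amod A I C \<subseteq> amod A' I C"
  unfolding amod_def by blast

lemma amod_ideal:
  assumes "0 \<in> A" "f \<in> I" shows "f \<in> amod A I C"
  by (rule amodI[of _ "\<lambda>_. 0"]) (use assms in auto)

lemma amod_base:
  assumes "is_ideal I" "add_closed A" "finite C" "c \<in> C" "a \<in> A" shows "a * c \<in> amod A I C"
proof (rule amodI)
  have "(\<Sum>x\<in>C. (if x = c then a else 0) * x) = (\<Sum>x\<in>C. if x = c then a * x else 0)" by (rule sum.cong) auto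
  also have "\<dots> = a * c" using assms by simp
  finally show "a * c - (\<Sum>x\<in>C. (if x = c then a else 0) * x) \<in> I" using is_idealD(1)[OF assms(1)] by simp
qed (use assms in \<open>auto simp: add_closed_def\<close>)

lemma amod_add:
  assumes "is_ideal I" "add_closed A" "f \<in> amod A I C" "g \<in> amod A I C"
  shows "f + g \<in> amod A I C"
proof -
  obtain a where a: "\<forall>c\<in>C. a c \<in> A" "f - (\<Sum>c\<in>C. a c * c) \<in> I" using assms(3) by (rule amodE)
  obtain b where b: "\<forall>c\<in>C. b c \<in> A" "g - (\<Sum>c\<in>C. b c * c) \<in> I" using assms(4) by (rule amodE)
  have "(f - (\<Sum>c\<in>C. a c * c)) + (g - (\<Sum>c\<in>C. b c * c)) \<in> I" by (rule is_idealD(2)[OF assms(1) a(2) b(2)])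
  then show ?thesis
    using assms(2) a(1) b(1)
    by (intro amodI[of C "\<lambda>c. a c + b c"]) (auto simp: add_closed_def algebra_simps sum.distrib)
qed

lemma amod_sum:
  assumes "is_ideal I" "add_closed A" "\<And>x. x \<in> S \<Longrightarrow> f x \<in> amod A I C"
  shows "sum f S \<in> amod A I C"
proof -
  have "0 \<in> amod A I C" using assms(2) is_idealD(1)[OF assms(1)] by (intro amod_ideal) (auto simp: add_closed_def)
  with assms(3) show ?thesis
    by (induction S rule: infinite_finite_induct) (auto intro: amod_add[OF assms(1,2)])
qed

lemma amod_scale:
  assumes "is_ideal I" "\<And>b. b \<in> A \<Longrightarrow> a * b \<in> A'" "f \<in> amod A I C"
  shows "a * f \<in> amod A' I C"
proof -
  obtain b where b: "\<forall>c\<in>C. b c \<in> A" "f - (\<Sum>c\<in>C. b c * c) \<in> I" using assms(3) by (rule amodE)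
  have "a * (f - (\<Sum>c\<in>C. b c * c)) \<in> I" by (rule is_idealD(3)[OF assms(1) b(2)])
  moreover have "a * (f - (\<Sum>c\<in>C. b c * c)) = a * f - (\<Sum>c\<in>C. (a * b c) * c)"
    by (simp add: right_diff_distrib sum_distrib_left mult.assoc)
  ultimately show ?thesis
    using assms(2) b(1) by (intro amodI[of C "\<lambda>c. a * b c"]) auto
qed

lemma amod_trans:
  assumes "is_ideal I" "is_subring A" "\<And>c. c \<in> C \<Longrightarrow> g * c \<in> amod A I C'" "f \<in> amod A I C"
  shows "g * f \<in> amod A I C'"
proof -
  obtain b where b: "\<forall>c\<in>C. b c \<in> A" "f - (\<Sum>c\<in>C. b c * c) \<in> I" using assms(4) by (rule amodE)
  have 1: "g * (f - (\<Sum>c\<in>C. b c * c)) \<in> amod A I C'"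
    by (rule amod_ideal[OF is_subringD(1)[OF assms(2)] is_idealD(3)[OF assms(1) b(2)]])
  have 2: "(\<Sum>c\<in>C. b c * (g * c)) \<in> amod A I C'"
  proof (rule amod_sum[OF assms(1) add_closed_subring[OF assms(2)]])
    fix c assume c: "c \<in> C"
    show "b c * (g * c) \<in> amod A I C'"
      by (rule amod_scale[OF assms(1) _ assms(3)[OF c]]) (rule is_subringD(4)[OF assms(2) bspec[OF b(1) c]])
  qed
  have "(\<Sum>c\<in>C. b c * (g * c)) = g * (\<Sum>c\<in>C. b c * c)"
    by (simp add: sum_distrib_left mult.left_commute)
  then have "g * (f - (\<Sum>c\<in>C. b c * c)) + (\<Sum>c\<in>C. b c * (g * c)) = g * f"
    by (simp add: right_diff_distrib)
  with amod_add[OF assms(1) add_closed_subring[OF assms(2)] 1 2]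
  show ?thesis by simp
qed

locale affine_alg = kalg_ac \<phi> for \<phi> :: "'k::alg_closed_field \<Rightarrow> 'r::idom" +
  fixes z :: "nat \<Rightarrow> 'r" and m :: nat
  assumes generated: "\<And>f. \<exists>p\<in>Pol {..<m}. ins \<phi> z p = f"
begin

lemma generated_induct:
  assumes S: "is_subring S" and "\<And>c. \<phi> c \<in> S" "\<And>i. i < m \<Longrightarrow> z i \<in> S"
  shows "f \<in> S"
proof -
  obtain p where p: "p \<in> Pol {..<m}" "ins \<phi> z p = f" using generated by blast
  have "ins \<phi> z p \<in> S"
    unfolding ins_def mono_at_def
    using p(1) assms(2,3) unfolding Pol_def
    by (intro is_subring_sum[OF S] is_subringD(4)[OF S] is_subring_prod[OF S] is_subring_power[OF S]) auto
  with p show ?thesis by simp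
qed

lemma is_subring_image: "is_subring S \<Longrightarrow> is_subring (ins \<phi> y ` S)"
  unfolding is_subring_def
proof (intro conjI ballI; (elim conjE)?)
  interpret i: comm_ring_hom "ins \<phi> y" by (rule comm_ring_hom_ins)
  assume S: "0 \<in> S" "1 \<in> S" "\<forall>a\<in>S. \<forall>b\<in>S. a + b \<in> S \<and> a * b \<in> S" "\<forall>a\<in>S. - a \<in> S"
  show "0 \<in> ins \<phi> y ` S" using S(1) by (force simp: image_iff)
  show "1 \<in> ins \<phi> y ` S" using S(2) by (force simp: image_iff)
  fix a assume "a \<in> ins \<phi> y ` S"
  then obtain a' where a': "a' \<in> S" "a = ins \<phi> y a'" by blast
  then show "- a \<in> ins \<phi> y ` S" using S(4) by (auto simp: image_iff i.hom_uminus intro!: bexI[of _ "- a'"])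
  fix b assume "b \<in> ins \<phi> y ` S"
  then obtain b' where b': "b' \<in> S" "b = ins \<phi> y b'" by blast
  show "a + b \<in> ins \<phi> y ` S" using S(3) a' b' by (auto simp: image_iff i.hom_add intro!: bexI[of _ "a' + b'"])
  show "a * b \<in> ins \<phi> y ` S" using S(3) a' b' by (auto simp: image_iff i.hom_mult intro!: bexI[of _ "a' * b'"])
qed

definition alg_indep :: "'r set \<Rightarrow> (nat \<Rightarrow> 'r) \<Rightarrow> nat set \<Rightarrow> bool" where
  "alg_indep I y T \<longleftrightarrow> (\<forall>p\<in>Pol T. ins \<phi> y p \<in> I \<longrightarrow> p = 0)"

text \<open>\<open>T\<close> is a largest set of generators independent modulo \<open>Q\<close>.
  Adjoining a further generator creates a relation, and it must involve the new variable, since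
  otherwise it would already be a relation over \<open>T\<close>.\<close>

lemma transcendence_basis:
  assumes Q: "is_prime Q"
  shows "\<exists>T\<subseteq>{..<m}. alg_indep Q z T \<and> (\<forall>j<m. \<exists>q. degree q > 0 \<and> (\<forall>i. coeff q i \<in> Pol T) \<and>
    poly (map_poly (ins \<phi> z) q) (z j) \<in> Q)"
proof -
  interpret i: comm_ring_hom "ins \<phi> z" by (rule comm_ring_hom_ins)
  interpret im: map_poly_comm_ring_hom "ins \<phi> z" ..
  let ?P = "\<lambda>T. T \<subseteq> {..<m} \<and> alg_indep Q z T"
  have "?P {}"
  proof (intro conjI)
    show "alg_indep Q z {}"
      unfolding alg_indep_def
    proof (intro ballI impI)
      fix p :: "'k mp" assume "p \<in> Pol {}" "ins \<phi> z p \<in> Q"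
      moreover obtain c where c: "p = Const c" using Pol_empty[OF \<open>p \<in> Pol {}\<close>] by (rule that)
      ultimately have "\<phi> c * 1 \<in> Q" by (simp add: ins_Const)
      then have "c = 0" using ksub_scale_iff[OF ksub_ideal[OF is_primeD(1)[OF Q]]] is_primeD(2)[OF Q] by blast
      then show "p = 0" by (simp add: c Const_def)
    qed
  qed simp
  moreover have "card T < Suc m" if "?P T" for T
    using that card_mono[of "{..<m}" T] by simp
  ultimately obtain T where T: "?P T" "\<And>T'. ?P T' \<Longrightarrow> card T' \<le> card T"
    using ex_has_greatest_nat[of ?P "{}" card "Suc m"] by (metis less_imp_le)
  have "\<exists>q. degree q > 0 \<and> (\<forall>i. coeff q i \<in> Pol T) \<and> poly (map_poly (ins \<phi> z) q) (z j) \<in> Q"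
    if j: "j < m" for j
  proof (cases "j \<in> T")
    case True
    have co: "coeff [:- Var j, 1 :: 'k mp:] i \<in> Pol T" for i
      using is_subringD[OF is_subring_Pol[of T]] Pol_Var[OF True]
      by (auto simp: coeff_pCons split: nat.split)
    have "poly (map_poly (ins \<phi> z) [:- Var j, 1:]) (z j) = 0"
      by (simp add: map_poly_pCons i.hom_uminus ins_Var)
    then have "poly (map_poly (ins \<phi> z) [:- Var j, 1:]) (z j) \<in> Q"
      using is_idealD(1)[OF is_primeD(1)[OF Q]] by simp
    then show ?thesis by (intro exI[of _ "[:- Var j, 1:]"] conjI allI co) simp_all
  next
    case False
    have "finite T" using T(1) finite_subset by blast
    then have "card (insert j T) > card T" using False by simp
    with T j have "\<not> alg_indep Q z (insert j T)" by (meson insert_subset lessThan_iff not_le)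
    then obtain p where p: "p \<in> Pol (insert j T)" "ins \<phi> z p \<in> Q" "p \<noteq> 0" by (auto simp: alg_indep_def)
    obtain q where q: "\<And>i. coeff q i \<in> Pol T" "poly q (Var j) = p" using Pol_insert_poly[OF p(1)] by blast
    have "degree q > 0"
    proof (rule ccontr)
      assume "\<not> degree q > 0"
      then obtain c where c: "q = [:c:]" using degree_eq_zeroE by blast
      then have "p = c" "c \<in> Pol T" using q(2) q(1)[of 0] by auto
      then show False using p T(1) by (auto simp: alg_indep_def)
    qed
    moreover have "poly (map_poly (ins \<phi> z) q) (z j) = ins \<phi> z p"
      using i.poly_map_poly[of q "Var j"] q(2) by (simp add: ins_Var)
    ultimately show ?thesis using q(1) p(2) by metis
  qed
  then show ?thesis using T(1) by blast
qed

text \<open>Each relation expresses its leading coefficient times \<open>w j ^ n\<close> through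
  lower powers. So the monomials with exponents below these degrees span once the product
  \<open>H\<close> of the leading coefficients is inverted, and \<open>H\<close> stays outside the
  prime.\<close>

lemma amod_generators:
  assumes Q: "is_prime Q" and A: "is_subring A" and "finite J"
    and rel: "\<And>j. j \<in> J \<Longrightarrow> \<exists>n a. n > 0 \<and> (\<forall>i\<le>n. a i \<in> A) \<and> a n \<notin> Q \<and> (\<Sum>i\<le>n. a i * w j ^ i) \<in> Q"
  shows "\<exists>C H. finite C \<and> 1 \<in> C \<and> H \<in> A \<and> H \<notin> Q \<and> (\<forall>j\<in>J. \<forall>c\<in>C. H * w j * c \<in> amod A Q C)"
  using assms(3,4)
proof (induction J rule: finite_induct)
  case empty
  show ?case using is_subringD(2)[OF A] is_primeD(2)[OF Q] by (intro exI[of _ "{1}"] exI[of _ 1]) auto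
next
  case (insert j J)
  note I = is_primeD(1)[OF Q] and AD = is_subringD[OF A] and AC = add_closed_subring[OF A]
  have "\<exists>C H. finite C \<and> 1 \<in> C \<and> H \<in> A \<and> H \<notin> Q \<and> (\<forall>j\<in>J. \<forall>c\<in>C. H * w j * c \<in> amod A Q C)"
    by (rule insert.IH) (rule insert.prems, simp)
  then obtain C H where C': "finite C" "1 \<in> C" "H \<in> A" "H \<notin> Q" "\<forall>j\<in>J. \<forall>c\<in>C. H * w j * c \<in> amod A Q C"
    by (elim exE conjE)
  note C = C'(1-4) bspec[OF bspec[OF C'(5)]]
  have "\<exists>n a. n > 0 \<and> (\<forall>i\<le>n. a i \<in> A) \<and> a n \<notin> Q \<and> (\<Sum>i\<le>n. a i * w j ^ i) \<in> Q"
    by (rule insert.prems) simp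
  then obtain n a where a': "n > 0" "\<forall>i\<le>n. a i \<in> A" "a n \<notin> Q" "(\<Sum>i\<le>n. a i * w j ^ i) \<in> Q"
    by (elim exE conjE)
  have a: "n > 0" "\<And>i. i \<le> n \<Longrightarrow> a i \<in> A" "a n \<notin> Q" "(\<Sum>i\<le>n. a i * w j ^ i) \<in> Q" using a' by auto
  let ?C = "(\<lambda>(c, i). c * w j ^ i) ` (C \<times> {..<n})"
  have fin: "finite ?C" using C(1) by simp
  have inC: "c * w j ^ i \<in> ?C" if "c \<in> C" "i < n" for c i using that by force
  have base: "x * (c * w j ^ i) \<in> amod A Q ?C" if "c \<in> C" "i < n" "x \<in> A" for c i x
    by (rule amod_base[OF I AC fin inC[OF that(1,2)] that(3)])
  show ?case
  proof (intro exI conjI ballI)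
    show "finite ?C" by (rule fin)
    show "1 \<in> ?C" using inC[OF C(2) a(1)] by simp
    show "H * a n \<in> A" using C a by (intro AD) auto
    show "H * a n \<notin> Q" using C a is_primeD(3)[OF Q] by blast
    fix l x assume l: "l \<in> insert j J" and "x \<in> ?C"
    then obtain c i where ci: "x = c * w j ^ i" "c \<in> C" "i < n" by auto
    show "H * a n * w l * x \<in> amod A Q ?C"
    proof (cases "l \<in> J")
      case True
      have "(a n * w j ^ i) * (H * w l * c) \<in> amod A Q ?C"
      proof (rule amod_trans[OF I A _ C(5)[OF True ci(2)]])
        fix d assume "d \<in> C"
        from base[OF this ci(3) a(2)[of n]] show "a n * w j ^ i * d \<in> amod A Q ?C" by (simp add: mult_ac)
      qed
      then show ?thesis by (simp add: ci(1) mult_ac)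
    next
      case False
      then have lj: "l = j" using l by simp
      show ?thesis
      proof (cases "Suc i < n")
        case True
        have "(H * a n) * (c * w j ^ Suc i) \<in> amod A Q ?C" using C a by (intro base True ci AD) auto
        then show ?thesis by (simp add: ci(1) lj mult_ac)
      next
        case False
        \<comment> \<open>The only case in which multiplication leaves the spanning set:
          \<open>w j ^ n\<close> is rewritten by its relation, whose leading coefficient is a factor
          of the multiplier.\<close>
        then have n: "n = Suc i" using ci by simp
        have 1: "H * c * (\<Sum>i\<le>n. a i * w j ^ i) \<in> amod A Q ?C"
          by (rule amod_ideal[OF AD(1) is_idealD(3)[OF I a(4)]])
        have 2: "(\<Sum>i<n. (- (H * a i)) * (c * w j ^ i)) \<in> amod A Q ?C"
          using C a by (intro amod_sum[OF I AC] base ci AD) auto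
        have "(\<Sum>i\<le>n. a i * w j ^ i) = a n * w j ^ n + (\<Sum>i<n. a i * w j ^ i)"
          unfolding lessThan_Suc_atMost[symmetric] by simp
        moreover have "(\<Sum>i<n. (- (H * a i)) * (c * w j ^ i)) = - (H * c * (\<Sum>i<n. a i * w j ^ i))"
          unfolding sum_distrib_left sum_negf[symmetric] by (rule sum.cong) simp_all
        ultimately have "H * c * (\<Sum>i\<le>n. a i * w j ^ i) + (\<Sum>i<n. (- (H * a i)) * (c * w j ^ i)) = H * c * (a n * w j ^ n)"
          by (simp add: distrib_left)
        with amod_add[OF I AC 1 2] show ?thesis by (simp add: ci(1) lj n mult_ac)
      qed
    qed
  qed
qed

text \<open>An element of \<open>C\<close> outside a largest independent subset satisfies a relation
  whose coefficient at that element is nonzero modulo \<open>Q\<close>; the product of these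
  coefficients is the common denominator \<open>e\<close>. The element 1 is kept in the basis
  because coordinates at 1 are compared later.\<close>

lemma indep_subset:
  assumes Q: "is_prime Q" and A: "is_subring A" and C: "finite C" "1 \<in> C"
  shows "\<exists>B e. B \<subseteq> C \<and> 1 \<in> B \<and> indep_mod A Q B \<and> e \<in> A \<and> e \<notin> Q \<and> (\<forall>c\<in>C. e * c \<in> amod A Q B)"
proof -
  note I = is_primeD(1)[OF Q] and AD = is_subringD[OF A] and AC = add_closed_subring[OF A]
  let ?P = "\<lambda>B. B \<subseteq> C \<and> 1 \<in> B \<and> indep_mod A Q B"
  have "?P {1}" using C(2) by (auto simp: indep_mod_def)
  moreover have "card B < Suc (card C)" if "?P B" for B using that card_mono[OF C(1)] by (simp add: less_Suc_eq_le)
  ultimately obtain B where B: "?P B" "\<And>B'. ?P B' \<Longrightarrow> card B' \<le> card B"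
    using ex_has_greatest_nat[of ?P "{1}" card "Suc (card C)"] by (metis less_imp_le)
  have finB: "finite B" using B(1) C(1) finite_subset by blast
  have "\<exists>e. e \<in> A \<and> e \<notin> Q \<and> e * c \<in> amod A Q B" if c: "c \<in> C" for c
  proof (cases "c \<in> B")
    case True
    then show ?thesis using amod_base[OF I AC finB True AD(2)] AD(2) is_primeD(2)[OF Q] by (intro exI[of _ 1]) auto
  next
    case False
    then have "card (insert c B) > card B" using finB by simp
    with B c have "\<not> indep_mod A Q (insert c B)" by (meson insertCI insert_subset not_le)
    then obtain a b0 where a: "\<forall>b\<in>insert c B. a b \<in> A" "(\<Sum>b\<in>insert c B. a b * b) \<in> Q"
      "b0 \<in> insert c B" "a b0 \<notin> Q" unfolding indep_mod_def by blast
    have sum: "a c * c + (\<Sum>b\<in>B. a b * b) \<in> Q" using a(2) False finB by simp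
    have "a c \<notin> Q"
    proof
      assume ac: "a c \<in> Q"
      then have "(a c * c + (\<Sum>b\<in>B. a b * b)) - a c * c \<in> Q" by (intro is_idealD(6)[OF I sum] is_idealD(4)[OF I])
      then have "(\<Sum>b\<in>B. a b * b) \<in> Q" by simp
      then have "\<forall>b\<in>B. a b \<in> Q" using B(1) a(1) unfolding indep_mod_def by auto
      with a(3,4) ac show False by auto
    qed
    moreover have "a c * c \<in> amod A Q B"
    proof (rule amodI)
      show "- a b \<in> A" if "b \<in> B" for b using a(1) that by (intro AD) auto
      show "a c * c - (\<Sum>b\<in>B. - a b * b) \<in> Q" using sum by (simp add: sum_negf)
    qed
    ultimately show ?thesis using a(1) by blast
  qed
  then have "\<exists>e. \<forall>c\<in>C. e c \<in> A \<and> e c \<notin> Q \<and> e c * c \<in> amod A Q B" by (intro bchoice ballI)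
  then obtain e where "\<forall>c\<in>C. e c \<in> A \<and> e c \<notin> Q \<and> e c * c \<in> amod A Q B" by (elim exE)
  then have e: "\<And>c. c \<in> C \<Longrightarrow> e c \<in> A" "\<And>c. c \<in> C \<Longrightarrow> e c \<notin> Q" "\<And>c. c \<in> C \<Longrightarrow> e c * c \<in> amod A Q B"
    by auto
  have "prod e C \<notin> Q" using is_prime_prod[OF Q C(1)] e(2) by blast
  moreover have "prod e C \<in> A" by (rule is_subring_prod[OF A e(1)])
  moreover have "prod e C * c \<in> amod A Q B" if c: "c \<in> C" for c
  proof -
    have "prod e (C - {c}) * (e c * c) \<in> amod A Q B"
      using e(1) by (intro amod_scale[OF I AD(4) e(3)[OF c]] is_subring_prod[OF A]) auto
    then show ?thesis using C(1) c by (simp add: prod.remove mult_ac)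
  qed
  ultimately show ?thesis using B(1) by blast
qed

text \<open>\<open>R\<close> modulo the prime \<open>Q\<close> becomes free over the polynomial ring in the \<open>y i\<close>, \<open>i \<in> T\<close>, with
  basis \<open>B\<close>, once the polynomial \<open>h\<close> is inverted.\<close>

definition normalization :: "'r set \<Rightarrow> nat set \<Rightarrow> 'r set \<Rightarrow> (nat \<Rightarrow> 'r) \<Rightarrow> 'k mp \<Rightarrow> bool" where
  "normalization Q T B y h \<longleftrightarrow> finite T \<and> finite B \<and> 1 \<in> B \<and> alg_indep Q y T \<and>
     indep_mod (ins \<phi> y ` Pol T) Q B \<and> h \<in> Pol T \<and> h \<noteq> 0 \<and>
     (\<forall>j<m. \<forall>b\<in>B. ins \<phi> y h * z j * b \<in> amod (ins \<phi> y ` Pol T) Q B)"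

lemma normalization_exists:
  assumes Q: "is_prime Q"
  shows "\<exists>T B h. normalization Q T B z h"
proof -
  interpret i: comm_ring_hom "ins \<phi> z" by (rule comm_ring_hom_ins)
  note I = is_primeD(1)[OF Q]
  obtain T where T: "T \<subseteq> {..<m}" "alg_indep Q z T" and
    rel: "\<forall>j<m. \<exists>q. degree q > 0 \<and> (\<forall>i. coeff q i \<in> Pol T) \<and> poly (map_poly (ins \<phi> z) q) (z j) \<in> Q"
    using transcendence_basis[OF Q] by blast
  let ?A = "ins \<phi> z ` Pol T"
  have A: "is_subring ?A" by (rule is_subring_image[OF is_subring_Pol])
  have "\<exists>n a. n > 0 \<and> (\<forall>i\<le>n. a i \<in> ?A) \<and> a n \<notin> Q \<and> (\<Sum>i\<le>n. a i * z j ^ i) \<in> Q" if j: "j \<in> {..<m}" for j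
  proof -
    obtain q where q: "degree q > 0" "\<And>i. coeff q i \<in> Pol T" "poly (map_poly (ins \<phi> z) q) (z j) \<in> Q"
      using rel j by blast
    \<comment> \<open>Independence of \<open>T\<close> modulo \<open>Q\<close> turns the nonzero
      leading coefficient into an element outside \<open>Q\<close>.\<close>
    have lead: "ins \<phi> z (lead_coeff q) \<notin> Q" using T(2) q(1,2) unfolding alg_indep_def by fastforce
    then have "ins \<phi> z (lead_coeff q) \<noteq> 0" using is_idealD(1)[OF I] by metis
    then have "degree (map_poly (ins \<phi> z) q) = degree q" by (rule map_poly_degree_eq)
    then have "poly (map_poly (ins \<phi> z) q) (z j) = (\<Sum>i\<le>degree q. ins \<phi> z (coeff q i) * z j ^ i)"
      by (simp add: poly_altdef coeff_map_poly)
    then show ?thesis using q lead by (intro exI[of _ "degree q"] exI[of _ "\<lambda>i. ins \<phi> z (coeff q i)"]) auto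
  qed
  then have "\<exists>C H. finite C \<and> 1 \<in> C \<and> H \<in> ?A \<and> H \<notin> Q \<and> (\<forall>j\<in>{..<m}. \<forall>c\<in>C. H * z j * c \<in> amod ?A Q C)"
    by (rule amod_generators[OF Q A finite_lessThan])
  then obtain C H where
    C: "finite C" "1 \<in> C" "H \<in> ?A" "H \<notin> Q" "\<forall>j\<in>{..<m}. \<forall>c\<in>C. H * z j * c \<in> amod ?A Q C"
    by (elim exE conjE)
  from indep_subset[OF Q A C(1,2)] obtain B e where
    B: "B \<subseteq> C" "1 \<in> B" "indep_mod ?A Q B" "e \<in> ?A" "e \<notin> Q" "\<forall>c\<in>C. e * c \<in> amod ?A Q B"
    by (elim exE conjE)
  have "e * H \<in> ?A" using B(4) C(3) by (rule is_subringD(4)[OF A])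
  then obtain h where h: "h \<in> Pol T" "ins \<phi> z h = e * H" by auto
  have "e * H \<notin> Q" using B C is_primeD(3)[OF Q] by blast
  then have "h \<noteq> 0" using h(2) is_idealD(1)[OF I] by (auto simp: ins_0)
  moreover have "ins \<phi> z h * z j * b \<in> amod ?A Q B" if "j < m" "b \<in> B" for j b
  proof -
    have "e * (H * z j * b) \<in> amod ?A Q B"
      by (rule amod_trans[OF I A, of C]) (use B C that in auto)
    then show ?thesis by (simp add: h mult_ac)
  qed
  moreover have "finite T" using T(1) finite_subset by blast
  moreover have "finite B" using B(1) C(1) finite_subset by blast
  ultimately show ?thesis using T(2) B(2,3) h(1) unfolding normalization_def by blast
qed

end

text \<open>A comparison of growth rates in \<open>s\<close>; testing one sufficiently large
  argument is enough.\<close>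

lemma growth_exponent_le:
  fixes n t K L :: nat
  assumes "\<And>s. Suc s ^ n \<le> K * (L * s + 1) ^ t"
  shows "n \<le> t"
proof (rule ccontr)
  assume "\<not> n \<le> t"
  \<comment> \<open>At \<open>s = K'\<close> the right side is at most
    \<open>K' * Suc K' ^ t\<close>, hence below \<open>Suc K' ^ Suc t\<close>.\<close>
  define K' where "K' = K * Suc L ^ t"
  have "Suc K' ^ n \<le> K * (L * K' + 1) ^ t" by (rule assms)
  also have "\<dots> \<le> K * (Suc L * Suc K') ^ t" by (intro mult_left_mono power_mono) auto
  also have "\<dots> = K' * Suc K' ^ t" by (simp only: power_mult_distrib mult.assoc[symmetric] K'_def[symmetric])
  also have "\<dots> < Suc K' ^ Suc t" by simp
  also have "\<dots> \<le> Suc K' ^ n" using \<open>\<not> n \<le> t\<close> by (intro power_increasing) auto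
  finally show False by simp
qed

lemma is_ideal_0: "is_ideal {0::'a::comm_ring_1}" by (simp add: is_ideal_def)

lemma is_prime_0: "is_prime {0::'a::idom}" by (simp add: is_prime_def is_ideal_0)

context affine_alg
begin

subsection \<open>The filtration attached to a normalization\<close>

lemma normalizationD:
  assumes "normalization Q T B y h"
  shows "finite T" "finite B" "1 \<in> B" "alg_indep Q y T" "indep_mod (ins \<phi> y ` Pol T) Q B"
    "h \<in> Pol T" "h \<noteq> 0" "\<And>j b. j < m \<Longrightarrow> b \<in> B \<Longrightarrow> ins \<phi> y h * z j * b \<in> amod (ins \<phi> y ` Pol T) Q B"
  using assms unfolding normalization_def by auto

definition boxed_im :: "(nat \<Rightarrow> 'r) \<Rightarrow> nat set \<Rightarrow> nat \<Rightarrow> 'r set" where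
  "boxed_im y T N = ins \<phi> y ` boxed T N"

lemma boxed_im_mult: "a \<in> boxed_im y T M \<Longrightarrow> b \<in> boxed_im y T N \<Longrightarrow> a * b \<in> boxed_im y T (M + N)"
  unfolding boxed_im_def by (auto simp: ins_mult[symmetric] intro!: imageI boxed_mult)

lemma boxed_im_mono: "M \<le> N \<Longrightarrow> boxed_im y T M \<subseteq> boxed_im y T N"
  unfolding boxed_im_def by (intro image_mono boxed_mono)

lemma phi_in_boxed_im: "\<phi> c \<in> boxed_im y T N"
  unfolding boxed_im_def using boxed_Const[of c T N] ins_Const[of y c] by force

lemma add_closed_boxed_im: "add_closed (boxed_im y T N)"
  unfolding add_closed_def
proof (intro conjI ballI)
  show "0 \<in> boxed_im y T N" using phi_in_boxed_im[of 0] by simp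
  fix a b assume "a \<in> boxed_im y T N" "b \<in> boxed_im y T N"
  then show "a + b \<in> boxed_im y T N"
    unfolding boxed_im_def by (auto simp: ins_add[symmetric] intro!: imageI boxed_add)
qed

lemma amod_boxed:
  assumes "f \<in> amod (ins \<phi> y ` Pol T) Q B" "finite B"
  shows "\<exists>N. f \<in> amod (boxed_im y T N) Q B"
proof -
  obtain a where a: "\<forall>b\<in>B. a b \<in> ins \<phi> y ` Pol T" "f - (\<Sum>b\<in>B. a b * b) \<in> Q" using assms(1) by (rule amodE)
  have "\<forall>b\<in>B. \<exists>N. a b \<in> boxed_im y T N" using a(1) Pol_boxed unfolding boxed_im_def by fastforce
  from bchoice[OF this] obtain N where N: "\<forall>b\<in>B. a b \<in> boxed_im y T (N b)" by blast
  have "a b \<in> boxed_im y T (sum N B)" if "b \<in> B" for b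
    using N that boxed_im_mono[of "N b" "sum N B"] member_le_sum[of b B N] assms(2) by blast
  then show ?thesis using a(2) by (intro exI[of _ "sum N B"] amodI[of B a]) auto
qed

text \<open>A filtration of \<open>R\<close> modulo \<open>Q\<close> by subspaces: level
  \<open>S\<close> allows the denominator \<open>h^S\<close> and exponents up to
  \<open>c * S\<close>, so that multiplication by one generator costs one level.\<close>

definition filt :: "nat \<Rightarrow> 'r set \<Rightarrow> nat set \<Rightarrow> 'r set \<Rightarrow> (nat \<Rightarrow> 'r) \<Rightarrow> 'k mp \<Rightarrow> nat \<Rightarrow> 'r set" where
  "filt c Q T B y h S = {f. ins \<phi> y h ^ S * f \<in> amod (boxed_im y T (c * S)) Q B}"

text \<open>The constant \<open>c\<close> dominates the exponents in \<open>h\<close> and in the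
  structure constants \<open>h * z j * b\<close>. Multiplication by a generator then raises the
  level by one, and the elements whose multiplication shifts levels by a bounded amount form a
  subring, hence all of \<open>R\<close>.\<close>

lemma filtration:
  assumes Q: "is_prime Q" and nz: "normalization Q T B y h"
  shows "\<exists>c. 1 \<in> filt c Q T B y h 0 \<and> (\<forall>S S'. S \<le> S' \<longrightarrow> filt c Q T B y h S \<subseteq> filt c Q T B y h S') \<and>
    (\<forall>w. \<exists>c0. \<forall>S. \<forall>f\<in>filt c Q T B y h S. w * f \<in> filt c Q T B y h (S + c0))"
proof -
  note I = is_primeD(1)[OF Q] and N = normalizationD[OF nz]
  note AC = add_closed_boxed_im
  let ?h = "ins \<phi> y h"
  have "\<forall>x\<in>{..<m} \<times> B. \<exists>N. ?h * z (fst x) * snd x \<in> amod (boxed_im y T N) Q B"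
    using N(8) amod_boxed[OF _ N(2)] by auto
  from bchoice[OF this] obtain n where n: "\<forall>x\<in>{..<m} \<times> B. ?h * z (fst x) * snd x \<in> amod (boxed_im y T (n x)) Q B" ..
  obtain nh where nh: "h \<in> boxed T nh" using Pol_boxed[OF N(6)] by blast
  define c where "c = nh + sum n ({..<m} \<times> B)"
  have hc: "?h \<in> boxed_im y T c" using nh boxed_mono[of nh c T] by (auto simp: boxed_im_def c_def)
  have zc: "?h * z j * b \<in> amod (boxed_im y T c) Q B" if "j < m" "b \<in> B" for j b
  proof -
    have "n (j, b) \<le> c" using member_le_sum[of "(j, b)" "{..<m} \<times> B" n] that N(2) by (simp add: c_def)
    moreover have "?h * z j * b \<in> amod (boxed_im y T (n (j, b))) Q B" using n that by auto
    ultimately show ?thesis using amod_mono[OF boxed_im_mono] by blast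
  qed
  let ?F = "filt c Q T B y h"
  have one: "1 \<in> ?F 0"
    unfolding filt_def using amod_base[OF I AC N(2,3) phi_in_boxed_im[of 1 y T 0]] by simp
  have mono1: "?F S \<subseteq> ?F (Suc S)" for S
  proof
    fix f assume "f \<in> ?F S"
    then have "?h ^ S * f \<in> amod (boxed_im y T (c * S)) Q B" by (simp add: filt_def)
    then have "?h * (?h ^ S * f) \<in> amod (boxed_im y T (c + c * S)) Q B"
      by (rule amod_scale[OF I, rotated]) (rule boxed_im_mult[OF hc])
    then show "f \<in> ?F (Suc S)" by (simp add: filt_def mult_ac)
  qed
  have mono: "?F S \<subseteq> ?F S'" if "S \<le> S'" for S S'
    using that by (rule lift_Suc_mono_le[of ?F, OF mono1])
  have add: "f + g \<in> ?F S" if "f \<in> ?F S" "g \<in> ?F S" for f g S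
    using that amod_add[OF I AC, of "?h ^ S * f" y T "c * S" B "?h ^ S * g"] by (simp add: filt_def distrib_left)
  have scale: "\<phi> a * f \<in> ?F S" if "f \<in> ?F S" for a f S
  proof -
    have "\<phi> a * (?h ^ S * f) \<in> amod (boxed_im y T (c * S)) Q B"
    proof (rule amod_scale[OF I])
      fix b assume "b \<in> boxed_im y T (c * S)"
      from boxed_im_mult[OF phi_in_boxed_im this, of a 0] show "\<phi> a * b \<in> boxed_im y T (c * S)" by simp
    qed (use that in \<open>simp add: filt_def\<close>)
    then show ?thesis by (simp add: filt_def mult_ac)
  qed
  have zmul: "z j * f \<in> ?F (Suc S)" if j: "j < m" and f: "f \<in> ?F S" for j f S
  proof -
    have "?h ^ S * f \<in> amod (boxed_im y T (c * S)) Q B" using f by (simp add: filt_def)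
    then obtain a where a: "\<forall>b\<in>B. a b \<in> boxed_im y T (c * S)" "?h ^ S * f - (\<Sum>b\<in>B. a b * b) \<in> Q" by (rule amodE)
    have 1: "?h * z j * (?h ^ S * f - (\<Sum>b\<in>B. a b * b)) \<in> amod (boxed_im y T (c * S + c)) Q B"
      using AC[of y T "c * S + c"] by (intro amod_ideal is_idealD(3)[OF I a(2)]) (simp add: add_closed_def)
    have 2: "(\<Sum>b\<in>B. a b * (?h * z j * b)) \<in> amod (boxed_im y T (c * S + c)) Q B"
    proof (rule amod_sum[OF I AC])
      fix b assume b: "b \<in> B"
      show "a b * (?h * z j * b) \<in> amod (boxed_im y T (c * S + c)) Q B"
        by (rule amod_scale[OF I _ zc[OF j b]]) (rule boxed_im_mult[OF bspec[OF a(1) b]])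
    qed
    have "(\<Sum>b\<in>B. a b * (?h * z j * b)) = ?h * z j * (\<Sum>b\<in>B. a b * b)"
      unfolding sum_distrib_left by (rule sum.cong) simp_all
    then have "?h * z j * (?h ^ S * f - (\<Sum>b\<in>B. a b * b)) + (\<Sum>b\<in>B. a b * (?h * z j * b)) = ?h ^ Suc S * (z j * f)"
      by (simp add: right_diff_distrib mult_ac)
    with amod_add[OF I AC 1 2] show ?thesis by (simp add: filt_def add.commute)
  qed
  let ?W = "{w. \<exists>c0. \<forall>S. \<forall>f\<in>?F S. w * f \<in> ?F (S + c0)}"
  have "w \<in> ?W" for w
  proof (rule generated_induct)
    show "is_subring ?W"
      unfolding is_subring_def
    proof (intro conjI ballI)
      have "0 * f \<in> ?F (S + 0)" if "f \<in> ?F S" for f S using scale[OF that, of 0] by simp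
      then show "0 \<in> ?W" by blast
      have "1 * f \<in> ?F (S + 0)" if "f \<in> ?F S" for f S using that by simp
      then show "1 \<in> ?W" by blast
      fix a assume "a \<in> ?W"
      then obtain ca where ca: "\<And>S f. f \<in> ?F S \<Longrightarrow> a * f \<in> ?F (S + ca)" by blast
      have "- a * f \<in> ?F (S + ca)" if "f \<in> ?F S" for f S
        using scale[OF ca[OF that], of "- 1"] by (simp add: hom_uminus)
      then show "- a \<in> ?W" by blast
      fix b assume "b \<in> ?W"
      then obtain cb where cb: "\<And>S f. f \<in> ?F S \<Longrightarrow> b * f \<in> ?F (S + cb)" by blast
      have "(a * b) * f \<in> ?F (S + (cb + ca))" if "f \<in> ?F S" for f S
        using ca[OF cb[OF that]] by (simp add: mult.assoc add.assoc)
      then show "a * b \<in> ?W" by blast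
      have "(a + b) * f \<in> ?F (S + (ca + cb))" if "f \<in> ?F S" for f S
      proof -
        have "a * f \<in> ?F (S + (ca + cb))" using ca[OF that] mono[of "S + ca" "S + (ca + cb)"] by auto
        moreover have "b * f \<in> ?F (S + (ca + cb))" using cb[OF that] mono[of "S + cb" "S + (ca + cb)"] by auto
        ultimately show ?thesis using add by (simp add: distrib_right)
      qed
      then show "a + b \<in> ?W" by blast
    qed
    have "\<phi> a * f \<in> ?F (S + 0)" if "f \<in> ?F S" for a f S using scale[OF that] by simp
    then show "\<phi> a \<in> ?W" for a by blast
    have "z j * f \<in> ?F (S + 1)" if "j < m" "f \<in> ?F S" for j f S using zmul[OF that] by simp
    then show "z j \<in> ?W" if "j < m" for j using that by blast
  qed
  then have "\<forall>w. \<exists>c0. \<forall>S. \<forall>f\<in>?F S. w * f \<in> ?F (S + c0)" by blast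
  with one mono show ?thesis by (intro exI[of _ c]) auto
qed

lemma normalization_denominator:
  assumes Q: "is_prime Q" and nz: "normalization Q T B y h"
  shows "\<exists>s. ins \<phi> y h ^ s * f \<in> amod (ins \<phi> y ` Pol T) Q B"
proof -
  obtain c where c: "1 \<in> filt c Q T B y h 0"
    "\<forall>w. \<exists>c0. \<forall>S. \<forall>f\<in>filt c Q T B y h S. w * f \<in> filt c Q T B y h (S + c0)"
    using filtration[OF assms] by blast
  then obtain c0 where "f * 1 \<in> filt c Q T B y h (0 + c0)" by blast
  then have "ins \<phi> y h ^ c0 * f \<in> amod (boxed_im y T (c * c0)) Q B" by (simp add: filt_def)
  moreover have "boxed_im y T (c * c0) \<subseteq> ins \<phi> y ` Pol T" unfolding boxed_im_def by (intro image_mono boxed_sub_Pol)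
  ultimately show ?thesis using amod_mono by blast
qed

lemma span_closure:
  assumes W: "ksub W" and X: "finite X"
  shows "ksub {f. \<exists>a. f - kcomb X a \<in> W}" (is "ksub ?V") "X \<subseteq> {f. \<exists>a. f - kcomb X a \<in> W}"
    "W \<subseteq> {f. \<exists>a. f - kcomb X a \<in> W}"
proof -
  show "ksub ?V" by (rule ksub_mod_span[OF W X])
  show "X \<subseteq> ?V"
  proof
    fix x assume x: "x \<in> X"
    show "x \<in> ?V"
      using kcomb_singleton_in[OF X x, of 1] ksubD(1)[OF W]
      by (intro CollectI exI[of _ "\<lambda>w. if w = x then 1 else 0"]) simp
  qed
  show "W \<subseteq> ?V" by (auto intro!: exI[of _ "\<lambda>_. 0"] simp: kcomb_def)
qed

text \<open>Counting dimensions: the \<open>Suc s ^ n\<close> monomials in the independent elements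
  \<open>w\<close> lie, up to a power of \<open>h\<close>, in the span of \<open>card B\<close>
  copies of a box in \<open>card T\<close> variables with side linear in \<open>s\<close>.
  Independence forbids a linear relation, so the growth exponents compare.\<close>

lemma alg_indep_card_le:
  assumes nz: "normalization {0} T B y h" and w: "alg_indep {0} w {..<n}"
  shows "n \<le> card T"
proof -
  note N = normalizationD[OF nz]
  interpret i: comm_ring_hom "ins \<phi> y" by (rule comm_ring_hom_ins)
  obtain c where one: "1 \<in> filt c {0} T B y h 0"
    and mono: "\<forall>S S'. S \<le> S' \<longrightarrow> filt c {0} T B y h S \<subseteq> filt c {0} T B y h S'"
    and mul: "\<forall>w. \<exists>c0. \<forall>S. \<forall>f\<in>filt c {0} T B y h S. w * f \<in> filt c {0} T B y h (S + c0)"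
    using filtration[OF is_prime_0 nz] by (elim exE conjE)
  let ?F = "filt c {0} T B y h" and ?h = "ins \<phi> y h"
  have h0: "?h \<noteq> 0" using N(4,6,7) unfolding alg_indep_def by auto
  have "\<forall>i. \<exists>c0. \<forall>S. \<forall>f\<in>?F S. w i * f \<in> ?F (S + c0)" using mul by blast
  from choice[OF this] obtain e where e: "\<forall>i S. \<forall>f\<in>?F S. w i * f \<in> ?F (S + e i)" ..
  define c0 where "c0 = (\<Sum>i<n. e i)"
  have wmul: "w i * f \<in> ?F (S + c0)" if "i < n" "f \<in> ?F S" for i f S
  proof -
    have "e i \<le> c0" unfolding c0_def using that by (intro member_le_sum) auto
    then have "?F (S + e i) \<subseteq> ?F (S + c0)" using mono by auto
    then show ?thesis using e that by blast
  qed
  have wpow: "w i ^ k * f \<in> ?F (S + c0 * k)" if "i < n" "f \<in> ?F S" for i k f S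
  proof (induction k)
    case (Suc k)
    from wmul[OF that(1) Suc] show ?case by (simp add: mult.assoc add_ac)
  qed (use that in simp)
  have wprod: "(\<Prod>i\<in>K. w i ^ k i) \<in> ?F (c0 * (\<Sum>i\<in>K. k i))" if "finite K" "K \<subseteq> {..<n}" for K k
    using that
  proof (induction K rule: finite_induct)
    case (insert i K)
    have "w i ^ k i * (\<Prod>i\<in>K. w i ^ k i) \<in> ?F (c0 * (\<Sum>i\<in>K. k i) + c0 * k i)"
      using insert by (intro wpow) auto
    then show ?case using insert.hyps by (simp add: algebra_simps)
  qed (use one in simp)
  have "Suc s ^ n \<le> card B * ((c * c0 * n) * s + 1) ^ card T" for s
  proof (rule ccontr)
    assume neg: "\<not> ?thesis"
    \<comment> \<open>A monomial in the box has total degree at most \<open>n * s\<close>, and each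
      factor \<open>w i\<close> raises the level by at most \<open>c0\<close>.\<close>
    define S where "S = c0 * (n * s)"
    define X where "X = (\<lambda>(b, g). mono_at y g * b) ` (B \<times> Box T (c * S))"
    have finX: "finite X" unfolding X_def using N card_Box by simp
    have "card X \<le> card (B \<times> Box T (c * S))" unfolding X_def using N card_Box(1)[OF N(1)] by (intro card_image_le) auto
    also have "\<dots> = card B * ((c * c0 * n) * s + 1) ^ card T"
      using card_Box(2)[OF N(1)] by (simp add: card_cartesian_product S_def mult_ac)
    also have "\<dots> < Suc s ^ n" using neg by simp
    also have "\<dots> = card (Box {..<n} s)" using card_Box(2)[of "{..<n}" s] by simp
    finally have cardX: "card X < card (Box {..<n} s)" .
    have W: "ksub {0::'r}" by (rule ksub_ideal[OF is_ideal_0])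
    let ?V = "{f. \<exists>a. f - kcomb X a \<in> {0}}"
    note V = span_closure[OF W finX]
    have "\<exists>a. (?h ^ S * mono_at w \<alpha>) - kcomb X a \<in> {0}" if al: "\<alpha> \<in> Box {..<n} s" for \<alpha>
    proof -
      have k: "Poly_Mapping.keys \<alpha> \<subseteq> {..<n}" using al by (auto simp: Box_def)
      have "mono_at w \<alpha> \<in> ?F (c0 * mdeg \<alpha>)" unfolding mono_at_def mdeg_def using k by (intro wprod) auto
      moreover have "c0 * mdeg \<alpha> \<le> S" using Box_mdeg[OF _ al] by (simp add: S_def)
      ultimately have "mono_at w \<alpha> \<in> ?F S" using mono by blast
      then have "?h ^ S * mono_at w \<alpha> \<in> amod (boxed_im y T (c * S)) {0} B" by (simp add: filt_def)
      then obtain a where a: "\<forall>b\<in>B. a b \<in> boxed_im y T (c * S)" "?h ^ S * mono_at w \<alpha> - (\<Sum>b\<in>B. a b * b) \<in> {0}"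
        by (rule amodE)
      have "a b * b \<in> ?V" if b: "b \<in> B" for b
      proof -
        obtain p where p: "p \<in> boxed T (c * S)" "a b = ins \<phi> y p" using a(1) b by (auto simp: boxed_im_def)
        have "a b * b = (\<Sum>g\<in>Poly_Mapping.keys p. \<phi> (Poly_Mapping.lookup p g) * (mono_at y g * b))"
          by (simp add: p(2) ins_def sum_distrib_right mult.assoc)
        also have "\<dots> \<in> ?V"
        proof (intro ksub_sum[OF V(1)] ksubD(3)[OF V(1)] subsetD[OF V(2)])
          fix g assume "g \<in> Poly_Mapping.keys p"
          then show "mono_at y g * b \<in> X" using p(1) b unfolding X_def boxed_def by force
        qed
        finally show ?thesis .
      qed
      then have "(\<Sum>b\<in>B. a b * b) \<in> ?V" by (intro ksub_sum[OF V(1)])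
      then show ?thesis using a(2) by simp
    qed
    then have "\<exists>k. (\<exists>\<alpha>\<in>Box {..<n} s. k \<alpha> \<noteq> 0) \<and> (\<Sum>\<alpha>\<in>Box {..<n} s. \<phi> (k \<alpha>) * (?h ^ S * mono_at w \<alpha>)) \<in> {0}"
      using card_Box(1)[of "{..<n}" s] by (intro linear_dependence_mod[OF W finX _ cardX]) auto
    then obtain k where k: "\<exists>\<alpha>\<in>Box {..<n} s. k \<alpha> \<noteq> 0" "(\<Sum>\<alpha>\<in>Box {..<n} s. \<phi> (k \<alpha>) * (?h ^ S * mono_at w \<alpha>)) = 0"
      by auto
    define p where "p = (\<Sum>\<alpha>\<in>Box {..<n} s. Poly_Mapping.single \<alpha> (k \<alpha>))"
    have "(\<Sum>\<alpha>\<in>Box {..<n} s. \<phi> (k \<alpha>) * (?h ^ S * mono_at w \<alpha>)) = ?h ^ S * ins \<phi> w p"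
      by (simp add: p_def ins_sum ins_single sum_distrib_left mult.left_commute)
    then have "ins \<phi> w p = 0" using k(2) h0 by simp
    moreover have "p \<in> Pol {..<n}"
      unfolding p_def by (intro is_subring_sum[OF is_subring_Pol] Pol_single) (auto simp: Box_def)
    ultimately have "p = 0" using w by (auto simp: alg_indep_def)
    obtain \<alpha> where al: "\<alpha> \<in> Box {..<n} s" "k \<alpha> \<noteq> 0" using k(1) by blast
    have "Poly_Mapping.lookup p \<alpha> = (\<Sum>\<beta>\<in>Box {..<n} s. if \<beta> = \<alpha> then k \<beta> else 0)"
      unfolding p_def lookup_sum by (rule sum.cong) (auto simp: lookup_single)
    also have "\<dots> = k \<alpha>" using al card_Box(1)[of "{..<n}" s] by simp
    finally show False using al(2) \<open>p = 0\<close> by simp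
  qed
  then show ?thesis by (rule growth_exponent_le)
qed

text \<open>Elements picked from the successive differences of a prime chain are algebraically
  independent: a relation modulo \<open>C i\<close> among \<open>w i\<close> and the later elements
  may be divided by its lowest power of \<open>w i\<close>, and the constant term in
  \<open>w i\<close> is then a relation modulo \<open>C (Suc i)\<close> among the later
  ones.\<close>

lemma chain_length_le:
  fixes C :: "nat \<Rightarrow> 'r set"
  assumes nz: "normalization {0} T B y h"
    and C: "\<And>i. i \<le> n \<Longrightarrow> is_prime (C i)" "\<And>i. i < n \<Longrightarrow> C i \<subset> C (Suc i)"
  shows "n \<le> card T"
proof -
  have "\<forall>i<n. \<exists>w. w \<in> C (Suc i) \<and> w \<notin> C i" using C(2) by blast
  then obtain w where w: "\<And>i. i < n \<Longrightarrow> w i \<in> C (Suc i)" "\<And>i. i < n \<Longrightarrow> w i \<notin> C i" by metis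
  interpret i: comm_ring_hom "ins \<phi> w" by (rule comm_ring_hom_ins)
  have "p = 0" if "i \<le> n" "p \<in> Pol {i..<n}" "ins \<phi> w p \<in> C i" for i p
    using that
  proof (induction i arbitrary: p rule: inc_induct)
    case base
    have "p \<in> Pol {}" using base by simp
    then obtain c where c: "p = Const c" using Pol_empty by (metis)
    then have "\<phi> c * 1 \<in> C n" using base by (simp add: ins_Const)
    then have "c = 0" using ksub_scale_iff[OF ksub_ideal[OF is_primeD(1)[OF C(1)[OF order_refl]]]]
        is_primeD(2)[OF C(1)[OF order_refl]] by blast
    then show ?case by (simp add: c Const_def)
  next
    case (step i)
    have pr: "is_prime (C i)" "is_prime (C (Suc i))" using C(1) step by auto
    have "{i..<n} = insert i {Suc i..<n}" using step by auto
    then obtain q where q: "\<And>l. coeff q l \<in> Pol {Suc i..<n}" "poly q (Var i) = p"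
      using Pol_insert_poly[of p i "{Suc i..<n}"] step.prems by auto
    show ?case
    proof (rule ccontr)
      assume "p \<noteq> 0"
      then have "q \<noteq> 0" using q(2) by auto
      then have "\<exists>l. coeff q l \<noteq> 0" using leading_coeff_0_iff by blast
      define l where "l = (LEAST l. coeff q l \<noteq> 0)"
      have l: "coeff q l \<noteq> 0" "\<And>j. j < l \<Longrightarrow> coeff q j = 0"
        unfolding l_def using LeastI_ex[OF \<open>\<exists>l. coeff q l \<noteq> 0\<close>] not_less_Least by auto
      let ?q = "map_poly (ins \<phi> w) q"
      have ev: "poly ?q (w i) = ins \<phi> w p" using i.poly_map_poly[of q "Var i"] q(2) by (simp add: ins_Var)
      have low: "coeff ?q j = 0" if "j < l" for j using l(2)[OF that] by (simp add: coeff_map_poly)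
      have "\<exists>r. ?q = monom 1 l * r"
      proof -
        have "monom 1 l dvd ?q" using low by (simp add: monom_1_dvd_iff')
        then show ?thesis by (auto simp: dvd_def)
      qed
      then obtain r where r: "?q = monom 1 l * r" ..
      \<comment> \<open>The lowest power of \<open>w i\<close> is split off; it can be cancelled
        since \<open>w i\<close> is not in the prime \<open>C i\<close>.\<close>
      have "w i ^ l * poly r (w i) \<in> C i" using step.prems ev by (simp add: r poly_monom)
      then have "poly r (w i) \<in> C i"
        using is_primeD(3)[OF pr(1)] is_prime_power[OF pr(1)] w(2)[of i] step by blast
      then have rC: "poly r (w i) \<in> C (Suc i)" using C(2)[of i] step by blast
      obtain a r' where ar: "r = pCons a r'" by (cases r)
      have "coeff ?q l = coeff r 0" unfolding r by (simp add: coeff_monom_mult)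
      then have "coeff ?q l = a" by (simp add: ar)
      then have a: "a = ins \<phi> w (coeff q l)" by (simp add: coeff_map_poly)
      have "poly r (w i) = a + w i * poly r' (w i)" by (simp add: ar)
      moreover have "w i * poly r' (w i) \<in> C (Suc i)" using w(1)[of i] step is_idealD(4)[OF is_primeD(1)[OF pr(2)]] by blast
      ultimately have "a \<in> C (Suc i)" using is_idealD(6)[OF is_primeD(1)[OF pr(2)] rC, of "w i * poly r' (w i)"] by simp
      then have "coeff q l = 0" using step.IH[OF q(1)] a by simp
      with l(1) show False by simp
    qed
  qed
  from this[of 0] have "alg_indep {0} w {..<n}"
    using is_idealD(1)[OF is_primeD(1)[OF C(1)[of 0]]] unfolding alg_indep_def by (auto simp: atLeast0LessThan)
  then show ?thesis by (rule alg_indep_card_le[OF nz])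
qed

end

subsection \<open>Translating the origin\<close>

definition shift :: "(nat \<Rightarrow> 'k::comm_ring_1) \<Rightarrow> 'k mp \<Rightarrow> 'k mp" where
  "shift a = ins Const (\<lambda>i. Var i + Const (a i))"

lemma comm_ring_hom_shift: "comm_ring_hom (shift a)"
  unfolding shift_def by (rule comm_ring_hom.comm_ring_hom_ins[OF comm_ring_hom_Const])

lemma shift_Const: "shift a (Const c) = Const c" and shift_Var: "shift a (Var i) = Var i + Const (a i)"
  unfolding shift_def
  by (simp_all add: comm_ring_hom.ins_Const[OF comm_ring_hom_Const] comm_ring_hom.ins_Var[OF comm_ring_hom_Const])

lemma shift_Pol: "p \<in> Pol T \<Longrightarrow> shift a p \<in> Pol T"
proof -
  interpret s: comm_ring_hom "shift a" by (rule comm_ring_hom_shift)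
  note P = is_subringD[OF is_subring_Pol[of T]]
  have "is_subring {p. shift a p \<in> Pol T}"
    unfolding is_subring_def by (auto simp: s.hom_add s.hom_mult s.hom_uminus intro: P)
  then have "Pol T \<subseteq> {p. shift a p \<in> Pol T}"
    by (rule Pol_least) (auto simp: shift_Const shift_Var intro!: Pol_Const Pol_Var P)
  then show "p \<in> Pol T \<Longrightarrow> shift a p \<in> Pol T" by blast
qed

lemma shift_inverse: "shift (\<lambda>i. - a i) (shift a p) = p"
proof -
  let ?s = "shift (\<lambda>i. - a i)"
  interpret s: comm_ring_hom ?s by (rule comm_ring_hom_shift)
  interpret C: comm_ring_hom Const by (rule comm_ring_hom_Const)
  have "?s (shift a p) = ins (?s \<circ> Const) (?s \<circ> (\<lambda>i. Var i + Const (a i))) p"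
    unfolding shift_def[of a] by (rule hom_ins[OF comm_ring_hom_shift])
  also have "?s \<circ> Const = Const" by (simp add: fun_eq_iff shift_Const)
  also have "?s \<circ> (\<lambda>i. Var i + Const (a i)) = Var"
    by (simp add: fun_eq_iff s.hom_add shift_Const shift_Var add.assoc C.hom_add[symmetric])
  finally show ?thesis by (simp add: ins_Const_Var)
qed

lemma ins_zero: "ins (\<lambda>c. c) (\<lambda>_. 0) p = Poly_Mapping.lookup p 0"
proof -
  have m: "mono_at (\<lambda>_. 0 :: 'a) g = (if g = 0 then 1 else 0)" for g
  proof (cases "g = 0")
    case False
    then obtain i where "i \<in> Poly_Mapping.keys g" by fastforce
    then show ?thesis using False unfolding mono_at_def
      by (auto simp: in_keys_iff power_0_left intro!: prod_zero bexI[of _ i])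
  qed simp
  show ?thesis unfolding ins_def m
    by (cases "0 \<in> Poly_Mapping.keys p") (simp_all add: if_distrib in_keys_iff cong: if_cong)
qed

text \<open>Links the nonvanishing of a polynomial at \<open>a\<close> to a nonzero constant term
  after the translation of \<open>a\<close> to the origin.\<close>

lemma lookup_shift: "Poly_Mapping.lookup (shift a p) 0 = ins (\<lambda>c. c) a p"
proof -
  let ?e = "ins (\<lambda>c::'a. c) (\<lambda>_. 0)"
  have "?e (shift a p) = ins (?e \<circ> Const) (?e \<circ> (\<lambda>i. Var i + Const (a i))) p"
    unfolding shift_def by (rule hom_ins[OF comm_ring_hom.comm_ring_hom_ins[OF comm_ring_hom_id]])
  also have "?e \<circ> Const = (\<lambda>c. c)"
    by (simp add: fun_eq_iff comm_ring_hom.ins_Const[OF comm_ring_hom_id])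
  also have "?e \<circ> (\<lambda>i. Var i + Const (a i)) = a"
    by (simp add: fun_eq_iff comm_ring_hom.ins_add[OF comm_ring_hom_id]
      comm_ring_hom.ins_Const[OF comm_ring_hom_id] comm_ring_hom.ins_Var[OF comm_ring_hom_id])
  finally show ?thesis by (simp add: ins_zero)
qed

context affine_alg
begin

lemma ins_shift: "ins \<phi> (\<lambda>i. y i - \<phi> (a i)) (shift a p) = ins \<phi> y p"
proof -
  let ?y = "\<lambda>i. y i - \<phi> (a i)"
  have "ins \<phi> ?y (shift a p) = ins (ins \<phi> ?y \<circ> Const) (ins \<phi> ?y \<circ> (\<lambda>i. Var i + Const (a i))) p"
    unfolding shift_def by (rule hom_ins[OF comm_ring_hom_ins])
  also have "ins \<phi> ?y \<circ> Const = \<phi>" by (simp add: fun_eq_iff ins_Const)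
  also have "ins \<phi> ?y \<circ> (\<lambda>i. Var i + Const (a i)) = y"
    by (simp add: fun_eq_iff ins_add ins_Const ins_Var)
  finally show ?thesis .
qed

text \<open>Translation is an automorphism of the polynomial subring, so independence, basis and
  denominators carry over.\<close>

lemma normalization_translate:
  assumes "normalization Q T B y h"
  shows "normalization Q T B (\<lambda>i. y i - \<phi> (a i)) (shift a h)"
proof -
  note N = normalizationD[OF assms]
  let ?y = "\<lambda>i. y i - \<phi> (a i)"
  have bk: "ins \<phi> ?y p = ins \<phi> y (shift (\<lambda>i. - a i) p)" for p
  proof -
    have "shift a (shift (\<lambda>i. - a i) p) = p" using shift_inverse[of "\<lambda>i. - a i" p] by simp
    then show ?thesis using ins_shift[of y a "shift (\<lambda>i. - a i) p"] by simp
  qed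
  have A: "ins \<phi> ?y ` Pol T = ins \<phi> y ` Pol T"
  proof
    show "ins \<phi> ?y ` Pol T \<subseteq> ins \<phi> y ` Pol T" unfolding bk using shift_Pol by blast
    show "ins \<phi> y ` Pol T \<subseteq> ins \<phi> ?y ` Pol T" using ins_shift[of y a, symmetric] shift_Pol by force
  qed
  have "alg_indep Q ?y T"
    unfolding alg_indep_def
  proof (intro ballI impI)
    fix p :: "'k mp" assume p: "p \<in> Pol T" "ins \<phi> ?y p \<in> Q"
    then have "shift (\<lambda>i. - a i) p = 0" using N(4) shift_Pol[OF p(1)] unfolding alg_indep_def bk by blast
    then have "shift a 0 = p" using shift_inverse[of "\<lambda>i. - a i" p] by simp
    then show "p = 0" by (simp add: shift_def comm_ring_hom.ins_0[OF comm_ring_hom_Const])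
  qed
  moreover have "shift a h \<noteq> 0"
  proof
    assume "shift a h = 0"
    then have "h = shift (\<lambda>i. - a i) 0" using shift_inverse[of a h] by simp
    then show False using N(7) by (simp add: shift_def comm_ring_hom.ins_0[OF comm_ring_hom_Const])
  qed
  ultimately show ?thesis
    using N shift_Pol[OF N(6), of a] unfolding normalization_def A ins_shift by blast
qed

subsection \<open>Ideal powers at the origin of a normalization\<close>

lemma add_closed_image: "add_closed S \<Longrightarrow> add_closed (ins \<phi> y ` S)"
  unfolding add_closed_def
proof (intro conjI ballI; elim conjE)
  assume S: "0 \<in> S" "\<forall>a\<in>S. \<forall>b\<in>S. a + b \<in> S"
  show "0 \<in> ins \<phi> y ` S" using S(1) ins_0[of y] by force
  fix a b assume "a \<in> ins \<phi> y ` S" "b \<in> ins \<phi> y ` S"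
  then show "a + b \<in> ins \<phi> y ` S" using S(2) by (auto simp: ins_add[symmetric])
qed

text \<open>Each factor \<open>y i\<close> multiplies the polynomial coordinates by a variable and
  so raises their order by one, while the denominators remain powers of \<open>h\<close>.\<close>

lemma ipow_numerator:
  assumes Q: "is_prime Q" and nz: "normalization Q T B y h" and f: "f \<in> ipow (gideal (y ` T)) M"
  shows "\<exists>s. ins \<phi> y h ^ s * f \<in> amod (ins \<phi> y ` (Pol T \<inter> high M)) Q B"
  using f
proof (induction M arbitrary: f)
  case 0
  have "high 0 = (UNIV :: 'k mp set)" by (simp add: high_def)
  then show ?case using normalization_denominator[OF Q nz] by simp
next
  case (Suc M)
  note N = normalizationD[OF nz] and I = is_primeD(1)[OF Q]
  interpret i: comm_ring_hom "ins \<phi> y" by (rule comm_ring_hom_ins)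
  let ?h = "ins \<phi> y h" and ?A = "\<lambda>M. ins \<phi> y ` (Pol T \<inter> high M)"
  have AC: "add_closed (?A M)" for M
    using is_subringD[OF is_subring_Pol[of T]] is_idealD[OF is_ideal_high[of M]]
    by (intro add_closed_image) (auto simp: add_closed_def)
  have hA: "?h ^ s * a \<in> ?A M" if a: "a \<in> ?A M" for a s M
  proof -
    obtain p where p: "p \<in> Pol T" "p \<in> high M" "a = ins \<phi> y p" using a by blast
    have "ins \<phi> y (h ^ s * p) = ?h ^ s * a"
      by (simp add: p(3) ins_mult i.hom_power)
    moreover have "h ^ s * p \<in> Pol T \<inter> high M"
      using p N(6) by (auto intro!: Pol_mult is_subring_power[OF is_subring_Pol] is_idealD(3)[OF is_ideal_high])
    ultimately show ?thesis by (metis imageI)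
  qed
  let ?P = "\<lambda>M. {f. \<exists>s. ?h ^ s * f \<in> amod (?A M) Q B}"
  have up: "?h ^ (s' + s) * f \<in> amod (?A M) Q B" if "?h ^ s * f \<in> amod (?A M) Q B" for s s' f M
  proof -
    have "?h ^ s' * (?h ^ s * f) \<in> amod (?A M) Q B" by (rule amod_scale[OF I _ that]) (rule hA)
    then show ?thesis by (simp add: power_add mult.assoc)
  qed
  have add: "f + g \<in> ?P M" if f: "f \<in> ?P M" and g: "g \<in> ?P M" for f g M
  proof -
    obtain s t where st: "?h ^ s * f \<in> amod (?A M) Q B" "?h ^ t * g \<in> amod (?A M) Q B" using f g by blast
    have "?h ^ (t + s) * f + ?h ^ (s + t) * g \<in> amod (?A M) Q B"
      by (intro amod_add[OF I AC] up st)
    then have "?h ^ (s + t) * (f + g) \<in> amod (?A M) Q B" by (simp add: distrib_left add.commute)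
    then show ?thesis by blast
  qed
  have zero: "0 \<in> ?P M" for M
    using amod_ideal[of "?A M" 0 Q B] AC[of M] is_idealD(1)[OF I] by (auto simp: add_closed_def)
  have sum: "sum g S \<in> ?P M" if "\<And>x. x \<in> S \<Longrightarrow> g x \<in> ?P M" for g M and S :: "'r set"
    using that by (induction S rule: infinite_finite_induct) (use zero add in simp_all)
  have step: "y i * f \<in> ?P (Suc M)" if i: "i \<in> T" and f: "f \<in> ?P M" for i f
  proof -
    obtain s where s: "?h ^ s * f \<in> amod (?A M) Q B" using f by blast
    have "y i * (?h ^ s * f) \<in> amod (?A (Suc M)) Q B"
    proof (rule amod_scale[OF I _ s])
      fix b assume "b \<in> ?A M"
      then obtain p where p: "p \<in> Pol T" "p \<in> high M" "b = ins \<phi> y p" by blast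
      have "ins \<phi> y (Var i * p) = y i * b" by (simp add: p(3) ins_mult ins_Var)
      moreover have "Var i * p \<in> Pol T \<inter> high (Suc M)"
        using p i high_mult[OF Var_in_high p(2)] by (auto intro!: Pol_mult Pol_Var)
      ultimately show "y i * b \<in> ?A (Suc M)" by (metis imageI)
    qed
    then have "?h ^ s * (y i * f) \<in> amod (?A (Suc M)) Q B" by (simp add: mult.left_commute)
    then show ?thesis by blast
  qed
  from Suc.prems have "f \<in> iprod (gideal (y ` T)) (ipow (gideal (y ` T)) M)" by simp
  then have "f \<in> ?P (Suc M)"
  proof (induction rule: iprod.induct)
    case (step a b t)
    obtain r where r: "a = (\<Sum>v\<in>y ` T. r v * v)" using step(1) by (auto simp: gideal_def)
    have "v * (r v * b) \<in> ?P (Suc M)" if v: "v \<in> y ` T" for v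
    proof -
      obtain i where i: "i \<in> T" "v = y i" using v by blast
      have "r v * b \<in> ?P M" using Suc.IH[OF ipowD(3)[OF step(2)]] by blast
      then show ?thesis using \<open>\<And>f i. i \<in> T \<Longrightarrow> f \<in> ?P M \<Longrightarrow> y i * f \<in> ?P (Suc M)\<close>[OF i(1)] i(2) by blast
    qed
    then have "(\<Sum>v\<in>y ` T. v * (r v * b)) \<in> ?P (Suc M)" by (rule sum)
    moreover have "(\<Sum>v\<in>y ` T. v * (r v * b)) = a * b"
      unfolding r sum_distrib_right by (rule sum.cong) simp_all
    ultimately show ?case using add step.IH by simp
  qed (rule zero)
  then show ?case by blast
qed

text \<open>Compare coordinates at the basis element 1: \<open>h^s * F\<close> equals a coordinate
  of order at least \<open>M\<close>, and \<open>h\<close> does not vanish at the origin. Thus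
  powers of the origin ideal contract to powers in the polynomial ring.\<close>

lemma high_of_ipow:
  assumes Q: "is_prime Q" and nz: "normalization Q T B y h" and h0: "Poly_Mapping.lookup h 0 \<noteq> 0"
    and F: "F \<in> Pol T" and f: "f \<in> ipow (gideal (y ` T)) M" and Ff: "ins \<phi> y F - f \<in> Q"
  shows "F \<in> high M"
proof -
  note N = normalizationD[OF nz] and I = is_primeD(1)[OF Q]
  interpret i: comm_ring_hom "ins \<phi> y" by (rule comm_ring_hom_ins)
  let ?h = "ins \<phi> y h"
  obtain s where "?h ^ s * f \<in> amod (ins \<phi> y ` (Pol T \<inter> high M)) Q B"
    using ipow_numerator[OF Q nz f] by blast
  then obtain a where a: "\<forall>b\<in>B. a b \<in> ins \<phi> y ` (Pol T \<inter> high M)" "?h ^ s * f - (\<Sum>b\<in>B. a b * b) \<in> Q"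
    by (rule amodE)
  obtain p where p: "p \<in> Pol T" "p \<in> high M" "a 1 = ins \<phi> y p" using a(1) N(3) by blast
  have hF: "h ^ s * F \<in> Pol T" using F N(6) by (auto intro!: Pol_mult is_subring_power[OF is_subring_Pol])
  define a' where "a' b = (if b = 1 then ins \<phi> y (h ^ s * F) else 0) - a b" for b
  have "(\<Sum>b\<in>B. a' b * b) = (\<Sum>b\<in>B. if b = 1 then ins \<phi> y (h ^ s * F) else 0) - (\<Sum>b\<in>B. a b * b)"
    unfolding a'_def sum_subtractf[symmetric] by (rule sum.cong) (auto simp: algebra_simps)
  also have "\<dots> = ?h ^ s * (ins \<phi> y F - f) + (?h ^ s * f - (\<Sum>b\<in>B. a b * b))"
    using N(2,3) by (simp add: ins_mult i.hom_power right_diff_distrib)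
  also have "\<dots> \<in> Q" by (rule is_idealD(2)[OF I is_idealD(3)[OF I Ff] a(2)])
  finally have sumQ: "(\<Sum>b\<in>B. a' b * b) \<in> Q" .
  have A: "is_subring (ins \<phi> y ` Pol T)" by (rule is_subring_image[OF is_subring_Pol])
  have "a' b \<in> ins \<phi> y ` Pol T" if "b \<in> B" for b
    unfolding a'_def using a(1) that hF by (intro is_subringD(6)[OF A]) (auto intro: is_subringD(1)[OF A])
  then have "a' 1 \<in> Q" using N(5) sumQ N(3) unfolding indep_mod_def by blast
  then have "ins \<phi> y (h ^ s * F - p) \<in> Q" by (simp add: a'_def p(3) i.hom_minus)
  moreover have "h ^ s * F - p \<in> Pol T" using hF p(1) by (intro is_subringD(6)[OF is_subring_Pol])
  ultimately have "h ^ s * F = p" using N(4) unfolding alg_indep_def by force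
  then have "h ^ s * F \<in> high M" using p by simp
  then show "F \<in> high M"
  proof (induction s)
    case (Suc s)
    then have "h * (h ^ s * F) \<in> high M" by (simp add: mult.assoc)
    from high_cancel[OF h0 this] Suc.IH show ?case by blast
  qed simp
qed

section \<open>The Nullstellensatz and the fibre over the origin\<close>

lemma one_not_high: "1 \<notin> high (Suc M)"
  by (simp add: high_def mdeg_def)

text \<open>If a variable \<open>y i\<close> remained, it would be invertible modulo
  \<open>P\<close>, so 1 would lie in the ideal of the origin modulo \<open>P\<close>, against the
  contraction property. With no variable left the denominator is a nonzero constant and the residue
  field is finite-dimensional over \<open>k\<close>.\<close>

lemma maximal_is_point:
  assumes P: "is_ideal P" "1 \<notin> P" and max: "\<And>f. f \<notin> P \<Longrightarrow> \<exists>r. r * f - 1 \<in> P"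
  shows "\<exists>\<chi>\<in>points. ker \<chi> = P"
proof -
  have Q: "is_prime P"
    unfolding is_prime_def
  proof (intro conjI P allI impI disjCI)
    fix a b assume ab: "a * b \<in> P" "b \<notin> P"
    then obtain r where "r * b - 1 \<in> P" using max by blast
    then have "r * (a * b) - a * (r * b - 1) \<in> P"
      using is_idealD(6)[OF P(1) is_idealD(3)[OF P(1) ab(1), of r] is_idealD(3)[OF P(1), of "r * b - 1" a]] by blast
    then show "a \<in> P" by (simp add: algebra_simps)
  qed
  obtain T B h where nz0: "normalization P T B z h" using normalization_exists[OF Q] by (elim exE)
  note N0 = normalizationD[OF nz0]
  obtain a where a: "ins (\<lambda>c. c) a h \<noteq> 0" using nonroot_exists[OF N0(1,6,7)] ..
  define y where "y = (\<lambda>i. z i - \<phi> (a i))"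
  define h' where "h' = shift a h"
  have nz: "normalization P T B y h'" unfolding y_def h'_def by (rule normalization_translate[OF nz0])
  note N = normalizationD[OF nz]
  interpret iy: comm_ring_hom "ins \<phi> y" by (rule comm_ring_hom_ins)
  have h0: "Poly_Mapping.lookup h' 0 \<noteq> 0" using a by (simp add: h'_def lookup_shift)
  have "T = {}"
  proof (rule ccontr)
    assume "T \<noteq> {}"
    then obtain i where i: "i \<in> T" by blast
    have "Var i \<noteq> (0 :: 'k mp)" by (metis Var_def lookup_single_eq lookup_zero zero_neq_one)
    then have "y i \<notin> P" using N(4) Pol_Var[OF i] unfolding alg_indep_def by (metis ins_Var)
    then obtain r where r: "r * y i - 1 \<in> P" using max by blast
    have "r * y i \<in> gideal (y ` T)" using i N(1) by (intro is_idealD(3)[OF is_ideal_gideal] gideal_incl) auto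
    then have "r * y i \<in> ipow (gideal (y ` T)) (Suc 0)" using ipow_Suc_0[OF is_ideal_gideal] by blast
    note high_of_ipow[OF Q nz h0 is_subringD(2)[OF is_subring_Pol] this]
    moreover have "ins \<phi> y 1 - r * y i \<in> P"
      using is_idealD(5)[OF P(1) r] iy.hom_one by simp
    ultimately have "(1 :: 'k mp) \<in> high (Suc 0)" by blast
    then show False using one_not_high by blast
  qed
  obtain c where c: "h' = Const c" using Pol_empty N(6) \<open>T = {}\<close> by metis
  have "c \<noteq> 0" using N(7) c by (auto simp: Const_def)
  have W: "ksub P" by (rule ksub_ideal[OF P(1)])
  note V = span_closure[OF W N(2)]
  have "spans_mod B P"
    unfolding spans_mod_def
  proof (intro conjI allI N(2))
    fix f
    obtain s where "ins \<phi> y h' ^ s * f \<in> amod (ins \<phi> y ` Pol T) P B"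
      using normalization_denominator[OF Q nz] by blast
    then have "\<phi> (c ^ s) * f \<in> amod (ins \<phi> y ` Pol T) P B" by (simp add: c ins_Const hom_power)
    then obtain e where e: "\<forall>b\<in>B. e b \<in> ins \<phi> y ` Pol T" "\<phi> (c ^ s) * f - (\<Sum>b\<in>B. e b * b) \<in> P" by (rule amodE)
    let ?V = "{f. \<exists>a. f - kcomb B a \<in> P}"
    have "e b * b \<in> ?V" if b: "b \<in> B" for b
    proof -
      obtain p where "p \<in> Pol T" "e b = ins \<phi> y p" using e(1) b by blast
      moreover from this obtain k where "p = Const k" using Pol_empty \<open>T = {}\<close> by metis
      ultimately have "e b = \<phi> k" by (simp add: ins_Const)
      then show ?thesis using ksubD(3)[OF V(1), of b k] b V(2) by auto
    qed
    then have "(\<Sum>b\<in>B. e b * b) \<in> ?V" by (intro ksub_sum[OF V(1)])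
    with e(2) V(3) have "(\<phi> (c ^ s) * f - (\<Sum>b\<in>B. e b * b)) + (\<Sum>b\<in>B. e b * b) \<in> ?V"
      by (intro ksubD(2)[OF V(1)]) auto
    then have "\<phi> (c ^ s) * f \<in> ?V" by simp
    then have "f \<in> ?V" using ksub_scale_iff[OF V(1), of "c ^ s" f] \<open>c \<noteq> 0\<close> by simp
    then show "\<exists>a. f - kcomb B a \<in> P" by blast
  qed
  then show ?thesis using finite_codim_prime_is_point[OF Q] by (auto simp: fin_codim_def)
qed

lemma const_mod_origin:
  assumes "finite T" "p \<in> Pol T"
  shows "ins \<phi> y p - \<phi> (Poly_Mapping.lookup p 0) \<in> gideal (y ` T)"
proof -
  let ?G = "gideal (y ` T)" and ?e = "ins (\<lambda>c::'k. c) (\<lambda>_. 0)"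
  note G = is_idealD[OF is_ideal_gideal[of "y ` T"]]
  interpret e: comm_ring_hom ?e by (rule comm_ring_hom.comm_ring_hom_ins[OF comm_ring_hom_id])
  interpret i: comm_ring_hom "ins \<phi> y" by (rule comm_ring_hom_ins)
  have "is_subring {p. ins \<phi> y p - \<phi> (?e p) \<in> ?G}"
    unfolding is_subring_def
  proof (intro conjI ballI; clarify?)
    show "ins \<phi> y 0 - \<phi> (?e 0) \<in> ?G" "ins \<phi> y 1 - \<phi> (?e 1) \<in> ?G" using G by simp_all
    fix p assume p: "ins \<phi> y p - \<phi> (?e p) \<in> ?G"
    show "ins \<phi> y (- p) - \<phi> (?e (- p)) \<in> ?G" using G(5)[OF p]
      by (simp add: i.hom_uminus e.hom_uminus hom_uminus)
    fix q assume q: "ins \<phi> y q - \<phi> (?e q) \<in> ?G"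
    show "ins \<phi> y (p + q) - \<phi> (?e (p + q)) \<in> ?G" using G(2)[OF p q]
      by (simp add: i.hom_add e.hom_add hom_add algebra_simps)
    have "ins \<phi> y p * (ins \<phi> y q - \<phi> (?e q)) + \<phi> (?e q) * (ins \<phi> y p - \<phi> (?e p)) \<in> ?G"
      by (intro G(2) G(3) p q)
    then show "ins \<phi> y (p * q) - \<phi> (?e (p * q)) \<in> ?G"
      by (simp add: i.hom_mult e.hom_mult hom_mult algebra_simps)
  qed
  then have "Pol T \<subseteq> {p. ins \<phi> y p - \<phi> (?e p) \<in> ?G}"
  proof (rule Pol_least)
    show "Const c \<in> {p. ins \<phi> y p - \<phi> (?e p) \<in> ?G}" for c
      using G(1) by (simp add: ins_Const comm_ring_hom.ins_Const[OF comm_ring_hom_id])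
    show "Var i \<in> {p. ins \<phi> y p - \<phi> (?e p) \<in> ?G}" if "i \<in> T" for i
      using that gideal_incl[of "y ` T" "y i"] assms(1) by (simp add: ins_Var comm_ring_hom.ins_Var[OF comm_ring_hom_id])
  qed
  then show ?thesis using assms(2) by (auto simp: ins_zero)
qed

text \<open>Modulo the ideal of the origin, polynomial coefficients become constants and
  \<open>h\<close> becomes a nonzero constant, so \<open>B\<close> spans the fibre over
  \<open>k\<close>.\<close>

lemma origin_codim:
  assumes nz: "normalization {0} T B y h" and h0: "Poly_Mapping.lookup h 0 \<noteq> 0"
  shows "spans_mod B (gideal (y ` T))"
  unfolding spans_mod_def
proof (intro conjI allI)
  note N = normalizationD[OF nz]
  show "finite B" by (rule N)
  fix f
  let ?G = "gideal (y ` T)" and ?h = "ins \<phi> y h"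
  interpret e: comm_ring_hom "ins (\<lambda>c::'k. c) (\<lambda>_. 0)"
    by (rule comm_ring_hom.comm_ring_hom_ins[OF comm_ring_hom_id])
  interpret i: comm_ring_hom "ins \<phi> y" by (rule comm_ring_hom_ins)
  note G = is_idealD[OF is_ideal_gideal[of "y ` T"]]
  note V = span_closure[OF ksub_ideal[OF is_ideal_gideal[of "y ` T"]] N(2)]
  let ?V = "{f. \<exists>a. f - kcomb B a \<in> ?G}"
  obtain s where "?h ^ s * f \<in> amod (ins \<phi> y ` Pol T) {0} B"
    using normalization_denominator[OF is_prime_0 nz] by blast
  then obtain a where a: "\<forall>b\<in>B. a b \<in> ins \<phi> y ` Pol T" "?h ^ s * f - (\<Sum>b\<in>B. a b * b) \<in> {0}" by (rule amodE)
  have "a b * b \<in> ?V" if b: "b \<in> B" for b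
  proof -
    obtain p where p: "p \<in> Pol T" "a b = ins \<phi> y p" using a(1) b by blast
    have "(ins \<phi> y p - \<phi> (Poly_Mapping.lookup p 0)) * b \<in> ?V"
      using G(4)[OF const_mod_origin[OF N(1) p(1)]] V(3) by blast
    moreover have "\<phi> (Poly_Mapping.lookup p 0) * b \<in> ?V" using b V(2) by (intro ksubD(3)[OF V(1)]) blast
    ultimately have "(ins \<phi> y p - \<phi> (Poly_Mapping.lookup p 0)) * b + \<phi> (Poly_Mapping.lookup p 0) * b \<in> ?V"
      by (rule ksubD(2)[OF V(1)])
    then show ?thesis by (simp add: p(2) algebra_simps)
  qed
  then have "(\<Sum>b\<in>B. a b * b) \<in> ?V" by (intro ksub_sum[OF V(1)])
  then have 1: "?h ^ s * f \<in> ?V" using a(2) by simp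
  have "Poly_Mapping.lookup (h ^ s) 0 = Poly_Mapping.lookup h 0 ^ s"
    using e.hom_power[of h s] by (simp add: ins_zero)
  moreover have "ins \<phi> y (h ^ s) = ?h ^ s" by (rule i.hom_power)
  ultimately have "?h ^ s - \<phi> (Poly_Mapping.lookup h 0 ^ s) \<in> ?G"
    using const_mod_origin[OF N(1) is_subring_power[OF is_subring_Pol N(6)], of y s] by simp
  then have 2: "(?h ^ s - \<phi> (Poly_Mapping.lookup h 0 ^ s)) * f \<in> ?V" using G(4) V(3) by blast
  have "?h ^ s * f - (?h ^ s - \<phi> (Poly_Mapping.lookup h 0 ^ s)) * f \<in> ?V"
    using 1 2 by (rule ksubD(5)[OF V(1)])
  then have "\<phi> (Poly_Mapping.lookup h 0 ^ s) * f \<in> ?V" by (simp add: algebra_simps)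
  then have "f \<in> ?V" using ksub_scale_iff[OF V(1), of "Poly_Mapping.lookup h 0 ^ s" f] h0 by simp
  then show "\<exists>a. f - kcomb B a \<in> ?G" by blast
qed

text \<open>After inverting \<open>h\<close> the ring has rank \<open>card B\<close> over the
  polynomials, so the powers of \<open>g\<close> up to that exponent are dependent. Cancelling the
  lowest power of \<open>g\<close> shows that the lowest nonzero coefficient is a multiple of
  \<open>g\<close>.\<close>

lemma polynomial_multiple:
  assumes nz: "normalization {0} T B y h" and g: "g \<noteq> 0"
  shows "\<exists>c\<in>Pol T. c \<noteq> 0 \<and> (\<exists>r. ins \<phi> y c = r * g)"
proof -
  note N = normalizationD[OF nz]
  let ?h = "ins \<phi> y h" and ?A = "ins \<phi> y ` Pol T" and ?D = "card B"
  have A: "is_subring ?A" by (rule is_subring_image[OF is_subring_Pol])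
  have h0: "?h \<noteq> 0" using N(4,6,7) unfolding alg_indep_def by auto
  have "\<forall>l. \<exists>s. ?h ^ s * g ^ l \<in> amod ?A {0} B" using normalization_denominator[OF is_prime_0 nz] by blast
  from choice[OF this] obtain s where s: "\<forall>l. ?h ^ s l * g ^ l \<in> amod ?A {0} B" ..
  have "\<forall>l. \<exists>a. (\<forall>b\<in>B. a b \<in> ?A) \<and> ?h ^ s l * g ^ l = (\<Sum>b\<in>B. a b * b)" using s unfolding amod_def by simp
  from choice[OF this] obtain a where a: "\<forall>l. (\<forall>b\<in>B. a l b \<in> ?A) \<and> ?h ^ s l * g ^ l = (\<Sum>b\<in>B. a l b * b)" ..
  have "\<exists>c. (\<forall>l. c l \<in> ?A) \<and> (\<exists>l\<in>{..?D}. c l \<noteq> 0) \<and> (\<forall>b\<in>B. (\<Sum>l\<in>{..?D}. c l * a l b) = 0)"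
    by (rule homogeneous_system[OF A N(2)]) (use a in auto)
  then obtain c where c: "\<forall>l. c l \<in> ?A" "\<exists>l\<in>{..?D}. c l \<noteq> 0" "\<forall>b\<in>B. (\<Sum>l\<in>{..?D}. c l * a l b) = 0"
    by (elim exE conjE)
  define e where "e l = c l * ?h ^ s l" for l
  have hA: "?h \<in> ?A" using N(6) by blast
  have eA: "e l \<in> ?A" for l unfolding e_def using c(1) hA by (auto intro!: is_subringD(4)[OF A] is_subring_power[OF A])
  have "(\<Sum>l\<in>{..?D}. e l * g ^ l) = (\<Sum>l\<in>{..?D}. c l * (\<Sum>b\<in>B. a l b * b))"
    using a by (simp add: e_def mult.assoc)
  also have "\<dots> = (\<Sum>b\<in>B. (\<Sum>l\<in>{..?D}. c l * a l b) * b)"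
    unfolding sum_distrib_left sum_distrib_right by (subst sum.swap) (simp add: mult.assoc)
  also have "\<dots> = 0" using c(3) by simp
  finally have rel: "(\<Sum>l\<in>{..?D}. e l * g ^ l) = 0" .
  obtain l1 where l1: "l1 \<le> ?D" "e l1 \<noteq> 0" using c(2) h0 by (auto simp: e_def)
  define l where "l = (LEAST l. e l \<noteq> 0)"
  have l: "e l \<noteq> 0" "\<And>j. j < l \<Longrightarrow> e j = 0" "l \<le> l1"
    unfolding l_def using LeastI[of "\<lambda>l. e l \<noteq> 0", OF l1(2)] not_less_Least Least_le[of "\<lambda>l. e l \<noteq> 0", OF l1(2)] by auto
  let ?S = "\<Sum>j\<in>{Suc l..?D}. e j * g ^ (j - Suc l)"
  have "{..?D} = {..<l} \<union> {l} \<union> {Suc l..?D}" using l(3) l1(1) by auto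
  then have "(\<Sum>j\<in>{..?D}. e j * g ^ j) = (\<Sum>j\<in>{..<l} \<union> {l} \<union> {Suc l..?D}. e j * g ^ j)" by simp
  also have "\<dots> = e l * g ^ l + (\<Sum>j\<in>{Suc l..?D}. e j * g ^ j)"
    by (subst sum.union_disjoint, auto)+ (simp add: l(2))
  also have "(\<Sum>j\<in>{Suc l..?D}. e j * g ^ j) = g ^ l * (g * ?S)"
    unfolding sum_distrib_left
  proof (rule sum.cong)
    fix j assume "j \<in> {Suc l..?D}"
    then have "j = l + Suc (j - Suc l)" by simp
    then have "g ^ j = g ^ (l + Suc (j - Suc l))" by metis
    then have "g ^ j = g ^ l * (g * g ^ (j - Suc l))" by (simp add: power_add)
    then show "e j * g ^ j = g ^ l * (g * (e j * g ^ (j - Suc l)))" by (simp add: mult_ac)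
  qed simp
  finally have "g ^ l * (e l + g * ?S) = 0" using rel by (simp add: algebra_simps)
  then have "e l = - ?S * g" using g by (simp add: eq_neg_iff_add_eq_0 mult.commute)
  moreover obtain q where q: "q \<in> Pol T" "e l = ins \<phi> y q" using eA by blast
  moreover have "q \<noteq> 0" using q(2) l(1) by (auto simp: ins_0)
  ultimately show ?thesis by metis
qed

end

declare ipow.simps(2) [simp del]

context affine_alg
begin

subsection \<open>Fibres and the growth of the Hilbert function\<close>

text \<open>The origin is moved to a point where \<open>h\<close> and a polynomial multiple of
  \<open>g\<close> do not vanish, so \<open>g\<close> is nonzero on the whole fibre. The order
  estimate combines the local criterion for powers of the fibre ideal with their contraction to the
  polynomial ring.\<close>

lemma good_fibre:
  assumes nz0: "normalization {0} T B z h" and g: "g \<noteq> 0"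
  shows "\<exists>y. \<exists>X\<subseteq>points. finite X \<and> card X \<le> card B \<and> X \<noteq> {} \<and> (\<forall>\<chi>\<in>X. \<chi> g \<noteq> 0) \<and>
    (\<forall>F\<in>Pol T. \<forall>M. (\<forall>\<chi>\<in>X. ins \<phi> y F \<in> ipow (ker \<chi>) (card B * M)) \<longrightarrow> F \<in> high M)"
proof -
  note N0 = normalizationD[OF nz0]
  obtain c r where c: "c \<in> Pol T" "c \<noteq> 0" "ins \<phi> z c = r * g" using polynomial_multiple[OF nz0 g] by blast
  have hc: "h * c \<in> Pol T" using Pol_mult[OF N0(6) c(1)] .
  have "h * c \<noteq> 0"
  proof
    assume "h * c = 0"
    then have "ins \<phi> z h * ins \<phi> z c = 0" by (metis ins_mult ins_0)
    then have "ins \<phi> z h = 0 \<or> ins \<phi> z c = 0" by simp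
    then show False using N0(4,6,7) c(1,2) unfolding alg_indep_def by auto
  qed
  then obtain a where a: "ins (\<lambda>c. c) a (h * c) \<noteq> 0" using nonroot_exists[OF N0(1) hc] by blast
  then have a2: "ins (\<lambda>c. c) a h \<noteq> 0" "ins (\<lambda>c. c) a c \<noteq> 0"
    by (auto simp: comm_ring_hom.ins_mult[OF comm_ring_hom_id])
  define y where "y = (\<lambda>i. z i - \<phi> (a i))"
  have nz: "normalization {0} T B y (shift a h)" unfolding y_def by (rule normalization_translate[OF nz0])
  have h0: "Poly_Mapping.lookup (shift a h) 0 \<noteq> 0" using a2(1) by (simp add: lookup_shift)
  note N = normalizationD[OF nz]
  have sp: "spans_mod B (gideal (y ` T))" by (rule origin_codim[OF nz h0])
  have fin: "finite (y ` T)" using N(1) by simp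
  have "fin_codim (gideal (y ` T))" using sp by (auto simp: fin_codim_def)
  from mem_ipow_of_local[OF fin this codim_le[OF sp]] obtain X where
    X: "X \<subseteq> points" "finite X" "card X \<le> card B" "\<forall>\<chi>\<in>X. y ` T \<subseteq> ker \<chi>" "1 \<in> gideal (y ` T) \<or> X \<noteq> {}"
    "\<forall>f M. (\<forall>\<chi>\<in>X. f \<in> ipow (ker \<chi>) (card B * M)) \<longrightarrow> f \<in> ipow (gideal (y ` T)) M"
    by (elim exE conjE)
  have high: "F \<in> high M" if "F \<in> Pol T" "ins \<phi> y F \<in> ipow (gideal (y ` T)) M" for F M
    by (rule high_of_ipow[OF is_prime_0 nz h0 that]) simp
  interpret iy: comm_ring_hom "ins \<phi> y" by (rule comm_ring_hom_ins)
  have "1 \<notin> gideal (y ` T)"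
  proof
    assume "1 \<in> gideal (y ` T)"
    then have "ins \<phi> y 1 \<in> ipow (gideal (y ` T)) (Suc 0)" using ipow_Suc_0[OF is_ideal_gideal] by auto
    from high[OF is_subringD(2)[OF is_subring_Pol] this] show False using one_not_high by blast
  qed
  then have ne: "X \<noteq> {}" using X(5) by blast
  have "\<chi> g \<noteq> 0" if \<chi>: "\<chi> \<in> X" for \<chi>
  proof
    assume "\<chi> g = 0"
    have p: "\<chi> \<in> points" using X(1) \<chi> by blast
    have "ins \<phi> y (shift a c) = r * g" unfolding y_def ins_shift by (rule c(3))
    moreover have "ins \<phi> y (shift a c) - \<phi> (Poly_Mapping.lookup (shift a c) 0) \<in> ker \<chi>"
      using const_mod_origin[OF N(1) shift_Pol[OF c(1)]] gideal_least[OF is_ideal_ker[OF p], of "y ` T"] X(4) \<chi> by blast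
    ultimately have "\<chi> (r * g) - Poly_Mapping.lookup (shift a c) 0 = 0" using p by (simp add: ker_def pointsD)
    then show False using a2(2) \<open>\<chi> g = 0\<close> p by (simp add: pointsD lookup_shift)
  qed
  moreover have "\<forall>F\<in>Pol T. \<forall>M. (\<forall>\<chi>\<in>X. ins \<phi> y F \<in> ipow (ker \<chi>) (card B * M)) \<longrightarrow> F \<in> high M"
    using X(6) high by blast
  ultimately show ?thesis using X(1-3) ne by (intro exI[of _ y] exI[of _ X]) blast
qed

lemma point_exists:
  assumes "g \<noteq> 0"
  shows "\<exists>\<chi>\<in>points. \<chi> g \<noteq> 0"
proof -
  obtain T B h where nz: "normalization {0} T B z h" using normalization_exists[OF is_prime_0] by (elim exE)
  from good_fibre[OF this assms] show ?thesis by blast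
qed

text \<open>Send the polynomials with exponents in a box to their jets at the points of a good
  fibre. If the box were larger than \<open>card B * card S\<close>, a nonzero one would have all
  jets zero; its order at the origin would then exceed \<open>card T * N\<close>, the largest degree
  in the box.\<close>

lemma growth:
  assumes nz: "normalization {0} T B z h" and g: "g \<noteq> 0" and S: "finite S"
    and sp: "\<And>\<chi>. \<chi> \<in> points \<Longrightarrow> \<chi> g \<noteq> 0 \<Longrightarrow> spans_mod S (ipow (ker \<chi>) (card B * Suc (card T * N)))"
  shows "Suc N ^ card T \<le> card B * card S"
proof (rule ccontr)
  assume neg: "\<not> ?thesis"
  let ?M = "Suc (card T * N)"
  from good_fibre[OF nz g] obtain y X where X: "X \<subseteq> points" "finite X" "card X \<le> card B" "X \<noteq> {}" "\<forall>\<chi>\<in>X. \<chi> g \<noteq> 0"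
    "\<forall>F\<in>Pol T. \<forall>M. (\<forall>\<chi>\<in>X. ins \<phi> y F \<in> ipow (ker \<chi>) (card B * M)) \<longrightarrow> F \<in> high M"
    by (elim exE conjE)
  note N = normalizationD[OF nz]
  have "\<forall>x\<in>X. \<forall>\<alpha>. \<exists>a. mono_at y \<alpha> - kcomb S a \<in> ipow (ker x) (card B * ?M)"
    using sp X(1,5) unfolding spans_mod_def by blast
  then have "\<forall>x\<in>X. \<exists>a. \<forall>\<alpha>. mono_at y \<alpha> - kcomb S (a \<alpha>) \<in> ipow (ker x) (card B * ?M)"
    by (intro ballI choice) blast
  from bchoice[OF this] obtain A where A: "\<forall>x\<in>X. \<forall>\<alpha>. mono_at y \<alpha> - kcomb S (A x \<alpha>) \<in> ipow (ker x) (card B * ?M)" ..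
  have "card (X \<times> S) \<le> card B * card S" using X(3) by (simp add: card_cartesian_product mult_right_mono)
  also have "\<dots> < card (Box T N)" using neg card_Box(2)[OF N(1)] by simp
  finally have card: "card (X \<times> S) < card (Box T N)" .
  have "\<exists>c. (\<forall>j. c j \<in> (UNIV :: 'k set)) \<and> (\<exists>j\<in>Box T N. c j \<noteq> 0) \<and>
      (\<forall>i\<in>X \<times> S. (\<Sum>j\<in>Box T N. c j * (\<lambda>\<alpha> (x, u). A x \<alpha> u) j i) = 0)"
    by (rule homogeneous_system) (use card X(2) S card_Box(1)[OF N(1)] in \<open>auto simp: is_subring_def\<close>)
  then obtain c where c: "\<exists>j\<in>Box T N. c j \<noteq> (0::'k)" "\<forall>x\<in>X. \<forall>u\<in>S. (\<Sum>j\<in>Box T N. c j * A x j u) = 0"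
    by auto
  define F where "F = (\<Sum>\<alpha>\<in>Box T N. Poly_Mapping.single \<alpha> (c \<alpha>))"
  have F: "ins \<phi> y F = (\<Sum>\<alpha>\<in>Box T N. \<phi> (c \<alpha>) * mono_at y \<alpha>)" by (simp add: F_def ins_sum ins_single)
  have "ins \<phi> y F \<in> ipow (ker x) (card B * ?M)" if x: "x \<in> X" for x
  proof -
    have "(\<Sum>\<alpha>\<in>Box T N. \<phi> (c \<alpha>) * kcomb S (A x \<alpha>)) = (\<Sum>u\<in>S. \<phi> (\<Sum>\<alpha>\<in>Box T N. c \<alpha> * A x \<alpha> u) * u)"
      unfolding kcomb_def sum_distrib_left hom_sum sum_distrib_right
      by (subst sum.swap) (simp add: hom_mult mult.assoc)
    also have "\<dots> = 0" using c(2) x by simp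
    finally have "ins \<phi> y F = (\<Sum>\<alpha>\<in>Box T N. \<phi> (c \<alpha>) * (mono_at y \<alpha> - kcomb S (A x \<alpha>)))"
      by (simp add: F right_diff_distrib sum_subtractf)
    also have "\<dots> \<in> ipow (ker x) (card B * ?M)"
      using A x by (intro is_ideal_sum[OF is_ideal_ipow] ipowD(3)) blast
    finally show ?thesis .
  qed
  moreover have "F \<in> Pol T"
    unfolding F_def by (intro is_subring_sum[OF is_subring_Pol] Pol_single) (auto simp: Box_def)
  ultimately have Fh: "F \<in> high ?M" using X(6) by blast
  obtain \<alpha> where al: "\<alpha> \<in> Box T N" "c \<alpha> \<noteq> 0" using c(1) by blast
  have "Poly_Mapping.lookup F \<alpha> = (\<Sum>\<beta>\<in>Box T N. if \<beta> = \<alpha> then c \<beta> else 0)"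
    unfolding F_def lookup_sum by (rule sum.cong) (auto simp: lookup_single)
  also have "\<dots> = c \<alpha>" using al card_Box(1)[OF N(1)] by simp
  finally have "\<alpha> \<in> Poly_Mapping.keys F" using al by (simp add: in_keys_iff)
  then have "?M \<le> mdeg \<alpha>" using Fh by (auto simp: high_def)
  with Box_mdeg[OF N(1) al(1)] show False by simp
qed

section \<open>Principal parts and the spreading of spanning sets to nearby points\<close>

subsection \<open>Semicontinuity\<close>

text \<open>The families \<open>F \<chi>\<close> model principal parts of order \<open>M\<close>, as
  a module over \<open>R\<close> through the moving point: being represented means lying in the span
  of \<open>U\<close> with coefficients from \<open>J\<close> evaluated at that point.\<close>

definition rep :: "'r set \<Rightarrow> 'r set \<Rightarrow> nat \<Rightarrow> (('r \<Rightarrow> 'k) \<Rightarrow> 'r) \<Rightarrow> bool" where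
  "rep J U M F \<longleftrightarrow> (\<exists>r. (\<forall>u\<in>U. r u \<in> J) \<and>
     (\<forall>\<chi>\<in>points. F \<chi> - (\<Sum>u\<in>U. \<phi> (\<chi> (r u)) * u) \<in> ipow (ker \<chi>) M))"

lemma rep_add:
  assumes J: "is_ideal J" and F: "rep J U M F" and G: "rep J U M G"
  shows "rep J U M (\<lambda>\<chi>. F \<chi> + G \<chi>)"
proof -
  obtain r where r: "\<forall>u\<in>U. r u \<in> J" "\<forall>\<chi>\<in>points. F \<chi> - (\<Sum>u\<in>U. \<phi> (\<chi> (r u)) * u) \<in> ipow (ker \<chi>) M"
    using F unfolding rep_def by blast
  obtain s where s: "\<forall>u\<in>U. s u \<in> J" "\<forall>\<chi>\<in>points. G \<chi> - (\<Sum>u\<in>U. \<phi> (\<chi> (s u)) * u) \<in> ipow (ker \<chi>) M"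
    using G unfolding rep_def by blast
  show ?thesis
    unfolding rep_def
  proof (intro exI[of _ "\<lambda>u. r u + s u"] conjI ballI)
    show "r u + s u \<in> J" if "u \<in> U" for u using r(1) s(1) that by (intro is_idealD(2)[OF J]) auto
    fix \<chi> assume \<chi>: "\<chi> \<in> points"
    have "(F \<chi> - (\<Sum>u\<in>U. \<phi> (\<chi> (r u)) * u)) + (G \<chi> - (\<Sum>u\<in>U. \<phi> (\<chi> (s u)) * u)) \<in> ipow (ker \<chi>) M"
      using r(2) s(2) \<chi> by (intro ipowD(2)) auto
    then show "F \<chi> + G \<chi> - (\<Sum>u\<in>U. \<phi> (\<chi> (r u + s u)) * u) \<in> ipow (ker \<chi>) M"
      using \<chi> by (simp add: pointsD hom_add distrib_right sum.distrib algebra_simps)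
  qed
qed

lemma rep_scale:
  assumes J: "\<And>r. r \<in> J \<Longrightarrow> a * r \<in> J'" and F: "rep J U M F"
  shows "rep J' U M (\<lambda>\<chi>. \<phi> (\<chi> a) * F \<chi>)"
proof -
  obtain r where r: "\<forall>u\<in>U. r u \<in> J" "\<forall>\<chi>\<in>points. F \<chi> - (\<Sum>u\<in>U. \<phi> (\<chi> (r u)) * u) \<in> ipow (ker \<chi>) M"
    using F unfolding rep_def by blast
  show ?thesis
    unfolding rep_def
  proof (intro exI[of _ "\<lambda>u. a * r u"] conjI ballI)
    show "a * r u \<in> J'" if "u \<in> U" for u using r(1) that J by auto
    fix \<chi> assume \<chi>: "\<chi> \<in> points"
    have "\<phi> (\<chi> a) * (F \<chi> - (\<Sum>u\<in>U. \<phi> (\<chi> (r u)) * u)) \<in> ipow (ker \<chi>) M"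
      using r(2) \<chi> by (intro ipowD(3)) auto
    moreover have "\<phi> (\<chi> a) * (\<Sum>u\<in>U. \<phi> (\<chi> (r u)) * u) = (\<Sum>u\<in>U. \<phi> (\<chi> (a * r u)) * u)"
      using \<chi> by (simp add: sum_distrib_left pointsD hom_mult mult.assoc)
    ultimately show "\<phi> (\<chi> a) * F \<chi> - (\<Sum>u\<in>U. \<phi> (\<chi> (a * r u)) * u) \<in> ipow (ker \<chi>) M"
      by (simp add: right_diff_distrib)
  qed
qed

lemma rep_base:
  assumes "finite U" "u \<in> U"
  shows "rep UNIV U M (\<lambda>_. u)"
  unfolding rep_def
proof (intro exI[of _ "\<lambda>v. if v = u then 1 else 0"] conjI ballI)
  fix \<chi> assume \<chi>: "\<chi> \<in> points"
  have "(\<Sum>v\<in>U. \<phi> (\<chi> (if v = u then 1 else 0)) * v) = (\<Sum>v\<in>U. if v = u then v else 0)"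
    using \<chi> by (intro sum.cong) (auto simp: pointsD)
  then show "u - (\<Sum>v\<in>U. \<phi> (\<chi> (if v = u then 1 else 0)) * v) \<in> ipow (ker \<chi>) M"
    using assms ipowD(1)[of "ker \<chi>" M] by simp
qed simp

lemma rep_cong:
  assumes "rep J U M F" "\<And>\<chi>. \<chi> \<in> points \<Longrightarrow> F \<chi> - G \<chi> \<in> ipow (ker \<chi>) M"
  shows "rep J U M G"
proof -
  obtain r where r: "\<forall>u\<in>U. r u \<in> J" "\<forall>\<chi>\<in>points. F \<chi> - (\<Sum>u\<in>U. \<phi> (\<chi> (r u)) * u) \<in> ipow (ker \<chi>) M"
    using assms unfolding rep_def by blast
  have "G \<chi> - (\<Sum>u\<in>U. \<phi> (\<chi> (r u)) * u) \<in> ipow (ker \<chi>) M" if \<chi>: "\<chi> \<in> points" for \<chi>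
    using ipowD(6)[OF bspec[OF r(2) \<chi>] assms(2)[OF \<chi>]] by simp
  then show ?thesis using r(1) unfolding rep_def by blast
qed

lemma rep_zero: "is_ideal J \<Longrightarrow> rep J U M (\<lambda>_. 0)"
  unfolding rep_def by (intro exI[of _ "\<lambda>_. 0"]) (auto simp: pointsD ipowD(1) is_idealD(1))

lemma rep_sum:
  assumes "is_ideal J" "\<And>x. x \<in> S \<Longrightarrow> rep J U M (F x)"
  shows "rep J U M (\<lambda>\<chi>. \<Sum>x\<in>S. F x \<chi>)"
  using assms(2)
proof (induction S rule: infinite_finite_induct)
  case (insert x S)
  then show ?case using rep_add[OF assms(1), of U M "F x" "\<lambda>\<chi>. \<Sum>x\<in>S. F x \<chi>"] by simp
qed (use rep_zero[OF assms(1)] in simp_all)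

text \<open>Finite generation of principal parts. Raising \<open>M\<close> by one costs the products
  of the \<open>z i\<close> with the old set, because \<open>z i\<close> minus its value at
  \<open>\<chi>\<close> vanishes at \<open>\<chi>\<close>; a Leibniz identity passes from generators
  to all functions.\<close>

lemma universal_spanning_set: "\<exists>U. finite U \<and> (\<forall>f. rep UNIV U M (\<lambda>_. f))"
proof (induction M)
  case 0
  show ?case by (intro exI[of _ "{}"]) (auto simp: rep_def)
next
  case (Suc M)
  then obtain U where U: "finite U" "\<forall>f. rep UNIV U M (\<lambda>_. f)" by (elim exE conjE)
  have IU: "is_ideal (UNIV :: 'r set)" by (simp add: is_ideal_def)
  let ?U = "insert 1 (U \<union> (\<lambda>(i, u). z i * u) ` ({..<m} \<times> U))"
  let ?R = "rep UNIV ?U (Suc M)"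
  have fin: "finite ?U" using U(1) by simp
  note base = rep_base[OF fin] and add = rep_add[OF IU] and scale = rep_scale[of UNIV _ UNIV, OF UNIV_I]
  have step: "?R (\<lambda>\<chi>. (z i - \<phi> (\<chi> (z i))) * g)" if i: "i < m" for i g
  proof -
    obtain r where r: "\<forall>\<chi>\<in>points. g - (\<Sum>u\<in>U. \<phi> (\<chi> (r u)) * u) \<in> ipow (ker \<chi>) M"
      using U(2) unfolding rep_def by blast
    have "?R (\<lambda>\<chi>. \<phi> (\<chi> (r u)) * (z i * u) + \<phi> (\<chi> (- (z i * r u))) * u)" if u: "u \<in> U" for u
      by (intro add scale base) (use i u in auto)
    then have "?R (\<lambda>\<chi>. \<Sum>u\<in>U. \<phi> (\<chi> (r u)) * (z i * u) + \<phi> (\<chi> (- (z i * r u))) * u)"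
      by (rule rep_sum[OF IU])
    then show ?thesis
    proof (rule rep_cong)
      fix \<chi> assume \<chi>: "\<chi> \<in> points"
      have "(z i - \<phi> (\<chi> (z i))) * (g - (\<Sum>u\<in>U. \<phi> (\<chi> (r u)) * u)) \<in> ipow (ker \<chi>) (Suc M)"
        unfolding ipow.simps using sub_point_in_ker[OF \<chi>] bspec[OF r \<chi>] by (rule iprod_mult)
      then have "- ((z i - \<phi> (\<chi> (z i))) * (g - (\<Sum>u\<in>U. \<phi> (\<chi> (r u)) * u))) \<in> ipow (ker \<chi>) (Suc M)"
        by (rule ipowD(5))
      moreover have "(\<Sum>u\<in>U. \<phi> (\<chi> (r u)) * (z i * u) + \<phi> (\<chi> (- (z i * r u))) * u) =
          (z i - \<phi> (\<chi> (z i))) * (\<Sum>u\<in>U. \<phi> (\<chi> (r u)) * u)"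
        unfolding sum_distrib_left
        by (rule sum.cong) (use \<chi> in \<open>auto simp: pointsD hom_mult hom_uminus algebra_simps\<close>)
      ultimately show "(\<Sum>u\<in>U. \<phi> (\<chi> (r u)) * (z i * u) + \<phi> (\<chi> (- (z i * r u))) * u) -
          (z i - \<phi> (\<chi> (z i))) * g \<in> ipow (ker \<chi>) (Suc M)"
        by (simp add: right_diff_distrib)
    qed
  qed
  \<comment> \<open>Closed under products since \<open>ab - a(\<chi>)b(\<chi>)\<close> equals
    \<open>(a - a(\<chi>)) b + a(\<chi>) (b - b(\<chi>))\<close>.\<close>
  let ?W = "{f. \<forall>g. ?R (\<lambda>\<chi>. (f - \<phi> (\<chi> f)) * g)}"
  have zero: "?R (\<lambda>_. 0)" by (rule rep_zero[OF IU])
  have "f \<in> ?W" for f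
  proof (rule generated_induct)
    show "is_subring ?W"
      unfolding is_subring_def
    proof (intro conjI ballI; (intro CollectI allI)?)
      show "?R (\<lambda>\<chi>. (0 - \<phi> (\<chi> 0)) * g)" "?R (\<lambda>\<chi>. (1 - \<phi> (\<chi> 1)) * g)" for g
        by (rule rep_cong[OF zero], simp add: pointsD ipowD(1))+
      fix a g assume a: "a \<in> ?W"
      then have "?R (\<lambda>\<chi>. \<phi> (\<chi> (\<phi> (- 1))) * ((a - \<phi> (\<chi> a)) * g))" by (intro scale) blast
      then show "?R (\<lambda>\<chi>. (- a - \<phi> (\<chi> (- a))) * g)"
        by (rule rep_cong) (simp add: pointsD hom_uminus ipowD(1) algebra_simps)
      fix b assume b: "b \<in> ?W"
      have "?R (\<lambda>\<chi>. (a - \<phi> (\<chi> a)) * g + (b - \<phi> (\<chi> b)) * g)" using a b by (intro add) auto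
      then show "?R (\<lambda>\<chi>. (a + b - \<phi> (\<chi> (a + b))) * g)"
        by (rule rep_cong) (simp add: pointsD hom_add ipowD(1) algebra_simps)
      have "?R (\<lambda>\<chi>. (a - \<phi> (\<chi> a)) * (b * g) + \<phi> (\<chi> a) * ((b - \<phi> (\<chi> b)) * g))" using a b by (intro add scale) auto
      then show "?R (\<lambda>\<chi>. (a * b - \<phi> (\<chi> (a * b))) * g)"
        by (rule rep_cong) (simp add: pointsD hom_mult ipowD(1) algebra_simps)
    qed
    show "\<phi> c \<in> ?W" for c
      by (intro CollectI allI) (rule rep_cong[OF zero], simp add: pointsD ipowD(1))
    show "z i \<in> ?W" if "i < m" for i using step[OF that] by blast
  qed
  then have 1: "?R (\<lambda>\<chi>. (f - \<phi> (\<chi> f)) * 1)" for f by blast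
  have 2: "?R (\<lambda>\<chi>. \<phi> (\<chi> f) * 1)" for f by (rule scale[OF base]) simp
  have "?R (\<lambda>_. f)" for f using add[OF 1[of f] 2[of f]] by simp
  then have "\<forall>f. ?R (\<lambda>_. f)" by blast
  with fin show ?case by blast
qed

text \<open>Every factor \<open>a\<close> in \<open>P\<close> is split as \<open>a(\<chi>)\<close>
  plus an element of \<open>ker \<chi>\<close>. In a product of \<open>M\<close> factors the term
  without any \<open>a(\<chi>)\<close> lies in the \<open>M\<close>-th power of
  \<open>ker \<chi>\<close>, and every other term carries a coefficient from
  \<open>P\<close>.\<close>

lemma rep_ipow:
  assumes P: "is_ideal P" and U: "\<forall>f. rep UNIV U M (\<lambda>_. f)" and f: "f \<in> ipow P M"
  shows "rep P U M (\<lambda>_. f)"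
proof -
  have good: "rep P U M (\<lambda>\<chi>. \<phi> (\<chi> p) * b)" if "p \<in> P" for p b
    by (rule rep_scale[OF _ spec[OF U]]) (rule is_idealD(4)[OF P that])
  \<comment> \<open>functions of the point with coefficients in \<open>P\<close>, i.e. elements of \<open>P \<otimes> R\<close>\<close>
  define E where "E = {G. \<exists>K p b. finite K \<and> (\<forall>k\<in>K. p k \<in> P) \<and> G = (\<lambda>\<chi>. \<Sum>k\<in>(K::nat set). \<phi> (\<chi> (p k)) * b k)}"
  have EI: "(\<lambda>\<chi>. \<Sum>k\<in>(K::nat set). \<phi> (\<chi> (p k)) * b k) \<in> E"
    if "finite K" "\<forall>k\<in>K. p k \<in> P" for K p b unfolding E_def using that by blast
  have E0: "(\<lambda>_. 0) \<in> E" using EI[of "{}"] by simp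
  have Eadd: "(\<lambda>\<chi>. \<phi> (\<chi> q) * c + G \<chi>) \<in> E" if q: "q \<in> P" and G: "G \<in> E" for q c G
  proof -
    obtain K p b where K: "finite K" "\<forall>k\<in>K. p k \<in> P" "G = (\<lambda>\<chi>. \<Sum>k\<in>(K::nat set). \<phi> (\<chi> (p k)) * b k)"
      using G unfolding E_def by blast
    obtain k0 where k0: "k0 \<notin> K" using K(1) ex_new_if_finite infinite_UNIV_nat by blast
    let ?p = "\<lambda>k. if k = k0 then q else p k" and ?b = "\<lambda>k. if k = k0 then c else b k"
    have "(\<Sum>k\<in>K. \<phi> (\<chi> (?p k)) * ?b k) = (\<Sum>k\<in>K. \<phi> (\<chi> (p k)) * b k)" for \<chi>
      using k0 by (intro sum.cong) auto
    then have "(\<lambda>\<chi>. \<phi> (\<chi> q) * c + G \<chi>) = (\<lambda>\<chi>. \<Sum>k\<in>insert k0 K. \<phi> (\<chi> (?p k)) * ?b k)"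
      using K(1) k0 by (simp add: K(3))
    also have "\<dots> \<in> E" using K(1,2) q by (intro EI) auto
    finally show ?thesis .
  qed
  have Esum: "(\<lambda>\<chi>. G \<chi> + H \<chi>) \<in> E" if GH: "G \<in> E" "H \<in> E" for G H
  proof -
    obtain K p b where K: "finite K" "\<forall>k\<in>K. p k \<in> P" "G = (\<lambda>\<chi>. \<Sum>k\<in>(K::nat set). \<phi> (\<chi> (p k)) * b k)"
      using GH(1) unfolding E_def by blast
    have "(\<lambda>\<chi>. (\<Sum>k\<in>K. \<phi> (\<chi> (p k)) * b k) + H \<chi>) \<in> E"
      using K(1,2)
    proof (induction K rule: finite_induct)
      case (insert k K)
      then show ?case using Eadd[of "p k" "\<lambda>\<chi>. (\<Sum>k\<in>K. \<phi> (\<chi> (p k)) * b k) + H \<chi>" "b k"] by (simp add: add.assoc)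
    qed (use GH(2) in simp)
    then show ?thesis by (simp add: K(3))
  qed
  have Emul: "(\<lambda>\<chi>. (a - \<phi> (\<chi> c)) * G \<chi>) \<in> {G. \<exists>H\<in>E. \<forall>\<chi>\<in>points. G \<chi> = H \<chi>}" if G: "G \<in> E" for a c G
  proof -
    obtain K p b where K: "finite K" "\<forall>k\<in>K. p k \<in> P" "G = (\<lambda>\<chi>. \<Sum>k\<in>(K::nat set). \<phi> (\<chi> (p k)) * b k)"
      using G unfolding E_def by blast
    have 1: "(\<lambda>\<chi>. \<Sum>k\<in>K. \<phi> (\<chi> (p k)) * (a * b k)) \<in> E" by (rule EI[OF K(1,2)])
    have "\<forall>k\<in>K. - (c * p k) \<in> P" using K(2) by (auto intro: is_idealD(3,5)[OF P])
    then have 2: "(\<lambda>\<chi>. \<Sum>k\<in>K. \<phi> (\<chi> (- (c * p k))) * b k) \<in> E" by (rule EI[OF K(1)])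
    have eq: "(a - \<phi> (\<chi> c)) * G \<chi> = (\<Sum>k\<in>K. \<phi> (\<chi> (p k)) * (a * b k)) + (\<Sum>k\<in>K. \<phi> (\<chi> (- (c * p k))) * b k)"
      if "\<chi> \<in> points" for \<chi>
      unfolding K(3) sum_distrib_left sum.distrib[symmetric]
      by (rule sum.cong) (use that in \<open>auto simp: pointsD hom_mult hom_uminus algebra_simps\<close>)
    show ?thesis by (intro CollectI bexI[OF _ Esum[OF 1 2]] ballI eq)
  qed
  have approx: "\<exists>G\<in>E. \<forall>\<chi>\<in>points. f - G \<chi> \<in> ipow (ker \<chi>) n" if "f \<in> ipow P n" for f n
    using that
  proof (induction n arbitrary: f)
    case 0 then show ?case using E0 by auto
  next
    case (Suc n)
    from Suc.prems have "f \<in> iprod P (ipow P n)" by (simp add: ipow.simps)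
    then show ?case
    proof (induction rule: iprod.induct)
      case zero then show ?case using E0 ipowD(1) by (intro bexI[of _ "\<lambda>_. 0"]) auto
    next
      case (step a b s)
      obtain G where G: "G \<in> E" "\<forall>\<chi>\<in>points. b - G \<chi> \<in> ipow (ker \<chi>) n" using Suc.IH[OF step(2)] by (elim bexE)
      obtain G' where G': "G' \<in> E" "\<forall>\<chi>\<in>points. s - G' \<chi> \<in> ipow (ker \<chi>) (Suc n)" using step.IH by (elim bexE)
      obtain H where H: "H \<in> E" "\<forall>\<chi>\<in>points. (a - \<phi> (\<chi> a)) * G \<chi> = H \<chi>" using Emul[OF G(1), of a a] by blast
      show ?case
      proof (intro bexI[of _ "\<lambda>\<chi>. \<phi> (\<chi> a) * b + (H \<chi> + G' \<chi>)"] ballI)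
        show "(\<lambda>\<chi>. \<phi> (\<chi> a) * b + (H \<chi> + G' \<chi>)) \<in> E" by (intro Eadd step Esum H G')
        fix \<chi> assume \<chi>: "\<chi> \<in> points"
        have "(a - \<phi> (\<chi> a)) * (b - G \<chi>) \<in> ipow (ker \<chi>) (Suc n)"
          unfolding ipow.simps using sub_point_in_ker[OF \<chi>] bspec[OF G(2) \<chi>] by (rule iprod_mult)
        from ipowD(2)[OF this bspec[OF G'(2) \<chi>]]
        have "(a - \<phi> (\<chi> a)) * (b - G \<chi>) + (s - G' \<chi>) \<in> ipow (ker \<chi>) (Suc n)" .
        moreover have "H \<chi> = (a - \<phi> (\<chi> a)) * G \<chi>" using H(2) \<chi> by simp
        then have "a * b + s - (\<phi> (\<chi> a) * b + (H \<chi> + G' \<chi>)) = (a - \<phi> (\<chi> a)) * (b - G \<chi>) + (s - G' \<chi>)"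
          by (simp only:) (simp add: algebra_simps)
        ultimately show "a * b + s - (\<phi> (\<chi> a) * b + (H \<chi> + G' \<chi>)) \<in> ipow (ker \<chi>) (Suc n)" by (simp only:)
      qed
    qed
  qed
  from approx[OF f] obtain G where G: "G \<in> E" "\<forall>\<chi>\<in>points. f - G \<chi> \<in> ipow (ker \<chi>) M" by blast
  obtain K p b where K: "finite K" "\<forall>k\<in>K. p k \<in> P" "G = (\<lambda>\<chi>. \<Sum>k\<in>(K::nat set). \<phi> (\<chi> (p k)) * b k)"
    using G(1) unfolding E_def by blast
  have "rep P U M G" unfolding K(3) using K(2) by (intro rep_sum[OF P] good) auto
  then show ?thesis
  proof (rule rep_cong)
    fix \<chi> assume "\<chi> \<in> points"
    then show "G \<chi> - f \<in> ipow (ker \<chi>) M" using ipowD(5)[of "f - G \<chi>"] G(2) by simp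
  qed
qed

text \<open>Nakayama's lemma for the module of principal parts, made explicit by the adjugate matrix.\<close>

lemma rep_open:
  assumes \<chi>0: "\<chi>\<^sub>0 \<in> points" and S: "spans_mod S (ipow (ker \<chi>\<^sub>0) M)"
  shows "\<exists>g. \<chi>\<^sub>0 g \<noteq> 0 \<and> (\<forall>f. rep UNIV S M (\<lambda>\<chi>. \<phi> (\<chi> g) * f))"
proof -
  let ?P = "ker \<chi>\<^sub>0" and ?R = "rep UNIV S M"
  have P: "is_ideal ?P" by (rule is_ideal_ker[OF \<chi>0])
  have IU: "is_ideal (UNIV :: 'r set)" by (simp add: is_ideal_def)
  have finS: "finite S" using S by (simp add: spans_mod_def)
  note add = rep_add[OF IU] and scale = rep_scale[of UNIV _ UNIV, OF UNIV_I] and sum = rep_sum[OF IU]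
  obtain U where U: "finite U" "\<forall>f. rep UNIV U M (\<lambda>_. f)" using universal_spanning_set by blast
  have "\<forall>u. \<exists>c. u - kcomb S c \<in> ipow ?P M" using S by (simp add: spans_mod_def)
  from choice[OF this] obtain c where c: "\<forall>u. u - kcomb S (c u) \<in> ipow ?P M" ..
  have "\<forall>u. \<exists>p. (\<forall>v\<in>U. p v \<in> ?P) \<and>
      (\<forall>\<chi>\<in>points. u - kcomb S (c u) - (\<Sum>v\<in>U. \<phi> (\<chi> (p v)) * v) \<in> ipow (ker \<chi>) M)"
    using rep_ipow[OF P U(2)] c unfolding rep_def by simp
  from choice[OF this] obtain p where p: "\<forall>u. (\<forall>v\<in>U. p u v \<in> ?P) \<and>
      (\<forall>\<chi>\<in>points. u - kcomb S (c u) - (\<Sum>v\<in>U. \<phi> (\<chi> (p u v)) * v) \<in> ipow (ker \<chi>) M)" ..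
  obtain us where us: "set us = U" "distinct us" using finite_distinct_list[OF U(1)] by blast
  let ?n = "length us"
  have sumU: "(\<Sum>v\<in>U. f v) = (\<Sum>j<?n. f (us ! j))" for f :: "'r \<Rightarrow> 'r"
    using sum.reindex_bij_betw[OF bij_betw_nth[OF us(2) refl us(1)[symmetric]], of f] by simp
  \<comment> \<open>The universal generators satisfy \<open>u_i - sum_j p_ij u_j\<close> in the span
    of \<open>S\<close>, with \<open>p_ij\<close> vanishing at the given point. The matrix
    \<open>1 - p\<close> of this system is inverted up to its determinant \<open>g\<close>, whose
    value at the point is 1.\<close>
  define A where "A = mat ?n ?n (\<lambda>(i, j). (if i = j then 1 else 0) - p (us ! i) (us ! j))"
  have A: "A \<in> carrier_mat ?n ?n" by (simp add: A_def)
  define g where "g = det A"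
  interpret h0: comm_ring_hom \<chi>\<^sub>0 by (rule pointsD(1)[OF \<chi>0])
  have "map_mat \<chi>\<^sub>0 A = 1\<^sub>m ?n"
  proof (rule eq_matI)
    fix i j assume ij: "i < dim_row (1\<^sub>m ?n)" "j < dim_col (1\<^sub>m ?n)"
    then have "us ! j \<in> U" using us by auto
    then have "\<chi>\<^sub>0 (p (us ! i) (us ! j)) = 0" using p by (simp add: ker_def)
    then show "map_mat \<chi>\<^sub>0 A $$ (i, j) = 1\<^sub>m ?n $$ (i, j)" using ij by (simp add: A_def pointsD[OF \<chi>0])
  qed (simp_all add: A_def)
  then have g1: "\<chi>\<^sub>0 g = 1" unfolding g_def using h0.hom_det[of A] by simp
  have row: "?R (\<lambda>\<chi>. \<Sum>j<?n. \<phi> (\<chi> (A $$ (i, j))) * us ! j)" if i: "i < ?n" for i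
  proof -
    let ?u = "us ! i"
    have "?R (\<lambda>\<chi>. \<Sum>s\<in>S. \<phi> (\<chi> (\<phi> (c ?u s))) * s)" by (rule sum, rule scale, rule rep_base[OF finS])
    then show ?thesis
    proof (rule rep_cong)
      fix \<chi> assume \<chi>: "\<chi> \<in> points"
      have "(\<Sum>j<?n. \<phi> (\<chi> (A $$ (i, j))) * us ! j) = (\<Sum>j<?n. (if j = i then us ! j else 0) - \<phi> (\<chi> (p ?u (us ! j))) * us ! j)"
        using i \<chi> by (intro sum.cong) (auto simp: A_def pointsD hom_minus left_diff_distrib)
      also have "\<dots> = ?u - (\<Sum>v\<in>U. \<phi> (\<chi> (p ?u v)) * v)"
        using i by (simp add: sum_subtractf sumU)
      finally have eq: "(\<Sum>s\<in>S. \<phi> (\<chi> (\<phi> (c ?u s))) * s) - (\<Sum>j<?n. \<phi> (\<chi> (A $$ (i, j))) * us ! j) =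
          - (?u - kcomb S (c ?u) - (\<Sum>v\<in>U. \<phi> (\<chi> (p ?u v)) * v))"
        using \<chi> by (simp add: kcomb_def pointsD)
      show "(\<Sum>s\<in>S. \<phi> (\<chi> (\<phi> (c ?u s))) * s) - (\<Sum>j<?n. \<phi> (\<chi> (A $$ (i, j))) * us ! j) \<in> ipow (ker \<chi>) M"
        unfolding eq using p \<chi> by (intro ipowD(5)) blast
    qed
  qed
  let ?B = "adj_mat A"
  have B: "?B \<in> carrier_mat ?n ?n" "?B * A = g \<cdot>\<^sub>m 1\<^sub>m ?n" using adj_mat[OF A] by (auto simp: g_def)
  have inU: "?R (\<lambda>\<chi>. \<phi> (\<chi> g) * us ! l)" if l: "l < ?n" for l
  proof -
    have entry: "(\<Sum>i<?n. ?B $$ (l, i) * A $$ (i, j)) = (if l = j then g else 0)" if j: "j < ?n" for j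
    proof -
      have "(?B * A) $$ (l, j) = (\<Sum>i<?n. ?B $$ (l, i) * A $$ (i, j))"
        using l j A B(1) by (simp add: scalar_prod_def atLeast0LessThan)
      moreover have "(g \<cdot>\<^sub>m 1\<^sub>m ?n) $$ (l, j) = (if l = j then g else 0)" using l j by simp
      ultimately show ?thesis unfolding B(2) by simp
    qed
    have "?R (\<lambda>\<chi>. \<Sum>i<?n. \<phi> (\<chi> (?B $$ (l, i))) * (\<Sum>j<?n. \<phi> (\<chi> (A $$ (i, j))) * us ! j))"
      by (rule sum, rule scale, rule row) simp
    then show ?thesis
    proof (rule rep_cong)
      fix \<chi> assume \<chi>: "\<chi> \<in> points"
      have "(\<Sum>i<?n. \<phi> (\<chi> (?B $$ (l, i))) * (\<Sum>j<?n. \<phi> (\<chi> (A $$ (i, j))) * us ! j)) =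
          (\<Sum>j<?n. \<phi> (\<chi> (\<Sum>i<?n. ?B $$ (l, i) * A $$ (i, j))) * us ! j)"
        unfolding sum_distrib_left
        by (subst sum.swap) (simp add: pointsD[OF \<chi>] hom_sum hom_mult sum_distrib_right mult.assoc)
      also have "\<dots> = (\<Sum>j<?n. if j = l then \<phi> (\<chi> g) * us ! j else 0)"
        using entry by (intro sum.cong) (auto simp: pointsD[OF \<chi>])
      also have "\<dots> = \<phi> (\<chi> g) * us ! l" using l by simp
      finally show "(\<Sum>i<?n. \<phi> (\<chi> (?B $$ (l, i))) * (\<Sum>j<?n. \<phi> (\<chi> (A $$ (i, j))) * us ! j)) - \<phi> (\<chi> g) * us ! l
          \<in> ipow (ker \<chi>) M" by (simp add: ipowD(1))
    qed
  qed
  have "?R (\<lambda>\<chi>. \<phi> (\<chi> g) * f)" for f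
  proof -
    obtain r where r: "\<forall>\<chi>\<in>points. f - (\<Sum>u\<in>U. \<phi> (\<chi> (r u)) * u) \<in> ipow (ker \<chi>) M"
      using U(2) unfolding rep_def by blast
    have "?R (\<lambda>\<chi>. \<Sum>u\<in>U. \<phi> (\<chi> (r u)) * (\<phi> (\<chi> g) * u))"
    proof (rule sum, rule scale)
      fix u assume "u \<in> U"
      then obtain l where "l < ?n" "u = us ! l" using us(1) by (auto simp: in_set_conv_nth)
      then show "?R (\<lambda>\<chi>. \<phi> (\<chi> g) * u)" using inU by simp
    qed
    then show ?thesis
    proof (rule rep_cong)
      fix \<chi> assume \<chi>: "\<chi> \<in> points"
      have "(\<Sum>u\<in>U. \<phi> (\<chi> (r u)) * (\<phi> (\<chi> g) * u)) = \<phi> (\<chi> g) * (\<Sum>u\<in>U. \<phi> (\<chi> (r u)) * u)"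
        unfolding sum_distrib_left by (rule sum.cong) simp_all
      then have eq: "(\<Sum>u\<in>U. \<phi> (\<chi> (r u)) * (\<phi> (\<chi> g) * u)) - \<phi> (\<chi> g) * f =
          - (\<phi> (\<chi> g) * (f - (\<Sum>u\<in>U. \<phi> (\<chi> (r u)) * u)))" by (simp add: right_diff_distrib)
      show "(\<Sum>u\<in>U. \<phi> (\<chi> (r u)) * (\<phi> (\<chi> g) * u)) - \<phi> (\<chi> g) * f \<in> ipow (ker \<chi>) M"
        unfolding eq using r \<chi> by (intro ipowD(5) ipowD(3)) blast
    qed
  qed
  then show ?thesis using g1 by (intro exI[of _ g]) simp
qed

lemma spans_mod_open:
  assumes "finite S" "\<forall>f. rep UNIV S M (\<lambda>\<chi>. \<phi> (\<chi> g) * f)" and \<chi>: "\<chi> \<in> points" and g: "\<chi> g \<noteq> 0"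
  shows "spans_mod S (ipow (ker \<chi>) M)"
proof -
  note V = span_closure[OF ksub_ideal[OF is_ideal_ipow[of "ker \<chi>" M]] assms(1)]
  let ?V = "{f. \<exists>a. f - kcomb S a \<in> ipow (ker \<chi>) M}"
  have "f \<in> ?V" for f
  proof -
    obtain r where "\<forall>\<chi>\<in>points. \<phi> (\<chi> g) * f - (\<Sum>u\<in>S. \<phi> (\<chi> (r u)) * u) \<in> ipow (ker \<chi>) M"
      using assms(2) unfolding rep_def by blast
    then have "\<phi> (\<chi> g) * f - kcomb S (\<lambda>u. \<chi> (r u)) \<in> ipow (ker \<chi>) M" using \<chi> by (simp add: kcomb_def)
    then have "\<phi> (\<chi> g) * f \<in> ?V" by blast
    then show ?thesis using ksub_scale_iff[OF V(1) g] by blast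
  qed
  then show ?thesis using assms(1) unfolding spans_mod_def by blast
qed

end

section \<open>Counting monomials and their independence in the graded ring\<close>

section \<open>Monomials in local parameters\<close>

definition MI :: "nat \<Rightarrow> nat \<Rightarrow> (nat \<Rightarrow> nat) set" where
  "MI n j = {I \<in> multi_indices n. multi_deg n I = j}"

definition MIle :: "nat \<Rightarrow> nat \<Rightarrow> (nat \<Rightarrow> nat) set" where
  "MIle n M = {I \<in> multi_indices n. multi_deg n I \<le> M}"

lemma multi_deg_add: "multi_deg n (\<lambda>i. I i + J i) = multi_deg n I + multi_deg n J"
  by (simp add: multi_deg_def sum.distrib)

lemma multi_power_add: "multi_power n x (\<lambda>i. I i + J i) = multi_power n x I * multi_power n x J"
  by (simp add: multi_power_def power_add prod.distrib)

lemma le_multi_deg: "i < n \<Longrightarrow> I i \<le> multi_deg n I"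
  unfolding multi_deg_def by (rule member_le_sum) auto

lemma restrict_inj_multi_indices: "inj_on (\<lambda>I. restrict I {..<n}) (multi_indices n)"
proof (rule inj_onI)
  fix I J assume "I \<in> multi_indices n" "J \<in> multi_indices n" and eq: "restrict I {..<n} = restrict J {..<n}"
  have "I i = J i" if "i < n" for i using that eq by (metis lessThan_iff restrict_apply')
  with \<open>I \<in> multi_indices n\<close> \<open>J \<in> multi_indices n\<close> have "I i = J i" for i
    by (cases "i < n") (auto simp: multi_indices_def)
  then show "I = J" ..
qed

lemma card_multi_box:
  assumes "A \<subseteq> multi_indices n" "\<And>I i. I \<in> A \<Longrightarrow> i < n \<Longrightarrow> I i \<in> F i" "\<And>i. i < n \<Longrightarrow> finite (F i)"
  shows "finite A" "card A \<le> (\<Prod>i<n. card (F i))"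
proof -
  have inj: "inj_on (\<lambda>I. restrict I {..<n}) A"
    using inj_on_subset[OF restrict_inj_multi_indices assms(1)] .
  have sub: "(\<lambda>I. restrict I {..<n}) ` A \<subseteq> PiE {..<n} F"
    using assms(2) by (intro image_subsetI) (simp add: restrict_PiE_iff)
  have fin: "finite (PiE {..<n} F)" using assms(3) by (intro finite_PiE) auto
  show "finite A" using inj_on_finite[OF inj sub fin] .
  show "card A \<le> (\<Prod>i<n. card (F i))" using card_inj_on_le[OF inj sub fin] by (simp add: card_PiE)
qed

lemma MIle_finite: "finite (MIle n M)" and card_MIle: "card (MIle n M) \<le> Suc M ^ n"
proof -
  have "I i \<in> {..M}" if "I \<in> MIle n M" "i < n" for I i
    using that le_multi_deg[of i n I] by (auto simp: MIle_def)
  moreover have "MIle n M \<subseteq> multi_indices n" by (auto simp: MIle_def)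
  ultimately show "finite (MIle n M)" "card (MIle n M) \<le> Suc M ^ n"
    using card_multi_box[of "MIle n M" n "\<lambda>_. {..M}"] by auto
qed

text \<open>Bounding one exponent by a constant lowers the order of growth in \<open>M\<close> by
  one.\<close>

lemma card_MIle_restricted: 
  assumes "i < n" shows "card {I \<in> MIle n M. I i < k} \<le> k * Suc M ^ (n - 1)"
proof -
  let ?F = "\<lambda>j. if j = i then {..<k} else {..M}"
  have "I j \<in> ?F j" if "I \<in> {I \<in> MIle n M. I i < k}" "j < n" for I j
    using that le_multi_deg[of j n I] by (auto simp: MIle_def)
  then have "card {I \<in> MIle n M. I i < k} \<le> (\<Prod>j<n. card (?F j))"
    by (intro card_multi_box) (auto simp: MIle_def)
  also have "\<dots> = card (?F i) * (\<Prod>j\<in>{..<n} - {i}. card (?F j))" using assms by (intro prod.remove) auto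
  also have "(\<Prod>j\<in>{..<n} - {i}. card (?F j)) = (\<Prod>j\<in>{..<n} - {i}. Suc M)" by (rule prod.cong) auto
  also have "card (?F i) * \<dots> = k * Suc M ^ (n - 1)" using assms by simp
  finally show ?thesis .
qed

lemma MI_finite: "finite (MI n j)"
  by (rule finite_subset[OF _ MIle_finite[of n j]]) (auto simp: MI_def MIle_def)

text \<open>Reads the exponents as digits in base \<open>b\<close>. This is additive, hence
  compatible with multiplication of monomials, and injective while the exponents stay below
  \<open>b\<close>, so it serves as a monomial order.\<close>

definition weight :: "nat \<Rightarrow> nat \<Rightarrow> (nat \<Rightarrow> nat) \<Rightarrow> nat" where
  "weight b n I = (\<Sum>i<n. I i * b ^ i)"

lemma weight_add: "weight b n (\<lambda>i. I i + J i) = weight b n I + weight b n J"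
  by (simp add: weight_def distrib_right sum.distrib)

lemma weight_inj:
  assumes "\<And>i. i < n \<Longrightarrow> I i < b" "\<And>i. i < n \<Longrightarrow> J i < b" "weight b n I = weight b n J" "i < n"
  shows "I i = J i"
  using assms
proof (induction n arbitrary: I J i)
  case (Suc n)
  have w: "weight b (Suc n) I = I 0 + b * weight b n (\<lambda>i. I (Suc i))" for I
    unfolding weight_def by (subst sum.lessThan_Suc_shift) (simp add: sum_distrib_left mult_ac)
  have eq: "I 0 + b * weight b n (\<lambda>i. I (Suc i)) = J 0 + b * weight b n (\<lambda>i. J (Suc i))"
    using Suc.prems(3) by (simp add: w)
  have b: "I 0 < b" "J 0 < b" using Suc.prems by auto
  have 0: "I 0 = J 0" using arg_cong[OF eq, of "\<lambda>x. x mod b"] b by simp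
  then have "weight b n (\<lambda>i. I (Suc i)) = weight b n (\<lambda>i. J (Suc i))" using eq b by simp
  then have "I (Suc i) = J (Suc i)" if "i < n" for i
    using Suc.IH[of "\<lambda>i. I (Suc i)" "\<lambda>i. J (Suc i)" i] Suc.prems(1,2) that by auto
  then show ?case using 0 Suc.prems(4) by (cases i) auto
qed simp

context kalg
begin

definition fspan :: "('j \<Rightarrow> 'r) \<Rightarrow> 'j set \<Rightarrow> 'r set \<Rightarrow> 'r set" where
  "fspan F J W = {f. \<exists>c. f - (\<Sum>j\<in>J. \<phi> (c j) * F j) \<in> W}"

lemma fspanE: 
  assumes "f \<in> fspan F J W" obtains c where "f - (\<Sum>j\<in>J. \<phi> (c j) * F j) \<in> W"
  using assms unfolding fspan_def by blast

lemma ksub_fspan: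
  assumes "ksub W"
  shows "ksub (fspan F J W)"
  unfolding ksub_def
proof (intro conjI ballI allI)
  show "0 \<in> fspan F J W" unfolding fspan_def
    by (intro CollectI exI[of _ "\<lambda>_. 0"]) (simp add: ksubD[OF assms])
next
  fix f g assume "f \<in> fspan F J W" "g \<in> fspan F J W"
  then obtain a b where "f - (\<Sum>j\<in>J. \<phi> (a j) * F j) \<in> W" "g - (\<Sum>j\<in>J. \<phi> (b j) * F j) \<in> W"
    unfolding fspan_def by blast
  then have "(f - (\<Sum>j\<in>J. \<phi> (a j) * F j)) + (g - (\<Sum>j\<in>J. \<phi> (b j) * F j)) \<in> W" by (rule ksubD[OF assms])
  then show "f + g \<in> fspan F J W" unfolding fspan_def
    by (intro CollectI exI[of _ "\<lambda>x. a x + b x"]) (simp add: hom_add distrib_right sum.distrib algebra_simps)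
next
  fix c f assume "f \<in> fspan F J W"
  then obtain a where "f - (\<Sum>j\<in>J. \<phi> (a j) * F j) \<in> W" unfolding fspan_def by blast
  then have "\<phi> c * (f - (\<Sum>j\<in>J. \<phi> (a j) * F j)) \<in> W" by (rule ksubD[OF assms])
  then show "\<phi> c * f \<in> fspan F J W" unfolding fspan_def
    by (intro CollectI exI[of _ "\<lambda>x. c * a x"]) (simp add: hom_mult right_diff_distrib sum_distrib_left mult.assoc)
qed

lemma fspan_base:
  assumes "ksub W" "finite J" "j \<in> J"
  shows "F j \<in> fspan F J W"
  unfolding fspan_def
proof (intro CollectI exI[of _ "\<lambda>i. if i = j then 1 else 0"])
  have "(\<Sum>i\<in>J. \<phi> (if i = j then 1 else 0) * F i) = (\<Sum>i\<in>J. if i = j then F i else 0)"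
    by (rule sum.cong) auto
  then show "F j - (\<Sum>i\<in>J. \<phi> (if i = j then 1 else 0) * F i) \<in> W" using assms by (simp add: ksubD(1))
qed

lemma fspan_W: "W \<subseteq> fspan F J W"
  unfolding fspan_def by (auto intro!: exI[of _ "\<lambda>_. 0"])

lemma fspan_least:
  assumes V: "ksub V" and "W \<subseteq> V" "\<And>j. j \<in> J \<Longrightarrow> F j \<in> V"
  shows "fspan F J W \<subseteq> V"
proof
  fix f assume "f \<in> fspan F J W"
  then obtain c where c: "f - (\<Sum>j\<in>J. \<phi> (c j) * F j) \<in> W" unfolding fspan_def by blast
  have "(f - (\<Sum>j\<in>J. \<phi> (c j) * F j)) + (\<Sum>j\<in>J. \<phi> (c j) * F j) \<in> V"
    using c assms by (intro ksubD(2)[OF V] ksub_sum[OF V] ksubD(3)[OF V]) auto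
  then show "f \<in> V" by simp
qed

text \<open>Generation modulo the square only, so that elements of \<open>R\<close> itself can stand
  for generators of the maximal ideal of the local ring.\<close>

definition params :: "('r \<Rightarrow> 'k) \<Rightarrow> nat \<Rightarrow> (nat \<Rightarrow> 'r) \<Rightarrow> bool" where
  "params \<chi> n x \<longleftrightarrow> (\<forall>i<n. x i \<in> ker \<chi>) \<and> ker \<chi> \<subseteq> fspan x {..<n} (ipow (ker \<chi>) 2)"

lemma multi_power_ipow:
  assumes "\<And>i. i < n \<Longrightarrow> x i \<in> P"
  shows "multi_power n x I \<in> ipow P (multi_deg n I)"
  unfolding multi_power_def multi_deg_def using assms by (intro ipow_prod ipow_power1) auto

lemma multi_power_Suc:
  assumes "i < n"
  shows "multi_power n x (I(i := Suc (I i))) = x i * multi_power n x I"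
    "multi_deg n (I(i := Suc (I i))) = Suc (multi_deg n I)"
proof -
  have 1: "(\<Prod>j\<in>{..<n} - {i}. x j ^ (I(i := Suc (I i))) j) = (\<Prod>j\<in>{..<n} - {i}. x j ^ I j)"
    by (rule prod.cong) auto
  show "multi_power n x (I(i := Suc (I i))) = x i * multi_power n x I"
    unfolding multi_power_def using assms
    by (simp only: prod.remove[OF finite_lessThan, of i n] lessThan_iff 1) (simp add: mult.assoc)
  have 2: "(\<Sum>j\<in>{..<n} - {i}. (I(i := Suc (I i))) j) = (\<Sum>j\<in>{..<n} - {i}. I j)"
    by (rule sum.cong) auto
  show "multi_deg n (I(i := Suc (I i))) = Suc (multi_deg n I)"
    unfolding multi_deg_def using assms
    by (simp only: sum.remove[OF finite_lessThan, of i n] lessThan_iff 2) simp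
qed

text \<open>Modulo the next power, a product depends only on the combination of parameters
  representing its first factor and the combination of monomials representing its second.\<close>

lemma ipow_fspan:
  assumes \<chi>: "\<chi> \<in> points" and x: "params \<chi> n x"
  shows "ipow (ker \<chi>) j \<subseteq> fspan (multi_power n x) (MI n j) (ipow (ker \<chi>) (Suc j))"
proof (induction j)
  case 0
  show ?case
  proof
    fix f
    have "I = (\<lambda>_. 0)" if "I \<in> MI n 0" for I
    proof
      fix i show "I i = 0" using that le_multi_deg[of i n I]
        by (cases "i < n") (auto simp: MI_def multi_indices_def)
    qed
    moreover have "(\<lambda>_. 0) \<in> MI n 0" by (simp add: MI_def multi_indices_def multi_deg_def)
    ultimately have "MI n 0 = {\<lambda>_. 0}" by blast
    then show "f \<in> fspan (multi_power n x) (MI n 0) (ipow (ker \<chi>) (Suc 0))"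
      using sub_point_in_ker[OF \<chi>, of f] unfolding fspan_def ipow_Suc_0[OF is_ideal_ker[OF \<chi>]]
      by (auto simp: multi_power_def intro!: exI[of _ "\<lambda>_. \<chi> f"])
  qed
next
  case (Suc j)
  let ?P = "ker \<chi>"
  let ?V = "fspan (multi_power n x) (MI n (Suc j)) (ipow ?P (Suc (Suc j)))"
  have W: "ksub (ipow ?P l)" for l by (rule ksub_ideal[OF is_ideal_ipow])
  have V: "ksub ?V" by (rule ksub_fspan[OF W])
  have xP: "\<And>i. i < n \<Longrightarrow> x i \<in> ?P" using x by (auto simp: params_def)
  show ?case
  proof
    fix f assume "f \<in> ipow ?P (Suc j)"
    then have "f \<in> iprod ?P (ipow ?P j)" by (simp add: ipow.simps)
    then show "f \<in> ?V"
    proof (induction rule: iprod.induct)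
      case (step a b s)
      have "a \<in> fspan x {..<n} (ipow ?P 2)" using x step(1) by (auto simp: params_def)
      then obtain c where c: "a - (\<Sum>i<n. \<phi> (c i) * x i) \<in> ipow ?P 2" by (rule fspanE)
      have "b \<in> fspan (multi_power n x) (MI n j) (ipow ?P (Suc j))" using Suc.IH step(2) by blast
      then obtain e where e: "b - (\<Sum>I\<in>MI n j. \<phi> (e I) * multi_power n x I) \<in> ipow ?P (Suc j)" by (rule fspanE)
      define A where "A = (\<Sum>i<n. \<phi> (c i) * x i)"
      define E where "E = (\<Sum>I\<in>MI n j. \<phi> (e I) * multi_power n x I)"
      have A: "A \<in> ipow ?P (Suc 0)"
        unfolding A_def ipow_Suc_0[OF is_ideal_ker[OF \<chi>]]
        using xP by (intro is_ideal_sum[OF is_ideal_ker[OF \<chi>]] is_idealD(3)[OF is_ideal_ker[OF \<chi>]]) auto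
      have 1: "(a - A) * b \<in> ipow ?P (Suc (Suc j))" using ipow_mult[OF c step(2)] by (simp add: A_def)
      have 2: "A * (b - E) \<in> ipow ?P (Suc (Suc j))" using ipow_mult[OF A e] by (simp add: E_def)
      have "A * E = (\<Sum>i<n. \<Sum>I\<in>MI n j. \<phi> (c i * e I) * (x i * multi_power n x I))"
        unfolding A_def E_def sum_product by (intro sum.cong) (auto simp: hom_mult mult_ac)
      also have "\<dots> \<in> ?V"
      proof (intro ksub_sum[OF V] ksubD(3)[OF V])
        fix i I assume "i \<in> {..<n}" "I \<in> MI n j"
        then have "I(i := Suc (I i)) \<in> MI n (Suc j)" "multi_power n x (I(i := Suc (I i))) = x i * multi_power n x I"
          using multi_power_Suc(1)[of i n x I] multi_power_Suc(2)[of i n I] by (auto simp: MI_def multi_indices_def)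
        then show "x i * multi_power n x I \<in> ?V" using fspan_base[OF W MI_finite] by metis
      qed
      finally have "A * E \<in> ?V" .
      then have "(a - A) * b + A * (b - E) + A * E + s \<in> ?V"
        using 1 2 step.IH fspan_W by (intro ksubD(2)[OF V]) blast+
      then show ?case by (simp add: algebra_simps)
    qed (rule ksubD(1)[OF V])
  qed
qed

end

context affine_alg
begin

text \<open>Generators of the graded pieces of degree up to \<open>M\<close> are collected by
  descending induction from the \<open>Suc M\<close>-th power.\<close>

lemma graded_generators_span:
  assumes gen: "\<And>j. ipow P j \<subseteq> fspan F (G j) (ipow P (Suc j))"
    and fin: "\<And>j. finite (G j)"
  shows "spans_mod (F ` (\<Union>j\<le>M. G j)) (ipow P (Suc M))"
proof -
  let ?S = "F ` (\<Union>j\<le>M. G j)"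
  have finS: "finite ?S" using fin by simp
  note V = span_closure[OF ksub_ideal[OF is_ideal_ipow[of P "Suc M"]] finS]
  let ?V = "{f. \<exists>a. f - kcomb ?S a \<in> ipow P (Suc M)}"
  have "ipow P j \<subseteq> ?V" if "j \<le> Suc M" for j
    using that
  proof (induction j rule: inc_induct)
    case base show ?case by (rule V(3))
  next
    case (step j)
    have "fspan F (G j) (ipow P (Suc j)) \<subseteq> ?V"
    proof (rule fspan_least[OF V(1) step.IH])
      fix k assume "k \<in> G j"
      with step.hyps have "F k \<in> ?S" by (intro imageI UN_I[of j]) auto
      with V(2) show "F k \<in> ?V" by blast
    qed
    with gen[of j] show ?case by blast
  qed
  from this[of 0] show ?thesis using finS unfolding spans_mod_def by auto
qed

text \<open>If some form in the parameters vanished in the associated graded ring (or if there were fewer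
  than \<open>card T\<close> parameters), the Hilbert function would grow too slowly.\<close>

lemma regular_monomials:
  assumes nz: "normalization {0} T B z h" and \<chi>: "\<chi> \<in> points" and x: "params \<chi> n x" and n: "n \<le> card T"
  shows "n = card T"
    and "(\<Sum>I\<in>MI n j. \<phi> (c I) * multi_power n x I) \<in> ipow (ker \<chi>) (Suc j) \<Longrightarrow> \<forall>I\<in>MI n j. c I = 0"
proof -
  let ?P = "ker \<chi>" and ?t = "card T" and ?x = "multi_power n x"
  note N = normalizationD[OF nz]
  have W: "ksub (ipow ?P l)" for l by (rule ksub_ideal[OF is_ideal_ipow])
  have D: "card B > 0" using N(2,3) by (auto simp: card_gt_0_iff)
  \<comment> \<open>A spanning family of size of order \<open>M^(t-1)\<close> at one point spreads
    to an open set and contradicts the growth there. For \<open>t = 0\<close> the truncated exponent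
    would still allow a constant number of elements, so \<open>K = 0\<close> is demanded and the
    family is empty.\<close>
  have contra: False
    if sp: "\<And>M. spans_mod (S M) (ipow ?P (Suc M))" and card: "\<And>M. card (S M) \<le> K * Suc M ^ (?t - 1)"
      and K: "?t = 0 \<Longrightarrow> K = 0" for S K
  proof -
    have "Suc N ^ ?t \<le> (card B * K * card B ^ (?t - 1)) * (?t * N + 1) ^ (?t - 1)" for N
    proof -
      \<comment> \<open>Chosen so that \<open>Suc M\<close> is the exponent in the growth
        estimate.\<close>
      define M where "M = card B * Suc (?t * N) - 1"
      have M: "Suc M = card B * Suc (?t * N)" using D by (simp add: M_def)
      obtain g where g: "\<chi> g \<noteq> 0" "\<forall>f. rep UNIV (S M) (Suc M) (\<lambda>\<chi>. \<phi> (\<chi> g) * f)"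
        using rep_open[OF \<chi> sp[of M]] by blast
      have finS: "finite (S M)" using sp[of M] by (simp add: spans_mod_def)
      have "g \<noteq> 0" using g(1) \<chi> by (auto simp: pointsD)
      have "Suc N ^ ?t \<le> card B * card (S M)"
        by (rule growth[OF nz \<open>g \<noteq> 0\<close> finS]) (use spans_mod_open[OF finS g(2)] in \<open>simp add: M del: mult_Suc_right\<close>)
      also have "\<dots> \<le> card B * (K * Suc M ^ (?t - 1))" using card by (intro mult_left_mono) auto
      also have "\<dots> = (card B * K * card B ^ (?t - 1)) * (?t * N + 1) ^ (?t - 1)"
        unfolding M power_mult_distrib by (simp add: mult.assoc)
      finally show ?thesis .
    qed
    then have "?t \<le> ?t - 1" by (rule growth_exponent_le)
    then have t0: "?t = 0" by simp
    then have "card (S (card B - 1)) = 0" using card[of "card B - 1"] K by simp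
    moreover have "finite (S M)" for M using sp by (simp add: spans_mod_def)
    ultimately have "S (card B - 1) = {}" by simp
    moreover obtain g where "\<chi> g \<noteq> 0" "\<forall>f. rep UNIV (S (card B - 1)) (card B) (\<lambda>\<chi>. \<phi> (\<chi> g) * f)"
      using rep_open[OF \<chi> sp[of "card B - 1"]] D by auto
    ultimately have g: "\<chi> g \<noteq> 0" "\<forall>f. rep UNIV {} (card B) (\<lambda>\<chi>. \<phi> (\<chi> g) * f)" by auto
    then have "g \<noteq> 0" using \<chi> by (auto simp: pointsD)
    have "Suc 0 ^ ?t \<le> card B * card ({} :: 'r set)"
      by (rule growth[OF nz \<open>g \<noteq> 0\<close>]) (use spans_mod_open[OF _ g(2)] t0 in auto)
    then show False by simp
  qed
  have gen: "ipow ?P j \<subseteq> fspan ?x (MI n j) (ipow ?P (Suc j))" for j by (rule ipow_fspan[OF \<chi> x])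
  have UMI: "(\<Union>j\<le>M. MI n j) = MIle n M" for M by (auto simp: MI_def MIle_def)
  show nt: "n = ?t"
  proof (rule ccontr)
    assume "n \<noteq> ?t"
    with n have lt: "n < ?t" by simp
    show False
    proof (rule contra)
      show "spans_mod (?x ` (\<Union>j\<le>M. MI n j)) (ipow ?P (Suc M))" for M
        by (rule graded_generators_span[OF gen MI_finite])
      have "card (?x ` (\<Union>j\<le>M. MI n j)) \<le> card (MIle n M)" for M
        unfolding UMI by (rule card_image_le[OF MIle_finite])
      also have "card (MIle n M) \<le> Suc M ^ n" for M by (rule card_MIle)
      also have "Suc M ^ n \<le> Suc M ^ (?t - 1)" for M using lt by (intro power_increasing) auto
      finally show "card (?x ` (\<Union>j\<le>M. MI n j)) \<le> 1 * Suc M ^ (?t - 1)" for M by simp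
      show "?t = 0 \<Longrightarrow> 1 = (0::nat)" using lt by simp
    qed
  qed
  assume rel: "(\<Sum>I\<in>MI n j. \<phi> (c I) * ?x I) \<in> ipow ?P (Suc j)"
  show "\<forall>I\<in>MI n j. c I = 0"
  proof (rule ccontr)
    assume neg: "\<not> ?thesis"
    \<comment> \<open>Exponents of degree \<open>j\<close> have entries at most \<open>j\<close>, so
      base \<open>Suc j\<close> separates them; \<open>I0\<close> will be the leading exponent of
      the relation in this order.\<close>
    let ?w = "weight (Suc j) n"
    have bd: "\<forall>I. I \<in> MI n j \<and> c I \<noteq> 0 \<longrightarrow> ?w I < Suc (Max (?w ` MI n j))"
      using MI_finite[of n j] by (auto simp: less_Suc_eq_le)
    obtain I1 where "I1 \<in> MI n j \<and> c I1 \<noteq> 0" using neg by blast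
    from ex_has_greatest_nat[of "\<lambda>I. I \<in> MI n j \<and> c I \<noteq> 0", OF this bd]
    obtain I0 where I0: "I0 \<in> MI n j" "c I0 \<noteq> 0" "\<And>I. I \<in> MI n j \<Longrightarrow> c I \<noteq> 0 \<Longrightarrow> ?w I \<le> ?w I0"
      by auto
    have strict: "?w I < ?w I0" if I: "I \<in> MI n j" "c I \<noteq> 0" "I \<noteq> I0" for I
    proof (rule ccontr)
      assume "\<not> ?w I < ?w I0"
      then have eq: "?w I = ?w I0" using I0(3)[OF I(1,2)] by simp
      have "I i = I0 i" if "i < n" for i
        by (rule weight_inj[OF _ _ eq that])
          (use le_multi_deg[of _ n I] le_multi_deg[of _ n I0] I(1) I0(1) in \<open>auto simp: MI_def less_Suc_eq_le\<close>)
      then have "I = I0" using I(1) I0(1) by (intro ext) (metis (mono_tags, lifting) MI_def mem_Collect_eq multi_indices_def not_less)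
      with I(3) show False by simp
    qed
    \<comment> \<open>The monomials not divisible by the leading one. Its multiples are rewritten
      through monomials of smaller weight, so these already generate each graded piece, and there
      are too few of them.\<close>
    define G where "G l = {I \<in> MI n l. \<not> (\<forall>i<n. I0 i \<le> I i)}" for l
    have finG: "finite (G l)" for l unfolding G_def using MI_finite[of n l] by simp
    have red: "?x I \<in> fspan ?x (G l) (ipow ?P (Suc l))" if "I \<in> MI n l" for I l
      using that
    proof (induction "?w I" arbitrary: I rule: less_induct)
      case less
      let ?V = "fspan ?x (G l) (ipow ?P (Suc l))"
      have V: "ksub ?V" by (rule ksub_fspan[OF W])
      show ?case
      proof (cases "\<forall>i<n. I0 i \<le> I i")
        case False
        then have "I \<in> G l" using less.prems by (simp add: G_def)
        then show ?thesis by (rule fspan_base[OF W finG])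
      next
        case True
        define J where "J = (\<lambda>i. I i - I0 i)"
        have IJ: "I = (\<lambda>i. I0 i + J i)"
        proof
          fix i show "I i = I0 i + J i"
            using True I0(1) by (cases "i < n") (auto simp: J_def MI_def multi_indices_def)
        qed
        have J: "J \<in> multi_indices n" using less.prems by (auto simp: J_def MI_def multi_indices_def)
        have dl: "l = j + multi_deg n J" using less.prems I0(1) multi_deg_add[of n I0 J] IJ by (simp add: MI_def)
        have xJ: "?x J \<in> ipow ?P (multi_deg n J)" using x by (intro multi_power_ipow) (auto simp: params_def)
        have 1: "(\<Sum>I\<in>MI n j. \<phi> (c I) * ?x I) * ?x J \<in> ?V"
          using ipow_mult[OF rel xJ] fspan_W dl by fastforce
        have 2: "(\<Sum>I'\<in>MI n j - {I0}. \<phi> (c I') * (?x I' * ?x J)) \<in> ?V"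
        proof (rule ksub_sum[OF V])
          fix I' assume I': "I' \<in> MI n j - {I0}"
          show "\<phi> (c I') * (?x I' * ?x J) \<in> ?V"
          proof (cases "c I' = 0")
            case True
            then show ?thesis using ksubD(1)[OF V] by simp
          next
            case False
            let ?L = "\<lambda>i. I' i + J i"
            have "?w ?L < ?w I" using strict[of I'] I' False unfolding IJ weight_add by auto
            moreover have "?L \<in> MI n l" using I' J dl by (auto simp: MI_def multi_indices_def multi_deg_add)
            ultimately have "?x ?L \<in> ?V" by (rule less.hyps)
            then show ?thesis by (intro ksubD(3)[OF V]) (simp add: multi_power_add)
          qed
        qed
        have xI: "?x I = ?x I0 * ?x J" using multi_power_add[of n x I0 J] IJ by simp
        have "(\<Sum>I\<in>MI n j. \<phi> (c I) * ?x I) * ?x J = \<phi> (c I0) * ?x I + (\<Sum>I'\<in>MI n j - {I0}. \<phi> (c I') * (?x I' * ?x J))"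
          unfolding sum.remove[OF MI_finite I0(1)] xI by (simp add: distrib_right sum_distrib_right mult.assoc)
        then have "\<phi> (c I0) * ?x I \<in> ?V" using ksubD(5)[OF V 1 2] by simp
        then show ?thesis using ksub_scale_iff[OF V I0(2)] by blast
      qed
    qed
    show False
    proof (rule contra)
      show "spans_mod (?x ` (\<Union>l\<le>M. G l)) (ipow ?P (Suc M))" for M
      proof (rule graded_generators_span[OF _ finG])
        fix l
        have "fspan ?x (MI n l) (ipow ?P (Suc l)) \<subseteq> fspan ?x (G l) (ipow ?P (Suc l))"
          by (rule fspan_least[OF ksub_fspan[OF W] fspan_W red])
        with gen[of l] show "ipow ?P l \<subseteq> fspan ?x (G l) (ipow ?P (Suc l))" by blast
      qed
      have "card (?x ` (\<Union>l\<le>M. G l)) \<le> (n * j) * Suc M ^ (?t - 1)" for M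
      proof -
        have sub: "(\<Union>l\<le>M. G l) \<subseteq> (\<Union>i<n. {I \<in> MIle n M. I i < I0 i})"
          unfolding G_def MI_def MIle_def by force
        have fin: "finite {I \<in> MIle n M. I i < k}" for i k using MIle_finite[of n M] by simp
        have "card (?x ` (\<Union>l\<le>M. G l)) \<le> card (\<Union>l\<le>M. G l)" using finG by (intro card_image_le) auto
        also have "\<dots> \<le> card (\<Union>i<n. {I \<in> MIle n M. I i < I0 i})" by (rule card_mono[OF _ sub]) (use fin in auto)
        also have "\<dots> \<le> (\<Sum>i<n. card {I \<in> MIle n M. I i < I0 i})" by (rule card_UN_le) simp
        also have "\<dots> \<le> (\<Sum>i<n. j * Suc M ^ (n - 1))"
        proof (rule sum_mono)
          fix i assume i: "i \<in> {..<n}"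
          have "card {I \<in> MIle n M. I i < I0 i} \<le> I0 i * Suc M ^ (n - 1)" using i by (intro card_MIle_restricted) simp
          also have "\<dots> \<le> j * Suc M ^ (n - 1)"
            using le_multi_deg[of i n I0] i I0(1) by (intro mult_right_mono) (auto simp: MI_def)
          finally show "card {I \<in> MIle n M. I i < I0 i} \<le> j * Suc M ^ (n - 1)" .
        qed
        also have "\<dots> = (n * j) * Suc M ^ (?t - 1)" using nt by (simp add: mult.assoc)
        finally show ?thesis .
      qed
      then show "card (?x ` (\<Union>l\<le>M. G l)) \<le> (n * j) * Suc M ^ (?t - 1)" for M .
      show "?t = 0 \<Longrightarrow> n * j = 0" using nt by simp
    qed
  qed
qed

end

section \<open>Effect of operators on orders of vanishing\<close>

section \<open>Differential operators\<close>

lemma diff_op_linear: "diff_op \<psi> A t D \<Longrightarrow> k_linear_on \<psi> A D"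
  by (cases t) auto

text \<open>Induction on the degree \<open>t\<close>, and within it on \<open>n\<close> through
  \<open>D(pb) = p D(b) + [D, p](b)\<close>, where the commutator has smaller degree or is zero. The
  map \<open>\<iota>\<close> and the filtration \<open>L\<close> are left abstract in order to treat
  \<open>R\<close> itself and \<open>R\<close> inside its localization together.\<close>

lemma diff_op_filtration:
  fixes \<iota> :: "'r::comm_ring_1 \<Rightarrow> 'a::comm_ring_1" and L :: "nat \<Rightarrow> 'a set"
  assumes D: "diff_op \<psi> A t D"
    and L: "L 0 = A" "\<And>j. L (Suc j) \<subseteq> L j" "\<And>j. 0 \<in> L j" "\<And>a b j. a \<in> L j \<Longrightarrow> b \<in> L j \<Longrightarrow> a + b \<in> L j"
    and \<iota>: "\<iota> 0 = 0" "\<And>f g. \<iota> (f + g) = \<iota> f + \<iota> g" "\<And>f g. \<iota> (f * g) = \<iota> f * \<iota> g" "\<And>f. \<iota> f \<in> A"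
    and P: "\<And>p b j. p \<in> P \<Longrightarrow> b \<in> L j \<Longrightarrow> \<iota> p * b \<in> L (Suc j)"
    and f: "f \<in> ipow P n"
  shows "D (\<iota> f) \<in> L (n - t)"
  using D f
proof (induction t arbitrary: D n f)
  have mono: "L j \<subseteq> L i" if "i \<le> j" for i j
    using that by (rule lift_Suc_antimono_le[of L, OF L(2)])
  have main: "D (\<iota> f) \<in> L (n - t)" if lin: "k_linear_on \<psi> A D"
    and com: "\<And>p b n. p \<in> P \<Longrightarrow> b \<in> ipow P n \<Longrightarrow> D (\<iota> p * \<iota> b) - \<iota> p * D (\<iota> b) \<in> L (Suc n - t)"
    and f: "f \<in> ipow P n" for D n f t
    using f
  proof (induction n arbitrary: f)
    case 0
    then show ?case using lin \<iota>(4) L(1) by (auto simp: k_linear_on_def)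
  next
    case (Suc n)
    from Suc.prems have "f \<in> iprod P (ipow P n)" by (simp add: ipow.simps)
    then show ?case
    proof (induction rule: iprod.induct)
      case zero
      have "0 \<in> A" using \<iota>(4)[of 0] \<iota>(1) by simp
      then have "D (0 + 0) = D 0 + D 0" using lin by (simp only: k_linear_on_def)
      then show ?case using \<iota>(1) L(3) by simp
    next
      case (step a b s)
      have AA: "\<iota> a * \<iota> b \<in> A" "\<iota> s \<in> A" using \<iota>(3)[of a b] \<iota>(4)[of "a * b"] \<iota>(4)[of s] by simp_all
      have "\<iota> a * D (\<iota> b) \<in> L (Suc (n - t))" by (rule P[OF step(1) Suc.IH[OF step(2)]])
      moreover have "Suc n - t \<le> Suc (n - t)" by arith
      ultimately have 1: "\<iota> a * D (\<iota> b) \<in> L (Suc n - t)" using mono by blast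
      have "D (\<iota> (a * b + s)) = \<iota> a * D (\<iota> b) + (D (\<iota> a * \<iota> b) - \<iota> a * D (\<iota> b)) + D (\<iota> s)"
        using lin AA by (simp add: k_linear_on_def \<iota>(2,3))
      then show ?case using L(4)[OF L(4)[OF 1 com[OF step(1,2)]] step.IH] by simp
    qed
  qed
  {
    case 0
    have com: "D (\<iota> p * \<iota> b) - \<iota> p * D (\<iota> b) \<in> L (Suc n - 0)" if "p \<in> P" "b \<in> ipow P n" for p b n
      using 0(1) \<iota>(4) L(3) by simp
    show ?case by (rule main[OF diff_op_linear[OF 0(1)] com 0(2)])
  next
    case (Suc t)
    have com: "D (\<iota> p * \<iota> b) - \<iota> p * D (\<iota> b) \<in> L (Suc n - Suc t)" if "p \<in> P" "b \<in> ipow P n" for p b n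
    proof -
      have "diff_op \<psi> A t (\<lambda>f. D (\<iota> p * f) - \<iota> p * D f)" using Suc.prems(1) \<iota>(4) by simp
      from Suc.IH[OF this that(2)] show ?thesis by simp
    qed
    show ?case by (rule main[OF diff_op_linear[OF Suc.prems(1)] com Suc.prems(2)])
  }
qed

text \<open>Nonsingularity distilled into two facts: parameters exist at every point, in a number
  \<open>t\<close> common to all points, and their monomials are independent in the graded
  ring.\<close>

locale smooth_alg = affine_alg \<phi> z m for \<phi> :: "'k::alg_closed_field \<Rightarrow> 'r::idom" and z m +
  fixes t :: nat
  assumes params_exist: "\<And>\<chi>. \<chi> \<in> points \<Longrightarrow> \<exists>x. params \<chi> t x"
    and monomials_indep: "\<And>\<chi> x c j I. \<chi> \<in> points \<Longrightarrow> params \<chi> t x \<Longrightarrow>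
      (\<Sum>I\<in>MI t j. \<phi> (c I) * multi_power t x I) \<in> ipow (ker \<chi>) (Suc j) \<Longrightarrow> I \<in> MI t j \<Longrightarrow> c I = 0"
begin

lemma monomials_indep_le:
  assumes \<chi>: "\<chi> \<in> points" and x: "params \<chi> t x"
    and rel: "(\<Sum>I\<in>MIle t M. \<phi> (c I) * multi_power t x I) \<in> ipow (ker \<chi>) (Suc M)" and I: "I \<in> MIle t M"
  shows "c I = 0"
  using I
proof (induction "multi_deg t I" arbitrary: I rule: less_induct)
  case less
  let ?x = "multi_power t x" and ?j = "multi_deg t I"
  have jM: "?j \<le> M" and IM: "I \<in> MI t ?j" using less.prems by (auto simp: MIle_def MI_def)
  have sub: "MI t ?j \<subseteq> MIle t M" using jM by (auto simp: MI_def MIle_def)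
  have "\<phi> (c J) * ?x J \<in> ipow (ker \<chi>) (Suc ?j)" if J: "J \<in> MIle t M - MI t ?j" for J
  proof (cases "multi_deg t J < ?j")
    case True
    then have "c J = 0" using less.hyps J by blast
    then show ?thesis by (simp add: ipowD(1))
  next
    case False
    then have "Suc ?j \<le> multi_deg t J" using J by (auto simp: MI_def MIle_def)
    then show ?thesis
      using multi_power_ipow[of t x "ker \<chi>" J] x ipow_antimono[of "Suc ?j" "multi_deg t J" "ker \<chi>"]
      by (intro ipowD(3)) (auto simp: params_def)
  qed
  then have rest: "(\<Sum>J\<in>MIle t M - MI t ?j. \<phi> (c J) * ?x J) \<in> ipow (ker \<chi>) (Suc ?j)"
    by (intro is_ideal_sum[OF is_ideal_ipow])
  have "(\<Sum>J\<in>MIle t M. \<phi> (c J) * ?x J) \<in> ipow (ker \<chi>) (Suc ?j)"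
    using rel ipow_antimono[of "Suc ?j" "Suc M" "ker \<chi>"] jM by auto
  from ipowD(6)[OF this rest] have "(\<Sum>J\<in>MI t ?j. \<phi> (c J) * ?x J) \<in> ipow (ker \<chi>) (Suc ?j)"
    using sum.subset_diff[OF sub MIle_finite, of "\<lambda>J. \<phi> (c J) * ?x J"] by simp
  from monomials_indep[OF \<chi> x this IM] show ?case .
qed

lemma monomials_inj:
  assumes \<chi>: "\<chi> \<in> points" and x: "params \<chi> t x"
  shows "inj_on (multi_power t x) (MIle t M)"
proof (rule inj_onI, rule ccontr)
  fix I J assume I: "I \<in> MIle t M" and J: "J \<in> MIle t M" and eq: "multi_power t x I = multi_power t x J" and ne: "I \<noteq> J"
  let ?c = "\<lambda>K. (if K = I then 1 else 0) - (if K = J then 1 else (0::'k))"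
  have "(\<Sum>K\<in>MIle t M. \<phi> (?c K) * multi_power t x K) =
    (\<Sum>K\<in>MIle t M. (if K = I then multi_power t x K else 0) - (if K = J then multi_power t x K else 0))"
    by (rule sum.cong) (auto simp: hom_minus)
  also have "\<dots> = 0" using I J eq MIle_finite[of t M] by (simp add: sum_subtractf)
  finally have "(\<Sum>K\<in>MIle t M. \<phi> (?c K) * multi_power t x K) \<in> ipow (ker \<chi>) (Suc M)" by (simp add: ipowD(1))
  from monomials_indep_le[OF \<chi> x this I] ne show False by simp
qed

text \<open>A redundant element would leave fewer spanning vectors than there are independent
  monomials in parameters at \<open>\<chi>\<close>. This will be applied to the monomials of one
  point at its neighbours.\<close>

lemma minimal_span_indep:
  assumes \<chi>: "\<chi> \<in> points" and S: "spans_mod S (ipow (ker \<chi>) (Suc M))" "card S = card (MIle t M)"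
    and rel: "kcomb S c \<in> ipow (ker \<chi>) (Suc M)" and s: "s \<in> S"
  shows "c s = 0"
proof (rule ccontr)
  assume cs: "c s \<noteq> 0"
  let ?W = "ipow (ker \<chi>) (Suc M)"
  have W: "ksub ?W" by (rule ksub_ideal[OF is_ideal_ipow])
  have fin: "finite S" using S by (simp add: spans_mod_def)
  then have fin': "finite (S - {s})" by simp
  note V = span_closure[OF W fin']
  let ?V = "{f. \<exists>a. f - kcomb (S - {s}) a \<in> ?W}"
  have "kcomb S c \<in> ?V" using rel V(3) by blast
  moreover have "kcomb (S - {s}) c \<in> ?V" using V(2) by (rule ksub_kcomb[OF V(1)])
  moreover have "kcomb S c = \<phi> (c s) * s + kcomb (S - {s}) c" unfolding kcomb_def using s fin by (simp add: sum.remove)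
  ultimately have "\<phi> (c s) * s \<in> ?V" using ksubD(5)[OF V(1), of "kcomb S c" "kcomb (S - {s}) c"] by simp
  then have "s \<in> ?V" using ksub_scale_iff[OF V(1) cs] by blast
  with V(2) have SV: "S \<subseteq> ?V" by blast
  have inV: "f \<in> ?V" for f
  proof -
    obtain a where "f - kcomb S a \<in> ?W" using S(1) by (auto simp: spans_mod_def)
    then have "f - kcomb S a \<in> ?V" using V(3) by blast
    from ksubD(2)[OF V(1) this ksub_kcomb[OF V(1) SV, of a]] show ?thesis by simp
  qed
  obtain y where y: "params \<chi> t y" using params_exist[OF \<chi>] ..
  have "card (S - {s}) < card (MIle t M)" using S(2) s fin by (metis card_Diff1_less)
  then have "\<exists>c. (\<exists>j\<in>MIle t M. c j \<noteq> 0) \<and> (\<Sum>j\<in>MIle t M. \<phi> (c j) * multi_power t y j) \<in> ?W"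
    using inV by (intro linear_dependence_mod[OF W fin' MIle_finite]) auto
  then show False using monomials_indep_le[OF \<chi> y] by blast
qed

section \<open>Operators on \<open>R\<close> prescribed by their values at points\<close>

lemma eq_of_points: "(\<And>\<chi>. \<chi> \<in> points \<Longrightarrow> \<chi> f = \<chi> g) \<Longrightarrow> f = g"
  using point_exists[of "f - g"] by (auto simp: pointsD)

text \<open>The value at \<open>\<chi>\<close> of the commutator with \<open>a\<close> is the
  functional applied to \<open>(a - a(\<chi>)) f\<close>, and this multiplication gains one power of
  \<open>ker \<chi>\<close>. Since functions are determined by their values, the recursive condition
  on commutators can be tested at points.\<close>

lemma diff_op_by_points:
  assumes "\<And>\<chi> f. \<chi> \<in> points \<Longrightarrow> \<chi> (E f) = \<Lambda> \<chi> f"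
    and "\<And>\<chi> f g. \<chi> \<in> points \<Longrightarrow> \<Lambda> \<chi> (f + g) = \<Lambda> \<chi> f + \<Lambda> \<chi> g"
    and "\<And>\<chi> c f. \<chi> \<in> points \<Longrightarrow> \<Lambda> \<chi> (\<phi> c * f) = c * \<Lambda> \<chi> f"
    and "\<And>\<chi> f. \<chi> \<in> points \<Longrightarrow> f \<in> ipow (ker \<chi>) (Suc s) \<Longrightarrow> \<Lambda> \<chi> f = 0"
  shows "diff_op \<phi> UNIV s E"
  using assms
proof (induction s arbitrary: E \<Lambda>)
  have lin: "k_linear_on \<phi> UNIV E" if "\<And>\<chi> f. \<chi> \<in> points \<Longrightarrow> \<chi> (E f) = \<Lambda> \<chi> f"
    "\<And>\<chi> f g. \<chi> \<in> points \<Longrightarrow> \<Lambda> \<chi> (f + g) = \<Lambda> \<chi> f + \<Lambda> \<chi> g"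
    "\<And>\<chi> c f. \<chi> \<in> points \<Longrightarrow> \<Lambda> \<chi> (\<phi> c * f) = c * \<Lambda> \<chi> f" for E and \<Lambda> :: "('r \<Rightarrow> 'k) \<Rightarrow> 'r \<Rightarrow> 'k"
    unfolding k_linear_on_def
  proof (intro conjI ballI allI)
    show "E (f + g) = E f + E g" for f g by (rule eq_of_points) (simp add: that pointsD)
    show "E (\<phi> c * f) = \<phi> c * E f" for c f by (rule eq_of_points) (simp add: that pointsD)
  qed simp
  have com: "\<chi> (E (a * f) - a * E f) = \<Lambda> \<chi> ((a - \<phi> (\<chi> a)) * f)" if \<chi>: "\<chi> \<in> points"
    and \<Lambda>: "\<And>\<chi> f. \<chi> \<in> points \<Longrightarrow> \<chi> (E f) = \<Lambda> \<chi> f"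
    "\<And>\<chi> f g. \<chi> \<in> points \<Longrightarrow> \<Lambda> \<chi> (f + g) = \<Lambda> \<chi> f + \<Lambda> \<chi> g"
    "\<And>\<chi> c f. \<chi> \<in> points \<Longrightarrow> \<Lambda> \<chi> (\<phi> c * f) = c * \<Lambda> \<chi> f" for E and \<Lambda> :: "('r \<Rightarrow> 'k) \<Rightarrow> 'r \<Rightarrow> 'k" and \<chi> a f
  proof -
    have "\<Lambda> \<chi> ((a - \<phi> (\<chi> a)) * f + \<phi> (\<chi> a) * f) = \<Lambda> \<chi> ((a - \<phi> (\<chi> a)) * f) + \<chi> a * \<Lambda> \<chi> f"
      using \<chi> by (simp only: \<Lambda>)
    then have "\<Lambda> \<chi> (a * f) = \<Lambda> \<chi> ((a - \<phi> (\<chi> a)) * f) + \<chi> a * \<Lambda> \<chi> f" by (simp add: algebra_simps)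
    then show ?thesis using \<chi> by (simp add: pointsD \<Lambda>(1))
  qed
  have in_ipow: "(a - \<phi> (\<chi> a)) * f \<in> ipow (ker \<chi>) (Suc n)" if "\<chi> \<in> points" "f \<in> ipow (ker \<chi>) n" for \<chi> a f n
    unfolding ipow.simps using sub_point_in_ker[OF that(1)] that(2) by (rule iprod_mult)
  {
    case 0
    have "E (a * f) - a * E f = 0" for a f
    proof (rule eq_of_points)
      fix \<chi> assume \<chi>: "\<chi> \<in> points"
      have "(a - \<phi> (\<chi> a)) * f \<in> ipow (ker \<chi>) (Suc 0)" by (rule in_ipow[OF \<chi>]) simp
      have "\<chi> (E (a * f) - a * E f) = \<Lambda> \<chi> ((a - \<phi> (\<chi> a)) * f)" by (rule com[OF \<chi> 0(1-3)])
      also have "\<dots> = 0" by (rule 0(4)[OF \<chi>]) fact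
      finally show "\<chi> (E (a * f) - a * E f) = \<chi> 0" by (simp only: pointsD(5)[OF \<chi>])
    qed
    then show ?case using lin[of E \<Lambda>, OF 0(1-3)] by simp
  next
    case (Suc s)
    have "diff_op \<phi> UNIV s (\<lambda>f. E (a * f) - a * E f)" for a
    proof (rule Suc.IH[of _ "\<lambda>\<chi> f. \<Lambda> \<chi> ((a - \<phi> (\<chi> a)) * f)"])
      fix \<chi> assume \<chi>: "\<chi> \<in> points"
      show "\<chi> (E (a * f) - a * E f) = \<Lambda> \<chi> ((a - \<phi> (\<chi> a)) * f)" for f by (rule com[OF \<chi> Suc.prems(1-3)])
      show "\<Lambda> \<chi> ((a - \<phi> (\<chi> a)) * (f + g)) = \<Lambda> \<chi> ((a - \<phi> (\<chi> a)) * f) + \<Lambda> \<chi> ((a - \<phi> (\<chi> a)) * g)" for f g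
        by (simp only: distrib_left Suc.prems(2)[OF \<chi>])
      show "\<Lambda> \<chi> ((a - \<phi> (\<chi> a)) * (\<phi> c * f)) = c * \<Lambda> \<chi> ((a - \<phi> (\<chi> a)) * f)" for c f
        by (simp only: mult.left_commute[of _ "\<phi> c"] Suc.prems(3)[OF \<chi>])
      show "\<Lambda> \<chi> ((a - \<phi> (\<chi> a)) * f) = 0" if "f \<in> ipow (ker \<chi>) (Suc s)" for f
        by (rule Suc.prems(4)[OF \<chi> in_ipow[OF \<chi> that]])
    qed
    then show ?case using lin[of E \<Lambda>, OF Suc.prems(1-3)] by simp
  }
qed

text \<open>Where \<open>g\<close> is nonzero the monomials of the given point remain a basis modulo
  the \<open>Suc M\<close>-th power of \<open>ker \<chi>\<close>, and the coordinates of
  \<open>g(\<chi>) f\<close> are values of functions in \<open>R\<close>. The operator takes the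
  coordinate at \<open>I0\<close>; a second factor \<open>g\<close> removes the points where
  coordinates are not unique, so the constant \<open>u\<close> is the square of the value of
  \<open>g\<close>.\<close>

lemma dual_operator:
  assumes \<chi>0: "\<chi>\<^sub>0 \<in> points" and x: "params \<chi>\<^sub>0 t x" and I0: "I0 \<in> MIle t M"
  shows "\<exists>D u. diff_op \<phi> UNIV M D \<and> u \<noteq> 0 \<and>
    (\<forall>J\<in>MIle t M. \<chi>\<^sub>0 (D (multi_power t x J)) = (if J = I0 then u else 0))"
proof -
  let ?x = "multi_power t x" and ?W = "\<lambda>\<chi>. ipow (ker \<chi>) (Suc M)"
  define S where "S = ?x ` MIle t M"
  have finS: "finite S" unfolding S_def using MIle_finite by simp
  have inj: "inj_on ?x (MIle t M)" by (rule monomials_inj[OF \<chi>0 x])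
  have cS: "card S = card (MIle t M)" unfolding S_def by (rule card_image[OF inj])
  have UMI: "(\<Union>j\<le>M. MI t j) = MIle t M" by (auto simp: MI_def MIle_def)
  have "spans_mod S (?W \<chi>\<^sub>0)"
    unfolding S_def UMI[symmetric] by (rule graded_generators_span[OF ipow_fspan[OF \<chi>0 x] MI_finite])
  from rep_open[OF \<chi>0 this] obtain g where g: "\<chi>\<^sub>0 g \<noteq> 0" "\<forall>f. rep UNIV S (Suc M) (\<lambda>\<chi>. \<phi> (\<chi> g) * f)" by blast
  have "\<forall>f. \<exists>r. \<forall>\<chi>\<in>points. \<phi> (\<chi> g) * f - (\<Sum>s\<in>S. \<phi> (\<chi> (r s)) * s) \<in> ?W \<chi>" using g(2) unfolding rep_def by simp
  from choice[OF this] obtain r where r0: "\<forall>f. \<forall>\<chi>\<in>points. \<phi> (\<chi> g) * f - (\<Sum>s\<in>S. \<phi> (\<chi> (r f s)) * s) \<in> ?W \<chi>" ..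
  have r: "\<phi> (\<chi> g) * f - kcomb S (\<lambda>s. \<chi> (r f s)) \<in> ?W \<chi>" if "\<chi> \<in> points" for \<chi> f
    using r0 that by (simp add: kcomb_def)
  have uniq: "a s = b s" if \<chi>: "\<chi> \<in> points" and gne: "\<chi> g \<noteq> 0" and f: "f - kcomb S a \<in> ?W \<chi>" "f - kcomb S b \<in> ?W \<chi>" and s: "s \<in> S" for \<chi> f a b s
  proof -
    have "(f - kcomb S b) - (f - kcomb S a) \<in> ?W \<chi>" by (rule ipowD(6)[OF f(2,1)])
    moreover have "(f - kcomb S b) - (f - kcomb S a) = kcomb S (\<lambda>s. a s - b s)"
      by (simp add: kcomb_def hom_minus left_diff_distrib sum_subtractf)
    ultimately have "kcomb S (\<lambda>s. a s - b s) \<in> ?W \<chi>" by simp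
    from minimal_span_indep[OF \<chi> spans_mod_open[OF finS g(2) \<chi> gne] cS this s] show ?thesis by simp
  qed
  let ?s = "?x I0"
  have s: "?s \<in> S" using I0 by (simp add: S_def)
  define D where "D f = g * r f ?s" for f
  have "diff_op \<phi> UNIV M D"
  proof (rule diff_op_by_points[of _ "\<lambda>\<chi> f. \<chi> g * \<chi> (r f ?s)"])
    fix \<chi> assume \<chi>: "\<chi> \<in> points"
    show "\<chi> (D f) = \<chi> g * \<chi> (r f ?s)" for f using \<chi> by (simp add: D_def pointsD)
    show "\<chi> g * \<chi> (r (f + h) ?s) = \<chi> g * \<chi> (r f ?s) + \<chi> g * \<chi> (r h ?s)" for f h
    proof (cases "\<chi> g = 0")
      case False
      have "(\<phi> (\<chi> g) * f - kcomb S (\<lambda>s. \<chi> (r f s))) + (\<phi> (\<chi> g) * h - kcomb S (\<lambda>s. \<chi> (r h s))) \<in> ?W \<chi>"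
        by (rule ipowD(2)[OF r r]; fact)
      then have "\<phi> (\<chi> g) * (f + h) - kcomb S (\<lambda>s. \<chi> (r f s) + \<chi> (r h s)) \<in> ?W \<chi>"
        by (simp add: kcomb_add algebra_simps)
      from uniq[OF \<chi> False r[OF \<chi>] this s] show ?thesis by (simp add: distrib_left)
    qed simp
    show "\<chi> g * \<chi> (r (\<phi> c * f) ?s) = c * (\<chi> g * \<chi> (r f ?s))" for c f
    proof (cases "\<chi> g = 0")
      case False
      have "\<phi> c * (\<phi> (\<chi> g) * f - kcomb S (\<lambda>s. \<chi> (r f s))) \<in> ?W \<chi>" by (rule ipowD(3)[OF r[OF \<chi>]])
      then have "\<phi> (\<chi> g) * (\<phi> c * f) - kcomb S (\<lambda>s. c * \<chi> (r f s)) \<in> ?W \<chi>"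
        by (simp add: kcomb_scale right_diff_distrib mult.left_commute)
      from uniq[OF \<chi> False r[OF \<chi>] this s] show ?thesis by (simp add: mult.left_commute)
    qed simp
    show "\<chi> g * \<chi> (r f ?s) = 0" if f: "f \<in> ?W \<chi>" for f
    proof (cases "\<chi> g = 0")
      case False
      have "\<phi> (\<chi> g) * f - kcomb S (\<lambda>_. 0) \<in> ?W \<chi>" using ipowD(3)[OF f] by (simp add: kcomb_def)
      from uniq[OF \<chi> False r[OF \<chi>] this s] show ?thesis by simp
    qed simp
  qed
  moreover have "\<chi>\<^sub>0 (D (?x J)) = (if J = I0 then \<chi>\<^sub>0 g * \<chi>\<^sub>0 g else 0)" if J: "J \<in> MIle t M" for J
  proof -
    have "?x J \<in> S" using J by (simp add: S_def)
    then have "\<phi> (\<chi>\<^sub>0 g) * ?x J - kcomb S (\<lambda>w. if w = ?x J then \<chi>\<^sub>0 g else 0) \<in> ?W \<chi>\<^sub>0"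
      using kcomb_singleton_in[OF finS, of "?x J" "\<chi>\<^sub>0 g"] by (simp add: ipowD(1))
    from uniq[OF \<chi>0 g(1) r[OF \<chi>0] this s] have "\<chi>\<^sub>0 (r (?x J) ?s) = (if ?s = ?x J then \<chi>\<^sub>0 g else 0)" .
    moreover have "?s = ?x J \<longleftrightarrow> J = I0" using inj I0 J by (auto dest: inj_onD)
    ultimately show ?thesis using \<chi>0 by (simp add: D_def pointsD)
  qed
  moreover have "\<chi>\<^sub>0 g * \<chi>\<^sub>0 g \<noteq> 0" using g(1) by simp
  ultimately show ?thesis by (intro exI[of _ D] exI[of _ "\<chi>\<^sub>0 g * \<chi>\<^sub>0 g"] conjI ballI)
qed

lemma diff_op_ipow:
  assumes "diff_op \<phi> UNIV s D" "f \<in> ipow P n"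
  shows "D f \<in> ipow P (n - s)"
proof (rule diff_op_filtration[OF assms(1), of "ipow P" "\<lambda>f. f" P])
  show "ipow P (Suc j) \<subseteq> ipow P j" for j by (rule ipow_antimono) simp
  show "p * b \<in> ipow P (Suc j)" if "p \<in> P" "b \<in> ipow P j" for p b j
    using that by (simp add: ipow.simps iprod_mult)
qed (auto intro: ipowD assms)

lemma MI_nonempty: "n > 0 \<Longrightarrow> \<exists>I. I \<in> MI n j"
  by (intro exI[of _ "\<lambda>i. if i = 0 then j else 0"]) (auto simp: MI_def multi_indices_def multi_deg_def)

section \<open>Action of an operator on leading forms\<close>

definition multi_binom :: "(nat \<Rightarrow> nat) \<Rightarrow> (nat \<Rightarrow> nat) \<Rightarrow> nat" where
  "multi_binom J I = (\<Prod>i<t. J i choose I i)"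

lemma multi_binom_eq_0: "multi_binom J I = 0 \<longleftrightarrow> (\<exists>i<t. J i < I i)"
  by (auto simp: multi_binom_def binomial_eq_0_iff)

lemma multi_binom_same_deg:
  assumes "I \<in> MI t s" "J \<in> MI t s"
  shows "multi_binom J I = (if J = I then 1 else 0)"
proof (cases "J = I")
  case False
  have "\<exists>i<t. J i < I i"
  proof (rule ccontr)
    assume neg: "\<not> ?thesis"
    have le: "I i \<le> J i" if "i < t" for i using neg that by (meson leI)
    have "\<exists>i. I i \<noteq> J i" using False by (metis ext)
    then obtain i where i: "I i \<noteq> J i" ..
    have "i < t"
    proof (rule ccontr)
      assume "\<not> i < t"
      then have "I i = 0" "J i = 0" using assms by (auto simp: MI_def multi_indices_def)
      with i show False by simp
    qed
    with i le have "I i < J i" by (metis le_neq_implies_less)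
    then have "multi_deg t I < multi_deg t J" unfolding multi_deg_def using le \<open>i < t\<close>
      by (intro sum_strict_mono_ex1) auto
    then show False using assms by (simp add: MI_def)
  qed
  then show ?thesis using False multi_binom_eq_0 by auto
qed (simp add: multi_binom_def)

text \<open>Pascal's rule in the coordinate \<open>l\<close>; the case distinction stands for the
  vanishing of a binomial coefficient with lower index -1.\<close>

lemma multi_binom_Suc:
  assumes l: "l < t"
  shows "multi_binom (J(l := Suc (J l))) I = multi_binom J I + (if I l = 0 then 0 else multi_binom J (I(l := I l - 1)))"
proof -
  have split: "multi_binom J I = (J l choose I l) * (\<Prod>i\<in>{..<t} - {l}. J i choose I i)" for J I
    unfolding multi_binom_def using l by (simp add: prod.remove)
  have "(\<Prod>i\<in>{..<t} - {l}. (J(l := x)) i choose (I(l := y)) i) = (\<Prod>i\<in>{..<t} - {l}. J i choose I i)" for x y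
    by (rule prod.cong) auto
  from this[of _ "I l"] this[of "J l"] show ?thesis
    by (cases "I l") (simp_all add: split distrib_right)
qed

text \<open>The leading part of \<open>D\<close> is determined by its values at the point on
  monomials of degree \<open>s\<close>, and here it is \<open>u\<close> times a Hasse derivative.
  Peeling one variable off the monomial gives \<open>x m\<close> times the action on the rest plus
  the action of the commutator, and the two terms match Pascal's rule.\<close>

lemma symbol:
  assumes \<chi>: "\<chi> \<in> points" and x: "\<And>i. i < t \<Longrightarrow> x i \<in> ker \<chi>"
    and "diff_op \<phi> UNIV s D" "I0 \<in> MI t s"
    and "\<And>I. I \<in> MI t s \<Longrightarrow> \<chi> (D (multi_power t x I)) = (if I = I0 then u else 0)"
    and "J \<in> multi_indices t" "s \<le> multi_deg t J"
  shows "D (multi_power t x J) - \<phi> (u * of_nat (multi_binom J I0)) * multi_power t x (\<lambda>i. J i - I0 i)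
    \<in> ipow (ker \<chi>) (Suc (multi_deg t J - s))"
  using assms(3-)
proof (induction "multi_deg t J" arbitrary: s D I0 u J rule: less_induct)
  case less
  let ?x = "multi_power t x" and ?P = "ker \<chi>"
  show ?case
  proof (cases "multi_deg t J = s")
    case True
    then have J: "J \<in> MI t s" using less.prems by (simp add: MI_def)
    have "\<phi> (u * of_nat (multi_binom J I0)) * ?x (\<lambda>i. J i - I0 i) = \<phi> (\<chi> (D (?x J)))"
      using multi_binom_same_deg[OF less.prems(2) J] less.prems(3)[OF J] by (simp add: multi_power_def)
    then show ?thesis using True sub_point_in_ker[OF \<chi>] ipow_Suc_0[OF is_ideal_ker[OF \<chi>]] by simp
  next
    case False
    then have lt: "s < multi_deg t J" using less.prems by simp
    have "\<exists>m<t. J m > 0"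
    proof (rule ccontr)
      assume "\<not> ?thesis"
      then have "multi_deg t J = 0" unfolding multi_deg_def by (intro sum.neutral) auto
      with lt show False by simp
    qed
    then obtain m where m: "m < t" "J m > 0" by blast
    define K where "K = J(m := J m - 1)"
    have JK: "J = K(m := Suc (K m))" using m by (auto simp: K_def)
    have Kmi: "K \<in> multi_indices t" using less.prems m by (auto simp: K_def multi_indices_def)
    have dJ: "multi_deg t J = Suc (multi_deg t K)" and xJ: "?x J = x m * ?x K"
      by (rule multi_power_Suc(2)[OF m(1), of K, folded JK], rule multi_power_Suc(1)[OF m(1), of x K, folded JK])
    let ?r = "Suc (multi_deg t J - s)"
    have IHK: "D (?x K) - \<phi> (u * of_nat (multi_binom K I0)) * ?x (\<lambda>i. K i - I0 i) \<in> ipow ?P (Suc (multi_deg t K - s))"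
      using less.hyps[of K s D I0 u] less.prems dJ lt Kmi by auto
    then have "x m * (D (?x K) - \<phi> (u * of_nat (multi_binom K I0)) * ?x (\<lambda>i. K i - I0 i)) \<in> ipow ?P (Suc (Suc (multi_deg t K - s)))"
      using x[OF m(1)] by (simp add: ipow.simps iprod_mult)
    then have 1: "x m * (D (?x K) - \<phi> (u * of_nat (multi_binom K I0)) * ?x (\<lambda>i. K i - I0 i)) \<in> ipow ?P ?r"
      using lt dJ by (simp add: Suc_diff_le)
    have e1: "x m * (\<phi> (u * of_nat (multi_binom K I0)) * ?x (\<lambda>i. K i - I0 i)) =
        \<phi> (u * of_nat (multi_binom K I0)) * ?x (\<lambda>i. J i - I0 i)"
    proof (cases "multi_binom K I0 = 0")
      case False
      then have "I0 m \<le> K m" using m(1) multi_binom_eq_0 by (meson leI)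
      then have "J i - I0 i = ((\<lambda>i. K i - I0 i)(m := Suc (K m - I0 m))) i" for i
        unfolding JK by (cases "i = m") (simp_all add: Suc_diff_le)
      then have feq: "(\<lambda>i. J i - I0 i) = (\<lambda>i. K i - I0 i)(m := Suc (K m - I0 m))" by (rule ext)
      have "?x (\<lambda>i. J i - I0 i) = x m * ?x (\<lambda>i. K i - I0 i)"
        unfolding feq by (rule multi_power_Suc(1)[OF m(1), of x "\<lambda>i. K i - I0 i"])
      then show ?thesis by (simp add: mult.left_commute)
    qed simp
    let ?E = "\<lambda>f. D (x m * f) - x m * D f"
    let ?b = "if I0 m = 0 then 0 else multi_binom K (I0(m := I0 m - 1))"
    have 2: "?E (?x K) - \<phi> (u * of_nat ?b) * ?x (\<lambda>i. J i - I0 i) \<in> ipow ?P ?r"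
    proof (cases s)
      case 0
      then have "I0 m = 0" using less.prems(2) le_multi_deg[OF m(1), of I0] by (simp add: MI_def)
      moreover have "?E (?x K) = 0" using less.prems(1) 0 by simp
      ultimately show ?thesis by (simp add: ipowD(1))
    next
      case (Suc s')
      have E: "diff_op \<phi> UNIV s' ?E" using less.prems(1) Suc by simp
      have sym: "\<chi> (?E (?x I)) = (if I(m := Suc (I m)) = I0 then u else 0)" if I: "I \<in> MI t s'" for I
      proof -
        have "I(m := Suc (I m)) \<in> MI t s" "?x (I(m := Suc (I m))) = x m * ?x I"
          using multi_power_Suc(1)[OF m(1), of x I] multi_power_Suc(2)[OF m(1), of I] I m Suc by (auto simp: MI_def multi_indices_def)
        with less.prems(3)[of "I(m := Suc (I m))"] show ?thesis
          using x[OF m(1)] \<chi> by (simp add: pointsD ker_def)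
      qed
      have r: "?r = Suc (multi_deg t K - s')" using dJ Suc by simp
      show ?thesis
      proof (cases "I0 m = 0")
        case True
        \<comment> \<open>The commutator takes the value 0 at the point on all monomials of degree
          \<open>s'\<close>; the induction hypothesis is applied with the constant 0 at an arbitrary
          index.\<close>
        obtain I1 where I1: "I1 \<in> MI t s'" using MI_nonempty[of t s'] m(1) by auto
        have "I(m := Suc (I m)) \<noteq> I0" for I using True by (metis fun_upd_same nat.distinct(1))
        then have "\<chi> (?E (?x I)) = (if I = I1 then 0 else 0)" if "I \<in> MI t s'" for I using sym[OF that] by simp
        from less.hyps[OF _ E I1 this Kmi] dJ lt Suc True r show ?thesis by simp
      next
        case False
        let ?I1 = "I0(m := I0 m - 1)"
        have I0': "I0 = ?I1(m := Suc (?I1 m))" using False by auto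
        have "Suc (multi_deg t ?I1) = s"
          using multi_power_Suc(2)[OF m(1), of ?I1] I0' less.prems(2) by (simp add: MI_def)
        then have I1: "?I1 \<in> MI t s'" using less.prems(2) Suc by (auto simp: MI_def multi_indices_def)
        have eqv: "I(m := Suc (I m)) = I0 \<longleftrightarrow> I = ?I1" for I
          using False by (auto simp: fun_eq_iff split: if_splits)
        have "\<chi> (?E (?x I)) = (if I = ?I1 then u else 0)" if "I \<in> MI t s'" for I using sym[OF that] eqv by simp
        then have "?E (?x K) - \<phi> (u * of_nat (multi_binom K ?I1)) * ?x (\<lambda>i. K i - ?I1 i) \<in> ipow ?P (Suc (multi_deg t K - s'))"
          by (intro less.hyps[OF _ E I1 _ Kmi]) (use dJ lt Suc in simp_all)
        moreover have "(\<lambda>i. K i - ?I1 i) = (\<lambda>i. J i - I0 i)" using False by (auto simp: JK fun_eq_iff)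
        ultimately show ?thesis using False r by simp
      qed
    qed
    have "multi_binom J I0 = multi_binom K I0 + ?b" unfolding JK by (rule multi_binom_Suc[OF m(1)])
    then have "D (?x J) - \<phi> (u * of_nat (multi_binom J I0)) * ?x (\<lambda>i. J i - I0 i) =
      x m * (D (?x K) - \<phi> (u * of_nat (multi_binom K I0)) * ?x (\<lambda>i. K i - I0 i)) +
      (?E (?x K) - \<phi> (u * of_nat ?b) * ?x (\<lambda>i. J i - I0 i))"
      unfolding xJ right_diff_distrib e1 by (simp only: of_nat_add distrib_left hom_add) (simp add: algebra_simps)
    then show ?thesis using ipowD(2)[OF 1 2] by simp
  qed
qed

end

section \<open>Independence modulo a subspace and bases adapted to a flag\<close>

section \<open>Adapted parameters\<close>

definition single_index :: "nat \<Rightarrow> nat \<Rightarrow> nat \<Rightarrow> nat" where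
  "single_index i q = (\<lambda>j. if j = i then q else 0)"

lemma single_index_MI: "i < n \<Longrightarrow> single_index i q \<in> MI n q"
  by (auto simp: single_index_def MI_def multi_indices_def multi_deg_def)

lemma multi_power_single: "i < n \<Longrightarrow> multi_power n x (single_index i q) = x i ^ q"
proof -
  assume i: "i < n"
  have "multi_power n x (single_index i q) = (\<Prod>j<n. if j = i then x j ^ q else 1)"
    unfolding multi_power_def single_index_def by (rule prod.cong) auto
  then show ?thesis using i by simp
qed

lemma add_le_multi_deg:
  assumes "i < n" "j < n" "i \<noteq> j"
  shows "I i + I j \<le> multi_deg n I"
proof -
  have "(\<Sum>l\<in>{i, j}. I l) \<le> (\<Sum>l<n. I l)" by (rule sum_mono2) (use assms in auto)
  then show ?thesis using assms by (simp add: multi_deg_def)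
qed

lemma MI_eq_single_index:
  assumes "I \<in> MI n q" "i < n" "\<And>j. j < n \<Longrightarrow> j \<noteq> i \<Longrightarrow> I j = 0"
  shows "I = single_index i q"
proof -
  have "multi_deg n I = (\<Sum>j<n. if j = i then I i else 0)"
    unfolding multi_deg_def by (rule sum.cong) (use assms(3) in auto)
  then have "I i = q" using assms by (simp add: MI_def)
  moreover have "I j = 0" if "j \<noteq> i" for j
    using assms that by (cases "j < n") (auto simp: MI_def multi_indices_def)
  ultimately show ?thesis by (auto simp: single_index_def)
qed

lemma MI_full_exponent:
  assumes "I \<in> MI n q" "i < n" "I i = q"
  shows "I = single_index i q"
proof (rule MI_eq_single_index[OF assms(1,2)])
  fix j assume "j < n" "j \<noteq> i"
  then show "I j = 0" using add_le_multi_deg[of i n j I] assms by (simp add: MI_def)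
qed

lemma single_index_inj: "q > 0 \<Longrightarrow> single_index i q = single_index j q \<longleftrightarrow> i = j"
  by (metis single_index_def less_numeral_extra(3))

context kalg
begin

definition findep :: "(nat \<Rightarrow> 'r) \<Rightarrow> nat \<Rightarrow> 'r set \<Rightarrow> bool" where
  "findep x n W \<longleftrightarrow> (\<forall>c. (\<Sum>i<n. \<phi> (c i) * x i) \<in> W \<longrightarrow> (\<forall>i<n. c i = 0))"

lemma fspan_cong: "(\<And>j. j \<in> J \<Longrightarrow> F j = G j) \<Longrightarrow> fspan F J W = fspan G J W"
  unfolding fspan_def by (simp cong: sum.cong)

lemma findep_le:
  assumes W: "ksub W" and y: "findep y n W" and sp: "\<And>i. i < n \<Longrightarrow> y i \<in> fspan x {..<l} W"
  shows "n \<le> l"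
proof (rule ccontr)
  assume neg: "\<not> n \<le> l"
  have "\<forall>i. \<exists>c. i < n \<longrightarrow> y i - (\<Sum>j<l. \<phi> (c j) * x j) \<in> W" using sp unfolding fspan_def by blast
  from choice[OF this] obtain A where A: "\<forall>i<n. y i - (\<Sum>j<l. \<phi> (A i j) * x j) \<in> W" by blast
  have "is_subring (UNIV :: 'k set)" by (simp add: is_subring_def)
  from homogeneous_system[OF this, of "{..<l}" "{..<n}" A] neg obtain c where
    c: "\<exists>i\<in>{..<n}. c i \<noteq> 0" "\<forall>j\<in>{..<l}. (\<Sum>i<n. c i * A i j) = 0" by auto
  have "(\<Sum>i<n. \<phi> (c i) * (\<Sum>j<l. \<phi> (A i j) * x j)) = (\<Sum>j<l. \<phi> (\<Sum>i<n. c i * A i j) * x j)"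
    unfolding sum_distrib_left hom_sum sum_distrib_right by (subst sum.swap) (simp add: hom_mult mult.assoc)
  also have "\<dots> = 0" using c(2) by simp
  finally have "(\<Sum>i<n. \<phi> (c i) * y i) = (\<Sum>i<n. \<phi> (c i) * (y i - (\<Sum>j<l. \<phi> (A i j) * x j)))"
    by (simp add: right_diff_distrib sum_subtractf)
  also have "\<dots> \<in> W" using A by (intro ksub_sum[OF W] ksubD(3)[OF W]) auto
  finally have "\<forall>i<n. c i = 0" using y unfolding findep_def by blast
  then show False using c(1) by auto
qed

text \<open>A longest independent extension inside \<open>V\<close> exists by the bound
  \<open>N\<close>; a vector of \<open>V\<close> outside its span could still be appended.\<close>

lemma findep_extend:
  assumes W: "ksub W" and V: "ksub V" "W \<subseteq> V" and x: "findep x l W" "\<And>i. i < l \<Longrightarrow> x i \<in> V"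
    and bound: "\<And>n y. findep y n W \<Longrightarrow> (\<And>i. i < n \<Longrightarrow> y i \<in> V) \<Longrightarrow> n \<le> N"
  shows "\<exists>x' n. l \<le> n \<and> (\<forall>i<l. x' i = x i) \<and> findep x' n W \<and> (\<forall>i<n. x' i \<in> V) \<and> V \<subseteq> fspan x' {..<n} W"
proof -
  let ?P = "\<lambda>n. \<exists>x'. l \<le> n \<and> (\<forall>i<l. x' i = x i) \<and> findep x' n W \<and> (\<forall>i<n. x' i \<in> V)"
  have "?P l" using x by (intro exI[of _ x]) auto
  moreover have "\<forall>n. ?P n \<longrightarrow> n < Suc N" using bound by (metis less_Suc_eq_le)
  ultimately obtain n where n: "?P n" "\<forall>k. ?P k \<longrightarrow> k \<le> n" using ex_has_greatest_nat[of ?P l "\<lambda>n. n" "Suc N"] by auto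
  obtain x' where x': "l \<le> n" "\<forall>i<l. x' i = x i" "findep x' n W" "\<forall>i<n. x' i \<in> V" using n(1) by blast
  have "V \<subseteq> fspan x' {..<n} W"
  proof (rule ccontr)
    assume "\<not> ?thesis"
    then obtain v where v: "v \<in> V" "v \<notin> fspan x' {..<n} W" by blast
    let ?y = "x'(n := v)"
    have S: "ksub (fspan x' {..<n} W)" by (rule ksub_fspan[OF W])
    have "findep ?y (Suc n) W"
      unfolding findep_def
    proof (intro allI impI)
      fix c i assume rel: "(\<Sum>i<Suc n. \<phi> (c i) * ?y i) \<in> W" and i: "i < Suc n"
      have "(\<Sum>i<n. \<phi> (c i) * ?y i) = (\<Sum>i<n. \<phi> (c i) * x' i)" by (rule sum.cong) auto
      then have rel': "(\<Sum>i<n. \<phi> (c i) * x' i) + \<phi> (c n) * v \<in> W" using rel by simp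
      have "(\<Sum>i<n. \<phi> (c i) * x' i) \<in> fspan x' {..<n} W"
        by (intro ksub_sum[OF S] ksubD(3)[OF S] fspan_base[OF W]) auto
      from ksubD(5)[OF S subsetD[OF fspan_W rel'] this] have "\<phi> (c n) * v \<in> fspan x' {..<n} W" by simp
      then have "c n = 0" using ksub_scale_iff[OF S] v(2) by blast
      moreover from this rel' have "(\<Sum>i<n. \<phi> (c i) * x' i) \<in> W" by simp
      then have "\<forall>i<n. c i = 0" using x'(3) unfolding findep_def by blast
      ultimately show "c i = 0" using i less_Suc_eq by auto
    qed
    then have "?P (Suc n)" using x' v(1) by (intro exI[of _ ?y]) (auto simp: less_Suc_eq)
    with n(2) have "Suc n \<le> n" by blast
    then show False by simp
  qed
  with x' show ?thesis by blast
qed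

text \<open>Bases are extended along the flag, earlier vectors being kept, so that one sequence
  serves all members and \<open>L a\<close> is the dimension of the \<open>a\<close>-th modulo
  \<open>W\<close>.\<close>

lemma adapted_chain:
  assumes W: "ksub W" and V: "\<And>a. a \<le> e \<Longrightarrow> ksub (V a)" "\<And>a. a \<le> e \<Longrightarrow> W \<subseteq> V a" "\<And>a. a < e \<Longrightarrow> V a \<subseteq> V (Suc a)"
    and bound: "\<And>n y. findep y n W \<Longrightarrow> (\<And>i. i < n \<Longrightarrow> y i \<in> V e) \<Longrightarrow> n \<le> N"
  shows "\<exists>x L. findep x (L e) W \<and> (\<forall>a\<le>e. (\<forall>i<L a. x i \<in> V a) \<and> V a \<subseteq> fspan x {..<L a} W) \<and>
    (\<forall>b\<le>e. \<forall>a\<le>b. L a \<le> L b)"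
  using V bound
proof (induction e)
  case 0
  have "\<exists>x' n. 0 \<le> n \<and> (\<forall>i<0. x' i = (0::'r)) \<and> findep x' n W \<and> (\<forall>i<n. x' i \<in> V 0) \<and> V 0 \<subseteq> fspan x' {..<n} W"
    by (rule findep_extend[OF W, of _ "\<lambda>_. 0" 0 N]) (use 0 in \<open>auto simp: findep_def\<close>)
  then obtain x n where "findep x n W" "\<forall>i<n. x i \<in> V 0" "V 0 \<subseteq> fspan x {..<n} W" by blast
  then show ?case by (intro exI[of _ x] exI[of _ "\<lambda>_. n"]) auto
next
  case (Suc e)
  have "\<exists>x L. findep x (L e) W \<and> (\<forall>a\<le>e. (\<forall>i<L a. x i \<in> V a) \<and> V a \<subseteq> fspan x {..<L a} W) \<and>
    (\<forall>b\<le>e. \<forall>a\<le>b. L a \<le> L b)"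
  proof (rule Suc.IH)
    fix n y assume "findep y n W" "\<And>i. i < n \<Longrightarrow> y i \<in> V e"
    then show "n \<le> N" using Suc.prems(3)[of e] by (intro Suc.prems(4)[of y]) auto
  qed (use Suc.prems in auto)
  then obtain x L where x: "findep x (L e) W" "\<forall>a\<le>e. (\<forall>i<L a. x i \<in> V a) \<and> V a \<subseteq> fspan x {..<L a} W"
    "\<forall>b\<le>e. \<forall>a\<le>b. L a \<le> L b" by (elim exE conjE)
  have "\<exists>x' n. L e \<le> n \<and> (\<forall>i<L e. x' i = x i) \<and> findep x' n W \<and> (\<forall>i<n. x' i \<in> V (Suc e)) \<and> V (Suc e) \<subseteq> fspan x' {..<n} W"
  proof (rule findep_extend[OF W _ _ x(1), of _ N])
    show "x i \<in> V (Suc e)" if "i < L e" for i using x(2) that Suc.prems(3)[of e] by auto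
  qed (use Suc.prems in auto)
  then obtain x' n where x': "L e \<le> n" "\<forall>i<L e. x' i = x i" "findep x' n W" "\<forall>i<n. x' i \<in> V (Suc e)"
    "V (Suc e) \<subseteq> fspan x' {..<n} W" by (elim exE conjE)
  let ?L = "L(Suc e := n)"
  have old: "(\<forall>i<?L a. x' i \<in> V a) \<and> V a \<subseteq> fspan x' {..<?L a} W" if a: "a \<le> e" for a
  proof -
    have La: "L a \<le> L e" using x(3) a by auto
    then have "fspan x' {..<L a} W = fspan x {..<L a} W" using x'(2) by (intro fspan_cong) auto
    moreover have "\<forall>i<L a. x' i \<in> V a" using x(2) a x'(2) La by auto
    ultimately show ?thesis using x(2) a by auto
  qed
  show ?case
  proof (intro exI[of _ x'] exI[of _ ?L] conjI)
    show "findep x' (?L (Suc e)) W" using x'(3) by simp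
    show "\<forall>a\<le>Suc e. (\<forall>i<?L a. x' i \<in> V a) \<and> V a \<subseteq> fspan x' {..<?L a} W"
      using old x'(4,5) by (auto simp: le_Suc_eq)
    show "\<forall>b\<le>Suc e. \<forall>a\<le>b. ?L a \<le> ?L b" using x(3) x'(1) by (auto simp: le_Suc_eq intro: order_trans)
  qed
qed

end

section \<open>Leading forms of a saturated filtration\<close>

section \<open>Saturated filtrations at a point of the support\<close>

lemma is_ideal_of_ideal:
  assumes "ideal I (ring_on UNIV)"
  shows "is_ideal I"
proof -
  have a: "additive_subgroup I (ring_on UNIV)" by (rule ideal.axioms(1)[OF assms])
  show ?thesis
    unfolding is_ideal_def
    using additive_subgroup.zero_closed[OF a] additive_subgroup.a_closed[OF a] ideal.I_l_closed[OF assms]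
    by (auto simp: ring_on_def)
qed

text \<open>Both sides are the coefficient of \<open>X^(p^a)\<close> in
  \<open>(X + 1)^(p^a v) = (X^(p^a) + 1)^v\<close>.\<close>

lemma binomial_coeff_char:
  assumes p: "prime p" "CHAR('k::field) = p"
  shows "(of_nat ((p ^ a * v) choose (p ^ a)) :: 'k) = of_nat v"
proof -
  let ?X = "monom 1 1 :: 'k poly"
  have X: "?X ^ n = monom 1 n" for n by (simp add: monom_power)
  have bin: "coeff ((?X ^ q + 1) ^ n) (q * l) = of_nat (n choose l)" if "q > 0" for q n l
  proof -
    have "(?X ^ q + 1) ^ n = (\<Sum>k\<le>n. of_nat (n choose k) * (?X ^ q) ^ k * 1 ^ (n - k))" by (rule binomial_ring)
    also have "\<dots> = (\<Sum>k\<le>n. monom (of_nat (n choose k)) (q * k))"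
      by (simp add: X monom_power of_nat_poly smult_monom flip: power_mult)
    finally show ?thesis using that by (simp add: coeff_sum binomial_eq_0)
  qed
  have pos: "p ^ a > 0" using p(1) prime_gt_0_nat by simp
  have "prime CHAR('k poly)" using p by simp
  then have "(?X + 1) ^ (p ^ a) = ?X ^ (p ^ a) + 1 ^ (p ^ a)"
    using p by (intro freshmans_dream'[of _ a]) auto
  then have "(?X ^ 1 + 1) ^ (p ^ a * v) = (?X ^ (p ^ a) + 1) ^ v" by (simp add: power_mult)
  then have "coeff ((?X ^ 1 + 1) ^ (p ^ a * v)) (1 * p ^ a) = coeff ((?X ^ (p ^ a) + 1) ^ v) (p ^ a * 1)" by simp
  then show ?thesis using bin[of 1 "p ^ a * v" "p ^ a"] bin[OF pos, of v 1] by simp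
qed

context smooth_alg
begin

lemma params_findep:
  assumes \<chi>: "\<chi> \<in> points" and x: "params \<chi> t x"
  shows "findep x t (ipow (ker \<chi>) 2)"
  unfolding findep_def
proof (intro allI impI)
  fix c i assume rel: "(\<Sum>i<t. \<phi> (c i) * x i) \<in> ipow (ker \<chi>) 2" and i: "i < t"
  \<comment> \<open>Extends the coefficients to all exponents so that the unit vector at
    \<open>i\<close> receives \<open>c i\<close>; independence is then that of monomials of degree
    one.\<close>
  let ?s = "\<lambda>i. single_index i 1" and ?c = "\<lambda>I. \<Sum>i<t. c i * of_nat (I i)"
  have MI1: "MI t 1 = ?s ` {..<t}"
  proof
    show "MI t 1 \<subseteq> ?s ` {..<t}"
    proof
      fix I assume I: "I \<in> MI t 1"
      have "\<exists>i<t. I i \<noteq> 0"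
      proof (rule ccontr)
        assume "\<not> ?thesis"
        then have "multi_deg t I = 0" unfolding multi_deg_def by (intro sum.neutral) auto
        with I show False by (simp add: MI_def)
      qed
      then obtain i where i: "i < t" "I i \<noteq> 0" by blast
      then have "I i = 1" using le_multi_deg[of i t I] I by (simp add: MI_def)
      with MI_full_exponent[OF I i(1)] i(1) show "I \<in> ?s ` {..<t}" by blast
    qed
  qed (auto intro: single_index_MI)
  have cs: "?c (?s i) = c i" if "i < t" for i
  proof -
    have "?c (?s i) = (\<Sum>j<t. if j = i then c j else 0)" unfolding single_index_def by (rule sum.cong) auto
    then show ?thesis using that by simp
  qed
  have "(\<Sum>I\<in>MI t 1. \<phi> (?c I) * multi_power t x I) = (\<Sum>i<t. \<phi> (?c (?s i)) * multi_power t x (?s i))"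
    unfolding MI1 by (subst sum.reindex) (auto simp: inj_on_def single_index_inj)
  also have "\<dots> = (\<Sum>i<t. \<phi> (c i) * x i)" using cs by (intro sum.cong) (auto simp: multi_power_single)
  finally have "(\<Sum>I\<in>MI t 1. \<phi> (?c I) * multi_power t x I) \<in> ipow (ker \<chi>) (Suc 1)" using rel by (simp add: numeral_2_eq_2)
  from monomials_indep[OF \<chi> x this single_index_MI[OF i]] show "c i = 0" using cs[OF i] by simp
qed

end

locale sat_filtration = smooth_alg \<phi> z m t for \<phi> :: "'k::alg_closed_field \<Rightarrow> 'r::idom" and z m t +
  fixes \<II> :: "('r \<times> real) set" and \<chi>\<^sub>0 :: "'r \<Rightarrow> 'k"
  assumes point: "\<chi>\<^sub>0 \<in> points" and filtration: "idealistic_filtration \<II>" and saturated: "D_saturated \<phi> \<II>"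
    and support: "\<And>n. level \<II> (real n) \<subseteq> ipow (ker \<chi>\<^sub>0) n"
begin

abbreviation "P \<equiv> ker \<chi>\<^sub>0"
definition U :: "nat \<Rightarrow> 'r set" where "U n = level \<II> (real n)"

lemma U_support: "U n \<subseteq> ipow (ker \<chi>\<^sub>0) n" unfolding U_def by (rule support)

lemma P_ideal: "is_ideal P" by (rule is_ideal_ker[OF point])

lemma U_ideal: "is_ideal (U n)"
  using filtration unfolding idealistic_filtration_def U_def by (intro is_ideal_of_ideal) blast

lemmas UD = is_idealD[OF U_ideal]

lemma U_0: "f \<in> U 0"
proof -
  have "level \<II> 0 = UNIV" using filtration unfolding idealistic_filtration_def by blast
  then show ?thesis by (simp add: U_def)
qed

lemma U_mult: "f \<in> U a \<Longrightarrow> g \<in> U b \<Longrightarrow> f * g \<in> U (a + b)"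
  using filtration unfolding idealistic_filtration_def level_def U_def by simp

lemma U_power: "f \<in> U a \<Longrightarrow> f ^ k \<in> U (a * k)"
proof (induction k)
  case (Suc k)
  then show ?case using U_mult[of f a "f ^ k" "a * k"] by simp
qed (simp add: U_0)

lemma U_diff: "f \<in> U a \<Longrightarrow> diff_op \<phi> UNIV s D \<Longrightarrow> s \<le> a \<Longrightarrow> D f \<in> U (a - s)"
  using saturated unfolding D_saturated_def level_def U_def by (simp add: of_nat_diff)

text \<open>Equality of classes in degree \<open>n\<close> of the graded ring.\<close>

definition appr :: "nat \<Rightarrow> 'r \<Rightarrow> 'r \<Rightarrow> bool" where
  "appr n f g \<longleftrightarrow> f \<in> ipow P n \<and> g \<in> ipow P n \<and> f - g \<in> ipow P (Suc n)"

lemma appr_mult: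
  assumes "appr a f g" "appr b f' g'"
  shows "appr (a + b) (f * f') (g * g')"
proof -
  have "(f - g) * f' \<in> ipow P (Suc (a + b))" using assms ipow_mult[of "f - g" P "Suc a" f' b] by (simp add: appr_def)
  moreover have "g * (f' - g') \<in> ipow P (Suc (a + b))" using assms ipow_mult[of g P a "f' - g'" "Suc b"] by (simp add: appr_def)
  ultimately have "(f - g) * f' + g * (f' - g') \<in> ipow P (Suc (a + b))" by (rule ipowD(2))
  then have "f * f' - g * g' \<in> ipow P (Suc (a + b))" by (simp add: algebra_simps)
  then show ?thesis using assms by (simp add: appr_def ipow_mult)
qed

lemma appr_power: "appr a f g \<Longrightarrow> appr (a * k) (f ^ k) (g ^ k)"
proof (induction k)
  case (Suc k)
  then show ?case using appr_mult[of a f g "a * k" "f ^ k" "g ^ k"] by simp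
qed (simp add: appr_def ipowD)

lemma appr_prod:
  assumes "finite S" "\<And>i. i \<in> S \<Longrightarrow> appr (e i) (f i) (g i)"
  shows "appr (sum e S) (prod f S) (prod g S)"
  using assms by (induction S rule: finite_induct) (auto intro: appr_mult simp: appr_def[of 0] ipowD)

lemma U_prod:
  assumes "finite S" "\<And>i. i \<in> S \<Longrightarrow> f i \<in> U (e i)"
  shows "prod f S \<in> U (sum e S)"
  using assms
proof (induction S rule: finite_induct)
  case (insert i S)
  then show ?case using U_mult[of "f i" "e i" "prod f S" "sum e S"] by simp
qed (simp add: U_0)

context
  fixes p :: nat
  assumes p: "CHAR('k) = p" "p > 0"
begin

lemma prime_p: "prime p" using prime_CHAR_semidom[where 'a = 'k] p by simp

lemma CHAR_R: "CHAR('r) = p"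
proof (rule CHAR_eqI)
  have "(of_nat p :: 'r) = \<phi> (of_nat p)" by (simp add: hom_of_nat)
  then show "(of_nat p :: 'r) = 0" using p by (metis hom_zero of_nat_CHAR)
  fix n assume "(of_nat n :: 'r) = 0"
  then have "\<phi> (of_nat n) * 1 \<in> {0}" by (simp add: hom_of_nat)
  then have "(of_nat n :: 'k) = 0" using ksub_scale_iff[OF ksub_ideal[OF is_ideal_0], of "of_nat n" 1] by auto
  then show "p dvd n" using p by (simp add: of_nat_eq_0_iff_char_dvd)
qed

lemma frobenius_add: "(f + g :: 'r) ^ (p ^ a) = f ^ (p ^ a) + g ^ (p ^ a)"
  using prime_p CHAR_R by (intro freshmans_dream'[of _ a]) auto

lemma frobenius_sum: "(sum (f :: 'a \<Rightarrow> 'r) S) ^ (p ^ a) = (\<Sum>i\<in>S. f i ^ (p ^ a))"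
  using prime_p CHAR_R by (intro freshmans_dream_sum'[of _ a]) auto

lemma frobenius_diff: "(f - g :: 'r) ^ (p ^ a) = f ^ (p ^ a) - g ^ (p ^ a)"
  using frobenius_add[of "f - g" g a] by (simp add: algebra_simps)

lemma pp: "p ^ a > 0" using p by simp

text \<open>The linear forms whose \<open>p^a\<close>-th powers are leading forms of degree
  \<open>p^a\<close>. Working with roots puts the pure parts for different \<open>a\<close> into one
  space, where they form a flag because raising to the \<open>p\<close>-th power carries each into
  the next.\<close>

definition V :: "nat \<Rightarrow> 'r set" where
  "V a = {v \<in> P. \<exists>f\<in>U (p ^ a). f - v ^ (p ^ a) \<in> ipow P (Suc (p ^ a))}"

text \<open>Additivity is the Frobenius identity; a scalar \<open>c\<close> acts on the witness in
  the filtration through \<open>c^(p^a)\<close>.\<close>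

lemma ksub_V: "ksub (V a)"
  unfolding ksub_def
proof (intro conjI ballI allI)
  show "0 \<in> V a" unfolding V_def using pp[of a] UD(1) is_idealD(1)[OF P_ideal]
    by (auto intro!: bexI[of _ 0] simp: power_0_left ipowD(1))
next
  fix v w assume "v \<in> V a" "w \<in> V a"
  then obtain f g where fg: "v \<in> P" "w \<in> P" "f \<in> U (p ^ a)" "g \<in> U (p ^ a)" "f - v ^ (p ^ a) \<in> ipow P (Suc (p ^ a))"
    "g - w ^ (p ^ a) \<in> ipow P (Suc (p ^ a))" unfolding V_def by blast
  have "(f + g) - (v + w) ^ (p ^ a) = (f - v ^ (p ^ a)) + (g - w ^ (p ^ a))" by (simp add: frobenius_add)
  with ipowD(2)[OF fg(5,6)] have "(f + g) - (v + w) ^ (p ^ a) \<in> ipow P (Suc (p ^ a))" by (simp only:)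
  then show "v + w \<in> V a" unfolding V_def using fg UD(2) is_idealD(2)[OF P_ideal] by blast
next
  fix c v assume "v \<in> V a"
  then obtain f where f: "v \<in> P" "f \<in> U (p ^ a)" "f - v ^ (p ^ a) \<in> ipow P (Suc (p ^ a))" unfolding V_def by blast
  have "\<phi> (c ^ (p ^ a)) * f - (\<phi> c * v) ^ (p ^ a) = \<phi> (c ^ (p ^ a)) * (f - v ^ (p ^ a))"
    by (simp add: power_mult_distrib hom_power right_diff_distrib)
  then have "\<phi> (c ^ (p ^ a)) * f - (\<phi> c * v) ^ (p ^ a) \<in> ipow P (Suc (p ^ a))" using ipowD(3)[OF f(3)] by simp
  then show "\<phi> c * v \<in> V a" unfolding V_def using UD(3)[OF f(2)] is_idealD(3)[OF P_ideal f(1)] by blast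
qed

lemma square_V: "ipow P 2 \<subseteq> V a"
proof
  fix v assume v: "v \<in> ipow P 2"
  then have "v ^ (p ^ a) \<in> ipow P (2 * p ^ a)" by (rule ipow_power)
  then have "v ^ (p ^ a) \<in> ipow P (Suc (p ^ a))" using ipow_antimono[of "Suc (p ^ a)" "2 * p ^ a" P] pp[of a] by auto
  then have "0 - v ^ (p ^ a) \<in> ipow P (Suc (p ^ a))" using ipowD(5) by fastforce
  moreover have "v \<in> P" using v ipow_antimono[of "Suc 0" 2 P] ipow_Suc_0[OF P_ideal] by auto
  ultimately show "v \<in> V a" unfolding V_def using UD(1) by blast
qed

lemma V_Suc: "V a \<subseteq> V (Suc a)"
proof
  fix v assume "v \<in> V a"
  then obtain f where f: "v \<in> P" "f \<in> U (p ^ a)" "f - v ^ (p ^ a) \<in> ipow P (Suc (p ^ a))" unfolding V_def by blast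
  have "f ^ p \<in> U (p ^ Suc a)" using U_power[OF f(2), of p] by (simp add: mult.commute)
  moreover have "(f - v ^ (p ^ a)) ^ p \<in> ipow P (Suc (p ^ a) * p)" by (rule ipow_power[OF f(3)])
  then have "(f - v ^ (p ^ a)) ^ p \<in> ipow P (Suc (p ^ Suc a))"
    using ipow_antimono[of "Suc (p ^ Suc a)" "Suc (p ^ a) * p" P] p(2) by (auto simp: mult.commute)
  then have "f ^ p - v ^ (p ^ Suc a) \<in> ipow P (Suc (p ^ Suc a))"
    using frobenius_diff[of f "v ^ (p ^ a)" 1] by (simp add: mult.commute flip: power_mult)
  ultimately show "v \<in> V (Suc a)" unfolding V_def using f(1) by blast
qed

text \<open>The maximal ideal is appended to the flag as a last member with index
  \<open>Suc e\<close>, so that the adapted sequence becomes a full system of parameters.\<close>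

lemma adapted_params:
  "\<exists>x L. params \<chi>\<^sub>0 t x \<and> (\<forall>a\<le>e. L a \<le> t \<and> (\<forall>i<L a. x i \<in> V a) \<and> V a \<subseteq> fspan x {..<L a} (ipow P 2)) \<and>
    (\<forall>b\<le>e. \<forall>a\<le>b. L a \<le> L b)"
proof -
  let ?W = "ipow P 2" and ?V = "\<lambda>a. if a \<le> e then V a else P"
  have W: "ksub ?W" by (rule ksub_ideal[OF is_ideal_ipow])
  have VP: "V a \<subseteq> P" for a by (auto simp: V_def)
  have WP: "?W \<subseteq> P" using square_V VP by blast
  obtain x0 where x0: "params \<chi>\<^sub>0 t x0" using params_exist[OF point] ..
  have bound: "n \<le> t" if "findep y n ?W" "\<And>i. i < n \<Longrightarrow> y i \<in> P" for n y
    by (rule findep_le[OF W that(1), of x0]) (use that(2) x0 in \<open>auto simp: params_def\<close>)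
  have "\<exists>x L. findep x (L (Suc e)) ?W \<and> (\<forall>a\<le>Suc e. (\<forall>i<L a. x i \<in> ?V a) \<and> ?V a \<subseteq> fspan x {..<L a} ?W) \<and>
    (\<forall>b\<le>Suc e. \<forall>a\<le>b. L a \<le> L b)"
  proof (rule adapted_chain[OF W])
    show "ksub (?V a)" for a using ksub_V ksub_ideal[OF P_ideal] by simp
    show "?W \<subseteq> ?V a" for a using square_V WP by simp
    show "?V a \<subseteq> ?V (Suc a)" for a using V_Suc VP by auto
    show "n \<le> t" if "findep y n ?W" "\<And>i. i < n \<Longrightarrow> y i \<in> ?V (Suc e)" for n y using bound[OF that(1)] that(2) by simp
  qed
  then obtain x L where x: "findep x (L (Suc e)) ?W" "\<forall>a\<le>Suc e. (\<forall>i<L a. x i \<in> ?V a) \<and> ?V a \<subseteq> fspan x {..<L a} ?W"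
    "\<forall>b\<le>Suc e. \<forall>a\<le>b. L a \<le> L b" by (elim exE conjE)
  have top: "\<forall>i<L (Suc e). x i \<in> P" "P \<subseteq> fspan x {..<L (Suc e)} ?W" using x(2)[rule_format, of "Suc e"] by auto
  have "t \<le> L (Suc e)"
    by (rule findep_le[OF W params_findep[OF point x0], of x]) (use x0 top(2) in \<open>auto simp: params_def\<close>)
  moreover have "L (Suc e) \<le> t" using bound[OF x(1)] top(1) by blast
  ultimately have Lt: "L (Suc e) = t" by simp
  have "params \<chi>\<^sub>0 t x" using top by (simp add: params_def Lt)
  moreover have "\<forall>a\<le>e. L a \<le> t \<and> (\<forall>i<L a. x i \<in> V a) \<and> V a \<subseteq> fspan x {..<L a} ?W"
  proof (intro allI impI)
    fix a assume a: "a \<le> e"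
    then have "L a \<le> t" using x(3)[rule_format, of "Suc e" a] Lt by simp
    moreover have "(\<forall>i<L a. x i \<in> V a) \<and> V a \<subseteq> fspan x {..<L a} ?W" using x(2)[rule_format, of a] a by simp
    ultimately show "L a \<le> t \<and> (\<forall>i<L a. x i \<in> V a) \<and> V a \<subseteq> fspan x {..<L a} ?W" by blast
  qed
  moreover have "\<forall>b\<le>e. \<forall>a\<le>b. L a \<le> L b" using x(3) by auto
  ultimately show ?thesis by blast
qed

context
  fixes e :: nat and x :: "nat \<Rightarrow> 'r" and L :: "nat \<Rightarrow> nat"
  assumes x: "params \<chi>\<^sub>0 t x"
    and L: "\<And>a. a \<le> e \<Longrightarrow> L a \<le> t" "\<And>a i. a \<le> e \<Longrightarrow> i < L a \<Longrightarrow> x i \<in> V a"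
      "\<And>a. a \<le> e \<Longrightarrow> V a \<subseteq> fspan x {..<L a} (ipow P 2)" "\<And>a b. a \<le> b \<Longrightarrow> b \<le> e \<Longrightarrow> L a \<le> L b"
begin

text \<open>The monomials that are products of powers \<open>x i ^ (p^a)\<close> coming from the
  pure parts up to \<open>e\<close>.\<close>

definition good :: "(nat \<Rightarrow> nat) \<Rightarrow> bool" where
  "good J \<longleftrightarrow> (\<forall>i<t. J i \<noteq> 0 \<longrightarrow> (\<exists>a\<le>e. i < L a \<and> p ^ a dvd J i))"

lemma xP: "i < t \<Longrightarrow> x i \<in> P" using x by (auto simp: params_def)

text \<open>A product of powers of the witnesses for the pure parts has the prescribed leading form,
  and its level is the sum of theirs.\<close>

lemma good_lift:
  assumes J: "good J"
  shows "\<exists>f\<in>U (multi_deg t J). appr (multi_deg t J) f (multi_power t x J)"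
proof -
  have "\<exists>f. f \<in> U (J i) \<and> appr (J i) f (x i ^ J i)" if i: "i < t" for i
  proof (cases "J i = 0")
    case True
    then show ?thesis by (intro exI[of _ 1]) (simp add: U_0 appr_def ipowD)
  next
    case False
    then obtain a where a: "a \<le> e" "i < L a" "p ^ a dvd J i" using J i unfolding good_def by blast
    then obtain k where k: "J i = p ^ a * k" by blast
    obtain f where f: "f \<in> U (p ^ a)" "f - x i ^ (p ^ a) \<in> ipow P (Suc (p ^ a))" using L(2)[OF a(1,2)] unfolding V_def by blast
    have "appr (p ^ a) f (x i ^ (p ^ a))"
      unfolding appr_def using f U_support ipow_power1[OF xP[OF i]] by blast
    from appr_power[OF this, of k] U_power[OF f(1), of k] show ?thesis
      by (intro exI[of _ "f ^ k"]) (simp add: k power_mult)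
  qed
  then have "\<forall>i. \<exists>f. i < t \<longrightarrow> f \<in> U (J i) \<and> appr (J i) f (x i ^ J i)" by blast
  from choice[OF this] obtain f where f: "\<forall>i<t. f i \<in> U (J i) \<and> appr (J i) (f i) (x i ^ J i)" by blast
  have "prod f {..<t} \<in> U (multi_deg t J)" unfolding multi_deg_def using f by (intro U_prod) auto
  moreover have "appr (multi_deg t J) (prod f {..<t}) (multi_power t x J)"
    unfolding multi_deg_def multi_power_def using f by (intro appr_prod) auto
  ultimately show ?thesis by blast
qed

lemma shift_index:
  assumes "I0 \<in> MI t s" "s \<le> n"
  shows "bij_betw (\<lambda>K i. K i + I0 i) (MI t (n - s)) {J \<in> MI t n. \<forall>i. I0 i \<le> J i}"
proof (rule bij_betw_byWitness[where f' = "\<lambda>J i. J i - I0 i"])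
  show "(\<lambda>K i. K i + I0 i) ` MI t (n - s) \<subseteq> {J \<in> MI t n. \<forall>i. I0 i \<le> J i}"
    using assms by (auto simp: MI_def multi_indices_def multi_deg_add)
  show "(\<lambda>J i. J i - I0 i) ` {J \<in> MI t n. \<forall>i. I0 i \<le> J i} \<subseteq> MI t (n - s)"
    using assms by (auto simp: MI_def multi_indices_def multi_deg_def sum_subtractf_nat)
qed auto

text \<open>The operator dual to \<open>I0\<close> lowers level and order by \<open>s\<close> and
  acts on the leading coefficients as a Hasse derivative, up to the constant
  \<open>u\<close>.\<close>

lemma derivative_expansion:
  assumes f: "f \<in> U n" and fc: "f - (\<Sum>J\<in>MI t n. \<phi> (c J) * multi_power t x J) \<in> ipow P (Suc n)"
    and I0: "I0 \<in> MI t s" and s: "s \<le> n"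
  shows "\<exists>g u. g \<in> U (n - s) \<and> u \<noteq> 0 \<and>
    g - (\<Sum>K\<in>MI t (n - s). \<phi> (u * c (\<lambda>i. K i + I0 i) * of_nat (multi_binom (\<lambda>i. K i + I0 i) I0)) * multi_power t x K)
      \<in> ipow P (Suc (n - s))"
proof -
  let ?x = "multi_power t x"
  have "I0 \<in> MIle t s" using I0 by (simp add: MI_def MIle_def)
  from dual_operator[OF point x this] obtain D u where
    D: "diff_op \<phi> UNIV s D" "u \<noteq> 0" "\<forall>J\<in>MIle t s. \<chi>\<^sub>0 (D (?x J)) = (if J = I0 then u else 0)" by blast
  have lin: "k_linear_on \<phi> UNIV D" by (rule diff_op_linear[OF D(1)])
  have add: "D (f + g) = D f + D g" and scale: "D (\<phi> c * f) = \<phi> c * D f" for f g c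
    using lin by (auto simp: k_linear_on_def)
  have Dsum: "D (\<Sum>J\<in>S. \<phi> (c J) * ?x J) = (\<Sum>J\<in>S. \<phi> (c J) * D (?x J))" if "finite S" for S
    using that
  proof (induction S rule: finite_induct)
    case empty
    have "D (\<phi> 0 * 0) = \<phi> 0 * D 0" by (rule scale)
    then show ?case by simp
  qed (simp add: add scale)
  let ?b = "\<lambda>J. of_nat (multi_binom J I0) :: 'k"
  have sym: "D (?x J) - \<phi> (u * ?b J) * ?x (\<lambda>i. J i - I0 i) \<in> ipow P (Suc (n - s))" if J: "J \<in> MI t n" for J
  proof -
    have "D (?x J) - \<phi> (u * ?b J) * ?x (\<lambda>i. J i - I0 i) \<in> ipow P (Suc (multi_deg t J - s))"
      by (rule symbol[OF point xP D(1) I0]) (use D(3) J s in \<open>auto simp: MI_def MIle_def\<close>)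
    then show ?thesis using J by (simp add: MI_def)
  qed
  let ?R = "f - (\<Sum>J\<in>MI t n. \<phi> (c J) * ?x J)"
  have "D ?R \<in> ipow P (Suc n - s)" by (rule diff_op_ipow[OF D(1) fc])
  then have 1: "D ?R \<in> ipow P (Suc (n - s))" using s by (simp add: Suc_diff_le)
  have "D f = D (?R + (\<Sum>J\<in>MI t n. \<phi> (c J) * ?x J))" by simp
  then have Df: "D f = D ?R + (\<Sum>J\<in>MI t n. \<phi> (c J) * D (?x J))" by (simp only: add Dsum[OF MI_finite])
  have 2: "(\<Sum>J\<in>MI t n. \<phi> (c J) * (D (?x J) - \<phi> (u * ?b J) * ?x (\<lambda>i. J i - I0 i))) \<in> ipow P (Suc (n - s))"
    by (intro is_ideal_sum[OF is_ideal_ipow] ipowD(3) sym)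
  let ?h = "\<lambda>J. \<phi> (u * c J * ?b J) * ?x (\<lambda>i. J i - I0 i)"
  have "(\<Sum>J\<in>MI t n. ?h J) = (\<Sum>J\<in>{J \<in> MI t n. \<forall>i. I0 i \<le> J i}. ?h J)"
  proof (rule sum.mono_neutral_right[OF MI_finite])
    show "\<forall>J\<in>MI t n - {J \<in> MI t n. \<forall>i. I0 i \<le> J i}. ?h J = 0"
    proof
      fix J assume J: "J \<in> MI t n - {J \<in> MI t n. \<forall>i. I0 i \<le> J i}"
      then obtain i where i: "J i < I0 i" by (auto simp: not_le)
      then have "i < t" using I0 by (metis (mono_tags, lifting) MI_def mem_Collect_eq multi_indices_def not_less0 not_less)
      then have "multi_binom J I0 = 0" using i multi_binom_eq_0 by blast
      then show "?h J = 0" by simp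
    qed
  qed auto
  also have "\<dots> = (\<Sum>K\<in>MI t (n - s). ?h (\<lambda>i. K i + I0 i))"
    by (rule sum.reindex_bij_betw[OF shift_index[OF I0 s], symmetric])
  also have "\<dots> = (\<Sum>K\<in>MI t (n - s). \<phi> (u * c (\<lambda>i. K i + I0 i) * ?b (\<lambda>i. K i + I0 i)) * ?x K)" by simp
  finally have eq: "(\<Sum>J\<in>MI t n. ?h J) = (\<Sum>K\<in>MI t (n - s). \<phi> (u * c (\<lambda>i. K i + I0 i) * ?b (\<lambda>i. K i + I0 i)) * ?x K)" .
  have "D ?R + (\<Sum>J\<in>MI t n. \<phi> (c J) * (D (?x J) - \<phi> (u * ?b J) * ?x (\<lambda>i. J i - I0 i))) = D f - (\<Sum>J\<in>MI t n. ?h J)"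
    unfolding Df by (simp add: right_diff_distrib sum_subtractf hom_mult mult_ac)
  with ipowD(2)[OF 1 2] have "D f - (\<Sum>J\<in>MI t n. ?h J) \<in> ipow P (Suc (n - s))" by simp
  then show ?thesis using U_diff[OF f D(1) s] D(2) unfolding eq by blast
qed

text \<open>The derivative of order \<open>s\<close> in the variable \<open>x j\<close> keeps the
  exponent \<open>J\<close> alive, shortened at \<open>j\<close>, as long as the binomial
  coefficient is nonzero in \<open>k\<close>; the induction hypothesis then applies in smaller
  degree.\<close>

lemma coefficient_step:
  assumes IH: "\<forall>k<n. \<forall>f\<in>U k. \<forall>c. f - (\<Sum>J\<in>MI t k. \<phi> (c J) * multi_power t x J) \<in> ipow P (Suc k) \<longrightarrow>
      (\<forall>J\<in>MI t k. c J \<noteq> 0 \<longrightarrow> good J)"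
    and f: "f \<in> U n" and fc: "f - (\<Sum>J\<in>MI t n. \<phi> (c J) * multi_power t x J) \<in> ipow P (Suc n)"
    and J: "J \<in> MI t n" "c J \<noteq> 0"
    and s: "j < t" "0 < s" "s \<le> J j" "(of_nat (J j choose s) :: 'k) \<noteq> 0"
  shows "good (J(j := J j - s))"
proof -
  let ?I0 = "single_index j s" and ?K = "J(j := J j - s)"
  have sn: "s \<le> n" using le_multi_deg[OF s(1), of J] J(1) s(3) by (simp add: MI_def)
  have I0: "?I0 \<in> MI t s" by (rule single_index_MI[OF s(1)])
  have KJ: "(\<lambda>i. ?K i + ?I0 i) = J" using s(3) by (auto simp: single_index_def)
  have "multi_deg t ?K + multi_deg t ?I0 = multi_deg t (\<lambda>i. ?K i + ?I0 i)" by (rule multi_deg_add[symmetric])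
  also have "\<dots> = n" using J(1) by (simp only: KJ) (simp add: MI_def)
  finally have "multi_deg t ?K = n - s" using I0 by (simp add: MI_def)
  then have K: "?K \<in> MI t (n - s)" using J(1) s(1) by (auto simp: MI_def multi_indices_def)
  obtain g u where g: "g \<in> U (n - s)" "u \<noteq> 0"
    "g - (\<Sum>K\<in>MI t (n - s). \<phi> (u * c (\<lambda>i. K i + ?I0 i) * of_nat (multi_binom (\<lambda>i. K i + ?I0 i) ?I0)) * multi_power t x K)
      \<in> ipow P (Suc (n - s))"
    using derivative_expansion[OF f fc I0 sn] by blast
  have "multi_binom J ?I0 = (\<Prod>i<t. if i = j then J j choose s else 1)"
    unfolding multi_binom_def single_index_def by (rule prod.cong) auto
  then have b: "multi_binom J ?I0 = J j choose s" using s(1) by simp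
  show ?thesis
  proof (rule IH[rule_format, OF _ g(1) g(3) K])
    show "n - s < n" using s(2) sn by simp
    show "u * c (\<lambda>i. ?K i + ?I0 i) * of_nat (multi_binom (\<lambda>i. ?K i + ?I0 i) ?I0) \<noteq> 0"
      unfolding KJ b using g(2) J(2) s(4) by simp
  qed
qed

lemma good_single: "i < t \<Longrightarrow> good (single_index i n) \<longleftrightarrow> n = 0 \<or> (\<exists>a\<le>e. i < L a \<and> p ^ a dvd n)"
  unfolding good_def single_index_def by auto

lemma good_single_power:
  assumes "i < t" "a \<le> e"
  shows "good (single_index i (p ^ a)) \<longleftrightarrow> i < L a"
proof
  assume "good (single_index i (p ^ a))"
  then obtain b where b: "b \<le> e" "i < L b" "p ^ b dvd p ^ a" unfolding good_single[OF assms(1)] using pp[of a] by auto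
  then have "b \<le> a" using power_dvd_imp_le prime_gt_1_nat[OF prime_p] by blast
  then show "i < L a" using b L(4)[OF _ assms(2)] by (meson less_le_trans)
qed (use assms good_single in auto)

text \<open>A bad exponent is moved to a smaller degree by a differential operator as long as it is not
  concentrated in a single variable with a \<open>p\<close>-power exponent; the remaining ones are excluded by
  the choice of the parameters.\<close>

lemma exponents_good:
  assumes "n \<le> p ^ e" "f \<in> U n" "f - (\<Sum>J\<in>MI t n. \<phi> (c J) * multi_power t x J) \<in> ipow P (Suc n)"
    "J \<in> MI t n" "c J \<noteq> 0"
  shows "good J"
  using assms
proof (induction n arbitrary: f c J rule: less_induct)
  case (less n)
  let ?x = "multi_power t x"
  have IH: "\<forall>k<n. \<forall>f\<in>U k. \<forall>c. f - (\<Sum>J\<in>MI t k. \<phi> (c J) * multi_power t x J) \<in> ipow P (Suc k) \<longrightarrow>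
      (\<forall>J\<in>MI t k. c J \<noteq> 0 \<longrightarrow> good J)"
  proof (intro allI ballI impI)
    fix k f c J assume k: "k < n" "f \<in> U k"
      "f - (\<Sum>J\<in>MI t k. \<phi> (c J) * multi_power t x J) \<in> ipow P (Suc k)" "J \<in> MI t k" "c J \<noteq> 0"
    show "good J" by (rule less.IH[OF k(1) _ k(2-5)]) (use k(1) less.prems(1) in simp)
  qed
  note step = coefficient_step[OF IH less.prems(2,3)]
  have bad: "\<exists>i a. i < t \<and> a \<le> e \<and> n = p ^ a \<and> L a \<le> i \<and> J = single_index i n"
    if J: "J \<in> MI t n" "c J \<noteq> 0" and nb: "\<not> good J" for J
  proof -
    obtain i where i: "i < t" "J i \<noteq> 0" "\<And>a. a \<le> e \<Longrightarrow> i < L a \<Longrightarrow> \<not> p ^ a dvd J i" using nb unfolding good_def by blast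
    \<comment> \<open>Differentiating away the whole power of \<open>x j\<close> has binomial
      coefficient 1 and leaves the bad exponent at \<open>i\<close> untouched, against the induction
      hypothesis.\<close>
    have z: "J j = 0" if j: "j < t" "j \<noteq> i" for j
    proof (rule ccontr)
      assume "J j \<noteq> 0"
      then have "good (J(j := J j - J j))" by (intro step[OF J j(1)]) auto
      then show False using i j unfolding good_def by (metis fun_upd_other)
    qed
    have Ji: "J = single_index i n" by (rule MI_eq_single_index[OF J(1) i(1) z])
    then have n0: "J i = n" "n > 0" using i(2) by (auto simp: single_index_def)
    obtain a v where v: "\<not> p dvd v" "n = v * p ^ a" using prime_power_canonical[OF prime_p n0(2)] by blast
    have v0: "v > 0" using v(1) by (cases v) auto
    then have "p ^ a \<le> n" using v(2) by simp
    then have "p ^ a \<le> p ^ e" using less.prems(1) by (rule order_trans)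
    then have a: "a \<le> e" by (rule power_le_imp_le_exp[OF prime_gt_1_nat[OF prime_p]])
    have "p ^ a dvd J i" using n0(1) v(2) by simp
    then have La: "L a \<le> i" using i(3)[OF a] not_less by blast
    have "v = 1"
    proof (rule ccontr)
      assume "v \<noteq> 1"
      then have v2: "1 < v" using v0 by simp
      then have lt: "p ^ a < n" using pp[of a] v(2) by simp
      \<comment> \<open>The derivative of order \<open>n - p^a\<close> leaves
        \<open>x i ^ (p^a)\<close> with a factor \<open>v\<close>, nonzero in \<open>k\<close>. That
        monomial has smaller degree and would have to be good, which puts \<open>i\<close> below
        \<open>L a\<close>.\<close>
      have "(of_nat (n choose (n - p ^ a)) :: 'k) = of_nat (n choose (p ^ a))"
        using binomial_symmetric[of "p ^ a" n] lt by simp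
      also have "\<dots> = of_nat v" using binomial_coeff_char[OF prime_p p(1), of a v] v(2) by (simp add: mult.commute)
      finally have "(of_nat (J i choose (n - p ^ a)) :: 'k) \<noteq> 0" using v(1) p(1) n0(1) by (simp add: of_nat_eq_0_iff_char_dvd)
      then have "good (J(i := J i - (n - p ^ a)))" by (intro step[OF J i(1)]) (use lt n0 in auto)
      moreover have "J(i := J i - (n - p ^ a)) = single_index i (p ^ a)" using lt n0(1) by (auto simp: Ji single_index_def)
      ultimately have "i < L a" using good_single_power[OF i(1) a] by simp
      then show False using La by simp
    qed
    then show ?thesis using i(1) a La Ji v(2) by auto
  qed
  show ?case
  proof (rule ccontr)
    assume nb: "\<not> good J"
    obtain i a where ia: "i < t" "a \<le> e" "n = p ^ a" "L a \<le> i" "J = single_index i n"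
      using bad[OF less.prems(4,5) nb] by blast
    let ?G = "{J \<in> MI t n. good J}" and ?B = "(\<lambda>i. single_index i n) ` {L a..<t}"
    let ?W = "ipow P (Suc n)"
    have lift: "\<forall>J. \<exists>h. good J \<longrightarrow> h \<in> U (multi_deg t J) \<and> appr (multi_deg t J) h (?x J)" using good_lift by blast
    from choice[OF lift] obtain F where F: "\<And>J. good J \<Longrightarrow> F J \<in> U (multi_deg t J)"
      "\<And>J. good J \<Longrightarrow> appr (multi_deg t J) (F J) (?x J)" by blast
    have inj: "inj_on (\<lambda>i. single_index i n) {L a..<t}"
      using single_index_inj[of n] pp[of a] ia(3) by (auto simp: inj_on_def)
    have sub: "?G \<union> ?B \<subseteq> MI t n" "?G \<inter> ?B = {}"
      using single_index_MI good_single_power[OF _ ia(2)] ia(3) by auto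
    have zero: "c J = 0" if rest: "J \<in> MI t n - (?G \<union> ?B)" for J
    proof (rule ccontr)
      assume "c J \<noteq> 0"
      then obtain i b where b: "i < t" "n = p ^ b" "L b \<le> i" "J = single_index i n" using bad[of J] rest by blast
      then have "b = a" using ia(3) power_inject_exp[OF prime_gt_1_nat[OF prime_p]] by simp
      then show False using b rest by auto
    qed
    have "(\<Sum>J\<in>MI t n. \<phi> (c J) * ?x J) = (\<Sum>J\<in>?G \<union> ?B. \<phi> (c J) * ?x J)"
      by (rule sum.mono_neutral_right[OF MI_finite sub(1)]) (use zero in simp)
    also have "\<dots> = (\<Sum>J\<in>?G. \<phi> (c J) * ?x J) + (\<Sum>J\<in>?B. \<phi> (c J) * ?x J)"
      by (rule sum.union_disjoint) (use MI_finite sub(2) in auto)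
    also have "(\<Sum>J\<in>?B. \<phi> (c J) * ?x J) = (\<Sum>i\<in>{L a..<t}. \<phi> (c (single_index i n)) * x i ^ n)"
      unfolding sum.reindex[OF inj] by (rule sum.cong) (auto simp: multi_power_single)
    finally have split: "(\<Sum>J\<in>MI t n. \<phi> (c J) * ?x J) =
      (\<Sum>J\<in>?G. \<phi> (c J) * ?x J) + (\<Sum>i\<in>{L a..<t}. \<phi> (c (single_index i n)) * x i ^ n)" .
    \<comment> \<open>Roots of the coefficients make the remaining bad part the \<open>n\<close>-th
      power of a linear form \<open>v\<close>, as \<open>n\<close> is a power of
      \<open>p\<close>.\<close>
    have "\<forall>i. \<exists>r. r ^ n = c (single_index i n)" using nth_root_exists pp[of a] ia(3) by metis
    from choice[OF this] obtain r where r: "\<And>i. r i ^ n = c (single_index i n)" by blast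
    define v where "v = (\<Sum>i\<in>{L a..<t}. \<phi> (r i) * x i)"
    have vn: "v ^ n = (\<Sum>i\<in>{L a..<t}. \<phi> (c (single_index i n)) * x i ^ n)"
      unfolding v_def ia(3) frobenius_sum by (simp add: power_mult_distrib r flip: ia(3) hom_power)
    have vP: "v \<in> P" unfolding v_def using xP by (intro is_ideal_sum[OF P_ideal] is_idealD(3)[OF P_ideal]) auto
    \<comment> \<open>Removing lifts of the good monomials stays in the filtration. What remains has
      the pure leading form \<open>v^n\<close>, so \<open>v\<close> belongs to the pure part at
      \<open>a\<close> and to the span of the first \<open>L a\<close> parameters, although it
      involves only later ones.\<close>
    define h where "h = f - (\<Sum>J\<in>?G. \<phi> (c J) * F J)"
    have deg: "multi_deg t J = n" if "J \<in> ?G" for J using that by (simp add: MI_def)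
    have hU: "h \<in> U n" unfolding h_def
      using F(1) deg less.prems(2) by (intro UD(6) is_ideal_sum[OF U_ideal] UD(3)) (metis (no_types, lifting) mem_Collect_eq)+
    have "F J - ?x J \<in> ?W" if "J \<in> ?G" for J using F(2)[of J] deg[OF that] that by (simp add: appr_def)
    then have "(\<Sum>J\<in>?G. \<phi> (c J) * (F J - ?x J)) \<in> ?W" by (intro is_ideal_sum[OF is_ideal_ipow] ipowD(3))
    from ipowD(6)[OF less.prems(3) this] have "h - v ^ n \<in> ?W"
      unfolding h_def vn split by (simp add: right_diff_distrib sum_subtractf algebra_simps)
    then have "v \<in> V a" unfolding V_def using vP hU ia(3) by auto
    then have "v \<in> fspan x {..<L a} (ipow P 2)" using L(3)[OF ia(2)] by blast
    then obtain d where d: "v - (\<Sum>i<L a. \<phi> (d i) * x i) \<in> ipow P 2" by (rule fspanE)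
    let ?c = "\<lambda>i. if i < L a then - d i else r i"
    have un: "{..<t} = {..<L a} \<union> {L a..<t}" using L(1)[OF ia(2)] by auto
    have "(\<Sum>i<t. \<phi> (?c i) * x i) = (\<Sum>i<L a. \<phi> (?c i) * x i) + (\<Sum>i\<in>{L a..<t}. \<phi> (?c i) * x i)"
      unfolding un by (rule sum.union_disjoint) auto
    also have "\<dots> = v - (\<Sum>i<L a. \<phi> (d i) * x i)" by (simp add: v_def hom_uminus sum_negf)
    finally have "(\<Sum>i<t. \<phi> (?c i) * x i) \<in> ipow P 2" using d by simp
    then have "\<forall>i<t. ?c i = 0" using params_findep[OF point x, unfolded findep_def, THEN spec, of ?c] by (rule rev_mp)
    then have "?c i = 0" using ia(1) by (simp only:)
    then have "r i ^ n = 0" using ia(3,4) pp[of a] by (simp add: power_0_left)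
    then show False using r less.prems(5) ia(5) by simp
  qed
qed

definition Gset :: "(nat \<Rightarrow> nat) set" where "Gset = {J \<in> MI t (p ^ e). good J}"

text \<open>One inclusion is the exclusion of bad exponents, the other the lifting of good
  monomials.\<close>

lemma leading_span:
  "{g. \<exists>f\<in>U (p ^ e). f - g \<in> ipow P (Suc (p ^ e))} = fspan (multi_power t x) Gset (ipow P (Suc (p ^ e)))"
    (is "?A = fspan ?x _ ?W")
proof (intro equalityI subsetI)
  fix g assume "g \<in> ?A"
  then obtain f where f: "f \<in> U (p ^ e)" "f - g \<in> ?W" by blast
  have "f \<in> fspan ?x (MI t (p ^ e)) ?W" using ipow_fspan[OF point x, of "p ^ e"] U_support f(1) by blast
  then obtain c where c: "f - (\<Sum>J\<in>MI t (p ^ e). \<phi> (c J) * ?x J) \<in> ?W" by (rule fspanE)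
  have "(\<Sum>J\<in>MI t (p ^ e). \<phi> (c J) * ?x J) = (\<Sum>J\<in>Gset. \<phi> (c J) * ?x J)"
  proof (rule sum.mono_neutral_right[OF MI_finite])
    show "\<forall>J\<in>MI t (p ^ e) - Gset. \<phi> (c J) * ?x J = 0"
    proof
      fix J assume "J \<in> MI t (p ^ e) - Gset"
      then have "c J = 0" using exponents_good[OF order_refl f(1) c, of J] by (auto simp: Gset_def)
      then show "\<phi> (c J) * ?x J = 0" by simp
    qed
  qed (auto simp: Gset_def)
  moreover have "(f - (\<Sum>J\<in>MI t (p ^ e). \<phi> (c J) * ?x J)) - (f - g) \<in> ?W" by (rule ipowD(6)[OF c f(2)])
  ultimately have "g - (\<Sum>J\<in>Gset. \<phi> (c J) * ?x J) \<in> ?W" by (simp add: algebra_simps)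
  then show "g \<in> fspan ?x Gset ?W" unfolding fspan_def by blast
next
  fix g assume "g \<in> fspan ?x Gset ?W"
  then obtain c where c: "g - (\<Sum>J\<in>Gset. \<phi> (c J) * ?x J) \<in> ?W" by (rule fspanE)
  have "\<forall>J. \<exists>h. J \<in> Gset \<longrightarrow> h \<in> U (p ^ e) \<and> h - ?x J \<in> ?W"
  proof
    fix J show "\<exists>h. J \<in> Gset \<longrightarrow> h \<in> U (p ^ e) \<and> h - ?x J \<in> ?W"
      using good_lift[of J] by (cases "J \<in> Gset") (auto simp: Gset_def MI_def appr_def)
  qed
  from choice[OF this] obtain F where F: "\<forall>J. J \<in> Gset \<longrightarrow> F J \<in> U (p ^ e) \<and> F J - ?x J \<in> ?W" by blast
  have "(\<Sum>J\<in>Gset. \<phi> (c J) * (F J - ?x J)) \<in> ?W" using F by (intro is_ideal_sum[OF is_ideal_ipow] ipowD(3)) auto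
  from ipowD(6)[OF this c] have "(\<Sum>J\<in>Gset. \<phi> (c J) * F J) - g \<in> ?W"
    by (simp add: right_diff_distrib sum_subtractf algebra_simps)
  moreover have "(\<Sum>J\<in>Gset. \<phi> (c J) * F J) \<in> U (p ^ e)" using F by (intro is_ideal_sum[OF U_ideal] UD(3)) auto
  ultimately show "g \<in> ?A" by blast
qed

lemmas leading_span' = leading_span[unfolded Gset_def good_def]

text \<open>Frobenius is additive and \<open>k\<close> has \<open>p^a\<close>-th roots, so powers of
  combinations and combinations of powers coincide modulo the next power.\<close>

lemma pure_span:
  assumes a: "a \<le> e"
  shows "{g. (\<exists>f\<in>U (p ^ a). f - g \<in> ipow P (Suc (p ^ a))) \<and> (\<exists>v\<in>P. g - v ^ (p ^ a) \<in> ipow P (Suc (p ^ a)))} =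
    fspan (\<lambda>i. x i ^ (p ^ a)) {..<L a} (ipow P (Suc (p ^ a)))" (is "?A = fspan ?y _ ?W")
proof (intro equalityI subsetI)
  fix g assume "g \<in> ?A"
  then obtain f v where f: "f \<in> U (p ^ a)" "f - g \<in> ?W" "v \<in> P" "g - v ^ (p ^ a) \<in> ?W" by blast
  have "f - v ^ (p ^ a) \<in> ?W" using ipowD(2)[OF f(2,4)] by simp
  then have "v \<in> V a" unfolding V_def using f by blast
  then obtain c where c: "v - (\<Sum>i<L a. \<phi> (c i) * x i) \<in> ipow P 2" using L(3)[OF a] unfolding fspan_def by blast
  have "(v - (\<Sum>i<L a. \<phi> (c i) * x i)) ^ (p ^ a) \<in> ipow P (2 * p ^ a)" by (rule ipow_power[OF c])
  then have "(v - (\<Sum>i<L a. \<phi> (c i) * x i)) ^ (p ^ a) \<in> ?W" using ipow_antimono[of "Suc (p ^ a)" "2 * p ^ a" P] pp[of a] by auto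
  then have "v ^ (p ^ a) - (\<Sum>i<L a. \<phi> (c i ^ (p ^ a)) * ?y i) \<in> ?W"
    by (simp add: frobenius_diff frobenius_sum power_mult_distrib hom_power)
  from ipowD(2)[OF f(4) this] have "g - (\<Sum>i<L a. \<phi> (c i ^ (p ^ a)) * ?y i) \<in> ?W" by simp
  then show "g \<in> fspan ?y {..<L a} ?W" unfolding fspan_def by (intro CollectI exI)
next
  fix g assume "g \<in> fspan ?y {..<L a} ?W"
  then obtain c where c: "g - (\<Sum>i<L a. \<phi> (c i) * ?y i) \<in> ?W" by (rule fspanE)
  have "\<forall>i. \<exists>r. r ^ (p ^ a) = c i" using nth_root_exists pp[of a] by metis
  from choice[OF this] obtain r where r: "\<And>i. r i ^ (p ^ a) = c i" by blast
  define v where "v = (\<Sum>i<L a. \<phi> (r i) * x i)"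
  have "v ^ (p ^ a) = (\<Sum>i<L a. \<phi> (c i) * ?y i)"
    unfolding v_def frobenius_sum by (simp add: power_mult_distrib r flip: hom_power)
  then have gv: "g - v ^ (p ^ a) \<in> ?W" using c by simp
  have "v \<in> V a" unfolding v_def using L(2)[OF a] by (intro ksub_sum[OF ksub_V] ksubD(3)[OF ksub_V]) auto
  then obtain f where f: "v \<in> P" "f \<in> U (p ^ a)" "f - v ^ (p ^ a) \<in> ?W" unfolding V_def by blast
  have "f - g \<in> ?W" using ipowD(6)[OF f(3) gv] by simp
  then show "g \<in> ?A" using f gv by blast
qed

end

lemma leading_structure:
  "\<exists>x L. params \<chi>\<^sub>0 t x \<and> (\<forall>a\<le>e. L a \<le> t) \<and> (\<forall>a b. a \<le> b \<longrightarrow> b \<le> e \<longrightarrow> L a \<le> L b) \<and>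
    {g. \<exists>f\<in>U (p ^ e). f - g \<in> ipow P (Suc (p ^ e))} =
      fspan (multi_power t x) {J \<in> MI t (p ^ e). \<forall>i<t. J i \<noteq> 0 \<longrightarrow> (\<exists>a\<le>e. i < L a \<and> p ^ a dvd J i)} (ipow P (Suc (p ^ e))) \<and>
    (\<forall>a\<le>e. {g. (\<exists>f\<in>U (p ^ a). f - g \<in> ipow P (Suc (p ^ a))) \<and> (\<exists>v\<in>P. g - v ^ (p ^ a) \<in> ipow P (Suc (p ^ a)))} =
      fspan (\<lambda>i. x i ^ (p ^ a)) {..<L a} (ipow P (Suc (p ^ a))))"
proof -
  obtain x L where x: "params \<chi>\<^sub>0 t x"
    and L: "\<forall>a\<le>e. L a \<le> t \<and> (\<forall>i<L a. x i \<in> V a) \<and> V a \<subseteq> fspan x {..<L a} (ipow P 2)" "\<forall>b\<le>e. \<forall>a\<le>b. L a \<le> L b"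
    using adapted_params[of e] by (elim exE conjE)
  have L': "\<And>a. a \<le> e \<Longrightarrow> L a \<le> t" "\<And>a i. a \<le> e \<Longrightarrow> i < L a \<Longrightarrow> x i \<in> V a"
      "\<And>a. a \<le> e \<Longrightarrow> V a \<subseteq> fspan x {..<L a} (ipow P 2)" "\<And>a b. a \<le> b \<Longrightarrow> b \<le> e \<Longrightarrow> L a \<le> L b"
    using L by auto
  show ?thesis
    using x L'(1,4) leading_span'[where e = e, OF x L'] pure_span[where e = e, OF x L']
    by (intro exI[of _ x] exI[of _ L]) simp
qed

end

end

section \<open>Numbering the variables and matching exponents with monomials\<close>

section \<open>Counting the mixed monomials\<close>

text \<open>\<open>before_jump l E k + (j - 1)\<close> is the zero-based position of
  \<open>v_kj\<close> when the variables are listed jump by jump, and the variables present at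
  \<open>a\<close> are those of the jumps up to \<open>a\<close>.\<close>

lemma jump_index:
  assumes mono: "\<And>a b. a \<le> b \<Longrightarrow> b \<le> e \<Longrightarrow> l a \<le> l b" and jp: "jump_places l e K E"
    and kj: "(k, j) \<in> var_indices l K E" and a: "a < e"
  shows "before_jump l E k + (j - 1) < l a \<longleftrightarrow> E k \<le> a"
proof -
  note J = jp[unfolded jump_places_def]
  have k: "1 \<le> k" "k \<le> K" "1 \<le> j" "j \<le> l (E k) - before_jump l E k" using kj by (auto simp: var_indices_def)
  have Ek: "E k < e" "before_jump l E k < l (E k)" using J k by auto
  have sm: "E i < E i'" if "1 \<le> i" "i < i'" "i' \<le> K" for i i'
    using J that by (auto simp: strict_mono_on_def)
  show ?thesis
  proof (cases "E k \<le> a")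
    case True
    then have "l (E k) \<le> l a" using mono a by simp
    then show ?thesis using True k Ek by auto
  next
    case False
    have "l a \<le> before_jump l E k"
    proof (cases "k = 1")
      case True
      have "\<forall>i\<in>{1..K}. a < E i"
      proof
        fix i assume i: "i \<in> {1..K}"
        have "E 1 \<le> E i" using sm[of 1 i] i by (cases "i = 1") auto
        then show "a < E i" using False True by simp
      qed
      then show ?thesis using J a by auto
    next
      case k1: False
      then have k1: "1 < k" "before_jump l E k = l (E (k - 1))" using k(1) by (auto simp: before_jump_def)
      have E1: "E (k - 1) < E k" using sm[of "k - 1" k] k k1 by auto
      show ?thesis
      proof (cases "E (k - 1) \<le> a")
        case True
        have "k - 1 \<in> {1..K}" "k - 1 < K \<longrightarrow> a < E (Suc (k - 1))" using k k1 False by auto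
        then have "l a = l (E (k - 1))" using J a True by blast
        then show ?thesis using k1 by simp
      next
        case False
        then show ?thesis using mono[of a "E (k - 1)"] E1 Ek k1 by simp
      qed
    qed
    then show ?thesis using False by simp
  qed
qed

text \<open>The blocks of variables belonging to the jumps are adjacent. For a given index, the
  first \<open>a\<close> with the index below \<open>l a\<close> is a jump, and the index falls in
  its block.\<close>

lemma jump_index_bij:
  assumes mono: "\<And>a b. a \<le> b \<Longrightarrow> b \<le> e \<Longrightarrow> l a \<le> l b" and jp: "jump_places l e K E"
  shows "bij_betw (\<lambda>(k, j). before_jump l E k + (j - 1)) (var_indices l K E) {i. \<exists>a<e. i < l a}"
    (is "bij_betw ?\<tau> ?VI ?N")
  unfolding bij_betw_def
proof
  note J = jp[unfolded jump_places_def]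
  have idx: "?\<tau> \<kappa> < l a \<longleftrightarrow> E (fst \<kappa>) \<le> a" if "\<kappa> \<in> ?VI" "a < e" for \<kappa> a
    using jump_index[OF mono jp, of "fst \<kappa>" "snd \<kappa>" a] that by (simp add: case_prod_beta)
  have E: "E (fst \<kappa>) < e" if "\<kappa> \<in> ?VI" for \<kappa> using J that by (auto simp: var_indices_def)
  show "inj_on ?\<tau> ?VI"
  proof
    fix \<kappa> \<kappa>' assume K: "\<kappa> \<in> ?VI" "\<kappa>' \<in> ?VI" "?\<tau> \<kappa> = ?\<tau> \<kappa>'"
    have "E (fst \<kappa>) = E (fst \<kappa>')"
      using idx[OF K(1), of "E (fst \<kappa>)"] idx[OF K(1), of "E (fst \<kappa>')"] idx[OF K(2), of "E (fst \<kappa>)"]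
        idx[OF K(2), of "E (fst \<kappa>')"] K(3) E K by simp
    moreover have "inj_on E {1..K}" by (rule strict_mono_on_imp_inj_on[OF conjunct1[OF J]])
    moreover have "fst \<kappa> \<in> {1..K}" "fst \<kappa>' \<in> {1..K}" "1 \<le> snd \<kappa>" "1 \<le> snd \<kappa>'"
      using K(1,2) by (auto simp: var_indices_def)
    ultimately have "fst \<kappa> = fst \<kappa>'" "1 \<le> snd \<kappa>" "1 \<le> snd \<kappa>'" by (auto dest: inj_onD)
    then show "\<kappa> = \<kappa>'" using K(3) by (simp add: prod_eq_iff case_prod_beta)
  qed
  show "?\<tau> ` ?VI = ?N"
  proof (intro equalityI subsetI)
    fix i assume "i \<in> ?\<tau> ` ?VI"
    then show "i \<in> ?N" using idx E by blast
  next
    fix i assume "i \<in> ?N"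
    then obtain a0 where a0: "a0 < e" "i < l a0" by blast
    define a where "a = (LEAST a. a < e \<and> i < l a)"
    have a: "a < e" "i < l a" using LeastI[of "\<lambda>a. a < e \<and> i < l a" a0] a0 by (auto simp: a_def)
    have least: "a \<le> b" if "b < e" "i < l b" for b unfolding a_def by (rule Least_le) (use that in simp)
    let ?S = "{k \<in> {1..K}. E k \<le> a}"
    have "?S \<noteq> {}"
    proof
      assume "?S = {}"
      have "\<forall>i\<in>{1..K}. a < E i"
      proof (intro ballI, rule ccontr)
        fix i assume "i \<in> {1..K}" "\<not> a < E i"
        then have "i \<in> ?S" by simp
        then show False using \<open>?S = {}\<close> by blast
      qed
      then show False using conjunct1[OF conjunct2[OF conjunct2[OF J]]] a by auto
    qed
    then have m: "Max ?S \<in> ?S" by (intro Max_in) auto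
    define k where "k = Max ?S"
    have k: "1 \<le> k" "k \<le> K" "E k \<le> a" using m by (auto simp: k_def)
    have "k < K \<longrightarrow> a < E (Suc k)"
    proof (intro impI, rule ccontr)
      assume "k < K" "\<not> a < E (Suc k)"
      then have "Suc k \<in> ?S" by auto
      then have "Suc k \<le> k" unfolding k_def by (intro Max_ge) auto
      then show False by simp
    qed
    then have "l a = l (E k)" using J k a(1) by auto
    \<comment> \<open>Since \<open>l\<close> takes the same value at \<open>E k\<close> and at
      \<open>a\<close>, minimality of \<open>a\<close> leaves no room between them.\<close>
    then have Ek: "E k = a" using least[of "E k"] a k by simp
    have bj: "before_jump l E k \<le> i"
    proof (cases "k = 1")
      case False
      have "E (k - 1) < E k" by (rule strict_mono_onD[OF conjunct1[OF J]]) (use k False in auto)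
      then have "\<not> i < l (E (k - 1))" using least[of "E (k - 1)"] Ek a(1) by auto
      then show ?thesis by (simp add: before_jump_def)
    qed (simp add: before_jump_def)
    have "(k, Suc (i - before_jump l E k)) \<in> ?VI" using k bj a(2) Ek by (auto simp: var_indices_def)
    moreover have "?\<tau> (k, Suc (i - before_jump l E k)) = i" using bj by simp
    ultimately show "i \<in> ?\<tau> ` ?VI" by (metis imageI)
  qed
qed

lemma finite_var_indices: "finite (var_indices l K E)"
  unfolding var_indices_def by auto

lemma lookup_sum_single:
  assumes "finite S"
  shows "Poly_Mapping.lookup (\<Sum>\<kappa>\<in>S. Poly_Mapping.single \<kappa> (f \<kappa>)) \<kappa> = (if \<kappa> \<in> S then f \<kappa> else 0)"
proof -
  have "Poly_Mapping.lookup (\<Sum>\<kappa>\<in>S. Poly_Mapping.single \<kappa> (f \<kappa>)) \<kappa> = (\<Sum>\<kappa>'\<in>S. if \<kappa>' = \<kappa> then f \<kappa>' else 0)"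
    unfolding lookup_sum lookup_single by (rule sum.cong) (auto simp: when_def)
  then show ?thesis using assms by simp
qed

text \<open>In degree \<open>p^e\<close> a good exponent is either a single full power, one for each
  index below \<open>l e\<close>, or has all entries different from \<open>p^e\<close>. In the
  latter case no nonzero entry is divisible by \<open>p^e\<close>, so only places
  \<open>a < e\<close> matter, and the numbering of the variables matches these exponents with the
  mixed monomials.\<close>

lemma count_good_exponents:
  assumes p: "prime p" and mono: "\<And>a b. a \<le> b \<Longrightarrow> b \<le> e \<Longrightarrow> l a \<le> l b" and le: "l e \<le> t"
    and jp: "jump_places l e K E"
  shows "card {J \<in> MI t (p ^ e). \<forall>i<t. J i \<noteq> 0 \<longrightarrow> (\<exists>a\<le>e. i < l a \<and> p ^ a dvd J i)} = l e + l_mixed p l e K E"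
proof -
  let ?q = "p ^ e" and ?VI = "var_indices l K E" and ?\<tau> = "\<lambda>(k, j). before_jump l E k + (j - 1)"
  let ?G = "{J \<in> MI t ?q. \<forall>i<t. J i \<noteq> 0 \<longrightarrow> (\<exists>a\<le>e. i < l a \<and> p ^ a dvd J i)}"
  let ?A = "(\<lambda>i. single_index i ?q) ` {..<l e}" and ?B = "{J \<in> ?G. \<forall>i<t. J i \<noteq> ?q}"
  let ?\<Phi> = "\<lambda>J. \<Sum>\<kappa>\<in>?VI. Poly_Mapping.single \<kappa> (J (?\<tau> \<kappa>))"
  note J = jp[unfolded jump_places_def]
  have p1: "p > 1" by (rule prime_gt_1_nat[OF p])
  then have q: "?q > 0" by simp
  have bij: "bij_betw ?\<tau> ?VI {i. \<exists>a<e. i < l a}" by (rule jump_index_bij[OF mono jp])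
  have idx: "?\<tau> \<kappa> < l a \<longleftrightarrow> E (fst \<kappa>) \<le> a" if "\<kappa> \<in> ?VI" "a < e" for \<kappa> a
    using jump_index[OF mono jp, of "fst \<kappa>" "snd \<kappa>" a] that by (simp add: case_prod_beta)
  have E: "E (fst \<kappa>) < e" if "\<kappa> \<in> ?VI" for \<kappa> using J that by (auto simp: var_indices_def)
  have lt: "i < t" if "i < l a" "a \<le> e" for i a using mono[of a e] le that by simp
  have tau: "?\<tau> \<kappa> < t" if "\<kappa> \<in> ?VI" for \<kappa> using lt idx[OF that E[OF that]] E[OF that] by simp
  have small: "\<exists>a<e. i < l a \<and> p ^ a dvd J i" if J: "J \<in> ?B" and i: "i < t" "J i \<noteq> 0" for J i
  proof -
    obtain a where a: "a \<le> e" "i < l a" "p ^ a dvd J i" using J i by blast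
    have "J i \<le> ?q" using le_multi_deg[OF i(1), of J] J by (simp add: MI_def)
    then have "\<not> ?q dvd J i" using J i dvd_imp_le[of ?q "J i"] by auto
    then have "a < e" using a le_neq_implies_less by blast
    then show ?thesis using a by blast
  qed
  have zero: "J i = 0" if J: "J \<in> ?B" and i: "i \<notin> {i. \<exists>a<e. i < l a}" for J i
    using small[OF J, of i] i J by (cases "i < t") (auto simp: MI_def multi_indices_def)
  have eq: "?G = ?A \<union> ?B"
  proof (intro equalityI subsetI)
    fix J assume "J \<in> ?G"
    then show "J \<in> ?A \<union> ?B"
    proof (cases "\<exists>i<t. J i = ?q")
      case True
      then obtain i where i: "i < t" "J i = ?q" by blast
      then have "J = single_index i ?q" using MI_full_exponent \<open>J \<in> ?G\<close> by blast
      moreover obtain a where "a \<le> e" "i < l a" using \<open>J \<in> ?G\<close> i q by fastforce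
      then have "i < l e" using mono[of a e] by simp
      ultimately show ?thesis by blast
    qed blast
  next
    fix J assume "J \<in> ?A \<union> ?B"
    then show "J \<in> ?G"
    proof
      assume "J \<in> ?A"
      then obtain i where "i < l e" "J = single_index i ?q" by blast
      then show ?thesis using single_index_MI[of i t ?q] lt by (auto simp: single_index_def)
    qed blast
  qed
  have disj: "?A \<inter> ?B = {}"
  proof (rule ccontr)
    assume "?A \<inter> ?B \<noteq> {}"
    then obtain J where JJ: "J \<in> ?A" "J \<in> ?B" by auto
    then obtain i where i: "i < l e" "J = single_index i ?q" by (elim imageE) simp
    have "\<forall>i<t. J i \<noteq> ?q" using JJ(2) by simp
    then have "J i \<noteq> ?q" using lt[OF i(1) order_refl] by simp
    then show False unfolding i(2) by (simp add: single_index_def)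
  qed
  have fin: "finite ?G" using MI_finite by simp
  have "inj_on (\<lambda>i. single_index i ?q) {..<l e}" using single_index_inj[OF q] by (auto simp: inj_on_def)
  then have cA: "card ?A = l e" by (simp add: card_image)
  have injB: "inj_on ?\<Phi> ?B"
  proof (rule inj_onI)
    fix J J' assume J: "J \<in> ?B" "J' \<in> ?B" "?\<Phi> J = ?\<Phi> J'"
    show "J = J'"
    proof
      fix i show "J i = J' i"
      proof (cases "i \<in> {i. \<exists>a<e. i < l a}")
        case True
        then obtain \<kappa> where k: "\<kappa> \<in> ?VI" "i = ?\<tau> \<kappa>" using bij unfolding bij_betw_def by blast
        have "Poly_Mapping.lookup (?\<Phi> J) \<kappa> = Poly_Mapping.lookup (?\<Phi> J') \<kappa>" using J(3) by simp
        then show ?thesis using k by (simp add: lookup_sum_single[OF finite_var_indices])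
      next
        case False
        then show ?thesis using zero[OF J(1)] zero[OF J(2)] by simp
      qed
    qed
  qed
  have degB: "multi_deg t J = (\<Sum>\<kappa>\<in>?VI. J (?\<tau> \<kappa>))" if z: "\<And>i. i \<notin> {i. \<exists>a<e. i < l a} \<Longrightarrow> J i = 0" for J
  proof -
    have "multi_deg t J = (\<Sum>i\<in>{i. \<exists>a<e. i < l a}. J i)"
      unfolding multi_deg_def by (rule sum.mono_neutral_right) (use lt z in auto)
    then show ?thesis using sum.reindex_bij_betw[OF bij, of J] by simp
  qed
  have mm: "mixed_monomials p l e K E = {\<Sum>\<kappa>\<in>?VI. Poly_Mapping.single \<kappa> (p ^ E (fst \<kappa>) * b \<kappa>) | b.
      (\<Sum>\<kappa>\<in>?VI. p ^ E (fst \<kappa>) * b \<kappa>) = ?q \<and> (\<forall>\<kappa>\<in>?VI. p ^ E (fst \<kappa>) * b \<kappa> \<noteq> ?q)}"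
    unfolding mixed_monomials_def case_prod_beta by simp
  have "mixed_monomials p l e K E = ?\<Phi> ` ?B"
  proof (intro equalityI subsetI)
    fix M assume "M \<in> mixed_monomials p l e K E"
    then obtain b where b: "M = (\<Sum>\<kappa>\<in>?VI. Poly_Mapping.single \<kappa> (p ^ E (fst \<kappa>) * b \<kappa>))"
      "(\<Sum>\<kappa>\<in>?VI. p ^ E (fst \<kappa>) * b \<kappa>) = ?q" "\<forall>\<kappa>\<in>?VI. p ^ E (fst \<kappa>) * b \<kappa> \<noteq> ?q" unfolding mm by blast
    \<comment> \<open>Transports the exponents back along the numbering; an index that numbers no
      variable gets exponent 0.\<close>
    define J where "J = (\<lambda>i. if \<exists>a<e. i < l a then let \<kappa> = inv_into ?VI ?\<tau> i in p ^ E (fst \<kappa>) * b \<kappa> else 0)"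
    have J\<tau>: "J (?\<tau> \<kappa>) = p ^ E (fst \<kappa>) * b \<kappa>" if k: "\<kappa> \<in> ?VI" for \<kappa>
    proof -
      have "inv_into ?VI ?\<tau> (?\<tau> \<kappa>) = \<kappa>" using bij k by (intro inv_into_f_f) (auto simp: bij_betw_def)
      moreover have "\<exists>a<e. ?\<tau> \<kappa> < l a" using idx[OF k E[OF k]] E[OF k] by auto
      ultimately show ?thesis unfolding J_def Let_def by simp
    qed
    have J0: "J i = 0" if "i \<notin> {i. \<exists>a<e. i < l a}" for i using that by (auto simp: J_def Let_def)
    have "multi_deg t J = ?q" using degB[OF J0] b(2) J\<tau> by simp
    moreover have "J \<in> multi_indices t" unfolding multi_indices_def
    proof (intro CollectI allI impI)
      fix i assume "t \<le> i"
      then have "i \<notin> {i. \<exists>a<e. i < l a}" using lt[of i] less_imp_le not_le by blast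
      then show "J i = 0" by (rule J0)
    qed
    ultimately have MI: "J \<in> MI t ?q" by (simp add: MI_def)
    have h: "(\<exists>a\<le>e. i < l a \<and> p ^ a dvd J i) \<and> J i \<noteq> ?q" if i: "J i \<noteq> 0" for i
    proof -
      obtain \<kappa> where k: "\<kappa> \<in> ?VI" "i = ?\<tau> \<kappa>" using J0[of i] i bij unfolding bij_betw_def by blast
      then show ?thesis using J\<tau>[OF k(1)] b(3) idx[OF k(1) E[OF k(1)]] E[OF k(1)] by (auto intro!: exI[of _ "E (fst \<kappa>)"])
    qed
    have "\<forall>i<t. J i \<noteq> ?q"
    proof (intro allI impI)
      fix i show "J i \<noteq> ?q" using h[of i] q by (cases "J i = 0") auto
    qed
    then have "J \<in> ?B" using MI h by simp
    moreover have "M = ?\<Phi> J" using b(1) J\<tau> by simp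
    ultimately show "M \<in> ?\<Phi> ` ?B" by blast
  next
    fix M assume "M \<in> ?\<Phi> ` ?B"
    then obtain J where J: "J \<in> ?B" "M = ?\<Phi> J" by blast
    \<comment> \<open>The division is exact: a nonzero entry is divisible by some \<open>p^a\<close>
      with its index below \<open>l a\<close>, and then its jump place is at most
      \<open>a\<close>.\<close>
    let ?b = "\<lambda>\<kappa>. J (?\<tau> \<kappa>) div p ^ E (fst \<kappa>)"
    have b: "p ^ E (fst \<kappa>) * ?b \<kappa> = J (?\<tau> \<kappa>)" if k: "\<kappa> \<in> ?VI" for \<kappa>
    proof (cases "J (?\<tau> \<kappa>) = 0")
      case False
      then obtain a where a: "a < e" "?\<tau> \<kappa> < l a" "p ^ a dvd J (?\<tau> \<kappa>)" using small[OF J(1) tau[OF k]] by blast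
      then have "p ^ E (fst \<kappa>) dvd J (?\<tau> \<kappa>)" using idx[OF k a(1)] le_imp_power_dvd dvd_trans by blast
      then show ?thesis by simp
    qed simp
    have "(\<Sum>\<kappa>\<in>?VI. p ^ E (fst \<kappa>) * ?b \<kappa>) = (\<Sum>\<kappa>\<in>?VI. J (?\<tau> \<kappa>))" by (rule sum.cong[OF refl b])
    also have "\<dots> = ?q" using degB[of J] zero[OF J(1)] J(1) by (simp add: MI_def)
    finally have 1: "(\<Sum>\<kappa>\<in>?VI. p ^ E (fst \<kappa>) * ?b \<kappa>) = ?q" .
    have 2: "\<forall>\<kappa>\<in>?VI. p ^ E (fst \<kappa>) * ?b \<kappa> \<noteq> ?q"
    proof
      fix \<kappa> assume k: "\<kappa> \<in> ?VI"
      show "p ^ E (fst \<kappa>) * ?b \<kappa> \<noteq> ?q" unfolding b[OF k] using J(1) tau[OF k] by blast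
    qed
    have 3: "M = (\<Sum>\<kappa>\<in>?VI. Poly_Mapping.single \<kappa> (p ^ E (fst \<kappa>) * ?b \<kappa>))"
      unfolding J(2) by (rule sum.cong[OF refl]) (simp only: b)
    show "M \<in> mixed_monomials p l e K E" unfolding mm by (intro CollectI exI[of _ ?b] conjI 1 2 3)
  qed
  then have cB: "card ?B = l_mixed p l e K E" using card_image[OF injB] by (simp add: l_mixed_def)
  have "finite ?A" "finite ?B" using fin eq finite_Un by (metis (lifting))+
  then have "card (?A \<union> ?B) = card ?A + card ?B" using disj by (rule card_Un_disjoint)
  then show ?thesis unfolding eq[symmetric] cA cB .
qed

text \<open>For \<open>e = 0\<close> there are no jump places and no variables, and the empty
  exponent sum is 0, not \<open>p^0 = 1\<close>.\<close>

lemma l_mixed_0: "l_mixed p l 0 K E = 0" if "jump_places l 0 K E"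
proof -
  have "K = 0" using that by (cases K) (auto simp: jump_places_def)
  then have "mixed_monomials p l 0 K E = {}" by (simp add: mixed_monomials_def var_indices_def)
  then show ?thesis by (simp add: l_mixed_def)
qed

section \<open>Ideals of the local ring described by numerators\<close>

section \<open>Local rings\<close>

lemma ring_on_simps:
  "carrier (ring_on A) = A" "x \<oplus>\<^bsub>ring_on A\<^esub> y = x + y" "x \<otimes>\<^bsub>ring_on A\<^esub> y = x * y" "\<zero>\<^bsub>ring_on A\<^esub> = 0" "\<one>\<^bsub>ring_on A\<^esub> = 1"
  by (simp_all add: ring_on_def)

lemma cring_ring_on:
  assumes "is_subring A"
  shows "cring (ring_on A)"
proof (rule cringI)
  show "abelian_group (ring_on A)"
  proof (rule abelian_groupI)
    fix x assume "x \<in> carrier (ring_on A)"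
    then show "\<exists>y\<in>carrier (ring_on A). y \<oplus>\<^bsub>ring_on A\<^esub> x = \<zero>\<^bsub>ring_on A\<^esub>"
      using is_subringD[OF assms] by (intro bexI[of _ "- x"]) (auto simp: ring_on_simps)
  qed (auto simp: ring_on_simps is_subringD[OF assms] add_ac)
  show "comm_monoid (ring_on A)"
    by (rule comm_monoidI) (auto simp: ring_on_simps is_subringD[OF assms] mult_ac)
qed (simp add: ring_on_simps distrib_right)

lemma ideal_ring_on_iff:
  assumes A: "is_subring A"
  shows "ideal I (ring_on A) \<longleftrightarrow> I \<subseteq> A \<and> 0 \<in> I \<and> (\<forall>a\<in>I. \<forall>b\<in>I. a + b \<in> I) \<and> (\<forall>r\<in>A. \<forall>a\<in>I. r * a \<in> I)"
proof
  assume I: "ideal I (ring_on A)"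
  have a: "additive_subgroup I (ring_on A)" by (rule ideal.axioms(1)[OF I])
  show "I \<subseteq> A \<and> 0 \<in> I \<and> (\<forall>a\<in>I. \<forall>b\<in>I. a + b \<in> I) \<and> (\<forall>r\<in>A. \<forall>a\<in>I. r * a \<in> I)"
    using additive_subgroup.a_subset[OF a] additive_subgroup.zero_closed[OF a] additive_subgroup.a_closed[OF a]
      ideal.I_l_closed[OF I] by (simp add: ring_on_simps)
next
  assume I: "I \<subseteq> A \<and> 0 \<in> I \<and> (\<forall>a\<in>I. \<forall>b\<in>I. a + b \<in> I) \<and> (\<forall>r\<in>A. \<forall>a\<in>I. r * a \<in> I)"
  interpret cring "ring_on A" by (rule cring_ring_on[OF A])
  have neg: "- x \<in> I" if "x \<in> I" for x
  proof -
    have "- 1 \<in> A" using is_subringD[OF A] by blast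
    then have "- 1 * x \<in> I" using I that by blast
    then show ?thesis by simp
  qed
  show "ideal I (ring_on A)"
  proof (rule idealI)
    show "subgroup I (add_monoid (ring_on A))"
    proof
      fix x assume x: "x \<in> I"
      have "\<ominus>\<^bsub>ring_on A\<^esub> x = - x"
        by (rule minus_equality) (use x neg I in \<open>auto simp: ring_on_simps\<close>)
      then show "inv\<^bsub>add_monoid (ring_on A)\<^esub> x \<in> I" using neg[OF x] by (simp add: a_inv_def)
    qed (use I in \<open>auto simp: ring_on_simps\<close>)
  next
    fix a x assume "a \<in> I" "x \<in> carrier (ring_on A)"
    then have ax: "x * a \<in> I" using I by (simp add: ring_on_simps)
    then show "x \<otimes>\<^bsub>ring_on A\<^esub> a \<in> I" by (simp add: ring_on_simps)
    show "a \<otimes>\<^bsub>ring_on A\<^esub> x \<in> I" using ax by (simp add: ring_on_simps mult.commute)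
  qed (rule ring_axioms)
qed

lemma is_subring_UNIV: "is_subring UNIV" by (simp add: is_subring_def)

lemma ideal_UNIV_iff: "ideal I (ring_on UNIV) \<longleftrightarrow> is_ideal I"
  by (simp add: ideal_ring_on_iff[OF is_subring_UNIV] is_ideal_def)

lemma primeideal_UNIV_iff: "primeideal I (ring_on UNIV) \<longleftrightarrow> is_prime I"
proof
  assume I: "primeideal I (ring_on UNIV)"
  have id: "is_ideal I" using primeideal.axioms(1)[OF I] by (simp add: ideal_UNIV_iff)
  have "1 \<notin> I"
  proof
    assume "1 \<in> I"
    then have "x * 1 \<in> I" for x by (rule is_idealD(3)[OF id])
    then show False using primeideal.I_notcarr[OF I] by (auto simp: ring_on_simps)
  qed
  then show "is_prime I" using id primeideal.I_prime[OF I] by (simp add: is_prime_def ring_on_simps)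
next
  assume I: "is_prime I"
  show "primeideal I (ring_on UNIV)"
    by (rule primeidealI) (use I cring_ring_on[OF is_subring_UNIV] in \<open>auto simp: is_prime_def ideal_UNIV_iff ring_on_simps\<close>)
qed

lemma to_frac_simps [simp]:
  "to_frac 0 = 0" "to_frac 1 = 1" "to_frac (f + g) = to_frac f + to_frac g" "to_frac (f - g) = to_frac f - to_frac g"
  "to_frac (f * g) = to_frac f * to_frac g" "to_frac (- f) = - to_frac f"
  by (simp_all add: to_frac_def fract_collapse)

lemma to_frac_power [simp]: "to_frac (f ^ n) = to_frac f ^ n" by (induction n) simp_all

lemma to_frac_sum: "to_frac (sum f S) = (\<Sum>x\<in>S. to_frac (f x))"
  by (induction S rule: infinite_finite_induct) simp_all

lemma to_frac_prod: "to_frac (prod f S) = (\<Prod>x\<in>S. to_frac (f x))"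
  by (induction S rule: infinite_finite_induct) simp_all

definition loc :: "'r::idom set \<Rightarrow> 'r fract set" where
  "loc P = {Fraction_Field.Fract a b | a b. b \<notin> P}"

text \<open>The \<open>n\<close>-th power of the maximal ideal of the local ring, with numerators
  taken in \<open>R\<close>.\<close>

definition lm :: "'r::idom set \<Rightarrow> nat \<Rightarrow> 'r fract set" where
  "lm P n = {Fraction_Field.Fract a b | a b. a \<in> ipow P n \<and> b \<notin> P}"

lemma lmI: "a \<in> ipow P n \<Longrightarrow> b \<notin> P \<Longrightarrow> Fraction_Field.Fract a b \<in> lm P n"
  unfolding lm_def by blast

lemma lmE:
  assumes "f \<in> lm P n" obtains a b where "f = Fraction_Field.Fract a b" "a \<in> ipow P n" "b \<notin> P"
  using assms unfolding lm_def by blast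

lemma lm_0: "lm P 0 = loc P" by (simp add: lm_def loc_def)

lemma lm_antimono: "k \<le> n \<Longrightarrow> lm P n \<subseteq> lm P k"
  unfolding lm_def using ipow_antimono[of k n P] by blast

lemma lm_loc: "lm P n \<subseteq> loc P" using lm_antimono[of 0 n P] by (simp add: lm_0)

lemma local_ring_loc: "local_ring P = ring_on (loc P)" by (simp add: local_ring_def loc_def)

context
  fixes P :: "'r::idom set"
  assumes P: "is_prime P"
begin

lemma not_in_prime: "b \<notin> P \<Longrightarrow> b \<noteq> 0" "1 \<notin> P" "b \<notin> P \<Longrightarrow> b' \<notin> P \<Longrightarrow> b * b' \<notin> P"
  using is_primeD[OF P] is_idealD(1) by blast+

lemma lm_add:
  assumes "f \<in> lm P n" "g \<in> lm P n"
  shows "f + g \<in> lm P n"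
proof -
  obtain a b where f: "f = Fraction_Field.Fract a b" "a \<in> ipow P n" "b \<notin> P" using assms(1) by (rule lmE)
  obtain c d where g: "g = Fraction_Field.Fract c d" "c \<in> ipow P n" "d \<notin> P" using assms(2) by (rule lmE)
  have "f + g = Fraction_Field.Fract (a * d + c * b) (b * d)" using f g not_in_prime(1) by simp
  moreover have "a * d + c * b \<in> ipow P n" using f g by (intro ipowD)
  ultimately show ?thesis using lmI not_in_prime(3)[OF f(3) g(3)] by simp
qed

lemma lm_mult:
  assumes "f \<in> lm P k" "g \<in> lm P n"
  shows "f * g \<in> lm P (k + n)"
proof -
  obtain a b where f: "f = Fraction_Field.Fract a b" "a \<in> ipow P k" "b \<notin> P" using assms(1) by (rule lmE)
  obtain c d where g: "g = Fraction_Field.Fract c d" "c \<in> ipow P n" "d \<notin> P" using assms(2) by (rule lmE)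
  have "f * g = Fraction_Field.Fract (a * c) (b * d)" using f g by simp
  then show ?thesis using lmI[OF ipow_mult[OF f(2) g(2)] not_in_prime(3)[OF f(3) g(3)]] by simp
qed

lemma lm_to_frac: "a \<in> ipow P n \<Longrightarrow> to_frac a \<in> lm P n"
  unfolding to_frac_def by (rule lmI) (use not_in_prime in auto)

lemma to_frac_loc: "to_frac a \<in> loc P"
  unfolding to_frac_def loc_def using not_in_prime(2) by blast

lemma lm_zero: "0 \<in> lm P n" using lm_to_frac[OF ipowD(1), of n] by simp

lemma lm_loc_mult: "r \<in> loc P \<Longrightarrow> f \<in> lm P n \<Longrightarrow> r * f \<in> lm P n"
  using lm_mult[of r 0 f n] by (simp add: lm_0)

lemma lm_uminus: "f \<in> lm P n \<Longrightarrow> - f \<in> lm P n"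
  using lm_loc_mult[OF to_frac_loc[of "- 1"], of f n] by simp

lemma lm_diff: "f \<in> lm P n \<Longrightarrow> g \<in> lm P n \<Longrightarrow> f - g \<in> lm P n"
  using lm_add[of f n "- g"] lm_uminus[of g n] by simp

lemma lm_sum: "(\<And>x. x \<in> S \<Longrightarrow> f x \<in> lm P n) \<Longrightarrow> sum f S \<in> lm P n"
  by (induction S rule: infinite_finite_induct) (auto intro: lm_zero lm_add)

lemma is_subring_loc: "is_subring (loc P)"
  unfolding is_subring_def
  using lm_zero[of 0] to_frac_loc[of 1] lm_add[of _ 0] lm_mult[of _ 0 _ 0] lm_uminus[of _ 0] by (simp add: lm_0)

lemma lm_power_diff:
  assumes "f \<in> loc P" "g \<in> loc P" "f - g \<in> lm P n"
  shows "f ^ q - g ^ q \<in> lm P n"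
proof (induction q)
  case (Suc q)
  have "g ^ q \<in> loc P" by (rule is_subring_power[OF is_subring_loc assms(2)])
  then have "f * (f ^ q - g ^ q) + g ^ q * (f - g) \<in> lm P n" by (intro lm_add lm_loc_mult assms Suc)
  then show ?case by (simp add: algebra_simps)
qed (simp add: lm_zero)

lemma cring_local: "cring (local_ring P)"
  unfolding local_ring_loc by (rule cring_ring_on[OF is_subring_loc])

lemma carrier_local: "carrier (local_ring P) = loc P" by (simp add: local_ring_loc ring_on_simps)

lemma ideal_local_iff:
  "ideal I (local_ring P) \<longleftrightarrow> I \<subseteq> loc P \<and> 0 \<in> I \<and> (\<forall>a\<in>I. \<forall>b\<in>I. a + b \<in> I) \<and> (\<forall>r\<in>loc P. \<forall>a\<in>I. r * a \<in> I)"
  unfolding local_ring_loc by (rule ideal_ring_on_iff[OF is_subring_loc])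

lemma ideal_localD:
  assumes "ideal I (local_ring P)"
  shows "a \<in> I \<Longrightarrow> a \<in> loc P" "0 \<in> I" "a \<in> I \<Longrightarrow> b \<in> I \<Longrightarrow> a + b \<in> I" "r \<in> loc P \<Longrightarrow> a \<in> I \<Longrightarrow> r * a \<in> I"
  using assms[unfolded ideal_local_iff] by auto

lemma ideal_lm: "ideal (lm P n) (local_ring P)"
  unfolding ideal_local_iff using lm_loc lm_zero lm_add lm_loc_mult by blast

lemma local_max_lm: "local_max P = lm P 1"
  using ipow_Suc_0[OF is_primeD(1)[OF P]] by (simp add: local_max_def lm_def)

lemma local_max_pow_lm: "local_max_pow P n = lm P n"
proof (induction n)
  case 0
  show ?case by (simp add: local_max_pow_def nat_pow_def ideals_set_def lm_0 carrier_local)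
next
  case (Suc n)
  let ?I = "ideal_prod (local_ring P) (lm P n) (lm P 1)"
  have prod: "f * g \<in> ?I" if "f \<in> lm P n" "g \<in> lm P 1" for f g
    using ideal_prod.prod[OF that, of "local_ring P"] by (simp add: local_ring_loc ring_on_simps)
  have add: "f + g \<in> ?I" if "f \<in> ?I" "g \<in> ?I" for f g
    using ideal_prod.sum[OF that] by (simp add: local_ring_loc ring_on_simps)
  have "local_max_pow P (Suc n) = ?I"
    using Suc by (simp add: local_max_pow_def nat_pow_def ideals_set_def local_max_lm)
  also have "?I = lm P (Suc n)"
  proof (intro equalityI subsetI)
    fix f assume "f \<in> ?I"
    then show "f \<in> lm P (Suc n)"
    proof (induction rule: ideal_prod.induct)
      case (prod i j)
      then show ?case using lm_mult[of i n j 1] by (simp add: local_ring_loc ring_on_simps)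
    next
      case (sum s1 s2)
      then show ?case using lm_add by (simp add: local_ring_loc ring_on_simps)
    qed
  next
    fix f assume "f \<in> lm P (Suc n)"
    then obtain a b where f: "f = Fraction_Field.Fract a b" "a \<in> ipow P (Suc n)" "b \<notin> P" by (rule lmE)
    from f(2) have "a \<in> iprod P (ipow P n)" by (simp add: ipow.simps)
    then have "Fraction_Field.Fract a b \<in> ?I"
    proof (induction a rule: iprod.induct)
      case zero
      then show ?case using prod[OF lm_zero lm_zero] by (simp add: fract_collapse)
    next
      case (step x y c)
      have "Fraction_Field.Fract y b * to_frac x \<in> ?I"
        using step f(3) by (intro prod lmI lm_to_frac) (auto simp: ipow_Suc_0[OF is_primeD(1)[OF P]])
      moreover have "Fraction_Field.Fract (x * y + c) b = Fraction_Field.Fract y b * to_frac x + Fraction_Field.Fract c b"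
        using not_in_prime(1)[OF f(3)] by (simp add: to_frac_def eq_fract algebra_simps)
      ultimately show ?case using step add by simp
    qed
    then show "f \<in> ?I" using f(1) by simp
  qed
  finally show ?case .
qed

lemma contraction_prime:
  assumes C: "primeideal C (local_ring P)"
  shows "primeideal (to_frac -` C) (ring_on UNIV)"
  unfolding primeideal_UNIV_iff is_prime_def is_ideal_def
proof (intro conjI)
  have id: "ideal C (local_ring P)" by (rule primeideal.axioms(1)[OF C])
  note I = id[unfolded ideal_local_iff]
  show "0 \<in> to_frac -` C" "\<forall>a\<in>to_frac -` C. \<forall>b\<in>to_frac -` C. a + b \<in> to_frac -` C"
    "\<forall>r. \<forall>a\<in>to_frac -` C. r * a \<in> to_frac -` C" using I to_frac_loc by auto
  show "1 \<notin> to_frac -` C"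
  proof
    assume "1 \<in> to_frac -` C"
    then have "r * 1 \<in> C" if "r \<in> loc P" for r using I that by (metis to_frac_simps(2) vimageD)
    then have "loc P \<subseteq> C" by auto
    then show False using primeideal.I_notcarr[OF C] I carrier_local by blast
  qed
  show "\<forall>a b. a * b \<in> to_frac -` C \<longrightarrow> a \<in> to_frac -` C \<or> b \<in> to_frac -` C"
    using primeideal.I_prime[OF C] to_frac_loc by (auto simp: local_ring_loc ring_on_simps)
qed

text \<open>An element and its numerator differ by a unit of the local ring, so numerators already
  separate the contractions.\<close>

lemma contraction_strict:
  assumes C: "ideal C (local_ring P)" "ideal C' (local_ring P)" and sub: "C \<subset> C'"
  shows "to_frac -` C \<subset> to_frac -` C'"
proof -
  obtain x where x: "x \<in> C'" "x \<notin> C" using sub by blast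
  then have "x \<in> loc P" by (intro ideal_localD(1)[OF C(2)])
  then obtain a b where ab: "x = Fraction_Field.Fract a b" "b \<notin> P" by (auto simp: loc_def)
  have nz: "b \<noteq> 0" by (rule not_in_prime(1)[OF ab(2)])
  have 1: "to_frac a = to_frac b * x" "x = Fraction_Field.Fract 1 b * to_frac a"
    using ab nz by (simp_all add: to_frac_def eq_fract)
  have "to_frac a \<in> C'" unfolding 1(1) by (rule ideal_localD(4)[OF C(2) to_frac_loc x(1)])
  moreover have "to_frac a \<notin> C"
  proof
    assume "to_frac a \<in> C"
    moreover have "Fraction_Field.Fract 1 b \<in> loc P" using ab(2) by (auto simp: loc_def)
    ultimately have "Fraction_Field.Fract 1 b * to_frac a \<in> C" by (intro ideal_localD(4)[OF C(1)])
    then show False using x(2) 1(2) by simp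
  qed
  ultimately show ?thesis using sub by blast
qed

text \<open>Contraction carries strict prime chains to strict prime chains.\<close>

lemma krull_dim_local_le: "krull_dim (local_ring P) \<le> krull_dim (ring_on (UNIV :: 'r set))"
  unfolding krull_dim_def
proof (rule SUP_subset_mono[OF _ order_refl], rule subsetI)
  fix n assume "n \<in> {n. \<exists>C :: nat \<Rightarrow> 'r fract set.
       (\<forall>i\<le>n. primeideal (C i) (local_ring P)) \<and> (\<forall>i<n. C i \<subset> C (Suc i))}"
  then obtain C where C: "\<forall>i\<le>n. primeideal (C i) (local_ring P)" "\<forall>i<n. C i \<subset> C (Suc i)" by blast
  have "\<forall>i\<le>n. primeideal (to_frac -` C i) (ring_on UNIV)" using C(1) contraction_prime by blast
  moreover have "\<forall>i<n. to_frac -` C i \<subset> to_frac -` C (Suc i)"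
  proof (intro allI impI)
    fix i assume i: "i < n"
    then have "primeideal (C i) (local_ring P)" "primeideal (C (Suc i)) (local_ring P)" using C(1) by simp_all
    then show "to_frac -` C i \<subset> to_frac -` C (Suc i)"
      using C(2) i by (intro contraction_strict primeideal.axioms(1)) auto
  qed
  ultimately show "n \<in> {n. \<exists>C :: nat \<Rightarrow> 'r set.
       (\<forall>i\<le>n. primeideal (C i) (ring_on UNIV)) \<and> (\<forall>i<n. C i \<subset> C (Suc i))}"
    by (intro CollectI exI[of _ "\<lambda>i. to_frac -` C i"] conjI)
qed

lemma maximal_local: "maximalideal (local_max P) (local_ring P)"
proof (rule maximalidealI)
  show "ideal (local_max P) (local_ring P)" unfolding local_max_lm by (rule ideal_lm)
  have unit: "a \<in> P" if fab: "Fraction_Field.Fract a b \<in> local_max P" "b \<notin> P" for a b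
  proof -
    obtain c d where cd: "Fraction_Field.Fract a b = Fraction_Field.Fract c d" "c \<in> P" "d \<notin> P"
      using fab(1) unfolding local_max_def by blast
    then have "a * d = c * b" using not_in_prime(1) fab(2) by (simp add: eq_fract)
    then have "a * d \<in> P" using is_idealD(4)[OF is_primeD(1)[OF P] cd(2)] by simp
    then show ?thesis using is_primeD(3)[OF P] cd(3) by blast
  qed
  have "1 \<notin> local_max P" using unit[of 1 1] not_in_prime(2) by (auto simp: One_fract_def)
  then show "carrier (local_ring P) \<noteq> local_max P" using to_frac_loc[of 1] carrier_local by auto
  fix J assume J: "ideal J (local_ring P)" "local_max P \<subseteq> J" "J \<subseteq> carrier (local_ring P)"
  show "J = local_max P \<or> J = carrier (local_ring P)"
  proof (rule disjCI)
    assume "J \<noteq> carrier (local_ring P)"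
    show "J = local_max P"
    proof (rule ccontr)
      assume "J \<noteq> local_max P"
      then obtain x where x: "x \<in> J" "x \<notin> local_max P" using J(2) by blast
      then obtain a b where ab: "x = Fraction_Field.Fract a b" "b \<notin> P" using J(3) carrier_local by (auto simp: loc_def)
      then have a: "a \<notin> P" using x(2) unfolding local_max_def by blast
      then have inv: "Fraction_Field.Fract b a * x = 1" using ab not_in_prime(1) by (simp add: One_fract_def eq_fract)
      have "y \<in> J" if "y \<in> loc P" for y
      proof -
        have "Fraction_Field.Fract b a \<in> loc P" using a by (auto simp: loc_def)
        with that have "y * Fraction_Field.Fract b a \<in> loc P" by (rule is_subringD(4)[OF is_subring_loc])
        then have "(y * Fraction_Field.Fract b a) * x \<in> J" by (rule ideal_localD(4)[OF J(1) _ x(1)])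
        then show ?thesis using inv by (simp add: mult.assoc)
      qed
      then show False using \<open>J \<noteq> carrier (local_ring P)\<close> J(3) carrier_local by blast
    qed
  qed
qed

lemma gr_class_eq_iff:
  assumes "f \<in> loc P" "g \<in> loc P"
  shows "gr_class P n f = gr_class P n g \<longleftrightarrow> f - g \<in> lm P (Suc n)"
proof -
  have gr: "gr_class P n f = {h + f | h. h \<in> lm P (Suc n)}" for f
    unfolding gr_class_def local_max_pow_lm a_r_coset_def' by (auto simp: local_ring_loc ring_on_simps)
  show ?thesis
  proof
    assume eq: "gr_class P n f = gr_class P n g"
    have "0 + f \<in> gr_class P n f" unfolding gr using lm_zero by blast
    then obtain h where "h \<in> lm P (Suc n)" "0 + f = h + g" unfolding eq unfolding gr by blast
    then show "f - g \<in> lm P (Suc n)" by simp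
  next
    have sub: "gr_class P n f \<subseteq> gr_class P n g" if fg: "f - g \<in> lm P (Suc n)" for f g
    proof
      fix y assume "y \<in> gr_class P n f"
      then obtain h where h: "h \<in> lm P (Suc n)" "y = h + f" unfolding gr by blast
      then have "y = (h + (f - g)) + g" "h + (f - g) \<in> lm P (Suc n)" using lm_add[OF h(1) fg] by simp_all
      then show "y \<in> gr_class P n g" unfolding gr by blast
    qed
    assume fg: "f - g \<in> lm P (Suc n)"
    then have "g - f \<in> lm P (Suc n)" using lm_uminus[OF fg] by simp
    with fg show "gr_class P n f = gr_class P n g" using sub by blast
  qed
qed

lemma gr_class_hom: "gr_class P n \<in> Ring.ring_hom (local_ring P) (jet_ring P n)"
proof -
  have "gr_class P n = a_r_coset (local_ring P) (lm P (Suc n))" by (rule ext) (simp add: gr_class_def local_max_pow_lm)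
  then show ?thesis using ideal.rcos_ring_hom[OF ideal_lm] by (simp add: jet_ring_def local_max_pow_lm)
qed

lemma ring_jet: "ring (jet_ring P n)"
  unfolding jet_ring_def local_max_pow_lm by (rule ideal.quotient_is_ring[OF ideal_lm])

lemma gr_class_simps:
  assumes "f \<in> loc P" "g \<in> loc P"
  shows "gr_class P n (f + g) = gr_class P n f \<oplus>\<^bsub>jet_ring P n\<^esub> gr_class P n g"
    "gr_class P n (f * g) = gr_class P n f \<otimes>\<^bsub>jet_ring P n\<^esub> gr_class P n g"
    "gr_class P n f \<in> carrier (jet_ring P n)"
    "gr_class P n 1 = \<one>\<^bsub>jet_ring P n\<^esub>" "gr_class P n 0 = \<zero>\<^bsub>jet_ring P n\<^esub>"
proof -
  note h = gr_class_hom[of n]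
  show "gr_class P n (f + g) = gr_class P n f \<oplus>\<^bsub>jet_ring P n\<^esub> gr_class P n g"
    "gr_class P n (f * g) = gr_class P n f \<otimes>\<^bsub>jet_ring P n\<^esub> gr_class P n g"
    "gr_class P n f \<in> carrier (jet_ring P n)" "gr_class P n 1 = \<one>\<^bsub>jet_ring P n\<^esub>"
    using ring_hom_add[OF h] ring_hom_mult[OF h] ring_hom_closed[OF h] ring_hom_one[OF h] assms
    by (simp_all add: carrier_local) (simp_all add: local_ring_loc ring_on_simps)
  have "gr_class P n (\<zero>\<^bsub>local_ring P\<^esub>) = \<zero>\<^bsub>jet_ring P n\<^esub>"
    by (rule ring_hom_zero[OF h cring.axioms(1)[OF cring_local] ring_jet])
  then show "gr_class P n 0 = \<zero>\<^bsub>jet_ring P n\<^esub>" by (simp add: local_ring_loc ring_on_simps)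
qed

lemma genideal_extension:
  assumes U: "is_ideal U"
  shows "genideal (local_ring P) (to_frac ` U) = {Fraction_Field.Fract a b | a b. a \<in> U \<and> b \<notin> P}" (is "?G = ?L")
proof
  interpret cring "local_ring P" by (rule cring_local)
  have car: "to_frac ` U \<subseteq> carrier (local_ring P)" using to_frac_loc carrier_local by blast
  show "?G \<subseteq> ?L"
  proof (rule genideal_minimal)
    show "to_frac ` U \<subseteq> ?L" unfolding to_frac_def using not_in_prime(2) by blast
    show "ideal ?L (local_ring P)"
      unfolding ideal_local_iff
    proof (intro conjI ballI)
      show "?L \<subseteq> loc P" by (auto simp: loc_def)
      have "0 = Fraction_Field.Fract 0 (1 :: 'r)" by (simp add: fract_collapse)
      then show "0 \<in> ?L" using is_idealD(1)[OF U] not_in_prime(2) by blast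
    next
      fix f g assume "f \<in> ?L" "g \<in> ?L"
      then obtain a b c d where ab: "f = Fraction_Field.Fract a b" "a \<in> U" "b \<notin> P" "g = Fraction_Field.Fract c d" "c \<in> U" "d \<notin> P"
        by blast
      then have "f + g = Fraction_Field.Fract (a * d + c * b) (b * d)" using not_in_prime(1) by simp
      moreover have "a * d + c * b \<in> U" using ab by (intro is_idealD[OF U])
      ultimately show "f + g \<in> ?L" using not_in_prime(3)[OF ab(3,6)] by blast
    next
      fix r f assume "r \<in> loc P" "f \<in> ?L"
      then obtain a b c d where ab: "f = Fraction_Field.Fract a b" "a \<in> U" "b \<notin> P" "r = Fraction_Field.Fract c d" "d \<notin> P"
        by (auto simp: loc_def)
      then have "r * f = Fraction_Field.Fract (c * a) (d * b)" by simp
      then show "r * f \<in> ?L" using is_idealD(3)[OF U ab(2)] not_in_prime(3)[OF ab(5,3)] by blast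
    qed
  qed
  show "?L \<subseteq> ?G"
  proof
    fix f assume "f \<in> ?L"
    then obtain a b where ab: "f = Fraction_Field.Fract a b" "a \<in> U" "b \<notin> P" by blast
    have "Fraction_Field.Fract 1 b \<in> loc P" using ab(3) by (auto simp: loc_def)
    moreover have "to_frac a \<in> ?G" using genideal_self[OF car] ab(2) by blast
    ultimately have "Fraction_Field.Fract 1 b * to_frac a \<in> ?G" by (rule ideal_localD(4)[OF genideal_ideal[OF car]])
    then show "f \<in> ?G" using ab(1) by (simp add: to_frac_def)
  qed
qed

end

section \<open>Jets and leading forms at a closed point, computed inside \<open>R\<close>\<close>

locale closed_point = kalg \<phi> for \<phi> :: "'k::field \<Rightarrow> 'r::idom" +
  fixes \<chi>\<^sub>0 :: "'r \<Rightarrow> 'k"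
  assumes pt: "\<chi>\<^sub>0 \<in> points"
begin

abbreviation "M \<equiv> ker \<chi>\<^sub>0"

lemma prime_M: "is_prime M" by (rule is_prime_ker[OF pt])

lemma M_iff: "f \<in> M \<longleftrightarrow> \<chi>\<^sub>0 f = 0" by (simp add: ker_def)

text \<open>The inverse of \<open>b\<close> divided by its value at the point is given by a
  truncated geometric series.\<close>

lemma unit_inverse:
  assumes b: "b \<notin> M"
  shows "\<exists>b'. b * b' - 1 \<in> ipow M n"
proof -
  let ?w = "1 - b * \<phi> (inverse (\<chi>\<^sub>0 b))"
  have "?w \<in> M" using b by (simp add: M_iff pointsD[OF pt])
  then have "?w ^ n \<in> ipow M n" by (rule ipow_power1)
  then have "- (?w ^ n) \<in> ipow M n" by (rule ipowD(5))
  moreover have "1 - ?w ^ n = (1 - ?w) * (\<Sum>i<n. ?w ^ i)" by (rule one_diff_power_eq)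
  then have "b * (\<phi> (inverse (\<chi>\<^sub>0 b)) * (\<Sum>i<n. ?w ^ i)) = 1 - ?w ^ n" by (simp add: mult.assoc)
  then have "b * (\<phi> (inverse (\<chi>\<^sub>0 b)) * (\<Sum>i<n. ?w ^ i)) - 1 = - (?w ^ n)" by (simp only:) simp
  ultimately show ?thesis by (intro exI[of _ "\<phi> (inverse (\<chi>\<^sub>0 b)) * (\<Sum>i<n. ?w ^ i)"]) (simp only:)
qed

text \<open>Modulo a power of the maximal ideal a denominator can be inverted inside
  \<open>R\<close>, uniformly in the numerator.\<close>

lemma fract_approx:
  assumes b: "b \<notin> M"
  shows "\<exists>b'. \<forall>a. Fraction_Field.Fract a b - to_frac (a * b') \<in> lm M n"
proof -
  obtain b' where b': "b * b' - 1 \<in> ipow M n" using unit_inverse[OF b] by blast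
  have "Fraction_Field.Fract a b - to_frac (a * b') \<in> lm M n" for a
  proof -
    have "- (b * b' - 1) * a \<in> ipow M n" by (intro ipowD b')
    then have "Fraction_Field.Fract (- (b * b' - 1) * a) b \<in> lm M n" by (rule lmI[OF _ b])
    moreover have "Fraction_Field.Fract a b - to_frac (a * b') = Fraction_Field.Fract (- (b * b' - 1) * a) b"
      using not_in_prime(1)[OF prime_M b] by (simp add: to_frac_def eq_fract algebra_simps)
    ultimately show ?thesis by simp
  qed
  then show ?thesis by blast
qed

text \<open>Denominators are units of \<open>R\<close> modulo every power of the maximal ideal, so
  clearing them preserves the order.\<close>

lemma to_frac_lm_iff: "to_frac h \<in> lm M n \<longleftrightarrow> h \<in> ipow M n"
proof
  assume "to_frac h \<in> lm M n"
  then obtain a b where ab: "to_frac h = Fraction_Field.Fract a b" "a \<in> ipow M n" "b \<notin> M" by (rule lmE)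
  then have hb: "h * b = a" using not_in_prime(1)[OF prime_M] by (simp add: to_frac_def eq_fract)
  obtain b' where b': "b * b' - 1 \<in> ipow M n" using unit_inverse[OF ab(3)] by blast
  have "a * b' - h * (b * b' - 1) \<in> ipow M n" by (intro ipowD ab b')
  moreover have "a * b' - h * (b * b' - 1) = h" unfolding hb[symmetric] by (simp add: algebra_simps)
  ultimately show "h \<in> ipow M n" by simp
qed (rule lm_to_frac[OF prime_M])

lemma residue: "r \<in> loc M \<Longrightarrow> \<exists>c. r - to_frac (\<phi> c) \<in> lm M 1"
proof -
  assume "r \<in> loc M"
  then obtain a b where ab: "r = Fraction_Field.Fract a b" "b \<notin> M" by (auto simp: loc_def)
  obtain b' where ap: "\<forall>a. Fraction_Field.Fract a b - to_frac (a * b') \<in> lm M 1" using fract_approx[OF ab(2)] by blast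
  then have b': "r - to_frac (a * b') \<in> lm M 1" unfolding ab(1) by (rule spec)
  have "a * b' - \<phi> (\<chi>\<^sub>0 (a * b')) \<in> ipow M 1"
    using sub_point_in_ker[OF pt] ipow_Suc_0[OF is_primeD(1)[OF prime_M]] by simp
  then have "to_frac (a * b' - \<phi> (\<chi>\<^sub>0 (a * b'))) \<in> lm M 1" by (rule lm_to_frac[OF prime_M])
  from lm_add[OF prime_M b' this] show ?thesis by (intro exI[of _ "\<chi>\<^sub>0 (a * b')"]) simp
qed

lemma value_at_eq: "f - to_frac (\<phi> c) \<in> lm M 1 \<Longrightarrow> value_at \<phi> M f = c"
  unfolding value_at_def local_max_lm[OF prime_M]
proof (rule the_equality)
  fix c' assume "f - to_frac (\<phi> c) \<in> lm M 1" "f - to_frac (\<phi> c') \<in> lm M 1"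
  then have "(f - to_frac (\<phi> c)) - (f - to_frac (\<phi> c')) \<in> lm M 1" by (rule lm_diff[OF prime_M])
  then have "to_frac (\<phi> c' - \<phi> c) \<in> lm M 1" by simp
  then have "\<phi> c' - \<phi> c \<in> M" unfolding to_frac_lm_iff using ipow_Suc_0[OF is_primeD(1)[OF prime_M]] by simp
  then show "c' = c" by (simp add: M_iff pointsD[OF pt])
qed

definition cls :: "nat \<Rightarrow> 'r \<Rightarrow> 'r fract set" where "cls n g = gr_class M n (to_frac g)"

lemma cls_eq_iff: "cls n f = cls n g \<longleftrightarrow> f - g \<in> ipow M (Suc n)"
  unfolding cls_def gr_class_eq_iff[OF prime_M to_frac_loc[OF prime_M] to_frac_loc[OF prime_M]]
  by (simp flip: to_frac_lm_iff)

lemma cls_simps: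
  "cls n (f + g) = cls n f \<oplus>\<^bsub>jet_ring M n\<^esub> cls n g" "cls n (f * g) = cls n f \<otimes>\<^bsub>jet_ring M n\<^esub> cls n g"
  "cls n f \<in> carrier (jet_ring M n)" "cls n 1 = \<one>\<^bsub>jet_ring M n\<^esub>" "cls n 0 = \<zero>\<^bsub>jet_ring M n\<^esub>"
  using gr_class_simps[OF prime_M to_frac_loc[OF prime_M, of f] to_frac_loc[OF prime_M, of g]] by (simp_all add: cls_def)

lemma subfield_jet: "subfield (range (\<lambda>c. cls n (\<phi> c))) (jet_ring M n)"
proof -
  interpret K: cring "ring_on (UNIV :: 'k set)" by (rule cring_ring_on[OF is_subring_UNIV])
  have "field (ring_on (UNIV :: 'k set))"
  proof (rule K.cring_fieldI2)
    fix a assume "a \<noteq> \<zero>\<^bsub>ring_on (UNIV :: 'k set)\<^esub>"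
    then show "\<exists>b\<in>carrier (ring_on (UNIV :: 'k set)). a \<otimes>\<^bsub>ring_on UNIV\<^esub> b = \<one>\<^bsub>ring_on UNIV\<^esub>"
      by (intro bexI[of _ "inverse a"]) (simp_all add: ring_on_simps)
  qed (simp add: ring_on_simps)
  then have sf: "subfield (UNIV :: 'k set) (ring_on UNIV)"
    using field.carrier_is_subfield by (fastforce simp: ring_on_simps)
  have "ring_hom_ring (ring_on (UNIV :: 'k set)) (jet_ring M n) (\<lambda>c. cls n (\<phi> c))"
    by (intro ring_hom_ringI2 ring_hom_memI K.ring_axioms ring_jet[OF prime_M])
      (simp_all add: ring_on_simps cls_simps hom_add hom_mult)
  from ring_hom_ring.img_is_subfield(2)[OF this sf] show ?thesis
    using cls_eq_iff[of n 1 0] ipow_antimono[of 1 "Suc n" M] ipow_Suc_0[OF is_primeD(1)[OF prime_M]] not_in_prime(2)[OF prime_M]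
    by (auto simp flip: cls_simps)
qed

lemma combine_cls:
  "ring.combine (jet_ring M n) (map (\<lambda>j. cls n (\<phi> (c j))) js) (map (\<lambda>j. cls n (b j)) js) = cls n (\<Sum>j\<leftarrow>js. \<phi> (c j) * b j)"
  by (induction js) (simp_all add: ring.combine.simps[OF ring_jet[OF prime_M]] cls_simps)

lemma ex_map_distinct: "distinct js \<Longrightarrow> length cs = length js \<Longrightarrow> \<exists>c. cs = map c js"
proof (induction js arbitrary: cs)
  case (Cons j js)
  then obtain x cs' where cs: "cs = x # cs'" "length cs' = length js" by (cases cs) auto
  then obtain c where "cs' = map c js" using Cons by auto
  then have "cs = map (c(j := x)) (j # js)" using cs Cons.prems(1) by auto
  then show ?case by blast
qed simp

text \<open>The family maps to a basis of its image in the jet ring over the constants; it is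
  arranged as a list so that span and independence become statements on combinations of
  lists.\<close>

lemma k_dim_fspan:
  assumes A: "finite A" and ind: "\<And>c. (\<Sum>j\<in>A. \<phi> (c j) * b j) \<in> ipow M (Suc n) \<Longrightarrow> \<forall>j\<in>A. c j = 0"
  shows "k_dim \<phi> M n (cls n ` fspan b A (ipow M (Suc n))) = card A"
proof -
  interpret J: ring "jet_ring M n" by (rule ring_jet[OF prime_M])
  let ?K = "range (\<lambda>c. cls n (\<phi> c))" and ?S = "fspan b A (ipow M (Suc n))"
  note sf = subfield_jet[of n]
  obtain js where js: "set js = A" "distinct js" using finite_distinct_list[OF A] by blast
  let ?Us = "map (\<lambda>j. cls n (b j)) js"
  have Us: "set ?Us \<subseteq> carrier (jet_ring M n)" using cls_simps(3) by auto
  have sum: "(\<Sum>j\<leftarrow>js. \<phi> (c j) * b j) = (\<Sum>j\<in>A. \<phi> (c j) * b j)" for c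
    using sum_list_distinct_conv_sum_set[OF js(2), of "\<lambda>j. \<phi> (c j) * b j"] js(1) by simp
  have coeffs: "\<exists>c. Ks = map (\<lambda>j. cls n (\<phi> (c j))) js" if Ks: "set Ks \<subseteq> ?K" "length Ks = length js" for Ks
  proof -
    have "\<forall>y\<in>set Ks. \<exists>c. y = cls n (\<phi> c)" using Ks(1) by blast
    then obtain cs where cs: "Ks = map (\<lambda>c. cls n (\<phi> c)) cs" using ex_map_conv[of Ks "\<lambda>c. cls n (\<phi> c)"] by blast
    then obtain c where "cs = map c js" using ex_map_distinct[OF js(2), of cs] Ks(2) by auto
    then show ?thesis using cs by (intro exI[of _ c]) simp
  qed
  have "J.Span ?K ?Us = cls n ` ?S"
  proof (intro equalityI subsetI)
    fix y assume "y \<in> J.Span ?K ?Us"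
    then obtain Ks where Ks: "set Ks \<subseteq> ?K" "length Ks = length ?Us" "y = J.combine Ks ?Us"
      unfolding J.Span_mem_iff_length_version[OF sf Us] by blast
    obtain c where c: "Ks = map (\<lambda>j. cls n (\<phi> (c j))) js" using coeffs[OF Ks(1)] Ks(2) by auto
    have "y = cls n (\<Sum>j\<in>A. \<phi> (c j) * b j)" unfolding Ks(3) c combine_cls sum ..
    moreover have "(\<Sum>j\<in>A. \<phi> (c j) * b j) \<in> ?S" unfolding fspan_def by (auto intro!: exI[of _ c] ipowD(1))
    ultimately show "y \<in> cls n ` ?S" by blast
  next
    fix y assume "y \<in> cls n ` ?S"
    then obtain g c where g: "y = cls n g" "g - (\<Sum>j\<in>A. \<phi> (c j) * b j) \<in> ipow M (Suc n)" unfolding fspan_def by blast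
    then have "y = J.combine (map (\<lambda>j. cls n (\<phi> (c j))) js) ?Us" unfolding combine_cls sum by (simp add: cls_eq_iff)
    then show "y \<in> J.Span ?K ?Us" unfolding J.Span_mem_iff_length_version[OF sf Us]
      by (intro exI[of _ "map (\<lambda>j. cls n (\<phi> (c j))) js"]) auto
  qed
  moreover have "J.independent ?K ?Us"
  proof (rule J.trivial_combine_imp_independent[OF sf Us])
    fix Ks assume Ks: "set Ks \<subseteq> ?K" "J.combine Ks ?Us = \<zero>\<^bsub>jet_ring M n\<^esub>"
    \<comment> \<open>A list of coefficients may be shorter or longer than the family; it is cut and
      padded with zeros before its entries are read off.\<close>
    obtain Ks' where Ks': "set (take (length ?Us) Ks) \<subseteq> set Ks'" "set Ks' \<subseteq> set (take (length ?Us) Ks) \<union> {\<zero>\<^bsub>jet_ring M n\<^esub>}"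
      "length Ks' = length ?Us" "J.combine Ks' ?Us = \<zero>\<^bsub>jet_ring M n\<^esub>"
      by (rule J.combine_normalize[of Ks ?Us "\<zero>\<^bsub>jet_ring M n\<^esub>"]) (use Ks Us cls_simps(3) in auto)
    have "\<zero>\<^bsub>jet_ring M n\<^esub> \<in> ?K" by (intro range_eqI[of _ _ 0]) (simp add: cls_simps)
    then have "set Ks' \<subseteq> ?K" using Ks'(2) Ks(1) set_take_subset[of "length ?Us" Ks] by blast
    then obtain c where c: "Ks' = map (\<lambda>j. cls n (\<phi> (c j))) js" using coeffs[of Ks'] Ks'(3) by auto
    then have "cls n (\<Sum>j\<in>A. \<phi> (c j) * b j) = cls n 0" using Ks'(4) by (simp add: combine_cls sum cls_simps)
    then have "\<forall>j\<in>A. c j = 0" using ind unfolding cls_eq_iff by simp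
    then have "set Ks' \<subseteq> {\<zero>\<^bsub>jet_ring M n\<^esub>}" using js(1) by (auto simp: c cls_simps)
    then show "set (take (length ?Us) Ks) \<subseteq> {\<zero>\<^bsub>jet_ring M n\<^esub>}" using Ks'(1) by blast
  qed
  ultimately have "J.dimension (length ?Us) ?K (cls n ` ?S)" using J.dimensionI[OF sf, of ?Us] by simp
  then have "J.dim ?K (cls n ` ?S) = length js" using J.dimI[OF sf] by (simp add: over_def)
  then show ?thesis using js distinct_card[OF js(2)] by (simp add: k_dim_def cls_def[symmetric])
qed

text \<open>Fractions are replaced by elements of \<open>R\<close> with the same class, using an
  inverse of the denominator modulo the next power.\<close>

lemma leading_eq:
  assumes U: "is_ideal (level \<II> (real n))"
  shows "leading M \<II> n = cls n ` {g \<in> ipow M n. \<exists>f\<in>level \<II> (real n). f - g \<in> ipow M (Suc n)}"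
proof (intro equalityI subsetI)
  fix y assume "y \<in> leading M \<II> n"
  then obtain f where f: "y = gr_class M n f" "f \<in> genideal (local_ring M) (to_frac ` level \<II> (real n))" "f \<in> lm M n"
    unfolding leading_def localized_filtration_def local_max_pow_lm[OF prime_M] by blast
  then obtain a b where ab: "f = Fraction_Field.Fract a b" "a \<in> level \<II> (real n)" "b \<notin> M"
    unfolding genideal_extension[OF prime_M U] by blast
  obtain b' where ap: "\<forall>a. Fraction_Field.Fract a b - to_frac (a * b') \<in> lm M (Suc n)" using fract_approx[OF ab(3)] by blast
  then have b': "f - to_frac (a * b') \<in> lm M (Suc n)" unfolding ab(1) by (rule spec)
  have "f - (f - to_frac (a * b')) \<in> lm M n"
    by (rule lm_diff[OF prime_M f(3) subsetD[OF lm_antimono b']]) simp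
  then have "to_frac (a * b') \<in> lm M n" by (simp only: diff_diff_eq2 add_diff_cancel_left')
  then have g: "a * b' \<in> ipow M n" by (simp only: to_frac_lm_iff)
  have "y = cls n (a * b')"
    unfolding f(1) cls_def using gr_class_eq_iff[OF prime_M _ to_frac_loc[OF prime_M]] b' f(3) lm_loc by blast
  moreover have "\<exists>f\<in>level \<II> (real n). f - a * b' \<in> ipow M (Suc n)"
    using is_idealD(4)[OF U ab(2)] by (intro bexI[of _ "a * b'"]) (auto intro: ipowD)
  ultimately show "y \<in> cls n ` {g \<in> ipow M n. \<exists>f\<in>level \<II> (real n). f - g \<in> ipow M (Suc n)}" using g by blast
next
  fix y assume "y \<in> cls n ` {g \<in> ipow M n. \<exists>f\<in>level \<II> (real n). f - g \<in> ipow M (Suc n)}"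
  then obtain g f where g: "y = cls n g" "g \<in> ipow M n" "f \<in> level \<II> (real n)" "f - g \<in> ipow M (Suc n)" by blast
  have "(f - g) + g \<in> ipow M n" by (rule ipowD(2)[OF subsetD[OF ipow_antimono g(4)] g(2)]) simp
  then have "to_frac f \<in> lm M n" by (simp add: to_frac_lm_iff)
  moreover have "to_frac f \<in> genideal (local_ring M) (to_frac ` level \<II> (real n))"
    unfolding genideal_extension[OF prime_M U] to_frac_def using g(3) not_in_prime(2)[OF prime_M] by blast
  moreover have "y = gr_class M n (to_frac f)" using g(1,4) cls_eq_iff[of n f g] by (simp add: cls_def)
  ultimately show "y \<in> leading M \<II> n"
    unfolding leading_def localized_filtration_def local_max_pow_lm[OF prime_M] by blast
qed

lemma leading_pure_eq:
  assumes U: "is_ideal (level \<II> (real q))"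
  shows "leading_pure M \<II> q = cls q ` {g \<in> ipow M q. (\<exists>f\<in>level \<II> (real q). f - g \<in> ipow M (Suc q)) \<and>
    (\<exists>v\<in>M. g - v ^ q \<in> ipow M (Suc q))}"
proof (intro equalityI subsetI)
  fix y assume y: "y \<in> leading_pure M \<II> q"
  then obtain g where g: "y = cls q g" "g \<in> ipow M q" "\<exists>f\<in>level \<II> (real q). f - g \<in> ipow M (Suc q)"
    unfolding leading_pure_def leading_eq[OF U] by blast
  obtain f where f: "y = gr_class M q (f ^ q)" "f \<in> local_max M" using y unfolding leading_pure_def by blast
  then obtain a b where ab: "f = Fraction_Field.Fract a b" "a \<in> M" "b \<notin> M" unfolding local_max_def by blast
  obtain b' where ap: "\<forall>a. Fraction_Field.Fract a b - to_frac (a * b') \<in> lm M (Suc q)" using fract_approx[OF ab(3)] by blast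
  then have b': "f - to_frac (a * b') \<in> lm M (Suc q)" unfolding ab(1) by (rule spec)
  have floc: "f \<in> loc M" using ab by (auto simp: loc_def)
  have "f ^ q - to_frac (a * b') ^ q \<in> lm M (Suc q)"
    by (rule lm_power_diff[OF prime_M floc to_frac_loc[OF prime_M] b'])
  then have "y = cls q ((a * b') ^ q)"
    unfolding f(1) cls_def to_frac_power
    using gr_class_eq_iff[OF prime_M] is_subring_power[OF is_subring_loc[OF prime_M]] floc to_frac_loc[OF prime_M] by blast
  then have "g - (a * b') ^ q \<in> ipow M (Suc q)" using g(1) cls_eq_iff by simp
  moreover have "a * b' \<in> M" by (rule is_idealD(4)[OF is_primeD(1)[OF prime_M] ab(2)])
  ultimately show "y \<in> cls q ` {g \<in> ipow M q. (\<exists>f\<in>level \<II> (real q). f - g \<in> ipow M (Suc q)) \<and>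
    (\<exists>v\<in>M. g - v ^ q \<in> ipow M (Suc q))}" using g by blast
next
  fix y assume "y \<in> cls q ` {g \<in> ipow M q. (\<exists>f\<in>level \<II> (real q). f - g \<in> ipow M (Suc q)) \<and>
    (\<exists>v\<in>M. g - v ^ q \<in> ipow M (Suc q))}"
  then obtain g v where g: "y = cls q g" "g \<in> ipow M q" "\<exists>f\<in>level \<II> (real q). f - g \<in> ipow M (Suc q)"
    "v \<in> M" "g - v ^ q \<in> ipow M (Suc q)" by blast
  have "y = gr_class M q (to_frac v ^ q)" using g(1,5) cls_eq_iff[of q g "v ^ q"] by (simp add: cls_def)
  moreover have "to_frac v \<in> local_max M"
    unfolding local_max_lm[OF prime_M] using g(4) ipow_Suc_0[OF is_primeD(1)[OF prime_M]] by (intro lm_to_frac[OF prime_M]) simp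
  ultimately show "y \<in> leading_pure M \<II> q" unfolding leading_pure_def leading_eq[OF U] using g(1-3) by blast
qed

text \<open>In degree one every form is its own first power.\<close>

lemma leading_pure_1: "is_ideal (level \<II> (real 1)) \<Longrightarrow> leading_pure M \<II> 1 = leading M \<II> 1"
proof -
  assume U: "is_ideal (level \<II> (real 1))"
  have "\<exists>v\<in>M. g - v ^ 1 \<in> ipow M (Suc 1)" if "g \<in> ipow M 1" for g
    using that ipow_Suc_0[OF is_primeD(1)[OF prime_M]] by (intro bexI[of _ g]) (auto intro: ipowD)
  then show ?thesis unfolding leading_pure_eq[OF U] leading_eq[OF U] by blast
qed

text \<open>The elements congruent modulo the square to a constant combination of the
  \<open>x i\<close> form an ideal, because the residue field is \<open>k\<close>. It contains the
  given generators, hence the maximal ideal.\<close>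

lemma params_of_generators:
  assumes y: "y ` {..<n} \<subseteq> carrier (local_ring M)" "genideal (local_ring M) (y ` {..<n}) = local_max M"
  shows "\<exists>x. params \<chi>\<^sub>0 n x \<and> (\<forall>i<n. y i - to_frac (x i) \<in> lm M 2)"
proof -
  interpret cring "local_ring M" by (rule cring_local[OF prime_M])
  have M1: "ipow M 1 = M" using ipow_Suc_0[OF is_primeD(1)[OF prime_M]] by simp
  have "\<exists>u. u \<in> M \<and> y i - to_frac u \<in> lm M 2" if "i < n" for i
  proof -
    have "y i \<in> local_max M" using genideal_self[OF y(1)] y(2) that by blast
    then obtain a b where ab: "y i = Fraction_Field.Fract a b" "a \<in> M" "b \<notin> M" unfolding local_max_def by blast
    obtain b' where ap: "\<forall>a. Fraction_Field.Fract a b - to_frac (a * b') \<in> lm M 2" using fract_approx[OF ab(3)] by blast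
    then have "y i - to_frac (a * b') \<in> lm M 2" unfolding ab(1) by (rule spec)
    then show ?thesis using is_idealD(4)[OF is_primeD(1)[OF prime_M] ab(2)] by blast
  qed
  then have "\<forall>i. \<exists>u. i < n \<longrightarrow> u \<in> M \<and> y i - to_frac u \<in> lm M 2" by blast
  from choice[OF this] obtain x where x: "\<forall>i<n. x i \<in> M \<and> y i - to_frac (x i) \<in> lm M 2" by blast
  let ?s = "\<lambda>c. \<Sum>i<n. \<phi> (c i) * x i"
  let ?J = "{h \<in> loc M. \<exists>c. h - to_frac (?s c) \<in> lm M 2}"
  have "ideal ?J (local_ring M)"
    unfolding ideal_local_iff[OF prime_M]
  proof (intro conjI ballI)
    show "0 \<in> ?J"
      by (intro CollectI conjI is_subringD(1)[OF is_subring_loc[OF prime_M]] exI[of _ "\<lambda>_. 0"])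
        (simp add: lm_zero[OF prime_M])
  next
    fix f g assume "f \<in> ?J" "g \<in> ?J"
    then obtain c c' where c: "f \<in> loc M" "g \<in> loc M" "f - to_frac (?s c) \<in> lm M 2" "g - to_frac (?s c') \<in> lm M 2" by blast
    have "?s (\<lambda>i. c i + c' i) = ?s c + ?s c'" by (simp add: hom_add distrib_right sum.distrib)
    then have "(f + g) - to_frac (?s (\<lambda>i. c i + c' i)) = (f - to_frac (?s c)) + (g - to_frac (?s c'))" by simp
    with lm_add[OF prime_M c(3,4)] have "(f + g) - to_frac (?s (\<lambda>i. c i + c' i)) \<in> lm M 2" by (simp only:)
    then show "f + g \<in> ?J"
      by (intro CollectI conjI is_subringD(3)[OF is_subring_loc[OF prime_M] c(1,2)] exI[of _ "\<lambda>i. c i + c' i"])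
  next
    fix r f assume r: "r \<in> loc M" and "f \<in> ?J"
    then obtain c where c: "f \<in> loc M" "f - to_frac (?s c) \<in> lm M 2" by blast
    obtain d where d: "r - to_frac (\<phi> d) \<in> lm M 1" using residue[OF r] by blast
    have "?s c \<in> ipow M 1" unfolding M1 using x by (intro is_ideal_sum[OF is_primeD(1)[OF prime_M]] is_idealD(3)[OF is_primeD(1)[OF prime_M]]) auto
    then have "(r - to_frac (\<phi> d)) * to_frac (?s c) \<in> lm M (1 + 1)" by (intro lm_mult[OF prime_M] d lm_to_frac[OF prime_M])
    then have 1: "(r - to_frac (\<phi> d)) * to_frac (?s c) \<in> lm M 2" by (simp add: numeral_2_eq_2)
    have 2: "r * (f - to_frac (?s c)) \<in> lm M 2" by (rule lm_loc_mult[OF prime_M r c(2)])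
    have "?s (\<lambda>i. d * c i) = \<phi> d * ?s c" by (simp add: hom_mult sum_distrib_left mult.assoc)
    then have "r * f - to_frac (?s (\<lambda>i. d * c i)) = (r - to_frac (\<phi> d)) * to_frac (?s c) + r * (f - to_frac (?s c))"
      by (simp add: algebra_simps)
    with lm_add[OF prime_M 1 2] have "r * f - to_frac (?s (\<lambda>i. d * c i)) \<in> lm M 2" by (simp only:)
    then show "r * f \<in> ?J"
      by (intro CollectI conjI is_subringD(4)[OF is_subring_loc[OF prime_M] r c(1)] exI[of _ "\<lambda>i. d * c i"])
  qed auto
  moreover have "y i \<in> ?J" if i: "i < n" for i
  proof -
    have "?s (\<lambda>j. if j = i then 1 else 0) = (\<Sum>j<n. if j = i then x j else 0)" by (rule sum.cong) auto
    then have "?s (\<lambda>j. if j = i then 1 else 0) = x i" using i by simp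
    then have "y i - to_frac (?s (\<lambda>j. if j = i then 1 else 0)) \<in> lm M 2" using x i by simp
    moreover have "y i \<in> loc M" using y(1) i carrier_local[OF prime_M] by blast
    ultimately show ?thesis by (intro CollectI conjI exI[of _ "\<lambda>j. if j = i then 1 else 0"])
  qed
  ultimately have sub: "local_max M \<subseteq> ?J" unfolding y(2)[symmetric] by (intro genideal_minimal) auto
  have "M \<subseteq> fspan x {..<n} (ipow M 2)"
  proof
    fix f assume "f \<in> M"
    then have "to_frac f \<in> local_max M" unfolding local_max_lm[OF prime_M] using M1 by (intro lm_to_frac[OF prime_M]) simp
    then obtain c where "to_frac f - to_frac (?s c) \<in> lm M 2" using sub by blast
    then have "f - ?s c \<in> ipow M 2" by (simp flip: to_frac_lm_iff)
    then show "f \<in> fspan x {..<n} (ipow M 2)" unfolding fspan_def by blast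
  qed
  then show ?thesis using x by (intro exI[of _ x]) (simp add: params_def)
qed

end

section \<open>Nonsingular affine varieties\<close>

lemma a_inv_UNIV: "\<ominus>\<^bsub>ring_on UNIV\<^esub> h = - h"
proof -
  interpret cring "ring_on (UNIV :: 'a set)" by (rule cring_ring_on[OF is_subring_UNIV])
  show ?thesis by (rule minus_equality) (simp_all add: ring_on_simps)
qed

lemma affine_alg_of_variety:
  fixes \<phi> :: "'k::alg_closed_field \<Rightarrow> 'r::idom"
  assumes V: "nonsingular_affine_variety \<phi> d"
  shows "\<exists>z m. affine_alg \<phi> z m"
proof -
  interpret comm_ring_hom \<phi> using V by (simp add: nonsingular_affine_variety_def)
  obtain S where S: "finite S" "generate_ring (ring_on UNIV) (range \<phi> \<union> S) = UNIV"
    using V unfolding nonsingular_affine_variety_def by blast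
  obtain z where "bij_betw z {0..<card S} S" using ex_bij_betw_nat_finite[OF S(1)] by blast
  then have z: "z ` {..<card S} = S" by (simp add: bij_betw_def lessThan_atLeast0)
  let ?G = "{ins \<phi> z p | p. p \<in> Pol {..<card S}}"
  have const: "\<phi> c \<in> ?G" for c by (intro CollectI exI[of _ "Const c"]) (simp add: Pol_Const ins_Const)
  have add: "f + g \<in> ?G" if fg: "f \<in> ?G" "g \<in> ?G" for f g
  proof -
    obtain p q where "p \<in> Pol {..<card S}" "q \<in> Pol {..<card S}" "f = ins \<phi> z p" "g = ins \<phi> z q" using fg by blast
    then show ?thesis by (intro CollectI exI[of _ "p + q"]) (simp add: ins_add Pol_add)
  qed
  have mult: "f * g \<in> ?G" if fg: "f \<in> ?G" "g \<in> ?G" for f g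
  proof -
    obtain p q where "p \<in> Pol {..<card S}" "q \<in> Pol {..<card S}" "f = ins \<phi> z p" "g = ins \<phi> z q" using fg by blast
    then show ?thesis by (intro CollectI exI[of _ "p * q"]) (simp add: ins_mult Pol_mult)
  qed
  have gen: "f \<in> ?G" if "f \<in> generate_ring (ring_on UNIV) (range \<phi> \<union> S)" for f
    using that
  proof (induction rule: generate_ring.induct)
    case one
    show ?case using const[of 1] by (simp add: ring_on_simps)
  next
    case (incl h)
    show ?case
    proof (cases "h \<in> range \<phi>")
      case True
      then obtain c where "h = \<phi> c" by blast
      then show ?thesis using const by simp
    next
      case False
      then obtain i where "i < card S" "h = z i" using incl z by blast
      then show ?thesis by (intro CollectI exI[of _ "Var i"]) (simp add: Pol_Var ins_Var)
    qed
  next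
    case (a_inv h)
    have "\<phi> (- 1) * h \<in> ?G" by (rule mult[OF const a_inv.IH])
    then show ?case by (simp add: a_inv_UNIV hom_uminus)
  next
    case (eng_add f g)
    then show ?case using add by (simp add: ring_on_simps)
  next
    case (eng_mult f g)
    then show ?case using mult by (simp add: ring_on_simps)
  qed
  have "affine_alg \<phi> z (card S)"
  proof
    fix f show "\<exists>p\<in>Pol {..<card S}. ins \<phi> z p = f" using gen[of f] S(2) by blast
  qed
  then show ?thesis by blast
qed

context affine_alg
begin

text \<open>Dimensions are squeezed: prime chains give \<open>d \<le> card T\<close>, while at any
  closed point the number of parameters, which is the dimension of the local ring, equals
  \<open>card T\<close> by the growth argument. Localization does not raise dimension, so
  \<open>card T \<le> d\<close>.\<close>

lemma smooth_of_variety: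
  assumes V: "nonsingular_affine_variety \<phi> d"
  shows "smooth_alg \<phi> z m d"
proof -
  obtain T B h where nz: "normalization {0} T B z h" using normalization_exists[OF is_prime_0] by blast
  have kr: "krull_dim (ring_on (UNIV :: 'r set)) \<le> enat (card T)"
    unfolding krull_dim_def
  proof (rule SUP_least)
    fix n assume "n \<in> {n. \<exists>C :: nat \<Rightarrow> 'r set.
       (\<forall>i\<le>n. primeideal (C i) (ring_on UNIV)) \<and> (\<forall>i<n. C i \<subset> C (Suc i))}"
    then obtain C :: "nat \<Rightarrow> 'r set" where C: "\<forall>i\<le>n. primeideal (C i) (ring_on UNIV)" "\<forall>i<n. C i \<subset> C (Suc i)" by blast
    have "n \<le> card T" by (rule chain_length_le[OF nz, of n C]) (use C in \<open>simp_all add: primeideal_UNIV_iff\<close>)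
    then show "enat n \<le> enat (card T)" by simp
  qed
  have kd: "krull_dim (ring_on (UNIV :: 'r set)) = enat d" using V by (simp add: nonsingular_affine_variety_def)
  have reg: "(\<exists>x. params \<chi> (card T) x) \<and> card T \<le> d" if chi: "\<chi> \<in> points" for \<chi>
  proof -
    interpret c: closed_point \<phi> \<chi> by unfold_locales (rule chi)
    have "regular_local_ring (local_ring (ker \<chi>))"
      using V c.prime_M unfolding nonsingular_affine_variety_def primeideal_UNIV_iff by blast
    then obtain M' S where M': "{M. maximalideal M (local_ring (ker \<chi>))} = {M'}" "S \<subseteq> carrier (local_ring (ker \<chi>))" "finite S"
      "krull_dim (local_ring (ker \<chi>)) = enat (card S)" "M' = genideal (local_ring (ker \<chi>)) S"
      unfolding regular_local_ring_def by blast
    have "local_max (ker \<chi>) \<in> {M. maximalideal M (local_ring (ker \<chi>))}" using maximal_local[OF c.prime_M] by simp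
    then have m: "local_max (ker \<chi>) = M'" unfolding M'(1) by simp
    obtain y where "bij_betw y {0..<card S} S" using ex_bij_betw_nat_finite[OF M'(3)] by blast
    then have y: "y ` {..<card S} = S" by (simp add: bij_betw_def lessThan_atLeast0)
    obtain x where x: "params \<chi> (card S) x"
      using c.params_of_generators[of y "card S"] M'(2,5) m unfolding y by blast
    have le: "enat (card S) \<le> krull_dim (ring_on (UNIV :: 'r set))"
      using krull_dim_local_le[OF c.prime_M] M'(4) by simp
    then have "enat (card S) \<le> enat (card T)" using kr order_trans by blast
    then have "card S = card T" by (intro regular_monomials(1)[OF nz chi x]) simp
    then show ?thesis using x le kd by auto
  qed
  \<comment> \<open>The inequality was proved at points, so one closed point has to exist.\<close>
  obtain \<chi>1 where "\<chi>1 \<in> points" using point_exists[of 1] by auto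
  then have "card T \<le> d" using reg by blast
  moreover have "d \<le> card T" using kr kd by simp
  ultimately have d: "d = card T" by simp
  show ?thesis
  proof
    show "\<exists>x. params \<chi> d x" if "\<chi> \<in> points" for \<chi> using reg[OF that] d by simp
    fix \<chi> x c j I
    assume a: "\<chi> \<in> points" "params \<chi> d x" "(\<Sum>I\<in>MI d j. \<phi> (c I) * multi_power d x I) \<in> ipow (ker \<chi>) (Suc j)" "I \<in> MI d j"
    then show "c I = 0" using regular_monomials(2)[OF nz a(1,2) _ a(3)] d by simp
  qed
qed

lemma point_of_maximal:
  assumes Q: "maximalideal Q (ring_on UNIV)"
  shows "\<exists>\<chi>\<in>points. ker \<chi> = Q"
proof (rule maximal_is_point)
  show id: "is_ideal Q" using maximalideal.axioms(1)[OF Q] by (simp add: ideal_UNIV_iff)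
  show "1 \<notin> Q"
  proof
    assume "1 \<in> Q"
    then have "x * 1 \<in> Q" for x by (rule is_idealD(3)[OF id])
    then show False using maximalideal.I_notcarr[OF Q] by (auto simp: ring_on_simps)
  qed
  fix f assume f: "f \<notin> Q"
  let ?J = "{a + r * f | a r. a \<in> Q}"
  have "is_ideal ?J"
    unfolding is_ideal_def
  proof (intro conjI ballI allI)
    have "0 = 0 + 0 * f" by simp
    then show "0 \<in> ?J" using is_idealD(1)[OF id] by blast
  next
    fix u v assume "u \<in> ?J" "v \<in> ?J"
    then obtain a r b w where "u = a + r * f" "v = b + w * f" "a \<in> Q" "b \<in> Q" by blast
    then have "u + v = (a + b) + (r + w) * f" "a + b \<in> Q" by (simp_all add: algebra_simps is_idealD(2)[OF id])
    then show "u + v \<in> ?J" by blast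
  next
    fix w u assume "u \<in> ?J"
    then obtain a r where u: "u = a + r * f" "a \<in> Q" by blast
    have "w * u = w * a + (w * r) * f" unfolding u(1) by (simp add: algebra_simps)
    then show "w * u \<in> ?J" using is_idealD(3)[OF id u(2), of w] by blast
  qed
  then have J: "ideal ?J (ring_on UNIV)" by (simp add: ideal_UNIV_iff)
  have sub: "Q \<subseteq> ?J"
  proof
    fix a assume "a \<in> Q"
    moreover have "a = a + 0 * f" by simp
    ultimately show "a \<in> ?J" by blast
  qed
  have "f = 0 + 1 * f" by simp
  then have "f \<in> ?J" using is_idealD(1)[OF id] by blast
  then have "?J \<noteq> Q" using f by blast
  then have "?J = UNIV" using maximalideal.I_maximal[OF Q J sub] by (simp add: ring_on_simps)
  then have "1 \<in> ?J" by simp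
  then obtain a r where ar: "1 = a + r * f" "a \<in> Q" by blast
  then have "r * f - 1 = - a" by (simp add: algebra_simps)
  then show "\<exists>r. r * f - 1 \<in> Q" using is_idealD(5)[OF id ar(2)] by (intro exI[of _ r]) simp
qed

end

section \<open>Ranks of matrices\<close>

text \<open>A maximal independent set of columns, given by indices chosen so that a repeated column
  is counted once.\<close>

lemma rank_choose_columns:
  fixes A :: "'k::field mat"
  assumes A: "A \<in> carrier_mat n r"
  shows "\<exists>B\<subseteq>{..<r}. vec_space.rank n A = card B \<and>
    (\<forall>a. (\<forall>i<n. (\<Sum>j\<in>B. a j * A $$ (i, j)) = 0) \<longrightarrow> (\<forall>j\<in>B. a j = 0)) \<and>
    (\<forall>k<r. \<exists>a. \<forall>i<n. A $$ (i, k) = (\<Sum>j\<in>B. a j * A $$ (i, j)))"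
proof -
  interpret vec_space "TYPE('k)" n .
  let ?P = "\<lambda>T. T \<subseteq> set (cols A) \<and> lin_indpt T"
  have "lin_indpt {}" by (rule finite_lin_indpt2) auto
  then obtain S where S: "finite S" "maximal S ?P"
    using maximal_exists_superset[of "set (cols A)" ?P "{}"] by auto
  have SP: "S \<subseteq> set (cols A)" "lin_indpt S" using S(2) by (auto simp: maximal_def)
  have colsA: "set (cols A) = col A ` {..<r}" using A by (auto simp: cols_def)
  have car: "set (cols A) \<subseteq> carrier_vec n" using cols_dim[of A] A by auto
  have Scar: "S \<subseteq> carrier_vec n" using SP(1) car by blast
  obtain B where B: "B \<subseteq> {..<r}" "inj_on (col A) B" "S = col A ` B"
    using SP(1) unfolding colsA subset_image_inj by blast
  have rank: "rank A = card B" unfolding rank_card_indpt[OF A S(2)] B(3) by (rule card_image[OF B(2)])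
  have lc: "lincomb a S $ i = (\<Sum>j\<in>B. a (col A j) * A $$ (i, j))" if i: "i < n" for a i
  proof -
    have "lincomb a S $ i = (\<Sum>v\<in>S. a v * v $ i)" by (rule lincomb_index[OF i Scar])
    also have "\<dots> = (\<Sum>j\<in>B. a (col A j) * col A j $ i)" unfolding B(3) by (rule sum.reindex[OF B(2), unfolded o_def])
    also have "\<dots> = (\<Sum>j\<in>B. a (col A j) * A $$ (i, j))" using B(1) A i by (intro sum.cong) auto
    finally show ?thesis .
  qed
  have ind: "\<forall>j\<in>B. a j = 0" if z: "\<forall>i<n. (\<Sum>j\<in>B. a j * A $$ (i, j)) = 0" for a
  proof -
    let ?a = "\<lambda>v. a (the_inv_into B (col A) v)"
    have inv: "?a (col A j) = a j" if "j \<in> B" for j using the_inv_into_f_f[OF B(2) that] by simp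
    have "lincomb ?a S = 0\<^sub>v n"
    proof (rule eq_vecI)
      show "dim_vec (lincomb ?a S) = dim_vec (0\<^sub>v n)" using lincomb_dim[OF S(1) Scar] by simp
      fix i assume "i < dim_vec (0\<^sub>v n :: 'k vec)"
      then have i: "i < n" by simp
      have "(\<Sum>j\<in>B. ?a (col A j) * A $$ (i, j)) = (\<Sum>j\<in>B. a j * A $$ (i, j))" by (rule sum.cong) (simp_all add: inv)
      then show "lincomb ?a S $ i = 0\<^sub>v n $ i" using lc[OF i, of ?a] z i by simp
    qed
    then have "?a \<in> S \<rightarrow> {0}" using not_lindepD[OF SP(2) S(1) subset_refl, of ?a] by simp
    then have "?a (col A j) = 0" if "j \<in> B" for j using B(3) that by (auto simp: Pi_iff)
    then show ?thesis by (simp add: inv)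
  qed
  have span: "\<exists>a. \<forall>i<n. A $$ (i, k) = (\<Sum>j\<in>B. a j * A $$ (i, j))" if k: "k < r" for k
  proof -
    have kc: "col A k \<in> set (cols A)" using k colsA by blast
    have "col A k \<in> span S"
    proof (cases "col A k \<in> S")
      case True
      then show ?thesis using span_mem[of S] Scar by auto
    next
      case False
      have "\<not> ?P (insert (col A k) S)" using S(2) False unfolding maximal_def by blast
      then have "lin_dep (S \<union> {col A k})" using SP(1) kc by simp
      then show ?thesis using lin_dep_iff_in_span[of S "col A k"] Scar SP(2) car kc False by auto
    qed
    then obtain a where a: "col A k = lincomb a S" using finite_span[OF S(1)] Scar by auto
    have "\<forall>i<n. A $$ (i, k) = (\<Sum>j\<in>B. a (col A j) * A $$ (i, j))"
    proof (intro allI impI)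
      fix i assume i: "i < n"
      have "A $$ (i, k) = col A k $ i" using A k i by auto
      then show "A $$ (i, k) = (\<Sum>j\<in>B. a (col A j) * A $$ (i, j))" using lc[OF i, of a] a by simp
    qed
    then show ?thesis by (rule exI[of _ "\<lambda>j. a (col A j)"])
  qed
  show ?thesis
    by (intro exI[of _ B] conjI allI impI, rule B(1), rule rank, rule ind, assumption, rule span, assumption)
qed

section \<open>The filtration at a closed point\<close>

lemma (in kalg) frobenius:
  assumes "CHAR('k) > 0"
  shows "(f + g :: 'r) ^ (CHAR('k) ^ a) = f ^ (CHAR('k) ^ a) + g ^ (CHAR('k) ^ a)"
proof -
  have "CHAR('r) = CHAR('k)"
  proof (rule CHAR_eqI)
    have "(of_nat CHAR('k) :: 'r) = \<phi> (of_nat CHAR('k))" by (simp only: hom_of_nat)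
    then show "(of_nat CHAR('k) :: 'r) = 0" by simp
    fix n assume "(of_nat n :: 'r) = 0"
    then have "\<phi> (of_nat n) * 1 \<in> {0}" by (simp add: hom_of_nat)
    then have "(of_nat n :: 'k) = 0" using ksub_scale_iff[of "{0}" "of_nat n" 1] by (auto simp: ksub_def)
    then show "CHAR('k) dvd n" by (simp add: of_nat_eq_0_iff_char_dvd)
  qed
  then show ?thesis using prime_CHAR_semidom[where 'a = 'k] assms by (intro freshmans_dream'[of _ a]) auto
qed

locale point_filtration = smooth_alg \<phi> z m t + closed_point \<phi> \<chi>\<^sub>0
  for \<phi> :: "'k::alg_closed_field \<Rightarrow> 'r::idom" and z m t and \<chi>\<^sub>0 :: "'r \<Rightarrow> 'k" +
  fixes \<II> :: "('r \<times> real) set"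
  assumes filt: "idealistic_filtration \<II>" and sat: "D_saturated \<phi> \<II>"
begin

lemma level_ideal: "is_ideal (level \<II> a)"
  using filt unfolding idealistic_filtration_def by (intro is_ideal_of_ideal) blast

lemma M_ipow: "ipow M 1 = M" using ipow_Suc_0[OF is_primeD(1)[OF prime_M]] by simp

lemma k_linear_sum:
  assumes "k_linear_on \<phi> UNIV D" "finite S"
  shows "D (\<Sum>J\<in>S. \<phi> (c J) * F J) = (\<Sum>J\<in>S. \<phi> (c J) * D (F J))"
  using assms(2)
proof (induction S rule: finite_induct)
  case empty
  have "D (\<phi> 0 * 0) = \<phi> 0 * D 0" using assms(1) unfolding k_linear_on_def by blast
  then show ?case by simp
next
  case (insert J S)
  have "D (\<phi> (c J) * F J + (\<Sum>J\<in>S. \<phi> (c J) * F J)) = \<phi> (c J) * D (F J) + D (\<Sum>J\<in>S. \<phi> (c J) * F J)"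
    using assms(1) unfolding k_linear_on_def by simp
  then show ?case using insert by simp
qed

lemma local_max_pow_iff: "to_frac f \<in> local_max_pow M n \<longleftrightarrow> f \<in> ipow M n"
  by (simp only: local_max_pow_lm[OF prime_M] to_frac_lm_iff)

lemma ord_at_le:
  assumes "f \<notin> ipow M (Suc s)"
  shows "ord_at M f \<le> ereal (real s)"
  unfolding ord_at_def local_max_pow_iff
proof (rule SUP_least)
  fix n assume "n \<in> {n. f \<in> ipow M n}"
  then have "\<not> Suc s \<le> n" using assms ipow_antimono[of "Suc s" n M] by blast
  then show "ereal (real n) \<le> ereal (real s)" by simp
qed

lemma ord_at_ge: "f \<in> ipow M n \<Longrightarrow> ereal (real n) \<le> ord_at M f"
  unfolding ord_at_def local_max_pow_iff by (rule SUP_upper) simp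

lemma Supp_iff: "M \<in> Supp \<II> \<longleftrightarrow> (\<forall>f a. (f, a) \<in> \<II> \<longrightarrow> a > 0 \<longrightarrow> ord_at M f \<ge> ereal a)"
  using prime_M by (simp add: Supp_def primeideal_UNIV_iff)

lemma support_level:
  assumes S: "M \<in> Supp \<II>"
  shows "level \<II> (real n) \<subseteq> ipow M n"
proof
  fix f assume f: "f \<in> level \<II> (real n)"
  show "f \<in> ipow M n"
  proof (cases n)
    case (Suc s)
    show ?thesis
    proof (rule ccontr)
      assume "f \<notin> ipow M n"
      then have "ord_at M f \<le> ereal (real s)" unfolding Suc by (rule ord_at_le)
      moreover have "ereal (real n) \<le> ord_at M f" using S f Suc unfolding Supp_iff level_def by simp
      ultimately have "ereal (real n) \<le> ereal (real s)" by (rule order_trans[rotated])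
      then show False by (simp add: Suc)
    qed
  qed simp
qed

text \<open>Outside the support some \<open>f\<close> of level \<open>a\<close> has order
  \<open>s < a\<close>. The operator dual to a monomial of its leading form turns it into a function
  that is nonzero at the point and has level \<open>a - s > 0\<close>; powers of this function reach
  every level.\<close>

lemma unit_level:
  assumes S: "M \<notin> Supp \<II>"
  shows "\<exists>h\<in>level \<II> b. h \<notin> M"
proof -
  obtain f a where fa: "(f, a) \<in> \<II>" "a > 0" "ord_at M f < ereal a" using S unfolding Supp_iff by (meson not_le)
  obtain N where "a < real N" using reals_Archimedean2 by blast
  have "f \<notin> ipow M N"
  proof
    assume "f \<in> ipow M N"
    then have "ereal (real N) < ereal a" using ord_at_ge fa(3) by (meson le_less_trans)
    then show False using \<open>a < real N\<close> by simp
  qed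
  \<comment> \<open>The order of \<open>f\<close> is below \<open>a\<close>, hence finite;
    \<open>s\<close> is one less than the first exponent whose power does not contain
    \<open>f\<close>.\<close>
  then have L: "f \<notin> ipow M (LEAST n. f \<notin> ipow M n)" by (rule LeastI)
  then obtain s where s: "(LEAST n. f \<notin> ipow M n) = Suc s" by (cases "LEAST n. f \<notin> ipow M n") auto
  then have f: "f \<in> ipow M s" "f \<notin> ipow M (Suc s)" using not_less_Least[of s "\<lambda>n. f \<notin> ipow M n"] L by auto
  have "ereal (real s) < ereal a" using ord_at_ge[OF f(1)] fa(3) by (rule le_less_trans)
  then have sa: "0 < a - real s" by simp
  obtain x where x: "params \<chi>\<^sub>0 t x" using params_exist[OF pt] ..
  let ?x = "multi_power t x"
  obtain c where c: "f - (\<Sum>J\<in>MI t s. \<phi> (c J) * ?x J) \<in> ipow M (Suc s)"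
    using ipow_fspan[OF pt x, of s] f(1) unfolding fspan_def by blast
  have "\<exists>I0\<in>MI t s. c I0 \<noteq> 0"
  proof (rule ccontr)
    assume "\<not> ?thesis"
    then have "(\<Sum>J\<in>MI t s. \<phi> (c J) * ?x J) = 0" by (intro sum.neutral) simp
    then show False using c f(2) by simp
  qed
  then obtain I0 where I0: "I0 \<in> MI t s" "c I0 \<noteq> 0" by blast
  then have "I0 \<in> MIle t s" by (simp add: MI_def MIle_def)
  from dual_operator[OF pt x this] obtain D u where
    D: "diff_op \<phi> UNIV s D" "u \<noteq> 0" "\<forall>J\<in>MIle t s. \<chi>\<^sub>0 (D (?x J)) = (if J = I0 then u else 0)" by blast
  have lin: "k_linear_on \<phi> UNIV D" by (rule diff_op_linear[OF D(1)])
  let ?R = "f - (\<Sum>J\<in>MI t s. \<phi> (c J) * ?x J)"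
  have "D ?R \<in> ipow M (Suc s - s)" by (rule diff_op_ipow[OF D(1) c])
  then have R: "\<chi>\<^sub>0 (D ?R) = 0" using M_ipow M_iff by simp
  have "D (?R + (\<Sum>J\<in>MI t s. \<phi> (c J) * ?x J)) = D ?R + D (\<Sum>J\<in>MI t s. \<phi> (c J) * ?x J)"
    using lin unfolding k_linear_on_def by blast
  then have "D f = D ?R + (\<Sum>J\<in>MI t s. \<phi> (c J) * D (?x J))" by (simp add: k_linear_sum[OF lin MI_finite])
  then have "\<chi>\<^sub>0 (D f) = (\<Sum>J\<in>MI t s. c J * \<chi>\<^sub>0 (D (?x J)))" using R by (simp add: pointsD[OF pt])
  also have "\<dots> = (\<Sum>J\<in>MI t s. if J = I0 then c I0 * u else 0)"
    by (rule sum.cong) (use D(3) in \<open>auto simp: MI_def MIle_def\<close>)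
  finally have "\<chi>\<^sub>0 (D f) \<noteq> 0" using I0 D(2) MI_finite by simp
  then have Df: "D f \<notin> M" by (simp add: M_iff)
  have lev: "(D f, a - real s) \<in> \<II>" using sat fa(1) D(1) unfolding D_saturated_def by blast
  have pow: "((D f) ^ n, real n * (a - real s)) \<in> \<II>" for n
  proof (induction n)
    case 0
    have "level \<II> 0 = UNIV" using filt unfolding idealistic_filtration_def by blast
    then show ?case by (auto simp: level_def)
  next
    case (Suc n)
    have "(D f * (D f) ^ n, (a - real s) + real n * (a - real s)) \<in> \<II>"
      using filt lev Suc unfolding idealistic_filtration_def by blast
    then show ?case by (simp add: algebra_simps)
  qed
  obtain n where "b < real n * (a - real s)" using ex_less_of_nat_mult[OF sa] by blast
  then have "((D f) ^ n, b) \<in> \<II>" using filt pow[of n] less_imp_le unfolding idealistic_filtration_def by blast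
  moreover have "(D f) ^ n \<notin> M" using is_prime_power[OF prime_M] Df by blast
  ultimately show ?thesis unfolding level_def by blast
qed

lemma localized_full:
  assumes S: "M \<notin> Supp \<II>"
  shows "localized_filtration M \<II> = carrier (local_ring M) \<times> UNIV"
proof -
  have "f \<in> genideal (local_ring M) (to_frac ` level \<II> a) \<longleftrightarrow> f \<in> loc M" for f a
    unfolding genideal_extension[OF prime_M level_ideal]
  proof
    assume "f \<in> loc M"
    then obtain c b where cb: "f = Fraction_Field.Fract c b" "b \<notin> M" by (auto simp: loc_def)
    obtain h where h: "h \<in> level \<II> a" "h \<notin> M" using unit_level[OF S] by blast
    have "f = Fraction_Field.Fract (c * h) (b * h)"
      using cb h not_in_prime(1)[OF prime_M] by (simp add: eq_fract)
    then show "f \<in> {Fraction_Field.Fract a' b | a' b. a' \<in> level \<II> a \<and> b \<notin> M}"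
      using is_idealD(3)[OF level_ideal h(1)] not_in_prime(3)[OF prime_M cb(2) h(2)] by blast
  qed (auto simp: loc_def)
  then show ?thesis unfolding localized_filtration_def carrier_local[OF prime_M] by auto
qed

lemma powers_indep:
  assumes x: "params \<chi>\<^sub>0 t x" and n: "n \<le> t" and q: "q > 0"
    and rel: "(\<Sum>i<n. \<phi> (c i) * x i ^ q) \<in> ipow M (Suc q)"
  shows "\<forall>i\<in>{..<n}. c i = 0"
proof
  fix j assume j: "j \<in> {..<n}"
  let ?c = "\<lambda>I. \<Sum>i<n. if I = single_index i q then c i else 0"
  have "(\<Sum>I\<in>MI t q. \<phi> (?c I) * multi_power t x I) = (\<Sum>I\<in>MI t q. \<Sum>i<n. if I = single_index i q then \<phi> (c i) * multi_power t x I else 0)"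
    unfolding hom_sum sum_distrib_right by (intro sum.cong refl) simp
  also have "\<dots> = (\<Sum>i<n. \<Sum>I\<in>MI t q. if I = single_index i q then \<phi> (c i) * multi_power t x I else 0)" by (rule sum.swap)
  also have "\<dots> = (\<Sum>i<n. \<phi> (c i) * x i ^ q)"
  proof (rule sum.cong)
    fix i assume "i \<in> {..<n}"
    then have i: "i < t" using n by simp
    show "(\<Sum>I\<in>MI t q. if I = single_index i q then \<phi> (c i) * multi_power t x I else 0) = \<phi> (c i) * x i ^ q"
      using single_index_MI[OF i, of q] by (simp add: MI_finite multi_power_single[OF i])
  qed simp
  finally have "(\<Sum>I\<in>MI t q. \<phi> (?c I) * multi_power t x I) \<in> ipow M (Suc q)" using rel by simp
  from monomials_indep[OF pt x this single_index_MI[of j]] have "?c (single_index j q) = 0" using j n by simp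
  then show "c j = 0" using j by (simp add: single_index_inj[OF q])
qed

text \<open>The additivity assumption covers powers of the characteristic and \<open>q = 1\<close>
  alike; together with roots in \<open>k\<close> it makes the \<open>q\<close>-th powers of linear
  forms a linear space.\<close>

lemma powers_span:
  assumes x: "params \<chi>\<^sub>0 t x" and q: "q > 0" and add: "\<And>f g :: 'r. (f + g) ^ q = f ^ q + g ^ q"
  shows "{g \<in> ipow M q. \<exists>v\<in>M. g - v ^ q \<in> ipow M (Suc q)} = fspan (\<lambda>i. x i ^ q) {..<t} (ipow M (Suc q))"
proof (intro equalityI subsetI)
  have pow: "(\<Sum>i<n. \<phi> (c i) * x i) ^ q = (\<Sum>i<n. \<phi> (c i ^ q) * x i ^ q)" for c and n :: nat
    by (induction n) (simp_all add: add power_mult_distrib hom_power q power_0_left)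
  {
    fix g assume "g \<in> {g \<in> ipow M q. \<exists>v\<in>M. g - v ^ q \<in> ipow M (Suc q)}"
    then obtain v where v: "v \<in> M" "g - v ^ q \<in> ipow M (Suc q)" by blast
    obtain c where c: "v - (\<Sum>i<t. \<phi> (c i) * x i) \<in> ipow M 2"
      using x v(1) unfolding params_def fspan_def by blast
    let ?w = "v - (\<Sum>i<t. \<phi> (c i) * x i)"
    have "?w ^ q \<in> ipow M (2 * q)" by (rule ipow_power[OF c])
    then have w: "?w ^ q \<in> ipow M (Suc q)" using ipow_antimono[of "Suc q" "2 * q" M] q by auto
    have "v ^ q = (?w + (\<Sum>i<t. \<phi> (c i) * x i)) ^ q" by simp
    then have "v ^ q = ?w ^ q + (\<Sum>i<t. \<phi> (c i ^ q) * x i ^ q)" by (simp only: add pow)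
    then have "g - (\<Sum>i<t. \<phi> (c i ^ q) * x i ^ q) = (g - v ^ q) + ?w ^ q" by simp
    with ipowD(2)[OF v(2) w] have "g - (\<Sum>i<t. \<phi> (c i ^ q) * x i ^ q) \<in> ipow M (Suc q)" by (simp only:)
    then show "g \<in> fspan (\<lambda>i. x i ^ q) {..<t} (ipow M (Suc q))" unfolding fspan_def by (intro CollectI exI)
  next
    fix g assume "g \<in> fspan (\<lambda>i. x i ^ q) {..<t} (ipow M (Suc q))"
    then obtain c where c: "g - (\<Sum>i<t. \<phi> (c i) * x i ^ q) \<in> ipow M (Suc q)" unfolding fspan_def by blast
    have "\<forall>i. \<exists>r. r ^ q = c i" using nth_root_exists[OF q] by metis
    from choice[OF this] obtain r where r: "\<And>i. r i ^ q = c i" by blast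
    have v: "(\<Sum>i<t. \<phi> (r i) * x i) \<in> M"
      using x unfolding params_def by (intro is_ideal_sum[OF is_primeD(1)[OF prime_M]] is_idealD(3)[OF is_primeD(1)[OF prime_M]]) auto
    have 1: "g - (\<Sum>i<t. \<phi> (r i) * x i) ^ q \<in> ipow M (Suc q)" using c by (simp add: pow r)
    have "(g - (\<Sum>i<t. \<phi> (r i) * x i) ^ q) + (\<Sum>i<t. \<phi> (r i) * x i) ^ q \<in> ipow M q"
      by (rule ipowD(2)[OF subsetD[OF ipow_antimono 1] ipow_power1[OF v]]) simp
    then show "g \<in> {g \<in> ipow M q. \<exists>v\<in>M. g - v ^ q \<in> ipow M (Suc q)}" using 1 v by auto
  }
qed

text \<open>An element of level \<open>p^e\<close> that is a unit at the point makes every form a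
  leading form, so the pure part consists of all \<open>p^e\<close>-th powers of linear forms and
  has dimension \<open>t\<close>.\<close>

lemma sigma_outside:
  assumes S: "M \<notin> Supp \<II>" and e: "CHAR('k) = 0 \<longrightarrow> e = 0"
  shows "sigma \<phi> t \<II> M e = 0"
proof -
  let ?q = "CHAR('k) ^ e"
  have q: "?q > 0" using e by (cases "CHAR('k) = 0") auto
  have add: "(f + g :: 'r) ^ ?q = f ^ ?q + g ^ ?q" for f g
    using frobenius[of f g e] e by (cases "CHAR('k) = 0") auto
  obtain x where x: "params \<chi>\<^sub>0 t x" using params_exist[OF pt] ..
  obtain h where h: "h \<in> level \<II> (real ?q)" "h \<notin> M" using unit_level[OF S] by blast
  obtain h' where h': "h * h' - 1 \<in> ipow M (Suc ?q)" using unit_inverse[OF h(2)] by blast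
  have full: "\<exists>f\<in>level \<II> (real ?q). f - g \<in> ipow M (Suc ?q)" for g
  proof (rule bexI)
    show "h * (h' * g) \<in> level \<II> (real ?q)" by (rule is_idealD(4)[OF level_ideal h(1)])
    have "h * (h' * g) - g = (h * h' - 1) * g" by (simp add: algebra_simps)
    then show "h * (h' * g) - g \<in> ipow M (Suc ?q)" using ipowD(4)[OF h'] by simp
  qed
  have "leading_pure M \<II> ?q = cls ?q ` fspan (\<lambda>i. x i ^ ?q) {..<t} (ipow M (Suc ?q))"
    unfolding leading_pure_eq[OF level_ideal] powers_span[OF x q add, symmetric] using full by auto
  then have "l_pure \<phi> M \<II> e = card {..<t}"
    unfolding l_pure_def by (simp only:) (rule k_dim_fspan[OF finite_lessThan powers_indep[OF x order_refl q]])
  then show ?thesis by (simp add: sigma_def)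
qed

lemma l_dim_0: "l_pure \<phi> M \<II> 0 = l_dim \<phi> M \<II> 0"
  using leading_pure_1[OF level_ideal] by (simp add: l_pure_def l_dim_def)

lemma monomials_indep_subset:
  assumes x: "params \<chi>\<^sub>0 t x" and A: "A \<subseteq> MI t q"
    and rel: "(\<Sum>J\<in>A. \<phi> (c J) * multi_power t x J) \<in> ipow M (Suc q)"
  shows "\<forall>J\<in>A. c J = 0"
proof
  fix J assume J: "J \<in> A"
  let ?c = "\<lambda>J. if J \<in> A then c J else 0"
  have "(\<Sum>J\<in>MI t q. \<phi> (?c J) * multi_power t x J) = (\<Sum>J\<in>A. \<phi> (c J) * multi_power t x J)"
    by (rule sum.mono_neutral_cong_right[OF MI_finite A]) auto
  then have "(\<Sum>J\<in>MI t q. \<phi> (?c J) * multi_power t x J) \<in> ipow M (Suc q)" using rel by simp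
  from monomials_indep[OF pt x this subsetD[OF A J]] show "c J = 0" using J by simp
qed

text \<open>The case \<open>e = 0\<close> is separate because it includes characteristic 0, where
  there is no Frobenius; there all leading forms are linear, hence pure. Otherwise adapted
  parameters identify \<open>l_pure\<close> with the dimensions \<open>L\<close> of the flag, and
  the leading part is counted by good exponents.\<close>

lemma jump_formula:
  assumes S: "M \<in> Supp \<II>" and e: "CHAR('k) = 0 \<longrightarrow> e = 0" and jp: "jump_places (l_pure \<phi> M \<II>) e K E"
  shows "l_dim \<phi> M \<II> e = l_pure \<phi> M \<II> e + l_mixed CHAR('k) (l_pure \<phi> M \<II>) e K E"
proof (cases "e = 0")
  case True
  then show ?thesis using l_mixed_0 jp l_dim_0 by simp
next
  case False
  let ?p = "CHAR('k)" and ?l = "l_pure \<phi> M \<II>"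
  have p: "?p > 0" using e False by auto
  interpret s: sat_filtration \<phi> z m t \<II> \<chi>\<^sub>0
    by unfold_locales (use pt filt sat support_level[OF S] in auto)
  obtain x L where x: "params \<chi>\<^sub>0 t x" and L: "\<forall>a\<le>e. L a \<le> t" "\<forall>a b. a \<le> b \<longrightarrow> b \<le> e \<longrightarrow> L a \<le> L b"
    and lead: "{g. \<exists>f\<in>s.U (?p ^ e). f - g \<in> ipow M (Suc (?p ^ e))} =
      fspan (multi_power t x) {J \<in> MI t (?p ^ e). \<forall>i<t. J i \<noteq> 0 \<longrightarrow> (\<exists>a\<le>e. i < L a \<and> ?p ^ a dvd J i)} (ipow M (Suc (?p ^ e)))"
    and pure: "\<forall>a\<le>e. {g. (\<exists>f\<in>s.U (?p ^ a). f - g \<in> ipow M (Suc (?p ^ a))) \<and> (\<exists>v\<in>M. g - v ^ (?p ^ a) \<in> ipow M (Suc (?p ^ a)))} =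
      fspan (\<lambda>i. x i ^ (?p ^ a)) {..<L a} (ipow M (Suc (?p ^ a)))"
    using s.leading_structure[OF refl p, of e] by (elim exE conjE)
  let ?G = "{J \<in> MI t (?p ^ e). \<forall>i<t. J i \<noteq> 0 \<longrightarrow> (\<exists>a\<le>e. i < L a \<and> ?p ^ a dvd J i)}"
  have deg: "g \<in> ipow M n" if fg: "f \<in> level \<II> (real n)" "f - g \<in> ipow M (Suc n)" for f g n
  proof -
    have "f - (f - g) \<in> ipow M n"
      by (rule ipowD(6)[OF subsetD[OF support_level[OF S] fg(1)] subsetD[OF ipow_antimono fg(2)]]) simp
    then show ?thesis by simp
  qed
  have "leading M \<II> (?p ^ e) = cls (?p ^ e) ` {g. \<exists>f\<in>s.U (?p ^ e). f - g \<in> ipow M (Suc (?p ^ e))}"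
    unfolding leading_eq[OF level_ideal] s.U_def using deg by (intro arg_cong[of _ _ "image (cls (?p ^ e))"]) blast
  then have "l_dim \<phi> M \<II> e = card ?G"
    unfolding l_dim_def lead
    by (simp only:) (rule k_dim_fspan, use MI_finite in simp, rule monomials_indep_subset[OF x], auto)
  moreover have lL: "?l a = L a" if a: "a \<le> e" for a
  proof -
    have "leading_pure M \<II> (?p ^ a) = cls (?p ^ a) ` {g. (\<exists>f\<in>s.U (?p ^ a). f - g \<in> ipow M (Suc (?p ^ a))) \<and>
        (\<exists>v\<in>M. g - v ^ (?p ^ a) \<in> ipow M (Suc (?p ^ a)))}"
      unfolding leading_pure_eq[OF level_ideal] s.U_def using deg by (intro arg_cong[of _ _ "image (cls (?p ^ a))"]) blast
    then have "leading_pure M \<II> (?p ^ a) = cls (?p ^ a) ` fspan (\<lambda>i. x i ^ (?p ^ a)) {..<L a} (ipow M (Suc (?p ^ a)))"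
      using pure a by simp
    moreover have "?p ^ a > 0" using p by simp
    ultimately have "?l a = card {..<L a}"
      unfolding l_pure_def using L(1) a by (simp only:) (rule k_dim_fspan[OF finite_lessThan powers_indep[OF x]], auto)
    then show ?thesis by simp
  qed
  have G: "?G = {J \<in> MI t (?p ^ e). \<forall>i<t. J i \<noteq> 0 \<longrightarrow> (\<exists>a\<le>e. i < ?l a \<and> ?p ^ a dvd J i)}"
    using lL by (intro Collect_cong) (metis (no_types, lifting))
  have "card {J \<in> MI t (?p ^ e). \<forall>i<t. J i \<noteq> 0 \<longrightarrow> (\<exists>a\<le>e. i < ?l a \<and> ?p ^ a dvd J i)} = ?l e + l_mixed ?p ?l e K E"
  proof (rule count_good_exponents[OF _ _ _ jp])
    show "prime ?p" using prime_CHAR_semidom[where 'a = 'k] p by simp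
    show "?l a \<le> ?l b" if "a \<le> b" "b \<le> e" for a b using lL L(2) that by simp
    show "?l e \<le> t" using lL[of e] L(1) by simp
  qed
  ultimately show ?thesis unfolding G by simp
qed

end

section \<open>The rank of the Hasse matrix\<close>

context closed_point
begin

definition lmappr :: "nat \<Rightarrow> 'r fract \<Rightarrow> 'r fract \<Rightarrow> bool" where
  "lmappr n f g \<longleftrightarrow> f \<in> lm M n \<and> g \<in> lm M n \<and> f - g \<in> lm M (Suc n)"

lemma lmappr_mult:
  assumes "lmappr a f g" "lmappr b f' g'"
  shows "lmappr (a + b) (f * f') (g * g')"
proof -
  have 1: "(f - g) * f' \<in> lm M (Suc (a + b))" using assms lm_mult[OF prime_M, of "f - g" "Suc a" f' b] by (simp add: lmappr_def)
  have 2: "g * (f' - g') \<in> lm M (Suc (a + b))" using assms lm_mult[OF prime_M, of g a "f' - g'" "Suc b"] by (simp add: lmappr_def)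
  have "f * f' - g * g' = (f - g) * f' + g * (f' - g')" by (simp add: algebra_simps)
  with lm_add[OF prime_M 1 2] have "f * f' - g * g' \<in> lm M (Suc (a + b))" by (simp only:)
  then show ?thesis using assms by (simp add: lmappr_def lm_mult[OF prime_M])
qed

lemma lmappr_1: "lmappr 0 1 1"
  using to_frac_loc[OF prime_M, of 1] lm_zero[OF prime_M] by (simp add: lmappr_def lm_0)

lemma lmappr_power: "lmappr 1 f g \<Longrightarrow> lmappr k (f ^ k) (g ^ k)"
proof (induction k)
  case (Suc k)
  then show ?case using lmappr_mult[of 1 f g k "f ^ k" "g ^ k"] by simp
qed (simp add: lmappr_1)

lemma lmappr_prod:
  assumes "finite S" "\<And>i. i \<in> S \<Longrightarrow> lmappr (e i) (f i) (g i)"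
  shows "lmappr (sum e S) (prod f S) (prod g S)"
  using assms by (induction S rule: finite_induct) (auto intro: lmappr_mult lmappr_1)

lemma diff_op_filtration_to_frac:
  assumes "diff_op (to_frac \<circ> \<phi>) (carrier (local_ring M)) k D" "a \<in> ipow M n"
  shows "D (to_frac a) \<in> lm M (n - k)"
proof (rule diff_op_filtration[OF assms(1), where P = M and L = "lm M" and \<iota> = to_frac])
  show "lm M 0 = carrier (local_ring M)" by (simp add: lm_0 carrier_local[OF prime_M])
  show "lm M (Suc j) \<subseteq> lm M j" for j by (rule lm_antimono) simp
  show "to_frac p * b \<in> lm M (Suc j)" if "p \<in> M" "b \<in> lm M j" for p b j
  proof -
    have "to_frac p \<in> lm M 1" using that(1) ipow_Suc_0[OF is_primeD(1)[OF prime_M]] by (intro lm_to_frac[OF prime_M]) simp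
    from lm_mult[OF prime_M this that(2)] show ?thesis by simp
  qed
  show "to_frac f \<in> carrier (local_ring M)" for f using to_frac_loc[OF prime_M] carrier_local[OF prime_M] by blast
qed (use lm_zero[OF prime_M] lm_add[OF prime_M] assms(2) in auto)

lemma lm_unit:
  assumes b: "b \<notin> M" and f: "to_frac b * f \<in> lm M n"
  shows "f \<in> lm M n"
proof -
  have "Fraction_Field.Fract 1 b \<in> loc M" using b by (auto simp: loc_def)
  then have "Fraction_Field.Fract 1 b * (to_frac b * f) \<in> lm M n" by (rule lm_loc_mult[OF prime_M _ f])
  moreover have "Fraction_Field.Fract 1 b * to_frac b = 1"
    using not_in_prime(1)[OF prime_M b] by (simp add: to_frac_def One_fract_def eq_fract)
  then have "Fraction_Field.Fract 1 b * (to_frac b * f) = f" by (simp only: mult.assoc[symmetric]) simp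
  ultimately show ?thesis by simp
qed

text \<open>For \<open>f = a/b\<close> one has \<open>b D(f) = D(a) - [D, b](f)\<close>. The first
  term is controlled by the estimate on \<open>R\<close>, the second by induction on the degree, and
  \<open>b\<close> is a unit.\<close>

lemma diff_op_lm:
  assumes "diff_op (to_frac \<circ> \<phi>) (carrier (local_ring M)) k D" "f \<in> lm M n"
  shows "D f \<in> lm M (n - k)"
  using assms
proof (induction k arbitrary: D)
  case base: 0
  obtain a b where ab: "f = Fraction_Field.Fract a b" "a \<in> ipow M n" "b \<notin> M" using base.prems(2) by (rule lmE)
  have nz: "b \<noteq> 0" by (rule not_in_prime(1)[OF prime_M ab(3)])
  have bf: "to_frac b * f = to_frac a" using nz by (simp add: ab(1) to_frac_def eq_fract)
  have Da: "D (to_frac a) \<in> lm M (n - 0)"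
    by (rule diff_op_filtration_to_frac[OF base.prems(1) ab(2)])
  have "f \<in> carrier (local_ring M)" using base.prems(2) lm_loc carrier_local[OF prime_M] by blast
  then have "D (to_frac b * f) - to_frac b * D f = 0" using base.prems(1) to_frac_loc[OF prime_M] carrier_local[OF prime_M] by simp
  then have "to_frac b * D f \<in> lm M (n - 0)" using Da by (simp add: bf)
  from lm_unit[OF ab(3) this] show ?case .
next
  case (Suc k)
  obtain a b where ab: "f = Fraction_Field.Fract a b" "a \<in> ipow M n" "b \<notin> M" using Suc.prems(2) by (rule lmE)
  have nz: "b \<noteq> 0" by (rule not_in_prime(1)[OF prime_M ab(3)])
  have bf: "to_frac b * f = to_frac a" using nz by (simp add: ab(1) to_frac_def eq_fract)
  have Da: "D (to_frac a) \<in> lm M (n - Suc k)"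
    by (rule diff_op_filtration_to_frac[OF Suc.prems(1) ab(2)])
  have tb: "to_frac b \<in> carrier (local_ring M)" using to_frac_loc[OF prime_M] carrier_local[OF prime_M] by simp
  have "diff_op (to_frac \<circ> \<phi>) (carrier (local_ring M)) k (\<lambda>f. D (to_frac b * f) - to_frac b * D f)"
    using Suc.prems(1) tb unfolding diff_op.simps by blast
  from Suc.IH[OF this Suc.prems(2)] have E0: "D (to_frac b * f) - to_frac b * D f \<in> lm M (n - k)" .
  have E: "D (to_frac b * f) - to_frac b * D f \<in> lm M (n - Suc k)" by (rule subsetD[OF lm_antimono E0]) simp
  have "D (to_frac a) - (D (to_frac b * f) - to_frac b * D f) \<in> lm M (n - Suc k)" by (rule lm_diff[OF prime_M Da E])
  then have "to_frac b * D f \<in> lm M (n - Suc k)" by (simp add: bf)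
  from lm_unit[OF ab(3) this] show ?case .
qed

end

context point_filtration
begin

text \<open>Parameters congruent modulo the square have monomials of degree \<open>q\<close> that
  agree modulo the next power, and an operator of degree \<open>q\<close> sends the error into the
  maximal ideal. On monomials of degree \<open>q\<close> the operator for \<open>I\<close> is dual,
  so only \<open>c I\<close> survives at the point.\<close>

lemma hasse_coefficient:
  assumes x: "params \<chi>\<^sub>0 t x" and y: "\<And>i. i < t \<Longrightarrow> y i - to_frac (x i) \<in> lm M 2"
    and \<Delta>: "hasse_operators \<phi> M t y \<Delta>" and I: "I \<in> MI t q"
    and c: "f - (\<Sum>J\<in>MI t q. \<phi> (c J) * multi_power t x J) \<in> ipow M (Suc q)"
  shows "value_at \<phi> M (\<Delta> I (to_frac f)) = c I"
proof (rule value_at_eq)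
  let ?Y = "multi_power t y" and ?A = "carrier (local_ring M)"
  have A: "?A = loc M" by (rule carrier_local[OF prime_M])
  have deg: "multi_deg t J = q" "J \<in> multi_indices t" if "J \<in> MI t q" for J using that by (simp_all add: MI_def)
  have D: "diff_op (to_frac \<circ> \<phi>) ?A q (\<Delta> I)" using \<Delta> deg[OF I] unfolding hasse_operators_def by blast
  have DY: "\<Delta> I (?Y J) = of_nat (\<Prod>i<t. J i choose I i) * ?Y (\<lambda>i. J i - I i)" if "J \<in> MI t q" for J
    using \<Delta> deg(2)[OF I] deg(2)[OF that] unfolding hasse_operators_def by blast
  have DYJ: "\<Delta> I (?Y J) = (if J = I then 1 else 0)" if J: "J \<in> MI t q" for J
  proof -
    have b: "(\<Prod>i<t. J i choose I i) = (if J = I then 1 else 0)"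
      using multi_binom_same_deg[OF I J] by (simp only: multi_binom_def)
    show ?thesis unfolding DY[OF J] b by (cases "J = I") (simp_all add: multi_power_def)
  qed
  have yi: "lmappr 1 (y i) (to_frac (x i))" if i: "i < t" for i
  proof -
    have xi: "to_frac (x i) \<in> lm M 1" using x i M_ipow unfolding params_def by (intro lm_to_frac[OF prime_M]) simp
    have d: "y i - to_frac (x i) \<in> lm M (Suc 1)" using y[OF i] by (simp add: numeral_2_eq_2)
    then have "(y i - to_frac (x i)) + to_frac (x i) \<in> lm M 1"
      using xi lm_antimono[of 1 "Suc 1" M] by (intro lm_add[OF prime_M]) auto
    then show ?thesis using xi d by (simp add: lmappr_def)
  qed
  have app: "lmappr (multi_deg t J) (?Y J) (to_frac (multi_power t x J))" for J
    unfolding multi_deg_def multi_power_def to_frac_prod to_frac_power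
    by (rule lmappr_prod) (use yi lmappr_power in auto)
  have Yq: "?Y J - to_frac (multi_power t x J) \<in> lm M (Suc q)" "?Y J \<in> loc M" if "J \<in> MI t q" for J
    using app[of J] deg[OF that] lm_loc by (auto simp: lmappr_def)
  let ?G = "\<Sum>J\<in>MI t q. to_frac (\<phi> (c J)) * ?Y J"
  have "to_frac (f - (\<Sum>J\<in>MI t q. \<phi> (c J) * multi_power t x J)) \<in> lm M (Suc q)" by (rule lm_to_frac[OF prime_M c])
  moreover have "(\<Sum>J\<in>MI t q. to_frac (\<phi> (c J)) * (?Y J - to_frac (multi_power t x J))) \<in> lm M (Suc q)"
    by (intro lm_sum[OF prime_M] lm_loc_mult[OF prime_M] to_frac_loc[OF prime_M] Yq(1))
  ultimately have "to_frac (f - (\<Sum>J\<in>MI t q. \<phi> (c J) * multi_power t x J)) -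
      (\<Sum>J\<in>MI t q. to_frac (\<phi> (c J)) * (?Y J - to_frac (multi_power t x J))) \<in> lm M (Suc q)" by (rule lm_diff[OF prime_M])
  then have R: "to_frac f - ?G \<in> lm M (Suc q)" by (simp add: to_frac_sum right_diff_distrib sum_subtractf)
  have "\<Delta> I (to_frac f - ?G) \<in> lm M (Suc q - q)" by (rule diff_op_lm[OF D R])
  then have DR: "\<Delta> I (to_frac f - ?G) \<in> lm M 1" by simp
  have lin: "k_linear_on (to_frac \<circ> \<phi>) ?A (\<Delta> I)" by (rule diff_op_linear[OF D])
  have add: "\<Delta> I (f + g) = \<Delta> I f + \<Delta> I g" if "f \<in> loc M" "g \<in> loc M" for f g
    using lin that unfolding k_linear_on_def A by blast
  have scale: "\<Delta> I (to_frac (\<phi> c) * f) = to_frac (\<phi> c) * \<Delta> I f" if "f \<in> loc M" for c f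
    using lin that unfolding k_linear_on_def A by simp
  have sumloc: "(\<Sum>J\<in>S. to_frac (\<phi> (c J)) * ?Y J) \<in> loc M" if "S \<subseteq> MI t q" for S
    using that Yq(2) by (intro is_subring_sum[OF is_subring_loc[OF prime_M]] is_subringD(4)[OF is_subring_loc[OF prime_M]] to_frac_loc[OF prime_M]) auto
  have "\<Delta> I (\<Sum>J\<in>S. to_frac (\<phi> (c J)) * ?Y J) = (\<Sum>J\<in>S. to_frac (\<phi> (c J)) * \<Delta> I (?Y J))" if "finite S" "S \<subseteq> MI t q" for S
    using that
  proof (induction S rule: finite_induct)
    case empty
    show ?case using scale[OF is_subringD(1)[OF is_subring_loc[OF prime_M]], of 0] by simp
  next
    case (insert J S)
    have Y: "?Y J \<in> loc M" using Yq(2) insert.prems by simp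
    have "to_frac (\<phi> (c J)) * ?Y J \<in> loc M"
      by (rule is_subringD(4)[OF is_subring_loc[OF prime_M] to_frac_loc[OF prime_M] Y])
    from add[OF this sumloc[of S]] insert scale[OF Y, of "c J"] show ?case by simp
  qed
  from this[OF MI_finite subset_refl] have "\<Delta> I ?G = (\<Sum>J\<in>MI t q. if J = I then to_frac (\<phi> (c J)) else 0)"
    by (simp only:) (rule sum.cong, auto simp: DYJ)
  then have DG: "\<Delta> I ?G = to_frac (\<phi> (c I))" using I MI_finite by simp
  have Rloc: "to_frac f - ?G \<in> loc M" using R lm_loc by blast
  have "\<Delta> I (to_frac f - ?G + ?G) = \<Delta> I (to_frac f - ?G) + \<Delta> I ?G" by (rule add[OF Rloc sumloc[OF subset_refl]])
  then have "\<Delta> I (to_frac f) - to_frac (\<phi> (c I)) = \<Delta> I (to_frac f - ?G)" unfolding DG by simp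
  then show "\<Delta> I (to_frac f) - to_frac (\<phi> (c I)) \<in> lm M 1" using DR by (simp only:)
qed

text \<open>The columns of the matrix are the coordinates of the leading forms of the generators.
  Relations between columns are relations modulo the next power, so a basis of the column space
  selects a basis of the leading part.\<close>

lemma rank_formula:
  assumes S: "M \<in> Supp \<II>"
    and gen: "genideal (ring_on UNIV) (s ` {..<r}) = level \<II> (real (CHAR('k) ^ e))"
    and y: "regular_parameters M t y" and \<Delta>: "hasse_operators \<phi> M t y \<Delta>"
    and Is: "set Is = {I \<in> multi_indices t. multi_deg t I = CHAR('k) ^ e}"
  shows "l_dim \<phi> M \<II> e = vec_space.rank (length Is) (hasse_matrix \<phi> M \<Delta> Is r s)"
proof -
  define q where "q = CHAR('k) ^ e"
  let ?W = "ipow M (Suc q)" and ?A = "hasse_matrix \<phi> M \<Delta> Is r s"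
  have W: "ksub ?W" by (rule ksub_ideal[OF is_ideal_ipow])
  have IsMI: "set Is = MI t q" unfolding Is MI_def q_def ..
  obtain x where x: "params \<chi>\<^sub>0 t x" "\<forall>i<t. y i - to_frac (x i) \<in> lm M 2"
    using params_of_generators[of y t] y unfolding regular_parameters_def by blast
  let ?x = "multi_power t x"
  interpret R: cring "ring_on (UNIV :: 'r set)" by (rule cring_ring_on[OF is_subring_UNIV])
  have car: "s ` {..<r} \<subseteq> carrier (ring_on UNIV)" by (simp add: ring_on_simps)
  have sl: "s \<beta> \<in> level \<II> (real q)" if "\<beta> < r" for \<beta>
    using R.genideal_self[OF car] gen that unfolding q_def by blast
  then have sq: "s \<beta> \<in> ipow M q" if "\<beta> < r" for \<beta> using support_level[OF S] that by blast
  have "\<forall>\<beta>. \<exists>c. \<beta> < r \<longrightarrow> s \<beta> - (\<Sum>J\<in>MI t q. \<phi> (c J) * ?x J) \<in> ?W"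
    using ipow_fspan[OF pt x(1), of q] sq unfolding fspan_def by blast
  from choice[OF this] obtain C where C: "\<forall>\<beta><r. s \<beta> - (\<Sum>J\<in>MI t q. \<phi> (C \<beta> J) * ?x J) \<in> ?W" by blast
  have A: "?A $$ (i, \<beta>) = C \<beta> (Is ! i)" if i: "i < length Is" and \<beta>: "\<beta> < r" for i \<beta>
  proof -
    have "Is ! i \<in> MI t q" using IsMI i nth_mem by blast
    then have "value_at \<phi> M (\<Delta> (Is ! i) (to_frac (s \<beta>))) = C \<beta> (Is ! i)"
      using x(2) C \<beta> by (intro hasse_coefficient[OF x(1) _ \<Delta>]) auto
    then show ?thesis using i \<beta> by (simp add: hasse_matrix_def)
  qed
  have "?A \<in> carrier_mat (length Is) r" by (simp add: hasse_matrix_def)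
  from rank_choose_columns[OF this] obtain B where B: "B \<subseteq> {..<r}" "vec_space.rank (length Is) ?A = card B"
    "\<forall>a. (\<forall>i<length Is. (\<Sum>j\<in>B. a j * ?A $$ (i, j)) = 0) \<longrightarrow> (\<forall>j\<in>B. a j = 0)"
    "\<forall>k<r. \<exists>a. \<forall>i<length Is. ?A $$ (i, k) = (\<Sum>j\<in>B. a j * ?A $$ (i, j))" by (elim exE conjE)
  have finB: "finite B" using B(1) finite_subset by blast
  have AJ: "(\<Sum>j\<in>B. a j * ?A $$ (i, j)) = (\<Sum>j\<in>B. a j * C j (Is ! i))" if "i < length Is" for i a
    using A[OF that] B(1) by (intro sum.cong) auto
  have comb: "(\<Sum>j\<in>B. \<phi> (a j) * s j) - (\<Sum>J\<in>MI t q. \<phi> (\<Sum>j\<in>B. a j * C j J) * ?x J) \<in> ?W" for a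
  proof -
    have 1: "(\<Sum>j\<in>B. \<phi> (a j) * (s j - (\<Sum>J\<in>MI t q. \<phi> (C j J) * ?x J))) \<in> ?W"
      using C B(1) by (intro is_ideal_sum[OF is_ideal_ipow] ipowD(3)) auto
    have "(\<Sum>J\<in>MI t q. \<phi> (\<Sum>j\<in>B. a j * C j J) * ?x J) = (\<Sum>j\<in>B. \<phi> (a j) * (\<Sum>J\<in>MI t q. \<phi> (C j J) * ?x J))"
      unfolding hom_sum sum_distrib_right sum_distrib_left by (subst sum.swap) (simp add: hom_mult mult.assoc)
    then have "(\<Sum>j\<in>B. \<phi> (a j) * s j) - (\<Sum>J\<in>MI t q. \<phi> (\<Sum>j\<in>B. a j * C j J) * ?x J) =
        (\<Sum>j\<in>B. \<phi> (a j) * (s j - (\<Sum>J\<in>MI t q. \<phi> (C j J) * ?x J)))"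
      by (simp add: right_diff_distrib sum_subtractf)
    with 1 show ?thesis by (simp only:)
  qed
  have ind: "\<forall>j\<in>B. a j = 0" if rel: "(\<Sum>j\<in>B. \<phi> (a j) * s j) \<in> ?W" for a
  proof -
    have "(\<Sum>J\<in>MI t q. \<phi> (\<Sum>j\<in>B. a j * C j J) * ?x J) \<in> ?W" using ipowD(6)[OF rel comb[of a]] by simp
    then have z: "\<forall>J\<in>MI t q. (\<Sum>j\<in>B. a j * C j J) = 0" by (rule monomials_indep_subset[OF x(1) subset_refl])
    have "\<forall>i<length Is. (\<Sum>j\<in>B. a j * ?A $$ (i, j)) = 0"
    proof (intro allI impI)
      fix i assume i: "i < length Is"
      then have "Is ! i \<in> MI t q" using IsMI nth_mem by blast
      then show "(\<Sum>j\<in>B. a j * ?A $$ (i, j)) = 0" using AJ[OF i, of a] z by simp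
    qed
    then show ?thesis using B(3) by blast
  qed
  have span: "s k \<in> fspan s B ?W" if k: "k < r" for k
  proof -
    obtain a where a: "\<forall>i<length Is. ?A $$ (i, k) = (\<Sum>j\<in>B. a j * ?A $$ (i, j))" using B(4) k by blast
    have CJ: "C k J = (\<Sum>j\<in>B. a j * C j J)" if J: "J \<in> MI t q" for J
    proof -
      obtain i where i: "i < length Is" "J = Is ! i" using J IsMI by (metis in_set_conv_nth)
      show ?thesis using a[rule_format, OF i(1)] unfolding A[OF i(1) k] AJ[OF i(1)] i(2) .
    qed
    have eq: "(\<Sum>J\<in>MI t q. \<phi> (C k J) * ?x J) = (\<Sum>J\<in>MI t q. \<phi> (\<Sum>j\<in>B. a j * C j J) * ?x J)"
      by (rule sum.cong) (simp_all add: CJ)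
    have "s k - (\<Sum>J\<in>MI t q. \<phi> (\<Sum>j\<in>B. a j * C j J) * ?x J) \<in> ?W" using C k unfolding eq[symmetric] by blast
    from ipowD(6)[OF this comb[of a]] have "s k - (\<Sum>j\<in>B. \<phi> (a j) * s j) \<in> ?W" by simp
    then show ?thesis unfolding fspan_def by blast
  qed
  have eqB: "fspan s {..<r} ?W = fspan s B ?W"
  proof
    show "fspan s {..<r} ?W \<subseteq> fspan s B ?W"
      by (rule fspan_least[OF ksub_fspan[OF W] fspan_W]) (use span in simp)
    show "fspan s B ?W \<subseteq> fspan s {..<r} ?W"
      by (rule fspan_least[OF ksub_fspan[OF W] fspan_W]) (use fspan_base[OF W finite_lessThan] B(1) in blast)
  qed
  have FK: "ksub (fspan s {..<r} ?W)" by (rule ksub_fspan[OF W])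
  \<comment> \<open>Coefficients in \<open>R\<close> may be replaced by their values at the point,
    since the generators already have order \<open>q\<close>; so the generators of the ideal span
    its leading part over \<open>k\<close>.\<close>
  have "is_ideal (fspan s {..<r} ?W)"
    unfolding is_ideal_def
  proof (intro conjI ballI allI)
    fix w h assume "h \<in> fspan s {..<r} ?W"
    then obtain a where a: "h - (\<Sum>j<r. \<phi> (a j) * s j) \<in> ?W" by (rule fspanE)
    let ?h = "\<Sum>j<r. \<phi> (a j) * s j"
    have hq: "?h \<in> ipow M q" using sq by (intro is_ideal_sum[OF is_ideal_ipow] ipowD(3)) auto
    have "w - \<phi> (\<chi>\<^sub>0 w) \<in> ipow M 1" using sub_point_in_ker[OF pt] M_ipow by simp
    from ipow_mult[OF this hq] have 1: "(w - \<phi> (\<chi>\<^sub>0 w)) * ?h \<in> ?W" by simp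
    have 2: "w * (h - ?h) \<in> ?W" by (rule ipowD(3)[OF a])
    have "(\<Sum>j<r. \<phi> (\<chi>\<^sub>0 w * a j) * s j) = \<phi> (\<chi>\<^sub>0 w) * ?h" by (simp add: hom_mult sum_distrib_left mult.assoc)
    then have "w * h - (\<Sum>j<r. \<phi> (\<chi>\<^sub>0 w * a j) * s j) = (w - \<phi> (\<chi>\<^sub>0 w)) * ?h + w * (h - ?h)" by (simp add: algebra_simps)
    with ipowD(2)[OF 1 2] have "w * h - (\<Sum>j<r. \<phi> (\<chi>\<^sub>0 w * a j) * s j) \<in> ?W" by (simp only:)
    then show "w * h \<in> fspan s {..<r} ?W" unfolding fspan_def by (intro CollectI exI)
  qed (use ksubD[OF FK] in auto)
  then have "ideal (fspan s {..<r} ?W) (ring_on UNIV)" by (simp add: ideal_UNIV_iff)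
  moreover have "s ` {..<r} \<subseteq> fspan s {..<r} ?W" using fspan_base[OF W finite_lessThan] by blast
  ultimately have lev: "level \<II> (real q) \<subseteq> fspan s {..<r} ?W"
    using R.genideal_minimal gen unfolding q_def by metis
  have "{g \<in> ipow M q. \<exists>f\<in>level \<II> (real q). f - g \<in> ?W} = fspan s {..<r} ?W"
  proof (intro equalityI subsetI)
    fix g assume "g \<in> {g \<in> ipow M q. \<exists>f\<in>level \<II> (real q). f - g \<in> ?W}"
    then obtain f where f: "f \<in> level \<II> (real q)" "f - g \<in> ?W" by blast
    have "f - (f - g) \<in> fspan s {..<r} ?W"
      using ksubD(5)[OF FK subsetD[OF lev f(1)] subsetD[OF fspan_W f(2)]] .
    then show "g \<in> fspan s {..<r} ?W" by simp
  next
    fix g assume "g \<in> fspan s {..<r} ?W"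
    then obtain a where a: "g - (\<Sum>j<r. \<phi> (a j) * s j) \<in> ?W" by (rule fspanE)
    let ?h = "\<Sum>j<r. \<phi> (a j) * s j"
    have h: "?h \<in> level \<II> (real q)" using sl by (intro is_ideal_sum[OF level_ideal] is_idealD(3)[OF level_ideal]) auto
    have "- (g - ?h) \<in> ?W" by (rule ipowD(5)[OF a])
    then have hg: "?h - g \<in> ?W" by simp
    have "(g - ?h) + ?h \<in> ipow M q"
      by (rule ipowD(2)[OF subsetD[OF ipow_antimono a] subsetD[OF support_level[OF S] h]]) simp
    then show "g \<in> {g \<in> ipow M q. \<exists>f\<in>level \<II> (real q). f - g \<in> ?W}" using h hg by auto
  qed
  then have "leading M \<II> q = cls q ` fspan s B ?W" unfolding leading_eq[OF level_ideal] eqB by simp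
  then have "l_dim \<phi> M \<II> e = card B"
    unfolding l_dim_def q_def[symmetric] by (simp only:) (rule k_dim_fspan[OF finB ind])
  then show ?thesis using B(2) by simp
qed

end

theorem lemma1p1p2p1:
  fixes \<phi> :: "'k::alg_closed_field \<Rightarrow> 'r::idom"
    and d :: nat and \<II> :: "('r \<times> real) set" and P :: "'r set"
  assumes "nonsingular_affine_variety \<phi> d"
    and "idealistic_filtration \<II>"
    and "D_saturated \<phi> \<II>"
    and "maximalideal P (ring_on UNIV)"
  shows
    "(P \<notin> Supp \<II> \<longrightarrow>
        localized_filtration P \<II> = carrier (local_ring P) \<times> UNIV \<and>
        (\<forall>e. (CHAR('k) = 0 \<longrightarrow> e = 0) \<longrightarrow> sigma \<phi> d \<II> P e = 0)) \<and>
     (P \<in> Supp \<II> \<longrightarrow>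
        (\<forall>e. (CHAR('k) = 0 \<longrightarrow> e = 0) \<longrightarrow>
          (\<forall>K E. jump_places (l_pure \<phi> P \<II>) e K E \<longrightarrow>
             int (l_pure \<phi> P \<II> e) =
             int (l_dim \<phi> P \<II> e) - int (l_mixed CHAR('k) (l_pure \<phi> P \<II>) e K E)) \<and>
          (\<forall>r s x \<Delta> Is.
             genideal (ring_on UNIV) (s ` {..<r}) = level \<II> (real (CHAR('k) ^ e)) \<longrightarrow>
             regular_parameters P d x \<longrightarrow>
             hasse_operators \<phi> P d x \<Delta> \<longrightarrow>
             distinct Is \<and> set Is = {I \<in> multi_indices d. multi_deg d I = CHAR('k) ^ e} \<longrightarrow>
             l_dim \<phi> P \<II> e = vec_space.rank (length Is) (hasse_matrix \<phi> P \<Delta> Is r s))))"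
proof -
  obtain z m where "affine_alg \<phi> z m" using affine_alg_of_variety[OF assms(1)] by blast
  then interpret affine_alg \<phi> z m .
  obtain \<chi> where \<chi>: "\<chi> \<in> points" "ker \<chi> = P" using point_of_maximal[OF assms(4)] by blast
  interpret smooth_alg \<phi> z m d by (rule smooth_of_variety[OF assms(1)])
  interpret point_filtration \<phi> z m d \<chi> \<II>
    by unfold_locales (rule \<chi>(1), rule assms(2), rule assms(3))
  show ?thesis
    unfolding \<chi>(2)[symmetric]
  proof (intro conjI impI allI)
    assume "ker \<chi> \<notin> Supp \<II>"
    then show "localized_filtration (ker \<chi>) \<II> = carrier (local_ring (ker \<chi>)) \<times> UNIV" by (rule localized_full)
  next
    fix e :: nat assume "ker \<chi> \<notin> Supp \<II>" "CHAR('k) = 0 \<longrightarrow> e = 0"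
    then show "sigma \<phi> d \<II> (ker \<chi>) e = 0" by (rule sigma_outside)
  next
    fix e :: nat and K E assume "ker \<chi> \<in> Supp \<II>" "CHAR('k) = 0 \<longrightarrow> e = 0" "jump_places (l_pure \<phi> (ker \<chi>) \<II>) e K E"
    from jump_formula[OF this] show "int (l_pure \<phi> (ker \<chi>) \<II> e) =
        int (l_dim \<phi> (ker \<chi>) \<II> e) - int (l_mixed CHAR('k) (l_pure \<phi> (ker \<chi>) \<II>) e K E)" by simp
  next
    fix e r :: nat and s x \<Delta> Is
    assume a: "ker \<chi> \<in> Supp \<II>" "genideal (ring_on UNIV) (s ` {..<r}) = level \<II> (real (CHAR('k) ^ e))"
      "regular_parameters (ker \<chi>) d x" "hasse_operators \<phi> (ker \<chi>) d x \<Delta>"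
      "distinct Is \<and> set Is = {I \<in> multi_indices d. multi_deg d I = CHAR('k) ^ e}"
    show "l_dim \<phi> (ker \<chi>) \<II> e = vec_space.rank (length Is) (hasse_matrix \<phi> (ker \<chi>) \<Delta> Is r s)"
      by (rule rank_formula[OF a(1-4) conjunct2[OF a(5)]])
  qed
qed

end
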